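(* Let $p,q\geq 2$ be multiplicatively independent integers. Then the canonical trace is the only faithful extreme tracial state on the group $C^*$-algebra $C^*(\mathbb{Z}[\frac{1}{pq}]\rtimes\mathbb{Z}^2)$ if and only if Furstenberg's $\times p,\times q$ conjecture holds for the pair $(p,q)$, i.e., if and only if the Lebesgue measure is the only ergodic $\times p,\times q$-invariant probability measure on $\mathbb{T}$ with infinite support.
   Context: Integers $p,q\geq 2$ are multiplicatively independent if there are no $r,s\in\mathbb{Z}_{>0}$ with $p^r=q^s$. The discrete group $\mathbb{Z}[\frac{1}{pq}]\rtimes\mathbb{Z}^2$ is the semidirect product with respect to the action of $\mathbb{Z}^2$ on the additive group $\mathbb{Z}[\frac{1}{pq}]$ given by $(n,m)\cdot x=p^nq^mx$. For a group $\Gamma$ and $g\in\Gamma$, $u_g$ denotes the canonical unitary in the group $C^*$-algebra; the group above is amenable, so its full and reduced group $C^*$-algebras coincide. The canonical trace on $C^*_r(\Gamma)$ is the tracial state $\tau$ with $\tau(u_g)=0$ for all $g\in\Gamma\setminus\{e\}$. A tracial state $\tau$ on a $C^*$-algebra $A$ is faithful if $\tau(a^*a)>0$ for all $a\in A\setminus\{0\}$; it is extreme if it is an extreme point of the convex set $T(A)$ of tracial states on $A$. A regular Borel probability measure $\mu$ on the circle $\mathbb{T}=\{z\in\mathbb{C}:|z|=1\}$ is $\times p,\times q$-invariant if it is invariant under pushforward by both $z\mapsto z^p$ and $z\mapsto z^q$; it is ergodic if it is an extreme point of the convex set of all such measures. An ergodic $\times p,\times q$-invariant measure with infinite support automatically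 has full support (by Furstenberg's theorem on closed invariant sets). *)

theory Defs
  imports
    "HOL-Probability.Probability"
    "HOL-Algebra.Module"
    "HOL-Algebra.Elementary_Groups"
begin

section \<open>The group\<close>

definition multiplicatively_independent :: "nat \<Rightarrow> nat \<Rightarrow> bool" where
  "multiplicatively_independent p q \<longleftrightarrow> \<not> (\<exists>r s. r > 0 \<and> s > 0 \<and> p ^ r = q ^ s)"

definition semidirect_product ::
    "('a, 'm) monoid_scheme \<Rightarrow> ('b, 'n) monoid_scheme \<Rightarrow> ('b \<Rightarrow> 'a \<Rightarrow> 'a) \<Rightarrow> ('a \<times> 'b) monoid" where
  "semidirect_product N H act =
     \<lparr>carrier = carrier N \<times> carrier H,
      mult = (\<lambda>(x, h) (y, k). (x \<otimes>\<^bsub>N\<^esub> act h y, h \<otimes>\<^bsub>H\<^esub> k)),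
      one = (\<one>\<^bsub>N\<^esub>, \<one>\<^bsub>H\<^esub>)\<rparr>"

text \<open>The additive group \<open>\<int>[1/d]\<close>, as a subgroup of the rationals.\<close>

definition Z_inverse :: "nat \<Rightarrow> rat monoid" where
  "Z_inverse d =
     \<lparr>carrier = {x. \<exists>(a::int) (k::nat). x = of_int a / of_nat d ^ k}, mult = (+), one = 0\<rparr>"

definition pq_action :: "nat \<Rightarrow> nat \<Rightarrow> int \<times> int \<Rightarrow> rat \<Rightarrow> rat" where
  "pq_action p q = (\<lambda>(n, m) x. (of_nat p powi n) * (of_nat q powi m) * x)"

definition pq_group :: "nat \<Rightarrow> nat \<Rightarrow> (rat \<times> int \<times> int) monoid" where
  "pq_group p q =
     semidirect_product (Z_inverse (p * q)) (integer_group \<times>\<times> integer_group) (pq_action p q)"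


section \<open>Group algebras and their enveloping \<open>C\<^sup>*\<close>-algebras\<close>

record 'b star_algebra = "(complex, 'b) module" +
  star :: "'b \<Rightarrow> 'b"

text \<open>The complex group algebra: finitely supported functions on the group under convolution,
  with \<open>f\<^sup>*(g) = cnj (f (g\<^sup>-\<^sup>1))\<close>. All functions vanish outside \<open>carrier G\<close>.\<close>

definition group_algebra :: "('a, 'm) monoid_scheme \<Rightarrow> ('a \<Rightarrow> complex) star_algebra" where
  "group_algebra G =
     \<lparr>carrier = {f. finite {g. f g \<noteq> 0} \<and> {g. f g \<noteq> 0} \<subseteq> carrier G},
      mult = (\<lambda>f h g. if g \<in> carrier G
                then \<Sum>x | f x \<noteq> 0. f x * h (inv\<^bsub>G\<^esub> x \<otimes>\<^bsub>G\<^esub> g) else 0),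
      one = (\<lambda>g. if g = \<one>\<^bsub>G\<^esub> then 1 else 0),
      zero = (\<lambda>g. 0),
      add = (\<lambda>f h g. f g + h g),
      smult = (\<lambda>c f g. c * f g),
      star = (\<lambda>f g. if g \<in> carrier G then cnj (f (inv\<^bsub>G\<^esub> g)) else 0)\<rparr>"

definition cstar_seminorm :: "('b, 'm) star_algebra_scheme \<Rightarrow> ('b \<Rightarrow> real) \<Rightarrow> bool" where
  "cstar_seminorm A N \<longleftrightarrow>
     (\<forall>x\<in>carrier A. 0 \<le> N x) \<and>
     (\<forall>x\<in>carrier A. \<forall>y\<in>carrier A. N (x \<oplus>\<^bsub>A\<^esub> y) \<le> N x + N y) \<and>
     (\<forall>c. \<forall>x\<in>carrier A. N (c \<odot>\<^bsub>A\<^esub> x) = cmod c * N x) \<and>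
     (\<forall>x\<in>carrier A. \<forall>y\<in>carrier A. N (x \<otimes>\<^bsub>A\<^esub> y) \<le> N x * N y) \<and>
     (\<forall>x\<in>carrier A. N (star A x \<otimes>\<^bsub>A\<^esub> x) = (N x)\<^sup>2)"

text \<open>The norm of the full (universal) \<open>C\<^sup>*\<close>-algebra. The \<open>C\<^sup>*\<close>-seminorms on a \<open>*\<close>-algebra are exactly
  the functions \<open>x \<mapsto> \<parallel>\<pi>(x)\<parallel>\<close> for \<open>*\<close>-homomorphisms \<open>\<pi>\<close> into \<open>C\<^sup>*\<close>-algebras, so that ranging over
  them avoids quantifying over types. For a group algebra the
  supremum is finite, since every \<open>C\<^sup>*\<close>-seminorm is bounded by the \<open>\<ell>\<^sup>1\<close>-norm.\<close>

definition universal_norm :: "('b, 'm) star_algebra_scheme \<Rightarrow> 'b \<Rightarrow> real" where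
  "universal_norm A x = (SUP N\<in>{N. cstar_seminorm A N}. N x)"

text \<open>Separated completion of a \<open>*\<close>-algebra in a seminorm: Cauchy sequences modulo null sequences.\<close>

definition cauchy_seqs :: "('b, 'm) star_algebra_scheme \<Rightarrow> ('b \<Rightarrow> real) \<Rightarrow> (nat \<Rightarrow> 'b) set" where
  "cauchy_seqs A N =
     {s. (\<forall>n. s n \<in> carrier A) \<and>
         (\<forall>e>0. \<exists>M. \<forall>m\<ge>M. \<forall>n\<ge>M. N (s m \<ominus>\<^bsub>A\<^esub> s n) < e)}"

definition cauchy_rel ::
    "('b, 'm) star_algebra_scheme \<Rightarrow> ('b \<Rightarrow> real) \<Rightarrow> ((nat \<Rightarrow> 'b) \<times> (nat \<Rightarrow> 'b)) set" where
  "cauchy_rel A N =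
     {(s, t). s \<in> cauchy_seqs A N \<and> t \<in> cauchy_seqs A N \<and> (\<lambda>n. N (s n \<ominus>\<^bsub>A\<^esub> t n)) \<longlonglongrightarrow> 0}"

definition completion_embed ::
    "('b, 'm) star_algebra_scheme \<Rightarrow> ('b \<Rightarrow> real) \<Rightarrow> 'b \<Rightarrow> (nat \<Rightarrow> 'b) set" where
  "completion_embed A N x = cauchy_rel A N `` {\<lambda>_. x}"

definition completion ::
    "('b, 'm) star_algebra_scheme \<Rightarrow> ('b \<Rightarrow> real) \<Rightarrow> (nat \<Rightarrow> 'b) set star_algebra" where
  "completion A N =
     \<lparr>carrier = cauchy_seqs A N // cauchy_rel A N,
      mult = (\<lambda>X Y. \<Union>s\<in>X. \<Union>t\<in>Y. cauchy_rel A N `` {\<lambda>n. s n \<otimes>\<^bsub>A\<^esub> t n}),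
      one = completion_embed A N \<one>\<^bsub>A\<^esub>,
      zero = completion_embed A N \<zero>\<^bsub>A\<^esub>,
      add = (\<lambda>X Y. \<Union>s\<in>X. \<Union>t\<in>Y. cauchy_rel A N `` {\<lambda>n. s n \<oplus>\<^bsub>A\<^esub> t n}),
      smult = (\<lambda>c X. \<Union>s\<in>X. cauchy_rel A N `` {\<lambda>n. c \<odot>\<^bsub>A\<^esub> s n}),
      star = (\<lambda>X. \<Union>s\<in>X. cauchy_rel A N `` {\<lambda>n. star A (s n)})\<rparr>"

definition group_cstar ::
    "('a, 'm) monoid_scheme \<Rightarrow> (nat \<Rightarrow> 'a \<Rightarrow> complex) set star_algebra" where
  "group_cstar G = completion (group_algebra G) (universal_norm (group_algebra G))"

definition canonical_unitary ::
    "('a, 'm) monoid_scheme \<Rightarrow> 'a \<Rightarrow> (nat \<Rightarrow> 'a \<Rightarrow> complex) set" where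
  "canonical_unitary G g =
     completion_embed (group_algebra G) (universal_norm (group_algebra G))
       (\<lambda>x. if x = g then 1 else 0)"


section \<open>Tracial states\<close>

text \<open>Functionals are made \<open>extensional\<close> so that equality of HOL functions is equality on the
  algebra. Positive functionals on a \<open>C\<^sup>*\<close>-algebra are automatically bounded, and on a unital one
  such a functional has norm \<open>1\<close> iff it maps the unit to \<open>1\<close>.\<close>

definition tracial_states :: "('b, 'm) star_algebra_scheme \<Rightarrow> ('b \<Rightarrow> complex) set" where
  "tracial_states A =
     {\<tau> \<in> extensional (carrier A).
        (\<forall>a\<in>carrier A. \<forall>b\<in>carrier A. \<tau> (a \<oplus>\<^bsub>A\<^esub> b) = \<tau> a + \<tau> b) \<and>
        (\<forall>c. \<forall>a\<in>carrier A. \<tau> (c \<odot>\<^bsub>A\<^esub> a) = c * \<tau> a) \<and>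
        (\<forall>a\<in>carrier A. \<tau> (star A a \<otimes>\<^bsub>A\<^esub> a) \<in> \<real>\<^sub>\<ge>\<^sub>0) \<and>
        \<tau> \<one>\<^bsub>A\<^esub> = 1 \<and>
        (\<forall>a\<in>carrier A. \<forall>b\<in>carrier A. \<tau> (a \<otimes>\<^bsub>A\<^esub> b) = \<tau> (b \<otimes>\<^bsub>A\<^esub> a))}"

definition faithful_trace :: "('b, 'm) star_algebra_scheme \<Rightarrow> ('b \<Rightarrow> complex) \<Rightarrow> bool" where
  "faithful_trace A \<tau> \<longleftrightarrow> 
     (\<forall>a\<in>carrier A. a \<noteq> \<zero>\<^bsub>A\<^esub> \<longrightarrow> Re (\<tau> (star A a \<otimes>\<^bsub>A\<^esub> a)) > 0)"

definition extreme_tracial_state :: "('b, 'm) star_algebra_scheme \<Rightarrow> ('b \<Rightarrow> complex) \<Rightarrow> bool" where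
  "extreme_tracial_state A \<tau> \<longleftrightarrow>
     \<tau> \<in> tracial_states A \<and>
     (\<forall>\<sigma>\<in>tracial_states A. \<forall>\<rho>\<in>tracial_states A. \<forall>t::real. 0 < t \<and> t < 1 \<longrightarrow>
        (\<forall>a\<in>carrier A. \<tau> a = of_real t * \<sigma> a + of_real (1 - t) * \<rho> a) \<longrightarrow>
        \<sigma> = \<tau> \<and> \<rho> = \<tau>)"

definition canonical_trace ::
    "('a, 'm) monoid_scheme \<Rightarrow> (nat \<Rightarrow> 'a \<Rightarrow> complex) set \<Rightarrow> complex" where
  "canonical_trace G =
     (THE \<tau>. \<tau> \<in> tracial_states (group_cstar G) \<and>
        (\<forall>g\<in>carrier G - {\<one>\<^bsub>G\<^esub>}. \<tau> (canonical_unitary G g) = 0))"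


section \<open>Invariant measures on the circle\<close>

abbreviation circle :: "complex set" where
  "circle \<equiv> sphere 0 1"

definition circle_borel :: "complex measure" where
  "circle_borel = restrict_space borel circle"

definition regular_measure_on_circle :: "complex measure \<Rightarrow> bool" where
  "regular_measure_on_circle M \<longleftrightarrow>
     (\<forall>A\<in>sets M.
        emeasure M A = (INF U\<in>{U. openin (top_of_set circle) U \<and> A \<subseteq> U}. emeasure M U) \<and>
        emeasure M A = (SUP K\<in>{K. compact K \<and> K \<subseteq> A}. emeasure M K))"

definition invariant_measures :: "nat \<Rightarrow> nat \<Rightarrow> complex measure set" where
  "invariant_measures p q =
     {M. sets M = sets circle_borel \<and> prob_space M \<and> regular_measure_on_circle M \<and>
         distr M circle_borel (\<lambda>z. z ^ p) = M \<and> distr M circle_borel (\<lambda>z. z ^ q) = M}"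

definition ergodic_measure :: "nat \<Rightarrow> nat \<Rightarrow> complex measure \<Rightarrow> bool" where
  "ergodic_measure p q M \<longleftrightarrow>
     M \<in> invariant_measures p q \<and>
     (\<forall>M1\<in>invariant_measures p q. \<forall>M2\<in>invariant_measures p q. \<forall>t::real. 0 < t \<and> t < 1 \<longrightarrow>
        (\<forall>A\<in>sets circle_borel. measure M A = t * measure M1 A + (1 - t) * measure M2 A) \<longrightarrow>
        M1 = M \<and> M2 = M)"

definition circle_support :: "complex measure \<Rightarrow> complex set" where
  "circle_support M =
     {z \<in> circle. \<forall>U. openin (top_of_set circle) U \<and> z \<in> U \<longrightarrow> measure M U > 0}"

text \<open>Normalised Lebesgue (arc length) measure.\<close>

definition circle_lebesgue :: "complex measure" where
  "circle_lebesgue = distr (restrict_space lborel {0..1::real}) circle_borel (\<lambda>t. cis (2 * pi * t))"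

definition furstenberg_conjecture :: "nat \<Rightarrow> nat \<Rightarrow> bool" where
  "furstenberg_conjecture p q \<longleftrightarrow>
     {M. ergodic_measure p q M \<and> infinite (circle_support M)} = {circle_lebesgue}"

end

theory Submission
  imports
    Defs
    "HOL-Library.Poly_Mapping"
    "HOL-Number_Theory.Residues"
    "HOL-Analysis.Kronecker_Approximation_Theorem"
begin

text \<open>A trace \<open>T\<close> on the group algebra restricts to the translations \<open>\<int>[1/pq]\<close>, and its values on \<open>\<int>\<close> are the
  Fourier coefficients of an invariant measure \<open>M\<close> on the circle. If \<open>M\<close> does not charge roots of unity,
  averaging over conjugates by translations shows that \<open>T\<close> vanishes off the translations, so that
  \<open>M\<close> determines \<open>T\<close>, and extremality of \<open>T\<close> corresponds to ergodicity of \<open>M\<close>. If \<open>M\<close> charges the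
  \<open>d\<close>-th roots of unity, the averages of the translations by multiples of \<open>d\<close> converge in the GNS space
  to a nonzero central projection; an extreme \<open>T\<close> forces it to be \<open>1\<close>, and then \<open>T\<close> is not faithful.
  Conversely, an ergodic measure with infinite support has no atoms at roots of unity and, by
  Furstenberg's theorem, has full support; its GNS norm then dominates the supremum norm on translations
  and, by polynomial growth of \<open>\<int>\<^sup>2\<close>, every \<open>C\<^sup>*\<close>-seminorm, whence faithfulness on the completion. The
  canonical trace corresponds to Lebesgue measure.\<close>

section \<open>Star algebras, traces and enveloping norms\<close>

text \<open>Roots of unity are the points of finite orbit under the power maps, so the argument
  splits on whether \<open>M\<close> charges them. Conjugation by the translation \<open>b\<close>
  moves the element with translation \<open>x\<close> and dilation \<open>s\<close> to the one with
  translation \<open>x + (1 - s) b\<close>. Letting \<open>(1 - s) b\<close> run through multiples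
  of an integer \<open>d\<close> produces \<open>avg d n\<close>, which on the circle is the mean of
  the powers of \<open>z ^ d\<close> and tends to the indicator of the \<open>d\<close>-th roots of
  unity. This one limit serves both cases. It is central because multiplying \<open>d\<close> by
  \<open>p\<close> or \<open>q\<close> enlarges the root set by a null set only.

  The obstacle is faithfulness on the completion: strict positivity on the group algebra does not
  survive limits. The inequality \<open>unorm f \<le> gnorm T f\<close> does: with it, a sequence
  that is Cauchy in \<open>unorm\<close> and null in \<open>tnorm\<close> is null in
  \<open>unorm\<close>. The inequality comes from the powers of \<open>galg_adj f * f\<close>: their
  number of components grows polynomially with the exponent, and taking roots removes a polynomial
  factor.\<close>

lemma complex_nonneg_iff: "z \<in> \<real>\<^sub>\<ge>\<^sub>0 \<longleftrightarrow> Im z = 0 \<and> 0 \<le> Re z"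
  by (auto simp: complex_nonneg_Reals_iff)

text \<open>Here \<open>x\<close>, \<open>f\<close>, \<open>g\<close>, \<open>y\<close> are the Gram
  entries of two vectors a and b, and \<open>pos\<close> is positivity of the form at a + c b. The
  statement is about numbers only, so that it serves both traces on the algebra and states on the
  completion.\<close>

lemma hermitian_Cauchy_Schwarz:
  fixes x y f g :: complex
  assumes pos: "\<And>c. x + c * f + cnj c * g + cnj c * c * y \<in> \<real>\<^sub>\<ge>\<^sub>0"
    and x: "x \<in> \<real>\<^sub>\<ge>\<^sub>0" and y: "y \<in> \<real>\<^sub>\<ge>\<^sub>0"
  shows "g = cnj f" and "(cmod f)\<^sup>2 \<le> Re x * Re y"
proof -
  have "Im f + Im g = 0" using pos[of 1] x y by (simp add: complex_nonneg_iff)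
  moreover have "Re f - Re g = 0" using pos[of \<i>] x y by (simp add: complex_nonneg_iff)
  ultimately show g: "g = cnj f" by (simp add: complex_eq_iff)
  \<comment> \<open>With \<open>c = - t cnj f\<close> the form becomes a real quadratic in
    \<open>t\<close>, whose minimum for \<open>Re y > 0\<close> is at
    \<open>t = 1 / Re y\<close>.\<close>
  have ineq: "0 \<le> Re x - 2 * t * (cmod f)\<^sup>2 + t\<^sup>2 * (cmod f)\<^sup>2 * Re y" for t :: real
  proof -
    have "Re (x + (- of_real t * cnj f) * f + cnj (- of_real t * cnj f) * g
       + cnj (- of_real t * cnj f) * (- of_real t * cnj f) * y)
       = Re x - 2 * t * (cmod f)\<^sup>2 + t\<^sup>2 * (cmod f)\<^sup>2 * Re y"
      unfolding g cmod_power2 by (simp add: power2_eq_square algebra_simps)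
    then show ?thesis using pos[of "- of_real t * cnj f"] by (simp add: complex_nonneg_iff)
  qed
  have "0 \<le> Re y" using y by (simp add: complex_nonneg_iff)
  show "(cmod f)\<^sup>2 \<le> Re x * Re y"
  proof (cases "Re y = 0")
    case True
    have "(cmod f)\<^sup>2 = 0"
    proof (rule ccontr)
      assume "(cmod f)\<^sup>2 \<noteq> 0"
      then show False
        \<comment> \<open>For \<open>Re y = 0\<close> the quadratic is affine in \<open>t\<close>;
          this value of \<open>t\<close> makes it -1.\<close>
        using ineq[of "(Re x + 1) / (2 * (cmod f)\<^sup>2)"] True by (simp add: field_simps)
    qed
    then show ?thesis using True by simp
  next
    case False
    then have "Re y > 0" using \<open>0 \<le> Re y\<close> by simp
    then show ?thesis
      using ineq[of "1 / Re y"] by (simp add: field_simps power2_eq_square)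
  qed
qed

text \<open>A unital star algebra carried by a subset of a ring type, so that the algebras of
  several subgroups can share one type. Complex multiples are products with central elements
  \<open>scalar c\<close>. The spanning unitaries stand in for a norm: they bound every
  C-star-seminorm and make left multiplication bounded for every trace.\<close>

locale star_ring =
  fixes B :: "'r::ring_1 set" and scalar :: "complex \<Rightarrow> 'r" and adj :: "'r \<Rightarrow> 'r"
    and unitaries :: "'r set"
  assumes scalar_closed [simp, intro]: "scalar c \<in> B"
    and add_closed [simp, intro]: "a \<in> B \<Longrightarrow> b \<in> B \<Longrightarrow> a + b \<in> B"
    and mult_closed [simp, intro]: "a \<in> B \<Longrightarrow> b \<in> B \<Longrightarrow> a * b \<in> B"
    and adj_closed [simp, intro]: "a \<in> B \<Longrightarrow> adj a \<in> B"
    and scalar_add: "scalar (c + d) = scalar c + scalar d"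
    and scalar_mult: "scalar (c * d) = scalar c * scalar d"
    and scalar_1: "scalar 1 = 1"
    and scalar_central: "a * scalar c = scalar c * a"
    and adj_add: "adj (a + b) = adj a + adj b"
    and adj_mult: "adj (a * b) = adj b * adj a"
    and adj_adj [simp]: "adj (adj a) = a"
    and adj_scalar: "adj (scalar c) = scalar (cnj c)"
    and unitary: "u \<in> unitaries \<Longrightarrow> u \<in> B \<and> adj u * u = 1 \<and> u * adj u = 1"
    and unitary_span: "a \<in> B \<Longrightarrow>
      \<exists>F c. finite F \<and> F \<subseteq> unitaries \<and> a = (\<Sum>u\<in>F. scalar (c u) * u)"
begin

lemma mult_scalar: "a * (scalar c * b) = scalar c * (a * b)"
  by (metis mult.assoc scalar_central)

lemma one_closed [simp, intro]: "1 \<in> B"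
  using scalar_closed[of 1] by (simp add: scalar_1)

lemma scalar_0 [simp]: "scalar 0 = 0"
  using scalar_add[of 0 0] by simp

lemma zero_closed [simp, intro]: "0 \<in> B"
  using scalar_closed[of 0] by simp

lemma scalar_minus: "scalar (- c) = - scalar c"
  using scalar_add[of c "- c"] by (simp add: eq_neg_iff_add_eq_0 add.commute)

lemma minus_eq_scalar: "- a = scalar (- 1) * a"
  by (simp add: scalar_minus scalar_1)

lemma uminus_closed [simp, intro]: "a \<in> B \<Longrightarrow> - a \<in> B"
  by (subst minus_eq_scalar) auto

lemma diff_closed [simp, intro]: "a \<in> B \<Longrightarrow> b \<in> B \<Longrightarrow> a - b \<in> B"
  using add_closed[of a "- b"] by simp

lemma sum_closed [simp, intro]: "(\<And>i. i \<in> F \<Longrightarrow> f i \<in> B) \<Longrightarrow> sum f F \<in> B"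
  by (induction F rule: infinite_finite_induct) auto

lemma power_closed [simp, intro]: "a \<in> B \<Longrightarrow> a ^ n \<in> B"
  by (induction n) auto

lemma adj_0 [simp]: "adj 0 = 0"
  using adj_scalar[of 0] by simp

lemma adj_1 [simp]: "adj 1 = 1"
  using adj_scalar[of 1] by (simp add: scalar_1)

lemma adj_minus [simp]: "adj (- a) = - adj a"
  using adj_add[of "- a" a] by (simp add: eq_neg_iff_add_eq_0)

lemma adj_diff: "adj (a - b) = adj a - adj b"
  using adj_add[of a "- b"] by simp

lemma adj_sum: "adj (sum f F) = (\<Sum>i\<in>F. adj (f i))"
  by (induction F rule: infinite_finite_induct) (auto simp: adj_add)

lemma unitaryD [simp]:
  "u \<in> unitaries \<Longrightarrow> u \<in> B" "u \<in> unitaries \<Longrightarrow> adj u * u = 1"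
  "u \<in> unitaries \<Longrightarrow> u * adj u = 1"
  using unitary by auto

section \<open>C-star-seminorms and the universal norm\<close>

definition cstar_seminorm_on :: "('r \<Rightarrow> real) \<Rightarrow> bool" where
  "cstar_seminorm_on N \<longleftrightarrow>
     (\<forall>x\<in>B. 0 \<le> N x) \<and> (\<forall>x\<in>B. \<forall>y\<in>B. N (x + y) \<le> N x + N y) \<and>
     (\<forall>c. \<forall>x\<in>B. N (scalar c * x) = cmod c * N x) \<and>
     (\<forall>x\<in>B. \<forall>y\<in>B. N (x * y) \<le> N x * N y) \<and>
     (\<forall>x\<in>B. N (adj x * x) = (N x)\<^sup>2)"

context
  fixes N assumes N: "cstar_seminorm_on N"
begin

lemma
  csn_nonneg: "x \<in> B \<Longrightarrow> 0 \<le> N x"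
  and csn_add: "x \<in> B \<Longrightarrow> y \<in> B \<Longrightarrow> N (x + y) \<le> N x + N y"
  and csn_scale: "x \<in> B \<Longrightarrow> N (scalar c * x) = cmod c * N x"
  and csn_mult: "x \<in> B \<Longrightarrow> y \<in> B \<Longrightarrow> N (x * y) \<le> N x * N y"
  and csn_cstar: "x \<in> B \<Longrightarrow> N (adj x * x) = (N x)\<^sup>2"
  using N by (auto simp: cstar_seminorm_on_def)

lemma csn_zero: "N 0 = 0"
  using csn_scale[of 0 0] by simp

lemma csn_minus: "x \<in> B \<Longrightarrow> N (- x) = N x"
  by (subst minus_eq_scalar) (simp add: csn_scale)

lemma csn_diff: "x \<in> B \<Longrightarrow> y \<in> B \<Longrightarrow> N (x - y) \<le> N x + N y"
  using csn_add[of x "- y"] by (simp add: csn_minus)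

lemma csn_diff_commute: "x \<in> B \<Longrightarrow> y \<in> B \<Longrightarrow> N (x - y) = N (y - x)"
  using csn_minus[of "x - y"] by simp

lemma csn_triangle: "x \<in> B \<Longrightarrow> y \<in> B \<Longrightarrow> z \<in> B \<Longrightarrow> N (x - z) \<le> N (x - y) + N (y - z)"
  using csn_add[of "x - y" "y - z"] by simp

lemma csn_sum:
  "(\<And>i. i \<in> F \<Longrightarrow> f i \<in> B) \<Longrightarrow> N (sum f F) \<le> (\<Sum>i\<in>F. N (f i))"
proof (induction F rule: infinite_finite_induct)
  case (insert i F)
  then show ?case using csn_add[of "f i" "sum f F"] by fastforce
qed (auto simp: csn_zero)

text \<open>Cancel \<open>N x\<close> in
  \<open>N x * N x = N (adj x * x) \<le> N (adj x) * N x\<close>.\<close>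

lemma csn_adj_le: assumes "x \<in> B" shows "N x \<le> N (adj x)"
proof (cases "N x = 0")
  case False
  then have "N x > 0" using csn_nonneg[OF assms] by simp
  moreover have "N x * N x \<le> N (adj x) * N x"
    using csn_mult[of "adj x" x] csn_cstar[of x] assms by (simp add: power2_eq_square)
  ultimately show ?thesis by simp
qed (use csn_nonneg assms in auto)

lemma csn_adj: "x \<in> B \<Longrightarrow> N (adj x) = N x"
  using csn_adj_le[of x] csn_adj_le[of "adj x"] by force

lemma csn_one_le: "N 1 \<le> 1"
proof -
  have "N 1 = (N 1)\<^sup>2" using csn_cstar[of 1] by simp
  then have "N 1 * (N 1 - 1) = 0" by (simp add: power2_eq_square algebra_simps)
  then show ?thesis by auto
qed

lemma csn_unitary_le: assumes "u \<in> unitaries" shows "N u \<le> 1"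
proof -
  have "(N u)\<^sup>2 \<le> 1" using csn_cstar[of u] csn_one_le assms by simp
  then show ?thesis by (simp add: abs_square_le_1)
qed

text \<open>The bound by the sum of the absolute coefficients does not depend on \<open>N\<close>;
  it makes the supremum defining \<open>unorm\<close> finite.\<close>

lemma csn_le_sum:
  assumes "finite F" "F \<subseteq> unitaries"
  shows "N (\<Sum>u\<in>F. scalar (c u) * u) \<le> (\<Sum>u\<in>F. cmod (c u))"
proof -
  have "N (\<Sum>u\<in>F. scalar (c u) * u) \<le> (\<Sum>u\<in>F. N (scalar (c u) * u))"
    using assms by (intro csn_sum) auto
  also have "\<dots> = (\<Sum>u\<in>F. cmod (c u) * N u)"
    using assms by (intro sum.cong) (auto simp: csn_scale)
  also have "\<dots> \<le> (\<Sum>u\<in>F. cmod (c u))"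
    using assms csn_unitary_le by (intro sum_mono) (auto intro!: mult_left_le)
  finally show ?thesis .
qed

lemma csn_conj_unitary:
  assumes "u \<in> unitaries" "x \<in> B" shows "N (u * x * adj u) = N x"
proof -
  have le: "N (v * y * adj v) \<le> N y" if "N v \<le> 1" "v \<in> B" "y \<in> B" for v y
  proof -
    have "N (v * y * adj v) \<le> N v * N y * N (adj v)"
      using that csn_mult[of "v * y" "adj v"] csn_mult[of v y] csn_nonneg[of "adj v"]
      by (meson adj_closed mult_closed mult_right_mono order_trans)
    also have "\<dots> \<le> 1 * N y * 1"
      using that csn_nonneg csn_adj by (intro mult_mono) auto
    finally show ?thesis by simp
  qed
  have "x = adj u * (u * x * adj u) * adj (adj u)"
    using assms by (simp add: mult.assoc) (simp flip: mult.assoc add: assms)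
  then have "N x \<le> N (u * x * adj u)"
    using le[of "adj u" "u * x * adj u"] assms csn_unitary_le csn_adj by auto
  then show ?thesis using le[of u x] assms csn_unitary_le by force
qed

end

definition unorm :: "'r \<Rightarrow> real" where
  "unorm x = (SUP N\<in>Collect cstar_seminorm_on. N x)"

text \<open>The family of seminorms is thus nonempty, and comparison with this member shows that
  \<open>unorm\<close> is nonnegative.\<close>

lemma csn_zero_function: "cstar_seminorm_on (\<lambda>_. 0)"
  by (simp add: cstar_seminorm_on_def)

lemma csn_bdd_above: assumes "x \<in> B" shows "bdd_above ((\<lambda>N. N x) ` Collect cstar_seminorm_on)"
proof -
  obtain F c where "finite F" "F \<subseteq> unitaries" "x = (\<Sum>u\<in>F. scalar (c u) * u)"
    using unitary_span[OF assms] by auto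
  then show ?thesis using csn_le_sum by (intro bdd_aboveI[where M = "\<Sum>u\<in>F. cmod (c u)"]) auto
qed

lemma csn_le_unorm: "cstar_seminorm_on N \<Longrightarrow> x \<in> B \<Longrightarrow> N x \<le> unorm x"
  unfolding unorm_def by (rule cSUP_upper) (auto intro: csn_bdd_above)

lemma unorm_least: "x \<in> B \<Longrightarrow> (\<And>N. cstar_seminorm_on N \<Longrightarrow> N x \<le> C) \<Longrightarrow> unorm x \<le> C"
  unfolding unorm_def using csn_zero_function by (intro cSUP_least) auto

lemma csn_unorm: "cstar_seminorm_on unorm"
  unfolding cstar_seminorm_on_def
proof (intro conjI ballI allI)
  fix x assume x: "x \<in> B"
  show nn: "0 \<le> unorm x" using csn_le_unorm[OF csn_zero_function x] .
  show "unorm (adj x * x) = (unorm x)\<^sup>2"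
  proof (rule antisym)
    show "unorm (adj x * x) \<le> (unorm x)\<^sup>2"
      using x csn_le_unorm csn_nonneg by (intro unorm_least) (auto simp: csn_cstar intro!: power_mono)
    \<comment> \<open>The identity \<open>N (adj x * x) = (N x)\<^sup>2\<close> bounds every
      \<open>N x\<close> by a quantity free of \<open>N\<close>.\<close>
    have "N x \<le> sqrt (unorm (adj x * x))" if "cstar_seminorm_on N" for N
      using csn_cstar[OF that x] csn_le_unorm[OF that, of "adj x * x"] csn_nonneg[OF that x] x
      by (intro real_le_rsqrt) auto
    then have "unorm x \<le> sqrt (unorm (adj x * x))" using x by (intro unorm_least)
    moreover have "0 \<le> unorm (adj x * x)"
      using csn_le_unorm[OF csn_zero_function, of "adj x * x"] x by simp
    ultimately show "(unorm x)\<^sup>2 \<le> unorm (adj x * x)"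
      using nn power_mono[of "unorm x" _ 2] by fastforce
  qed
  fix c
  show "unorm (scalar c * x) = cmod c * unorm x"
  proof (rule antisym)
    show "unorm (scalar c * x) \<le> cmod c * unorm x"
      using x csn_le_unorm by (intro unorm_least) (auto simp: csn_scale intro!: mult_left_mono)
    show "cmod c * unorm x \<le> unorm (scalar c * x)"
    proof (cases "c = 0")
      case True
      then show ?thesis using csn_le_unorm[OF csn_zero_function, of 0] by simp
    next
      case False
      have "N x \<le> unorm (scalar c * x) / cmod c" if "cstar_seminorm_on N" for N
        using csn_le_unorm[OF that, of "scalar c * x"] csn_scale[OF that x] x False
        by (simp add: field_simps)
      then have "unorm x \<le> unorm (scalar c * x) / cmod c" using x by (intro unorm_least)
      then show ?thesis using False by (simp add: field_simps)
    qed
  qed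
next
  fix x y assume xy: "x \<in> B" "y \<in> B"
  show "unorm (x + y) \<le> unorm x + unorm y"
  proof (rule unorm_least)
    fix N assume N: "cstar_seminorm_on N"
    show "N (x + y) \<le> unorm x + unorm y"
      using csn_add[OF N xy] csn_le_unorm[OF N xy(1)] csn_le_unorm[OF N xy(2)] by linarith
  qed (use xy in auto)
  show "unorm (x * y) \<le> unorm x * unorm y"
  proof (rule unorm_least)
    fix N assume N: "cstar_seminorm_on N"
    have "N x * N y \<le> unorm x * unorm y"
      using csn_le_unorm[OF N] csn_nonneg[OF N] csn_le_unorm[OF csn_zero_function] xy
      by (intro mult_mono) auto
    then show "N (x * y) \<le> unorm x * unorm y"
      using csn_mult[OF N xy] by linarith
  qed (use xy in auto)
qed

lemmas unorm_nonneg [simp] = csn_nonneg[OF csn_unorm]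
  and unorm_add = csn_add[OF csn_unorm]
  and unorm_scale = csn_scale[OF csn_unorm]
  and unorm_mult = csn_mult[OF csn_unorm]
  and unorm_cstar = csn_cstar[OF csn_unorm]
  and unorm_zero [simp] = csn_zero[OF csn_unorm]
  and unorm_diff = csn_diff[OF csn_unorm]
  and unorm_adj = csn_adj[OF csn_unorm]
  and unorm_diff_commute = csn_diff_commute[OF csn_unorm]
  and unorm_triangle = csn_triangle[OF csn_unorm]

section \<open>Traces, the GNS seminorm and the GNS operator norm\<close>

definition trace_on :: "('r \<Rightarrow> complex) \<Rightarrow> bool" where
  "trace_on T \<longleftrightarrow>
     (\<forall>a\<in>B. \<forall>b\<in>B. T (a + b) = T a + T b) \<and> (\<forall>c. \<forall>a\<in>B. T (scalar c * a) = c * T a) \<and>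
     (\<forall>a\<in>B. T (adj a * a) \<in> \<real>\<^sub>\<ge>\<^sub>0) \<and> T 1 = 1 \<and> (\<forall>a\<in>B. \<forall>b\<in>B. T (a * b) = T (b * a))"

definition extreme_trace_on :: "('r \<Rightarrow> complex) \<Rightarrow> bool" where
  "extreme_trace_on T \<longleftrightarrow> trace_on T \<and>
     (\<forall>S R. \<forall>t::real. trace_on S \<longrightarrow> trace_on R \<longrightarrow> 0 < t \<and> t < 1 \<longrightarrow>
        (\<forall>a\<in>B. T a = of_real t * S a + of_real (1 - t) * R a) \<longrightarrow>
        (\<forall>a\<in>B. S a = T a \<and> R a = T a))"

definition tnorm :: "('r \<Rightarrow> complex) \<Rightarrow> 'r \<Rightarrow> real" where
  "tnorm T a = sqrt (Re (T (adj a * a)))"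

text \<open>The operator norm in the GNS representation of \<open>T\<close>.\<close>

definition gnorm :: "('r \<Rightarrow> complex) \<Rightarrow> 'r \<Rightarrow> real" where
  "gnorm T a = (SUP b\<in>{b \<in> B. tnorm T b \<le> 1}. tnorm T (a * b))"

context
  fixes T assumes T: "trace_on T"
begin

lemma
  trace_add: "a \<in> B \<Longrightarrow> b \<in> B \<Longrightarrow> T (a + b) = T a + T b"
  and trace_scale: "a \<in> B \<Longrightarrow> T (scalar c * a) = c * T a"
  and trace_pos: "a \<in> B \<Longrightarrow> T (adj a * a) \<in> \<real>\<^sub>\<ge>\<^sub>0"
  and trace_1: "T 1 = 1"
  and trace_commute: "a \<in> B \<Longrightarrow> b \<in> B \<Longrightarrow> T (a * b) = T (b * a)"
  using T by (auto simp: trace_on_def)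

lemma trace_zero: "T 0 = 0"
  using trace_scale[of 0 0] by simp

lemma trace_minus: "a \<in> B \<Longrightarrow> T (- a) = - T a"
  by (subst minus_eq_scalar) (simp add: trace_scale)

lemma trace_diff: "a \<in> B \<Longrightarrow> b \<in> B \<Longrightarrow> T (a - b) = T a - T b"
  using trace_add[of a "- b"] by (simp add: trace_minus)

lemma trace_sum: "(\<And>i. i \<in> F \<Longrightarrow> f i \<in> B) \<Longrightarrow> T (sum f F) = (\<Sum>i\<in>F. T (f i))"
  by (induction F rule: infinite_finite_induct) (auto simp: trace_zero trace_add)

lemma tnorm_nonneg: "a \<in> B \<Longrightarrow> 0 \<le> tnorm T a"
  using trace_pos[of a] by (simp add: tnorm_def complex_nonneg_iff)

lemma trace_adj_mult: "a \<in> B \<Longrightarrow> T (adj a * a) = of_real ((tnorm T a)\<^sup>2)"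
  using trace_pos[of a] by (simp add: tnorm_def complex_nonneg_iff complex_eq_iff)

lemma tnorm_sq: "a \<in> B \<Longrightarrow> (tnorm T a)\<^sup>2 = Re (T (adj a * a))"
  by (simp add: trace_adj_mult)

lemma trace_Cauchy_Schwarz_aux:
  assumes "a \<in> B" "b \<in> B"
  shows "T (adj b * a) = cnj (T (adj a * b)) \<and> (cmod (T (adj a * b)))\<^sup>2 \<le> (tnorm T a * tnorm T b)\<^sup>2"
proof -
  have "T (adj a * a) + c * T (adj a * b) + cnj c * T (adj b * a) + cnj c * c * T (adj b * b) \<in> \<real>\<^sub>\<ge>\<^sub>0" for c
  proof -
    have "adj (a + scalar c * b) * (a + scalar c * b) = adj a * a + scalar c * (adj a * b)
        + scalar (cnj c) * (adj b * a) + scalar (cnj c * c) * (adj b * b)"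
      by (simp add: adj_add adj_mult adj_scalar scalar_central[of "adj b"] mult_scalar[of "adj a"]
          mult_scalar[of "adj b"] scalar_mult distrib_left distrib_right mult.assoc add.assoc)
    then have "T (adj (a + scalar c * b) * (a + scalar c * b)) = T (adj a * a) + c * T (adj a * b)
        + cnj c * T (adj b * a) + cnj c * c * T (adj b * b)"
      using assms by (simp add: trace_add trace_scale)
    then show ?thesis using trace_pos[of "a + scalar c * b"] assms by simp
  qed
  from hermitian_Cauchy_Schwarz[OF this] trace_pos assms show ?thesis
    by (simp add: power_mult_distrib tnorm_sq)
qed

lemma trace_Cauchy_Schwarz:
  assumes "a \<in> B" "b \<in> B" shows "cmod (T (adj a * b)) \<le> tnorm T a * tnorm T b"
  using trace_Cauchy_Schwarz_aux[OF assms] tnorm_nonneg assms by (auto intro: power2_le_imp_le)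

lemma tnorm_adj: "a \<in> B \<Longrightarrow> tnorm T (adj a) = tnorm T a"
  by (simp add: tnorm_def trace_commute)

lemma trace_Cauchy_Schwarz':
  "a \<in> B \<Longrightarrow> b \<in> B \<Longrightarrow> cmod (T (a * b)) \<le> tnorm T a * tnorm T b"
  using trace_Cauchy_Schwarz[of "adj a" b] by (simp add: tnorm_adj)

lemma tnorm_one: "tnorm T 1 = 1"
  by (simp add: tnorm_def trace_1)

lemma trace_le_tnorm: "a \<in> B \<Longrightarrow> cmod (T a) \<le> tnorm T a"
  using trace_Cauchy_Schwarz[of 1 a] by (simp add: tnorm_one)

lemma tnorm_add:
  assumes "a \<in> B" "b \<in> B" shows "tnorm T (a + b) \<le> tnorm T a + tnorm T b"
proof (rule power2_le_imp_le)
  have "(tnorm T (a + b))\<^sup>2 = Re (T (adj a * a)) + Re (T (adj a * b)) + Re (T (adj b * a)) + Re (T (adj b * b))"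
    using assms by (simp add: tnorm_sq adj_add distrib_left distrib_right trace_add)
  also have "\<dots> \<le> (tnorm T a)\<^sup>2 + 2 * (tnorm T a * tnorm T b) + (tnorm T b)\<^sup>2"
    using trace_Cauchy_Schwarz[of a b] trace_Cauchy_Schwarz[of b a] assms
      complex_Re_le_cmod[of "T (adj a * b)"] complex_Re_le_cmod[of "T (adj b * a)"]
    by (simp add: tnorm_sq mult.commute)
  finally show "(tnorm T (a + b))\<^sup>2 \<le> (tnorm T a + tnorm T b)\<^sup>2"
    by (simp add: power2_sum algebra_simps)
qed (use assms tnorm_nonneg in simp)

lemma tnorm_scale: "a \<in> B \<Longrightarrow> tnorm T (scalar c * a) = cmod c * tnorm T a"
proof -
  assume a: "a \<in> B"
  have "adj (scalar c * a) * (scalar c * a) = scalar (cnj c * c) * (adj a * a)"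
    by (simp add: adj_mult adj_scalar scalar_mult scalar_central[of "adj a"] mult_scalar[of "adj a"]
        mult.assoc)
  then have "T (adj (scalar c * a) * (scalar c * a)) = of_real ((cmod c)\<^sup>2 * (tnorm T a)\<^sup>2)"
    using a complex_norm_square[of c] by (simp add: trace_scale trace_adj_mult mult.commute)
  then show ?thesis unfolding tnorm_def[of T "scalar c * a"] using tnorm_nonneg[OF a]
    by (simp add: real_sqrt_mult)
qed

lemma tnorm_minus: "a \<in> B \<Longrightarrow> tnorm T (- a) = tnorm T a"
  by (subst minus_eq_scalar) (simp add: tnorm_scale)

lemma tnorm_sum: "(\<And>i. i \<in> F \<Longrightarrow> f i \<in> B) \<Longrightarrow> tnorm T (sum f F) \<le> (\<Sum>i\<in>F. tnorm T (f i))"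
proof (induction F rule: infinite_finite_induct)
  case (insert i F)
  then show ?case using tnorm_add[of "f i" "sum f F"] by fastforce
qed (auto simp: tnorm_def trace_zero)

lemma tnorm_unitary_mult:
  assumes "u \<in> unitaries" "a \<in> B" shows "tnorm T (u * a) = tnorm T a"
proof -
  have "adj (u * a) * (u * a) = adj a * (adj u * u) * a" by (simp add: adj_mult mult.assoc)
  then show ?thesis using assms by (simp add: tnorm_def)
qed

lemma tnorm_mult_unitary:
  assumes "u \<in> unitaries" "a \<in> B" shows "tnorm T (a * u) = tnorm T a"
proof -
  have "T (adj (a * u) * (a * u)) = T (adj u * (adj a * a * u))"
    by (simp add: adj_mult mult.assoc)
  also have "\<dots> = T (adj a * a * (u * adj u))"
    using assms by (subst trace_commute) (auto simp: mult.assoc)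
  finally show ?thesis using assms by (simp add: tnorm_def)
qed

text \<open>Left multiplication by a unitary is isometric, and \<open>a\<close> is a finite
  combination of unitaries. The constant is crude; it is there to make the supremum in
  \<open>gnorm\<close> finite.\<close>

lemma tnorm_mult_bounded: assumes "a \<in> B" shows "\<exists>C\<ge>0. \<forall>b\<in>B. tnorm T (a * b) \<le> C * tnorm T b"
proof -
  obtain F c where F: "finite F" "F \<subseteq> unitaries" "a = (\<Sum>u\<in>F. scalar (c u) * u)"
    using unitary_span[OF assms] by auto
  have "tnorm T (a * b) \<le> (\<Sum>u\<in>F. cmod (c u)) * tnorm T b" if "b \<in> B" for b
  proof -
    have "tnorm T (a * b) \<le> (\<Sum>u\<in>F. tnorm T (scalar (c u) * (u * b)))"
      using F that by (simp add: sum_distrib_right mult.assoc) (rule tnorm_sum, auto)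
    also have "\<dots> = (\<Sum>u\<in>F. cmod (c u) * tnorm T b)"
      using F that by (intro sum.cong) (auto simp: tnorm_scale subsetD tnorm_unitary_mult)
    finally show ?thesis by (simp add: sum_distrib_right)
  qed
  then show ?thesis by (meson sum_nonneg norm_ge_zero)
qed

lemma gnorm_bdd_above: "a \<in> B \<Longrightarrow> bdd_above ((\<lambda>b. tnorm T (a * b)) ` {b \<in> B. tnorm T b \<le> 1})"
proof -
  assume "a \<in> B"
  then obtain C where "C \<ge> 0" and C: "\<forall>b\<in>B. tnorm T (a * b) \<le> C * tnorm T b"
    using tnorm_mult_bounded by blast
  have "tnorm T (a * b) \<le> C" if "b \<in> B" "tnorm T b \<le> 1" for b
    using C that \<open>C \<ge> 0\<close> mult_left_mono[of "tnorm T b" 1 C] by fastforce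
  then show ?thesis by (intro bdd_aboveI[where M = C]) auto
qed

lemma gnorm_nonneg: "a \<in> B \<Longrightarrow> 0 \<le> gnorm T a"
proof -
  assume a: "a \<in> B"
  have "tnorm T (a * 1) \<le> gnorm T a" unfolding gnorm_def
    using a by (intro cSUP_upper gnorm_bdd_above) (auto simp: tnorm_one)
  then show ?thesis using tnorm_nonneg[OF a] by simp
qed

lemma tnorm_mult_le: assumes "a \<in> B" "b \<in> B" shows "tnorm T (a * b) \<le> gnorm T a * tnorm T b"
proof (cases "tnorm T b = 0")
  case True
  \<comment> \<open>A null vector cannot be normalised; the crude bound shows that
    \<open>a * b\<close> is null too.\<close>
  obtain C where "\<forall>b\<in>B. tnorm T (a * b) \<le> C * tnorm T b"
    using tnorm_mult_bounded assms by blast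
  then show ?thesis using True assms by fastforce
next
  case False
  then have pos: "tnorm T b > 0" using tnorm_nonneg assms by force
  let ?b = "scalar (of_real (1 / tnorm T b)) * b"
  have "tnorm T (a * ?b) \<le> gnorm T a" unfolding gnorm_def
    using assms pos by (intro cSUP_upper gnorm_bdd_above) (auto simp: tnorm_scale norm_divide)
  moreover have "a * ?b = scalar (of_real (1 / tnorm T b)) * (a * b)"
    by (rule mult_scalar)
  ultimately show ?thesis using assms pos by (simp add: tnorm_scale norm_divide field_simps)
qed

lemma gnorm_least:
  assumes "a \<in> B" "0 \<le> R" "\<And>b. b \<in> B \<Longrightarrow> tnorm T (a * b) \<le> R * tnorm T b"
  shows "gnorm T a \<le> R"
  unfolding gnorm_def
proof (rule cSUP_least)
  show "{b \<in> B. tnorm T b \<le> 1} \<noteq> {}" using tnorm_one by auto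
next
  fix b assume "b \<in> {b \<in> B. tnorm T b \<le> 1}"
  then show "tnorm T (a * b) \<le> R"
    using assms mult_left_mono[of "tnorm T b" 1 R] by fastforce
qed

lemma gnorm_mult: assumes "a \<in> B" "b \<in> B" shows "gnorm T (a * b) \<le> gnorm T a * gnorm T b"
proof (rule gnorm_least)
  fix c assume c: "c \<in> B"
  have "tnorm T (a * b * c) \<le> gnorm T a * tnorm T (b * c)"
    using tnorm_mult_le[of a "b * c"] assms c by (simp add: mult.assoc)
  also have "\<dots> \<le> gnorm T a * (gnorm T b * tnorm T c)"
    using assms c tnorm_mult_le gnorm_nonneg by (intro mult_left_mono) auto
  finally show "tnorm T (a * b * c) \<le> gnorm T a * gnorm T b * tnorm T c"
    by (simp add: mult.assoc)
qed (use assms gnorm_nonneg in auto)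

text \<open>The half of the C-star identity that needs Cauchy-Schwarz: the square of
  \<open>tnorm T (a * b)\<close> is the inner product of \<open>b\<close> with
  \<open>adj a * a * b\<close>. The other half is submultiplicativity.\<close>

lemma gnorm_sq_le: assumes "a \<in> B" shows "(gnorm T a)\<^sup>2 \<le> gnorm T (adj a * a)"
proof -
  have "gnorm T a \<le> sqrt (gnorm T (adj a * a))"
  proof (rule gnorm_least)
    fix b assume b: "b \<in> B"
    have "(tnorm T (a * b))\<^sup>2 \<le> cmod (T (adj b * (adj a * a * b)))"
      using assms b complex_Re_le_cmod by (simp add: tnorm_sq adj_mult mult.assoc)
    also have "\<dots> \<le> tnorm T b * (gnorm T (adj a * a) * tnorm T b)"
      using assms b trace_Cauchy_Schwarz[of b "adj a * a * b"] tnorm_mult_le[of "adj a * a" b]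
        mult_left_mono[OF _ tnorm_nonneg[OF b]] by (meson adj_closed mult_closed order_trans)
    also have "\<dots> = (sqrt (gnorm T (adj a * a)) * tnorm T b)\<^sup>2"
      using assms gnorm_nonneg by (simp add: power_mult_distrib power2_eq_square)
    finally show "tnorm T (a * b) \<le> sqrt (gnorm T (adj a * a)) * tnorm T b"
      using assms b gnorm_nonneg tnorm_nonneg by (auto intro: power2_le_imp_le)
  qed (use assms gnorm_nonneg in auto)
  then show ?thesis
    using assms gnorm_nonneg power_mono[of "gnorm T a" "sqrt (gnorm T (adj a * a))" 2] by force
qed

lemma gnorm_adj_le: assumes "a \<in> B" shows "gnorm T a \<le> gnorm T (adj a)"
proof (cases "gnorm T a = 0")
  case False
  then have "gnorm T a > 0" using gnorm_nonneg[OF assms] by simp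
  moreover have "gnorm T a * gnorm T a \<le> gnorm T (adj a) * gnorm T a"
    using gnorm_mult[of "adj a" a] gnorm_sq_le[of a] assms by (simp add: power2_eq_square)
  ultimately show ?thesis by simp
qed (use gnorm_nonneg assms in auto)

lemma csn_gnorm: "cstar_seminorm_on (gnorm T)"
  unfolding cstar_seminorm_on_def
proof (intro conjI ballI allI)
  fix x assume x: "x \<in> B"
  show "0 \<le> gnorm T x" using gnorm_nonneg x .
  have "gnorm T (adj x) = gnorm T x"
    using gnorm_adj_le[of x] gnorm_adj_le[of "adj x"] x by force
  then have "gnorm T (adj x * x) \<le> (gnorm T x)\<^sup>2"
    using gnorm_mult[of "adj x" x] x by (simp add: power2_eq_square)
  then show "gnorm T (adj x * x) = (gnorm T x)\<^sup>2" using gnorm_sq_le[OF x] by simp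
  fix c
  have le: "gnorm T (scalar c * x) \<le> cmod c * gnorm T x" if x: "x \<in> B" for c x
  proof (rule gnorm_least)
    fix b assume b: "b \<in> B"
    show "tnorm T (scalar c * x * b) \<le> cmod c * gnorm T x * tnorm T b"
      using tnorm_mult_le[OF x b] x b by (simp add: mult.assoc tnorm_scale mult_left_mono)
  qed (use x gnorm_nonneg in auto)
  show "gnorm T (scalar c * x) = cmod c * gnorm T x"
  proof (cases "c = 0")
    case True
    then show ?thesis using le[OF x, of 0] gnorm_nonneg[of 0] by simp
  next
    case False
    have "gnorm T (scalar (1 / c) * (scalar c * x)) \<le> cmod (1 / c) * gnorm T (scalar c * x)"
      using le x by blast
    then have "gnorm T x \<le> gnorm T (scalar c * x) / cmod c"
      using False by (simp add: mult.assoc[symmetric] scalar_mult[symmetric] scalar_1 norm_divide)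
    then show ?thesis using le[OF x, of c] False by (simp add: field_simps)
  qed
next
  fix x y assume xy: "x \<in> B" "y \<in> B"
  show "gnorm T (x * y) \<le> gnorm T x * gnorm T y" using gnorm_mult xy .
  show "gnorm T (x + y) \<le> gnorm T x + gnorm T y"
  proof (rule gnorm_least)
    fix b assume b: "b \<in> B"
    show "tnorm T ((x + y) * b) \<le> (gnorm T x + gnorm T y) * tnorm T b"
      using tnorm_add[of "x * b" "y * b"] tnorm_mult_le[of x b] tnorm_mult_le[of y b] xy b
      by (simp add: distrib_right)
  qed (use xy gnorm_nonneg in auto)
qed

text \<open>Apply the GNS operator of \<open>a\<close> to the unit vector 1. Hence every trace on
  the algebra is continuous for \<open>unorm\<close>.\<close>

lemma tnorm_le_unorm: "a \<in> B \<Longrightarrow> tnorm T a \<le> unorm a"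
  using tnorm_mult_le[of a 1] csn_le_unorm[OF csn_gnorm, of a] by (simp add: tnorm_one)

lemma trace_le_unorm: "a \<in> B \<Longrightarrow> cmod (T a) \<le> unorm a"
  using trace_le_tnorm tnorm_le_unorm order_trans by blast

end

end

section \<open>Traces on the enveloping completion\<close>

text \<open>A bridge between the record-based algebra of the definitions and a ring type, where ring
  simplification is available. Statements about the completion are read off from sequences in
  \<open>B\<close>.\<close>

locale star_ring_model = star_ring B scalar adj unitaries
  for B :: "'r::ring_1 set" and scalar adj unitaries +
  fixes A :: "('b, 'm) star_algebra_scheme" and emb :: "'r \<Rightarrow> 'b"
  assumes emb_bij: "bij_betw emb B (carrier A)"
    and emb_add: "a \<in> B \<Longrightarrow> b \<in> B \<Longrightarrow> emb (a + b) = emb a \<oplus>\<^bsub>A\<^esub> emb b"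
    and emb_mult: "a \<in> B \<Longrightarrow> b \<in> B \<Longrightarrow> emb (a * b) = emb a \<otimes>\<^bsub>A\<^esub> emb b"
    and emb_scale: "a \<in> B \<Longrightarrow> emb (scalar c * a) = c \<odot>\<^bsub>A\<^esub> emb a"
    and emb_adj: "a \<in> B \<Longrightarrow> emb (adj a) = star A (emb a)"
    and emb_one: "emb 1 = \<one>\<^bsub>A\<^esub>"
    and emb_zero: "emb 0 = \<zero>\<^bsub>A\<^esub>"
begin

lemma emb_closed [simp]: "a \<in> B \<Longrightarrow> emb a \<in> carrier A"
  using emb_bij by (auto simp: bij_betw_def)

lemma emb_inj [simp]: "a \<in> B \<Longrightarrow> b \<in> B \<Longrightarrow> emb a = emb b \<longleftrightarrow> a = b"
  using emb_bij by (auto simp: bij_betw_def inj_on_def)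

lemma carrier_image: "carrier A = emb ` B"
  using emb_bij by (auto simp: bij_betw_def)

text \<open>\<open>A\<close> is known only as the image of \<open>B\<close>, not as an instance of
  \<open>ring\<close>, so the additive inverse is computed from its definite description.\<close>

lemma a_inv_emb: assumes "a \<in> B" shows "\<ominus>\<^bsub>A\<^esub> emb a = emb (- a)"
  unfolding a_inv_def m_inv_def
proof (rule the_equality)
  show "emb (- a) \<in> carrier (add_monoid A) \<and> emb a \<otimes>\<^bsub>add_monoid A\<^esub> emb (- a) = \<one>\<^bsub>add_monoid A\<^esub>
      \<and> emb (- a) \<otimes>\<^bsub>add_monoid A\<^esub> emb a = \<one>\<^bsub>add_monoid A\<^esub>"
    using assms by (simp flip: emb_add emb_zero)
next
  fix y assume "y \<in> carrier (add_monoid A) \<and> emb a \<otimes>\<^bsub>add_monoid A\<^esub> y = \<one>\<^bsub>add_monoid A\<^esub>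
      \<and> y \<otimes>\<^bsub>add_monoid A\<^esub> emb a = \<one>\<^bsub>add_monoid A\<^esub>"
  then obtain b where b: "b \<in> B" "y = emb b" and "emb b \<oplus>\<^bsub>A\<^esub> emb a = \<zero>\<^bsub>A\<^esub>"
    by (auto simp: carrier_image)
  then have "b + a = 0" using assms by (simp flip: emb_add emb_zero)
  then have "b = - a" by (simp only: eq_neg_iff_add_eq_0)
  then show "y = emb (- a)" using b by simp
qed

lemma emb_diff: "a \<in> B \<Longrightarrow> b \<in> B \<Longrightarrow> emb a \<ominus>\<^bsub>A\<^esub> emb b = emb (a - b)"
  using emb_add[of a "- b"] by (simp add: a_minus_def a_inv_emb)

lemma cstar_seminorm_emb: "cstar_seminorm A N \<longleftrightarrow> cstar_seminorm_on (\<lambda>a. N (emb a))"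
  unfolding cstar_seminorm_def cstar_seminorm_on_def carrier_image
  by (simp flip: emb_add emb_mult emb_scale emb_adj)

lemma universal_norm_emb: assumes "a \<in> B" shows "universal_norm A (emb a) = unorm a"
proof -
  have "(\<lambda>N. N (emb a)) ` Collect (cstar_seminorm A) = (\<lambda>N. N a) ` Collect cstar_seminorm_on"
  proof (intro equalityI subsetI)
    fix x assume "x \<in> (\<lambda>N. N a) ` Collect cstar_seminorm_on"
    then obtain N where N: "cstar_seminorm_on N" "x = N a" by auto
    let ?N = "\<lambda>y. N (inv_into B emb y)"
    have inv: "inv_into B emb (emb b) = b" if "b \<in> B" for b
      using emb_bij that by (auto simp: bij_betw_def)
    have "cstar_seminorm_on (\<lambda>b. ?N (emb b))"
      using N(1) unfolding cstar_seminorm_on_def by (simp add: inv)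
    then show "x \<in> (\<lambda>N. N (emb a)) ` Collect (cstar_seminorm A)"
      using N(2) inv[OF assms] by (intro image_eqI[of _ _ ?N]) (auto simp: cstar_seminorm_emb)
  qed (auto simp: cstar_seminorm_emb)
  then show ?thesis by (simp add: universal_norm_def unorm_def)
qed

section \<open>Cauchy sequences for the universal norm and operations on their classes\<close>

definition csq :: "(nat \<Rightarrow> 'r) set" where
  "csq = {a. (\<forall>n. a n \<in> B) \<and> (\<forall>e>0. \<exists>M. \<forall>m\<ge>M. \<forall>n\<ge>M. unorm (a m - a n) < e)}"

definition cls :: "(nat \<Rightarrow> 'r) \<Rightarrow> (nat \<Rightarrow> 'b) set" where
  "cls a = cauchy_rel A (universal_norm A) `` {\<lambda>n. emb (a n)}"

abbreviation "C \<equiv> completion A (universal_norm A)"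

lemma csqD: "a \<in> csq \<Longrightarrow> a n \<in> B"
  unfolding csq_def by blast

lemma csq_Cauchy: "a \<in> csq \<Longrightarrow> e > 0 \<Longrightarrow> \<exists>M. \<forall>m\<ge>M. \<forall>n\<ge>M. unorm (a m - a n) < e"
  unfolding csq_def by blast

lemma csq_const: "x \<in> B \<Longrightarrow> (\<lambda>_. x) \<in> csq"
  by (simp add: csq_def)

lemma csq_one [simp]: "(\<lambda>_. 1) \<in> csq" and csq_zero [simp]: "(\<lambda>_. 0) \<in> csq"
  by (auto intro: csq_const)

declare csqD [simp]

lemma csq_bounded: assumes "a \<in> csq" shows "\<exists>K\<ge>0. \<forall>n. unorm (a n) \<le> K"
proof -
  obtain M where M: "\<forall>m\<ge>M. \<forall>n\<ge>M. unorm (a m - a n) < 1"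
    using csq_Cauchy[OF assms, of 1] by auto
  have "unorm (a n) \<le> Max ((\<lambda>n. unorm (a n)) ` {..M}) + 1" for n
  proof (cases "n \<le> M")
    case True
    then have "unorm (a n) \<le> Max ((\<lambda>n. unorm (a n)) ` {..M})" by (intro Max_ge) auto
    then show ?thesis by simp
  next
    case False
    have "unorm (a n) \<le> unorm (a n - a M) + unorm (a M)"
      using unorm_add[of "a n - a M" "a M"] assms by simp
    moreover have "unorm (a M) \<le> Max ((\<lambda>n. unorm (a n)) ` {..M})" by (intro Max_ge) auto
    moreover have "unorm (a n - a M) < 1" using M False by simp
    ultimately show ?thesis by linarith
  qed
  then show ?thesis
    by (intro exI[of _ "Max ((\<lambda>n. unorm (a n)) ` {..M}) + 1"])
      (use unorm_nonneg[of "a 0"] assms order_trans in \<open>auto simp del: unorm_nonneg\<close>)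
qed

lemma csqI_dominated:
  assumes B: "\<And>n. c n \<in> B" and a: "a \<in> csq" and b: "b \<in> csq"
    and le: "\<And>m n. unorm (c m - c n) \<le> K * unorm (a m - a n) + L * unorm (b m - b n)"
  shows "c \<in> csq"
  unfolding csq_def
proof (intro CollectI conjI allI impI B)
  fix e :: real assume e: "e > 0"
  \<comment> \<open>\<open>K\<close> and \<open>L\<close> carry no sign; \<open>D\<close> is
    positive and dominates both.\<close>
  define D where "D = \<bar>K\<bar> + \<bar>L\<bar> + 1"
  have D: "D > 0" by (simp add: D_def)
  obtain M1 where M1: "\<forall>m\<ge>M1. \<forall>n\<ge>M1. unorm (a m - a n) < e / (2 * D)"
    using csq_Cauchy[OF a, of "e / (2 * D)"] e D by auto
  obtain M2 where M2: "\<forall>m\<ge>M2. \<forall>n\<ge>M2. unorm (b m - b n) < e / (2 * D)"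
    using csq_Cauchy[OF b, of "e / (2 * D)"] e D by auto
  have "unorm (c m - c n) < e" if "m \<ge> max M1 M2" "n \<ge> max M1 M2" for m n
  proof -
    have "K * unorm (a m - a n) \<le> D * unorm (a m - a n)"
      using a by (intro mult_right_mono) (auto simp: D_def)
    also have "\<dots> < D * (e / (2 * D))" using M1 that D by (intro mult_strict_left_mono) auto
    finally have *: "K * unorm (a m - a n) < e / 2" using D by simp
    have "L * unorm (b m - b n) \<le> D * unorm (b m - b n)"
      using b by (intro mult_right_mono) (auto simp: D_def)
    also have "\<dots> < D * (e / (2 * D))" using M2 that D by (intro mult_strict_left_mono) auto
    finally have "L * unorm (b m - b n) < e / 2" using D by simp
    with * le[of m n] show ?thesis by simp
  qed
  then show "\<exists>M. \<forall>m\<ge>M. \<forall>n\<ge>M. unorm (c m - c n) < e" by blast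
qed

lemma csq_add [simp]: assumes "a \<in> csq" "b \<in> csq" shows "(\<lambda>n. a n + b n) \<in> csq"
proof (rule csqI_dominated[OF _ assms, where K = 1 and L = 1])
  fix m n
  have "a m + b m - (a n + b n) = (a m - a n) + (b m - b n)" by simp
  then show "unorm (a m + b m - (a n + b n)) \<le> 1 * unorm (a m - a n) + 1 * unorm (b m - b n)"
    using unorm_add[of "a m - a n" "b m - b n"] assms by (simp only: csqD diff_closed mult_1)
qed (use assms in auto)

lemma unorm_mult_diff:
  assumes "x \<in> B" "y \<in> B" "x' \<in> B" "y' \<in> B"
  shows "unorm (x * y - x' * y') \<le> unorm (x - x') * unorm y + unorm x' * unorm (y - y')"
proof -
  have "x * y - x' * y' = (x - x') * y + x' * (y - y')" by (simp add: algebra_simps)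
  then show ?thesis
    using unorm_add[of "(x - x') * y" "x' * (y - y')"] unorm_mult[of "x - x'" y]
      unorm_mult[of x' "y - y'"] assms by simp
qed

lemma csq_mult [simp]: assumes "a \<in> csq" "b \<in> csq" shows "(\<lambda>n. a n * b n) \<in> csq"
proof -
  obtain K where K: "K \<ge> 0" "\<forall>n. unorm (a n) \<le> K" using csq_bounded assms by blast
  obtain L where L: "L \<ge> 0" "\<forall>n. unorm (b n) \<le> L" using csq_bounded assms by blast
  show ?thesis
  proof (rule csqI_dominated[OF _ assms, where K = L and L = K])
    fix m n
    have "unorm (a m - a n) * unorm (b m) \<le> L * unorm (a m - a n)"
      using mult_left_mono[of "unorm (b m)" L "unorm (a m - a n)"] L assms by (simp add: mult.commute)
    moreover have "unorm (a n) * unorm (b m - b n) \<le> K * unorm (b m - b n)"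
      using mult_right_mono[of "unorm (a n)" K "unorm (b m - b n)"] K assms by simp
    ultimately show "unorm (a m * b m - a n * b n) \<le> L * unorm (a m - a n) + K * unorm (b m - b n)"
      using unorm_mult_diff[of "a m" "b m" "a n" "b n"] assms by simp
  qed (use assms in auto)
qed

lemma csq_scale [simp]: "a \<in> csq \<Longrightarrow> (\<lambda>n. scalar c * a n) \<in> csq"
  by (intro csq_mult csq_const) simp_all

lemma csq_adj [simp]: assumes "a \<in> csq" shows "(\<lambda>n. adj (a n)) \<in> csq"
  by (rule csqI_dominated[OF _ assms assms, where K = 1 and L = 0])
    (use assms in \<open>auto simp: unorm_adj simp flip: adj_diff\<close>)

lemma csq_minus [simp]: "a \<in> csq \<Longrightarrow> (\<lambda>n. - a n) \<in> csq"
  using csq_scale[of a "- 1"] by (simp flip: minus_eq_scalar)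

lemma csq_diff [simp]: "a \<in> csq \<Longrightarrow> b \<in> csq \<Longrightarrow> (\<lambda>n. a n - b n) \<in> csq"
  using csq_add[OF _ csq_minus, of a b] by simp

lemma csq_shift: assumes "a \<in> csq" shows "(\<lambda>n. a (n + k)) \<in> csq"
  unfolding csq_def
proof (intro CollectI conjI allI impI)
  fix e :: real assume "e > 0"
  then obtain M where "\<forall>m\<ge>M. \<forall>n\<ge>M. unorm (a m - a n) < e" using csq_Cauchy assms by blast
  then show "\<exists>M. \<forall>m\<ge>M. \<forall>n\<ge>M. unorm (a (m + k) - a (n + k)) < e"
    by (intro exI[of _ M]) simp
qed (use assms in simp)

lemma csq_shift_limit: assumes "a \<in> csq" shows "(\<lambda>n. unorm (a n - a (n + k))) \<longlonglongrightarrow> 0"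
proof (rule LIMSEQ_I)
  fix r :: real assume "r > 0"
  then obtain M where "\<forall>m\<ge>M. \<forall>n\<ge>M. unorm (a m - a n) < r"
    using csq_Cauchy assms by blast
  then show "\<exists>N. \<forall>n\<ge>N. norm (unorm (a n - a (n + k)) - 0) < r"
    using assms by (intro exI[of _ M]) auto
qed

lemma unorm_le_limit_zero: 
  assumes "(\<lambda>n. unorm (a n - b n)) \<longlonglongrightarrow> 0" "(\<lambda>n. unorm (b n - c n)) \<longlonglongrightarrow> 0"
    and "\<And>n. a n \<in> B" "\<And>n. b n \<in> B" "\<And>n. c n \<in> B"
  shows "(\<lambda>n. unorm (a n - c n)) \<longlonglongrightarrow> 0"
  by (rule tendsto_sandwich[OF _ _ tendsto_const tendsto_add_zero[OF assms(1,2)]])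
    (use assms in \<open>auto intro!: always_eventually unorm_triangle\<close>)

lemma cauchy_seqs_emb:
  "(\<forall>n. a n \<in> B) \<Longrightarrow> (\<lambda>n. emb (a n)) \<in> cauchy_seqs A (universal_norm A) \<longleftrightarrow> a \<in> csq"
  unfolding cauchy_seqs_def csq_def by (simp add: emb_diff universal_norm_emb del: csqD)

lemma cauchy_seqs_obtain:
  assumes "s \<in> cauchy_seqs A (universal_norm A)"
  obtains a where "a \<in> csq" "s = (\<lambda>n. emb (a n))"
proof -
  have "\<forall>n. \<exists>x. x \<in> B \<and> s n = emb x"
    using assms by (auto simp: cauchy_seqs_def carrier_image)
  then obtain a where "\<forall>n. a n \<in> B \<and> s n = emb (a n)" by metis
  then show thesis using that[of a] assms cauchy_seqs_emb[of a] by (metis ext)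
qed

lemma cauchy_rel_emb:
  assumes "\<forall>n. a n \<in> B" "\<forall>n. b n \<in> B"
  shows "(\<lambda>n. emb (a n), \<lambda>n. emb (b n)) \<in> cauchy_rel A (universal_norm A)
     \<longleftrightarrow> a \<in> csq \<and> b \<in> csq \<and> (\<lambda>n. unorm (a n - b n)) \<longlonglongrightarrow> 0"
  using assms by (simp add: cauchy_rel_def cauchy_seqs_emb emb_diff universal_norm_emb)

lemma in_cls_iff:
  assumes "a \<in> csq"
  shows "s \<in> cls a \<longleftrightarrow> (\<exists>b\<in>csq. s = (\<lambda>n. emb (b n)) \<and> (\<lambda>n. unorm (a n - b n)) \<longlonglongrightarrow> 0)"
proof
  assume "s \<in> cls a"
  then have *: "(\<lambda>n. emb (a n), s) \<in> cauchy_rel A (universal_norm A)" by (simp add: cls_def)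
  then have "s \<in> cauchy_seqs A (universal_norm A)" by (simp add: cauchy_rel_def)
  then obtain b where "b \<in> csq" "s = (\<lambda>n. emb (b n))" by (rule cauchy_seqs_obtain)
  then show "\<exists>b\<in>csq. s = (\<lambda>n. emb (b n)) \<and> (\<lambda>n. unorm (a n - b n)) \<longlonglongrightarrow> 0"
    using * assms cauchy_rel_emb[of a b] by auto
next
  assume "\<exists>b\<in>csq. s = (\<lambda>n. emb (b n)) \<and> (\<lambda>n. unorm (a n - b n)) \<longlonglongrightarrow> 0"
  then show "s \<in> cls a" using assms by (auto simp: cls_def cauchy_rel_emb)
qed

lemma cls_eqI:
  assumes "a \<in> csq" "b \<in> csq" "(\<lambda>n. unorm (a n - b n)) \<longlonglongrightarrow> 0" shows "cls a = cls b"
proof -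
  have *: "(\<lambda>n. unorm (b n - a n)) \<longlonglongrightarrow> 0"
    using assms unorm_diff_commute by simp
  have "s \<in> cls a \<longleftrightarrow> s \<in> cls b" for s
    unfolding in_cls_iff[OF assms(1)] in_cls_iff[OF assms(2)]
    using unorm_le_limit_zero[OF *] unorm_le_limit_zero[OF assms(3)] assms csqD by meson
  then show ?thesis by blast
qed

lemma emb_in_cls: "a \<in> csq \<Longrightarrow> (\<lambda>n. emb (a n)) \<in> cls a"
  by (auto simp: in_cls_iff)

lemma cls_eqD:
  assumes "a \<in> csq" "b \<in> csq" "cls a = cls b" shows "(\<lambda>n. unorm (a n - b n)) \<longlonglongrightarrow> 0"
proof -
  have "(\<lambda>n. emb (b n)) \<in> cls a" using emb_in_cls assms by simp
  then obtain c where c: "c \<in> csq" "(\<lambda>n. emb (b n)) = (\<lambda>n. emb (c n))"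
      "(\<lambda>n. unorm (a n - c n)) \<longlonglongrightarrow> 0"
    using in_cls_iff assms by blast
  then have "b n = c n" for n using assms by (metis csqD emb_inj)
  then have "b = c" by blast
  then show ?thesis using c by simp
qed

lemma carrier_completion: "carrier C = cls ` csq"
proof (intro equalityI subsetI)
  fix X assume "X \<in> carrier C"
  then obtain s where s: "s \<in> cauchy_seqs A (universal_norm A)"
      "X = cauchy_rel A (universal_norm A) `` {s}"
    by (auto simp: completion_def quotient_def)
  obtain a where a: "a \<in> csq" "s = (\<lambda>n. emb (a n))" using cauchy_seqs_obtain[OF s(1)] .
  then have "X = cls a" using s(2) by (simp only: cls_def)
  then show "X \<in> cls ` csq" using a(1) by blast
next
  fix X assume "X \<in> cls ` csq"
  then obtain a where a: "a \<in> csq" "X = cls a" by blast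
  then have "(\<lambda>n. emb (a n)) \<in> cauchy_seqs A (universal_norm A)"
    using cauchy_seqs_emb[of a] by simp
  then show "X \<in> carrier C"
    unfolding a(2) cls_def completion_def star_algebra.simps partial_object.simps
    by (rule quotientI)
qed

lemma cls_closed [simp]: "a \<in> csq \<Longrightarrow> cls a \<in> carrier C"
  by (simp add: carrier_completion)

text \<open>The operations of the completion are unions over all representatives. If every
  representative yields the same set, the union over the nonempty class is that set, so each
  operation reduces to its well-definedness.\<close>

lemma UN_cls_eq:
  assumes "a \<in> csq"
    and "\<And>b. b \<in> csq \<Longrightarrow> (\<lambda>n. unorm (a n - b n)) \<longlonglongrightarrow> 0 \<Longrightarrow> f (\<lambda>n. emb (b n)) = Y"
  shows "(\<Union>s\<in>cls a. f s) = Y"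
proof -
  have "f s = Y" if "s \<in> cls a" for s using that assms in_cls_iff by auto
  moreover have "cls a \<noteq> {}" using emb_in_cls assms by blast
  ultimately show ?thesis by auto
qed

lemma cls_add:
  assumes "a \<in> csq" "b \<in> csq" shows "cls a \<oplus>\<^bsub>C\<^esub> cls b = cls (\<lambda>n. a n + b n)"
proof -
  have "cls (\<lambda>n. c n + d n) = cls (\<lambda>n. a n + b n)"
    if "c \<in> csq" "(\<lambda>n. unorm (a n - c n)) \<longlonglongrightarrow> 0" "d \<in> csq" "(\<lambda>n. unorm (b n - d n)) \<longlonglongrightarrow> 0" for c d
  proof (rule cls_eqI[symmetric])
    show "(\<lambda>n. unorm (a n + b n - (c n + d n))) \<longlonglongrightarrow> 0"
    proof (rule tendsto_sandwich[OF _ _ tendsto_const tendsto_add_zero[OF that(2,4)]])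
      show "\<forall>\<^sub>F n in sequentially. unorm (a n + b n - (c n + d n)) \<le> unorm (a n - c n) + unorm (b n - d n)"
        using unorm_add[of "a n - c n" "b n - d n" for n] assms that
        by (intro always_eventually allI) (simp add: add_diff_add)
    qed (use assms that in auto)
  qed (use assms that in auto)
  note * = this
  have "(\<Union>s\<in>cls a. \<Union>t\<in>cls b. cauchy_rel A (universal_norm A) `` {\<lambda>n. s n \<oplus>\<^bsub>A\<^esub> t n})
      = cls (\<lambda>n. a n + b n)"
  proof (rule UN_cls_eq[OF assms(1)], rule UN_cls_eq[OF assms(2)])
    fix c d assume cd: "c \<in> csq" "(\<lambda>n. unorm (a n - c n)) \<longlonglongrightarrow> 0"
      "d \<in> csq" "(\<lambda>n. unorm (b n - d n)) \<longlonglongrightarrow> 0"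
    have "(\<lambda>n. emb (c n) \<oplus>\<^bsub>A\<^esub> emb (d n)) = (\<lambda>n. emb (c n + d n))"
      using cd by (simp add: emb_add)
    then show "cauchy_rel A (universal_norm A) `` {\<lambda>n. emb (c n) \<oplus>\<^bsub>A\<^esub> emb (d n)} = cls (\<lambda>n. a n + b n)"
      using *[OF cd] by (simp only: cls_def)
  qed
  then show ?thesis unfolding completion_def by (simp only: star_algebra.simps module.simps ring.simps monoid.simps)
qed

lemma cls_mult:
  assumes "a \<in> csq" "b \<in> csq" shows "cls a \<otimes>\<^bsub>C\<^esub> cls b = cls (\<lambda>n. a n * b n)"
proof -
  have "cls (\<lambda>n. c n * d n) = cls (\<lambda>n. a n * b n)"
    if cd: "c \<in> csq" "(\<lambda>n. unorm (a n - c n)) \<longlonglongrightarrow> 0" "d \<in> csq" "(\<lambda>n. unorm (b n - d n)) \<longlonglongrightarrow> 0" for c d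
  proof (rule cls_eqI[symmetric])
    obtain K where K: "K \<ge> 0" "\<forall>n. unorm (b n) \<le> K" using csq_bounded assms by blast
    obtain L where L: "L \<ge> 0" "\<forall>n. unorm (c n) \<le> L" using csq_bounded cd by blast
    have lim: "(\<lambda>n. unorm (a n - c n) * K + L * unorm (b n - d n)) \<longlonglongrightarrow> 0"
      using tendsto_add[OF tendsto_mult_right[OF cd(2), of K] tendsto_mult_left[OF cd(4), of L]] by simp
    show "(\<lambda>n. unorm (a n * b n - c n * d n)) \<longlonglongrightarrow> 0"
    proof (rule tendsto_sandwich[OF _ _ tendsto_const lim])
      show "\<forall>\<^sub>F n in sequentially. unorm (a n * b n - c n * d n)
          \<le> unorm (a n - c n) * K + L * unorm (b n - d n)"
      proof (intro always_eventually allI)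
        fix n
        have "unorm (a n - c n) * unorm (b n) \<le> unorm (a n - c n) * K"
          using K assms cd by (intro mult_left_mono) auto
        moreover have "unorm (c n) * unorm (b n - d n) \<le> L * unorm (b n - d n)"
          using L assms cd by (intro mult_right_mono) auto
        ultimately show "unorm (a n * b n - c n * d n)
          \<le> unorm (a n - c n) * K + L * unorm (b n - d n)"
          using unorm_mult_diff[of "a n" "b n" "c n" "d n"] assms cd by simp
      qed
    qed (use assms cd in auto)
  qed (use assms cd in auto)
  note * = this
  have "(\<Union>s\<in>cls a. \<Union>t\<in>cls b. cauchy_rel A (universal_norm A) `` {\<lambda>n. s n \<otimes>\<^bsub>A\<^esub> t n})
      = cls (\<lambda>n. a n * b n)"
  proof (rule UN_cls_eq[OF assms(1)], rule UN_cls_eq[OF assms(2)])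
    fix c d assume cd: "c \<in> csq" "(\<lambda>n. unorm (a n - c n)) \<longlonglongrightarrow> 0"
      "d \<in> csq" "(\<lambda>n. unorm (b n - d n)) \<longlonglongrightarrow> 0"
    have "(\<lambda>n. emb (c n) \<otimes>\<^bsub>A\<^esub> emb (d n)) = (\<lambda>n. emb (c n * d n))"
      using cd by (simp add: emb_mult)
    then show "cauchy_rel A (universal_norm A) `` {\<lambda>n. emb (c n) \<otimes>\<^bsub>A\<^esub> emb (d n)} = cls (\<lambda>n. a n * b n)"
      using *[OF cd] by (simp only: cls_def)
  qed
  then show ?thesis unfolding completion_def by (simp only: star_algebra.simps module.simps ring.simps monoid.simps)
qed

lemma cls_scale: assumes "a \<in> csq" shows "c \<odot>\<^bsub>C\<^esub> cls a = cls (\<lambda>n. scalar c * a n)"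
proof -
  have "cls (\<lambda>n. scalar c * b n) = cls (\<lambda>n. scalar c * a n)"
    if b: "b \<in> csq" "(\<lambda>n. unorm (a n - b n)) \<longlonglongrightarrow> 0" for b
  proof (rule cls_eqI[symmetric])
    show "(\<lambda>n. unorm (scalar c * a n - scalar c * b n)) \<longlonglongrightarrow> 0"
      using tendsto_mult_left[OF b(2), of "cmod c"] assms b
      by (simp add: unorm_scale flip: right_diff_distrib)
  qed (use assms b in auto)
  note * = this
  have "(\<Union>s\<in>cls a. cauchy_rel A (universal_norm A) `` {\<lambda>n. c \<odot>\<^bsub>A\<^esub> s n}) = cls (\<lambda>n. scalar c * a n)"
  proof (rule UN_cls_eq[OF assms])
    fix b assume b: "b \<in> csq" "(\<lambda>n. unorm (a n - b n)) \<longlonglongrightarrow> 0"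
    have "(\<lambda>n. c \<odot>\<^bsub>A\<^esub> emb (b n)) = (\<lambda>n. emb (scalar c * b n))" using b by (simp add: emb_scale)
    then show "cauchy_rel A (universal_norm A) `` {\<lambda>n. c \<odot>\<^bsub>A\<^esub> emb (b n)} = cls (\<lambda>n. scalar c * a n)"
      using *[OF b] by (simp only: cls_def)
  qed
  then show ?thesis unfolding completion_def by (simp only: star_algebra.simps module.simps ring.simps monoid.simps)
qed

lemma cls_adj: assumes "a \<in> csq" shows "star C (cls a) = cls (\<lambda>n. adj (a n))"
proof -
  have "cls (\<lambda>n. adj (b n)) = cls (\<lambda>n. adj (a n))"
    if b: "b \<in> csq" "(\<lambda>n. unorm (a n - b n)) \<longlonglongrightarrow> 0" for b
    using assms b by (intro cls_eqI[symmetric]) (auto simp: unorm_adj simp flip: adj_diff)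
  note * = this
  have "(\<Union>s\<in>cls a. cauchy_rel A (universal_norm A) `` {\<lambda>n. star A (s n)}) = cls (\<lambda>n. adj (a n))"
  proof (rule UN_cls_eq[OF assms])
    fix b assume b: "b \<in> csq" "(\<lambda>n. unorm (a n - b n)) \<longlonglongrightarrow> 0"
    have "(\<lambda>n. star A (emb (b n))) = (\<lambda>n. emb (adj (b n)))" using b by (simp add: emb_adj)
    then show "cauchy_rel A (universal_norm A) `` {\<lambda>n. star A (emb (b n))} = cls (\<lambda>n. adj (a n))"
      using *[OF b] by (simp only: cls_def)
  qed
  then show ?thesis unfolding completion_def by (simp only: star_algebra.simps module.simps ring.simps monoid.simps)
qed

lemma completion_embed_emb: "completion_embed A (universal_norm A) (emb x) = cls (\<lambda>_. x)"
  by (simp add: completion_embed_def cls_def)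

lemma cls_one: "\<one>\<^bsub>C\<^esub> = cls (\<lambda>_. 1)"
  by (simp add: completion_def flip: completion_embed_emb emb_one)

lemma cls_zero: "\<zero>\<^bsub>C\<^esub> = cls (\<lambda>_. 0)"
  by (simp add: completion_def flip: completion_embed_emb emb_zero)

section \<open>Restriction of tracial states to the algebra and extension of traces to the
  completion\<close>

definition restr :: "((nat \<Rightarrow> 'b) set \<Rightarrow> complex) \<Rightarrow> 'r \<Rightarrow> complex" where
  "restr \<tau> x = \<tau> (cls (\<lambda>_. x))"

text \<open>The limit is taken along a chosen representative; \<open>extension_cls\<close> shows
  that any other gives the same value. The bounded abstraction supplies membership in
  \<open>extensional\<close>.\<close>

definition extension :: "('r \<Rightarrow> complex) \<Rightarrow> (nat \<Rightarrow> 'b) set \<Rightarrow> complex" where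
  "extension T = (\<lambda>X\<in>carrier C. lim (\<lambda>n. T ((SOME a. a \<in> csq \<and> cls a = X) n)))"

lemma tracial_statesD:
  assumes "\<tau> \<in> tracial_states C" "a \<in> csq" "b \<in> csq"
  shows "\<tau> (cls (\<lambda>n. a n + b n)) = \<tau> (cls a) + \<tau> (cls b)"
    and "\<tau> (cls (\<lambda>n. scalar c * a n)) = c * \<tau> (cls a)"
    and "\<tau> (cls (\<lambda>n. adj (a n) * a n)) \<in> \<real>\<^sub>\<ge>\<^sub>0"
    and "\<tau> (cls (\<lambda>_. 1)) = 1"
    and "\<tau> (cls (\<lambda>n. a n * b n)) = \<tau> (cls (\<lambda>n. b n * a n))"
    and "\<tau> (cls (\<lambda>n. a n - b n)) = \<tau> (cls a) - \<tau> (cls b)"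
proof -
  note d = assms(1)[unfolded tracial_states_def, simplified]
  have add: "\<tau> (cls (\<lambda>n. a n + b n)) = \<tau> (cls a) + \<tau> (cls b)" if "a \<in> csq" "b \<in> csq" for a b
    using d that by (simp flip: cls_add)
  have scl: "\<tau> (cls (\<lambda>n. scalar c * a n)) = c * \<tau> (cls a)" if "a \<in> csq" for a c
    using d that by (simp flip: cls_scale)
  show "\<tau> (cls (\<lambda>n. a n + b n)) = \<tau> (cls a) + \<tau> (cls b)" using add assms by blast
  show "\<tau> (cls (\<lambda>n. scalar c * a n)) = c * \<tau> (cls a)" using scl assms by blast
  show "\<tau> (cls (\<lambda>n. adj (a n) * a n)) \<in> \<real>\<^sub>\<ge>\<^sub>0"
    using d assms by (simp flip: cls_mult cls_adj)
  show "\<tau> (cls (\<lambda>_. 1)) = 1" using d by (simp flip: cls_one)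
  show "\<tau> (cls (\<lambda>n. a n * b n)) = \<tau> (cls (\<lambda>n. b n * a n))"
    using d assms by (simp flip: cls_mult)
  have "\<tau> (cls (\<lambda>n. a n + - b n)) = \<tau> (cls a) + \<tau> (cls (\<lambda>n. - b n))"
    using add[of a "\<lambda>n. - b n"] assms by simp
  moreover have "\<tau> (cls (\<lambda>n. - b n)) = - \<tau> (cls b)"
    using scl[of b "- 1"] assms by (simp flip: minus_eq_scalar)
  ultimately show "\<tau> (cls (\<lambda>n. a n - b n)) = \<tau> (cls a) - \<tau> (cls b)" by simp
qed

text \<open>Fixed-point iteration for \<open>1 - sqrt (1 - x)\<close>.\<close>

fun sqrt_iter :: "'r \<Rightarrow> nat \<Rightarrow> 'r" where
  "sqrt_iter x 0 = 0"
| "sqrt_iter x (Suc k) = scalar (1/2) * (x + sqrt_iter x k * sqrt_iter x k)"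

lemma sqrt_iter_closed [simp]: "x \<in> B \<Longrightarrow> sqrt_iter x k \<in> B"
  by (induction k) auto

lemma sqrt_iter_adj: "adj x = x \<Longrightarrow> adj (sqrt_iter x k) = sqrt_iter x k"
  by (induction k) (auto simp: adj_mult adj_add adj_scalar scalar_central)

lemma sqrt_iter_bound:
  assumes "x \<in> B" "unorm x \<le> 1/2" shows "unorm (sqrt_iter x k) \<le> 1/2"
proof (induction k)
  case (Suc k)
  let ?y = "sqrt_iter x k"
  have "unorm (?y * ?y) \<le> unorm ?y * unorm ?y" using assms unorm_mult by simp
  also have "\<dots> \<le> 1/2 * (1/2)" using Suc assms by (intro mult_mono) auto
  finally show ?case using unorm_add[of x "?y * ?y"] assms by (simp add: unorm_scale)
qed auto

text \<open>On the ball of radius 1/2 squaring is 1-Lipschitz, so one step averages the distance of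
  the parameters and the previous distance of the iterates.\<close>

lemma sqrt_iter_diff:
  assumes "x \<in> B" "unorm x \<le> 1/2" "y \<in> B" "unorm y \<le> 1/2"
  shows "unorm (sqrt_iter x k - sqrt_iter y k) \<le> unorm (x - y)"
proof (induction k)
  case (Suc k)
  let ?u = "sqrt_iter x k" and ?v = "sqrt_iter y k"
  have "unorm (?u * ?u - ?v * ?v) \<le> unorm (?u - ?v) * unorm ?u + unorm ?v * unorm (?u - ?v)"
    using assms unorm_mult_diff by simp
  also have "\<dots> \<le> unorm (?u - ?v) * (1/2) + (1/2) * unorm (?u - ?v)"
    using sqrt_iter_bound assms by (intro add_mono mult_left_mono mult_right_mono) auto
  finally have "unorm (?u * ?u - ?v * ?v) \<le> unorm (x - y)" using Suc by simp
  moreover have "sqrt_iter x (Suc k) - sqrt_iter y (Suc k)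
      = scalar (1/2) * ((x - y) + (?u * ?u - ?v * ?v))" by (simp add: algebra_simps)
  ultimately show ?case
    using unorm_add[of "x - y" "?u * ?u - ?v * ?v"] assms by (simp add: unorm_scale)
qed (use assms in auto)

text \<open>The parameter cancels in the difference of two consecutive iterates, and half of a
  1-Lipschitz map remains.\<close>

lemma sqrt_iter_step:
  assumes "x \<in> B" "unorm x \<le> 1/2"
  shows "unorm (sqrt_iter x (Suc k) - sqrt_iter x k) \<le> (1/2) ^ k"
proof (induction k)
  case 0
  then show ?case using assms by (simp add: unorm_scale)
next
  case (Suc k)
  let ?u = "sqrt_iter x (Suc k)" and ?v = "sqrt_iter x k"
  have u: "?u \<in> B" and v: "?v \<in> B" using assms sqrt_iter_closed by blast+
  have "unorm (?u * ?u - ?v * ?v) \<le> unorm (?u - ?v) * unorm ?u + unorm ?v * unorm (?u - ?v)"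
    using u v unorm_mult_diff by blast
  also have "\<dots> \<le> unorm (?u - ?v) * (1/2) + (1/2) * unorm (?u - ?v)"
    using sqrt_iter_bound[OF assms] u v
    by (intro add_mono mult_left_mono mult_right_mono unorm_nonneg diff_closed) 
  finally have "unorm (?u * ?u - ?v * ?v) \<le> (1/2) ^ k" using Suc by simp
  moreover have "sqrt_iter x (Suc (Suc k)) - ?u = scalar (1/2) * (?u * ?u - ?v * ?v)"
    unfolding sqrt_iter.simps(2)[of x "Suc k"] by (subst (4) sqrt_iter.simps(2)) (simp add: algebra_simps)
  ultimately show ?case using u v by (simp add: unorm_scale del: sqrt_iter.simps)
qed

text \<open>A telescoped geometric series; subtracting \<open>2 * (1/2) ^ n\<close> is what lets the
  induction on \<open>n\<close> close.\<close>

lemma sqrt_iter_diff_later: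
  assumes "x \<in> B" "unorm x \<le> 1/2" "m \<le> n"
  shows "unorm (sqrt_iter x n - sqrt_iter x m) \<le> 2 * (1/2) ^ m - 2 * (1/2) ^ n"
  using assms(3)
proof (induction n rule: dec_induct)
  case (step n)
  have "unorm (sqrt_iter x (Suc n) - sqrt_iter x m)
      \<le> unorm (sqrt_iter x (Suc n) - sqrt_iter x n) + unorm (sqrt_iter x n - sqrt_iter x m)"
    using assms sqrt_iter_closed by (intro unorm_triangle) blast+
  then show ?case using step sqrt_iter_step[OF assms(1,2), of n] by simp
qed (use assms in auto)

text \<open>Positivity forces continuity: \<open>1 - a\<^sup>*a = b\<^sup>*b\<close> in the completion when \<open>a\<close> is small.\<close>

lemma tracial_state_small:
  assumes \<tau>: "\<tau> \<in> tracial_states C" and a: "a \<in> csq" and le: "\<And>n. unorm (a n) \<le> 1/2"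
  shows "Re (\<tau> (cls (\<lambda>n. adj (a n) * a n))) \<le> 1"
proof -
  define s where "s n = adj (a n) * a n" for n
  have s: "s \<in> csq" unfolding s_def using a by simp
  have s_adj: "adj (s n) = s n" for n by (simp add: s_def adj_mult)
  have s_le: "unorm (s n) \<le> 1/2" for n
  proof -
    have "(unorm (a n))\<^sup>2 \<le> (1/2)\<^sup>2" using le a by (intro power_mono) auto
    then show ?thesis using a by (simp add: s_def unorm_cstar power2_eq_square)
  qed
  \<comment> \<open>A diagonal choice: the number of iterations grows with the index, so that the
    one sequence \<open>w\<close> represents the limit \<open>1 - sqrt (1 - s)\<close> in the
    completion.\<close>
  define w where "w n = sqrt_iter (s n) n" for n
  have wB: "w n \<in> B" for n using s by (simp add: w_def)
  have w_diff: "unorm (w n - w m) \<le> unorm (s n - s m) + 2 * (1/2) ^ m" if "m \<le> n" for m n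
  proof -
    have "unorm (w n - w m) \<le> unorm (w n - sqrt_iter (s m) n) + unorm (sqrt_iter (s m) n - w m)"
      using s wB by (intro unorm_triangle) auto
    also have "unorm (w n - sqrt_iter (s m) n) \<le> unorm (s n - s m)"
      unfolding w_def using s s_le by (intro sqrt_iter_diff) auto
    also have "unorm (sqrt_iter (s m) n - w m) \<le> 2 * (1/2) ^ m - 2 * (1/2) ^ n"
      unfolding w_def using s s_le that by (intro sqrt_iter_diff_later) auto
    finally show ?thesis using zero_le_power[of "1/2 :: real" n] by linarith
  qed
  have pow_lim: "(\<lambda>n. 2 * (1/2::real) ^ n) \<longlonglongrightarrow> 0"
    using tendsto_mult_left[OF LIMSEQ_realpow_zero[of "1/2"], of 2] by simp
  have w: "w \<in> csq"
    unfolding csq_def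
  proof (intro CollectI conjI allI impI wB)
    fix e :: real assume e: "e > 0"
    obtain M1 where M1: "\<forall>m\<ge>M1. \<forall>n\<ge>M1. unorm (s m - s n) < e/2"
      using csq_Cauchy[OF s, of "e/2"] e by auto
    obtain M2 where M2: "\<forall>m\<ge>M2. 2 * (1/2) ^ m < e/2"
      using LIMSEQ_D[OF pow_lim, of "e/2"] e by auto
    have *: "unorm (w n - w m) < e" if "m \<ge> max M1 M2" "m \<le> n" for m n
    proof -
      have "unorm (s n - s m) < e/2" "2 * (1/2) ^ m < e/2" using M1 M2 that by simp_all
      then show ?thesis using w_diff[OF that(2)] by linarith
    qed
    then have "unorm (w m - w n) < e" if "m \<ge> max M1 M2" "n \<ge> max M1 M2" for m n
      using *[of m n] *[of n m] that unorm_diff_commute[OF wB wB, of m n] by (cases "m \<le> n") auto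
    then show "\<exists>M. \<forall>m\<ge>M. \<forall>n\<ge>M. unorm (w m - w n) < e" by blast
  qed
  define b where "b n = 1 - w n" for n
  have b: "b \<in> csq" unfolding b_def using w csq_const[of 1] by simp
  have b_adj: "adj (b n) = b n" for n
    by (simp add: b_def adj_diff w_def sqrt_iter_adj s_adj)
  have "cls (\<lambda>n. adj (b n) * b n) = cls (\<lambda>n. 1 - s n)"
  proof (rule cls_eqI)
    show "(\<lambda>n. unorm (adj (b n) * b n - (1 - s n))) \<longlonglongrightarrow> 0"
    proof (rule tendsto_sandwich[OF _ _ tendsto_const pow_lim])
      show "\<forall>\<^sub>F n in sequentially. unorm (adj (b n) * b n - (1 - s n)) \<le> 2 * (1/2) ^ n"
      proof (intro always_eventually allI)
        fix n
        have half: "scalar 2 * (scalar (1/2) * x) = x" for x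
          by (simp add: scalar_1 flip: mult.assoc scalar_mult)
        have two: "scalar 2 * x = x + x" for x
          using scalar_add[of 1 1] by (simp add: scalar_1 mult_2)
        \<comment> \<open>The fixed-point equation \<open>2 w = s + w * w\<close> would give
          \<open>(1 - w) * (1 - w) = 1 - s\<close> exactly; the actual error is twice the last step
          of the iteration.\<close>
        have "adj (b n) * b n - (1 - s n) = s n + w n * w n - (w n + w n)"
          unfolding b_adj by (simp add: b_def algebra_simps)
        also have "\<dots> = scalar 2 * (sqrt_iter (s n) (Suc n) - w n)"
          using half[of "s n + w n * w n"] by (simp only: right_diff_distrib two sqrt_iter.simps w_def)
        finally show "unorm (adj (b n) * b n - (1 - s n)) \<le> 2 * (1/2) ^ n"
          using sqrt_iter_step[OF csqD[OF s] s_le, of n n] s wB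
          by (simp add: unorm_scale w_def del: sqrt_iter.simps)
      qed
    qed (use b s in auto)
  qed (use b s in auto)
  then have "\<tau> (cls (\<lambda>n. 1 - s n)) \<in> \<real>\<^sub>\<ge>\<^sub>0"
    using tracial_statesD(3)[OF \<tau> b b] by simp
  moreover have "\<tau> (cls (\<lambda>n. 1 - s n)) = 1 - \<tau> (cls s)"
    using tracial_statesD(4,6)[OF \<tau> csq_const[OF one_closed] s] by simp
  ultimately have "Re (\<tau> (cls s)) \<le> 1" by (simp add: complex_nonneg_iff)
  then show ?thesis unfolding s_def .
qed

text \<open>Cauchy-Schwarz against the unit turns the bound on \<open>adj a * a\<close> into one on
  the state itself. It has to be carried out on the completion, since continuity of the state is
  deduced from it.\<close>

lemma tracial_state_bounded:
  assumes \<tau>: "\<tau> \<in> tracial_states C" and a: "a \<in> csq" and le: "\<And>n. unorm (a n) \<le> 1/2"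
  shows "cmod (\<tau> (cls a)) \<le> 1"
proof -
  let ?one = "\<lambda>_. 1 :: 'r"
  have one: "?one \<in> csq" by (rule csq_const) simp
  have pos: "\<tau> (cls (\<lambda>n. adj (a n) * a n)) + c * \<tau> (cls (\<lambda>n. adj (a n))) + cnj c * \<tau> (cls a)
      + cnj c * c * 1 \<in> \<real>\<^sub>\<ge>\<^sub>0" for c
  proof -
    have d: "(\<lambda>n. a n + scalar c * 1) \<in> csq" using a one by (intro csq_add csq_scale)
    have "(\<lambda>n. adj (a n + scalar c * 1) * (a n + scalar c * 1))
      = (\<lambda>n. adj (a n) * a n + (scalar c * adj (a n) + (scalar (cnj c) * a n + scalar (cnj c * c) * 1)))"
      by (simp add: adj_add adj_scalar distrib_left distrib_right scalar_mult add.assoc add.left_commute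
          scalar_central[of "adj (a _)"])
    moreover have "\<tau> (cls (\<lambda>n. scalar c * adj (a n) + (scalar (cnj c) * a n + scalar (cnj c * c) * 1)))
        = c * \<tau> (cls (\<lambda>n. adj (a n))) + (cnj c * \<tau> (cls a) + cnj c * c * 1)"
      using a one tracial_statesD(1,2)[OF \<tau>] tracial_statesD(4)[OF \<tau> one one]
      by (simp only: csq_add csq_scale csq_adj)
    ultimately show ?thesis
      using tracial_statesD(3)[OF \<tau> d d] a one
        tracial_statesD(1)[OF \<tau>, of "\<lambda>n. adj (a n) * a n"
          "\<lambda>n. scalar c * adj (a n) + (scalar (cnj c) * a n + scalar (cnj c * c) * 1)"]
      by (simp only: csq_add csq_scale csq_adj csq_mult add.assoc)
  qed
  have x: "\<tau> (cls (\<lambda>n. adj (a n) * a n)) \<in> \<real>\<^sub>\<ge>\<^sub>0" using tracial_statesD(3)[OF \<tau> a a] .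
  have "(cmod (\<tau> (cls (\<lambda>n. adj (a n)))))\<^sup>2 \<le> 1"
    using hermitian_Cauchy_Schwarz(2)[OF pos x] tracial_state_small[OF assms] by simp
  moreover have "\<tau> (cls a) = cnj (\<tau> (cls (\<lambda>n. adj (a n))))"
    using hermitian_Cauchy_Schwarz(1)[OF pos x] by simp
  ultimately show ?thesis by (simp add: abs_square_le_1)
qed

lemma cls_shift: "a \<in> csq \<Longrightarrow> cls (\<lambda>n. a (n + k)) = cls a"
  using csq_shift_limit csq_shift by (intro cls_eqI[symmetric])

lemma tracial_state_continuous:
  assumes \<tau>: "\<tau> \<in> tracial_states C" and a: "a \<in> csq"
  shows "(\<lambda>n. restr \<tau> (a n)) \<longlonglongrightarrow> \<tau> (cls a)"
proof (rule LIMSEQ_I)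
  fix e :: real assume e: "e > 0"
  obtain M where M: "\<forall>m\<ge>M. \<forall>n\<ge>M. unorm (a m - a n) < e / 4"
    using csq_Cauchy[OF a, of "e / 4"] e by auto
  have "cmod (restr \<tau> (a m) - \<tau> (cls a)) < e" if m: "m \<ge> M" for m
  proof -
    \<comment> \<open>Shifting the sequence leaves its class unchanged but makes every term, not
      only the late ones, of norm at most \<open>e / 4\<close>; scaling by \<open>2 / e\<close> then
      reaches the bound 1/2 of \<open>tracial_state_bounded\<close>.\<close>
    define b where "b n = a (n + M) - a m" for n
    have am: "(\<lambda>_. a m) \<in> csq" using a by (intro csq_const) simp
    have b: "b \<in> csq" unfolding b_def using a am csq_shift by simp
    have \<tau>b: "\<tau> (cls b) = \<tau> (cls a) - restr \<tau> (a m)"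
      unfolding b_def restr_def using tracial_statesD(6)[OF \<tau> csq_shift[OF a] am] cls_shift[OF a]
      by simp
    have bn: "unorm (b n) \<le> e / 4" for n
      using M m by (simp add: b_def less_imp_le)
    have "cmod (\<tau> (cls (\<lambda>n. scalar (of_real (2 / e)) * b n))) \<le> 1"
    proof (rule tracial_state_bounded[OF \<tau>])
      show "unorm (scalar (of_real (2 / e)) * b n) \<le> 1/2" for n
        using bn[of n] e b by (simp add: unorm_scale norm_divide field_simps)
    qed (use b in auto)
    then have "2 / e * cmod (\<tau> (cls b)) \<le> 1"
      using tracial_statesD(2)[OF \<tau> b b] e by (simp add: norm_mult norm_divide)
    then have "cmod (\<tau> (cls b)) \<le> e / 2" using e by (simp add: field_simps)
    then show ?thesis using e \<tau>b by (simp add: norm_minus_commute)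
  qed
  then show "\<exists>no. \<forall>n\<ge>no. norm (restr \<tau> (a n) - \<tau> (cls a)) < e" by blast
qed

lemma trace_on_restr: assumes "\<tau> \<in> tracial_states C" shows "trace_on (restr \<tau>)"
  unfolding trace_on_def restr_def
proof (intro conjI ballI allI)
  note D = tracial_statesD[OF assms csq_const csq_const]
  show "\<tau> (cls (\<lambda>_. 1)) = 1" by (rule D(4)[OF one_closed one_closed])
  fix a c assume a: "a \<in> B"
  show "\<tau> (cls (\<lambda>_. scalar c * a)) = c * \<tau> (cls (\<lambda>_. a))" by (rule D(2)[OF a a])
  show "\<tau> (cls (\<lambda>_. adj a * a)) \<in> \<real>\<^sub>\<ge>\<^sub>0" by (rule D(3)[OF a a])
  fix b assume b: "b \<in> B"
  show "\<tau> (cls (\<lambda>_. a + b)) = \<tau> (cls (\<lambda>_. a)) + \<tau> (cls (\<lambda>_. b))" by (rule D(1)[OF a b])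
  show "\<tau> (cls (\<lambda>_. a * b)) = \<tau> (cls (\<lambda>_. b * a))" by (rule D(5)[OF a b])
qed

lemma trace_convergent:
  assumes T: "trace_on T" and a: "a \<in> csq" shows "convergent (\<lambda>n. T (a n))"
proof (rule Cauchy_convergent, rule metric_CauchyI)
  fix e :: real assume "e > 0"
  then obtain M where M: "\<forall>m\<ge>M. \<forall>n\<ge>M. unorm (a m - a n) < e" using csq_Cauchy[OF a] by blast
  have "dist (T (a m)) (T (a n)) < e" if "m \<ge> M" "n \<ge> M" for m n
    using trace_le_unorm[OF T, of "a m - a n"] M that a by (simp add: dist_norm trace_diff[OF T] le_less_trans)
  then show "\<exists>M. \<forall>m\<ge>M. \<forall>n\<ge>M. dist (T (a m)) (T (a n)) < e" by blast
qed

lemma extension_cls: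
  assumes T: "trace_on T" and a: "a \<in> csq"
  shows "(\<lambda>n. T (a n)) \<longlonglongrightarrow> extension T (cls a)"
proof -
  define b where "b = (SOME b. b \<in> csq \<and> cls b = cls a)"
  have "b \<in> csq \<and> cls b = cls a" unfolding b_def by (rule someI[of _ a]) (use a in simp)
  then have b: "b \<in> csq" and *: "(\<lambda>n. unorm (a n - b n)) \<longlonglongrightarrow> 0"
    using cls_eqD a by auto
  have "(\<lambda>n. T (b n)) \<longlonglongrightarrow> extension T (cls a)"
    using trace_convergent[OF T b] a by (simp add: extension_def b_def convergent_LIMSEQ_iff)
  moreover have "(\<lambda>n. T (a n) - T (b n)) \<longlonglongrightarrow> 0"
  proof (rule tendsto_norm_zero_cancel, rule tendsto_sandwich[OF _ _ tendsto_const *])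
    show "\<forall>\<^sub>F n in sequentially. norm (T (a n) - T (b n)) \<le> unorm (a n - b n)"
      using trace_le_unorm[OF T, of "a n - b n" for n] a b
      by (intro always_eventually allI) (simp add: trace_diff[OF T])
  qed auto
  ultimately show ?thesis using tendsto_add by fastforce
qed

lemma extension_tracial_state: assumes T: "trace_on T" shows "extension T \<in> tracial_states C"
proof -
  note lim = extension_cls[OF T]
  have eq: "extension T (cls a) = l" if "a \<in> csq" "(\<lambda>n. T (a n)) \<longlonglongrightarrow> l" for a l
    using lim[OF that(1)] that(2) LIMSEQ_unique by blast
  show ?thesis
    unfolding tracial_states_def
  proof (intro CollectI conjI ballI allI)
    show "extension T \<in> extensional (carrier C)" by (simp add: extension_def)
    show "extension T \<one>\<^bsub>C\<^esub> = 1"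
      unfolding cls_one by (rule eq[OF csq_const]) (simp_all add: trace_1[OF T])
    fix X assume "X \<in> carrier C"
    then obtain a where a: "a \<in> csq" "X = cls a" by (auto simp: carrier_completion)
    show "extension T (c \<odot>\<^bsub>C\<^esub> X) = c * extension T X" for c
      unfolding a(2) cls_scale[OF a(1)] using a tendsto_mult_left[OF lim[OF a(1)], of c]
      by (intro eq) (auto simp: trace_scale[OF T])
    show "extension T (star C X \<otimes>\<^bsub>C\<^esub> X) \<in> \<real>\<^sub>\<ge>\<^sub>0"
    proof -
      have s: "(\<lambda>n. adj (a n) * a n) \<in> csq" using a by simp
      have "extension T (star C X \<otimes>\<^bsub>C\<^esub> X) = extension T (cls (\<lambda>n. adj (a n) * a n))"
        using a by (simp add: cls_adj cls_mult)
      moreover have "extension T (cls (\<lambda>n. adj (a n) * a n)) \<in> \<real>\<^sub>\<ge>\<^sub>0"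
        using closed_sequentially[OF closed_nonneg_Reals_complex _ lim[OF s]] a trace_pos[OF T] by simp
      ultimately show ?thesis by simp
    qed
    fix Y assume "Y \<in> carrier C"
    then obtain b where b: "b \<in> csq" "Y = cls b" by (auto simp: carrier_completion)
    show "extension T (X \<oplus>\<^bsub>C\<^esub> Y) = extension T X + extension T Y"
      unfolding a(2) b(2) cls_add[OF a(1) b(1)]
      using a b tendsto_add[OF lim[OF a(1)] lim[OF b(1)]] by (intro eq) (auto simp: trace_add[OF T])
    show "extension T (X \<otimes>\<^bsub>C\<^esub> Y) = extension T (Y \<otimes>\<^bsub>C\<^esub> X)"
      using a b lim[of "\<lambda>n. b n * a n"]
      by (simp add: cls_mult) (intro eq, auto simp: trace_commute[OF T, of "a _" "b _"])
  qed
qed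

lemma restr_extension: "trace_on T \<Longrightarrow> x \<in> B \<Longrightarrow> restr (extension T) x = T x"
  using extension_cls[of T "\<lambda>_. x"] csq_const[of x] by (simp add: restr_def LIMSEQ_const_iff)

lemma tracial_state_eqI:
  assumes "\<tau> \<in> tracial_states C" "\<sigma> \<in> tracial_states C" "\<And>x. x \<in> B \<Longrightarrow> restr \<tau> x = restr \<sigma> x"
  shows "\<tau> = \<sigma>"
proof (rule extensionalityI)
  show "\<tau> \<in> extensional (carrier C)" "\<sigma> \<in> extensional (carrier C)"
    using assms by (auto simp: tracial_states_def)
  fix X assume "X \<in> carrier C"
  then obtain a where a: "a \<in> csq" "X = cls a" by (auto simp: carrier_completion)
  then show "\<tau> X = \<sigma> X"
    using tracial_state_continuous[OF assms(1) a(1)] tracial_state_continuous[OF assms(2) a(1)] assms(3)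
    by (simp add: LIMSEQ_unique)
qed

text \<open>\<open>restr\<close> and \<open>extension\<close> are affine and inverse to each other
  as far as values on \<open>B\<close> are concerned, so convex decompositions can be carried in
  both directions.\<close>

lemma extreme_tracial_state_iff:
  "extreme_tracial_state C \<tau> \<longleftrightarrow> \<tau> \<in> tracial_states C \<and> extreme_trace_on (restr \<tau>)"
proof (intro iffI conjI)
  assume ex: "extreme_tracial_state C \<tau>"
  then show \<tau>: "\<tau> \<in> tracial_states C" by (simp add: extreme_tracial_state_def)
  show "extreme_trace_on (restr \<tau>)"
    unfolding extreme_trace_on_def
  proof (intro conjI allI impI trace_on_restr[OF \<tau>])
    fix S R :: "'r \<Rightarrow> complex" and t :: real
    assume S: "trace_on S" and R: "trace_on R" and t: "0 < t \<and> t < 1"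
      and eq: "\<forall>a\<in>B. restr \<tau> a = of_real t * S a + of_real (1 - t) * R a"
    have "\<forall>X\<in>carrier C. \<tau> X = of_real t * extension S X + of_real (1 - t) * extension R X"
    proof
      fix X assume "X \<in> carrier C"
      then obtain a where a: "a \<in> csq" "X = cls a" by (auto simp: carrier_completion)
      have "(\<lambda>n. restr \<tau> (a n)) \<longlonglongrightarrow> of_real t * extension S X + of_real (1 - t) * extension R X"
        using tendsto_add[OF tendsto_mult_left[OF extension_cls[OF S a(1)], of "of_real t"]
            tendsto_mult_left[OF extension_cls[OF R a(1)], of "of_real (1 - t)"]] a eq by simp
      then show "\<tau> X = of_real t * extension S X + of_real (1 - t) * extension R X"
        using tracial_state_continuous[OF \<tau> a(1)] a LIMSEQ_unique by blast
    qed
    then have "extension S = \<tau> \<and> extension R = \<tau>"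
      using ex t extension_tracial_state[OF S] extension_tracial_state[OF R]
      unfolding extreme_tracial_state_def by blast
    then show "\<forall>a\<in>B. S a = restr \<tau> a \<and> R a = restr \<tau> a"
      using restr_extension S R by fastforce
  qed
next
  assume as: "\<tau> \<in> tracial_states C \<and> extreme_trace_on (restr \<tau>)"
  show "extreme_tracial_state C \<tau>"
    unfolding extreme_tracial_state_def
  proof (intro conjI ballI allI impI)
    fix \<sigma> \<rho> and t :: real
    assume s: "\<sigma> \<in> tracial_states C" and r: "\<rho> \<in> tracial_states C" and t: "0 < t \<and> t < 1"
      and eq: "\<forall>a\<in>carrier C. \<tau> a = of_real t * \<sigma> a + of_real (1 - t) * \<rho> a"
    have "\<forall>a\<in>B. restr \<tau> a = of_real t * restr \<sigma> a + of_real (1 - t) * restr \<rho> a"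
      using eq csq_const by (auto simp: restr_def)
    then have "\<forall>a\<in>B. restr \<sigma> a = restr \<tau> a \<and> restr \<rho> a = restr \<tau> a"
      using as t trace_on_restr[OF s] trace_on_restr[OF r] unfolding extreme_trace_on_def by blast
    then show "\<sigma> = \<tau>" "\<rho> = \<tau>" using as s r by (auto intro!: tracial_state_eqI)
  qed (use as in auto)
qed

lemma faithful_trace_unorm_zero:
  assumes "faithful_trace C \<tau>" "x \<in> B" "restr \<tau> (adj x * x) = 0"
  shows "unorm x = 0"
proof -
  have x: "(\<lambda>_. x) \<in> csq" and 0: "(\<lambda>_. 0) \<in> csq"
    using assms by (auto intro: csq_const)
  have "\<tau> (star C (cls (\<lambda>_. x)) \<otimes>\<^bsub>C\<^esub> cls (\<lambda>_. x)) = 0"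
    using assms x by (simp add: cls_adj cls_mult restr_def)
  then have "cls (\<lambda>_. x) = cls (\<lambda>_. 0)"
    using assms(1) cls_closed[OF x] unfolding faithful_trace_def cls_zero by fastforce
  then have "(\<lambda>n. unorm (x - 0)) \<longlonglongrightarrow> 0"
    using x 0 by (intro cls_eqD)
  then show ?thesis by (simp add: LIMSEQ_const_iff)
qed

text \<open>For a trace the unit vector is separating: if \<open>a n\<close> tends to zero in
  \<open>tnorm\<close>, so does \<open>a n * b\<close> for each fixed \<open>b\<close>, and the GNS
  operator of the limit vanishes. The hypothesis \<open>le\<close> converts smallness of the GNS
  operator norm into smallness in \<open>unorm\<close>.\<close>

lemma faithful_traceI:
  assumes \<tau>: "\<tau> \<in> tracial_states C" and le: "\<And>a. a \<in> B \<Longrightarrow> unorm a \<le> gnorm (restr \<tau>) a"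
  shows "faithful_trace C \<tau>"
  unfolding faithful_trace_def
proof (intro ballI impI)
  fix X assume X: "X \<in> carrier C" "X \<noteq> \<zero>\<^bsub>C\<^esub>"
  then obtain a where a: "a \<in> csq" "X = cls a" by (auto simp: carrier_completion)
  let ?T = "restr \<tau>"
  note T = trace_on_restr[OF \<tau>]
  have s: "(\<lambda>n. adj (a n) * a n) \<in> csq" using a by simp
  have lim: "(\<lambda>n. (tnorm ?T (a n))\<^sup>2) \<longlonglongrightarrow> Re (\<tau> (star C X \<otimes>\<^bsub>C\<^esub> X))"
    using tendsto_Re[OF tracial_state_continuous[OF \<tau> s]] a
    by (simp add: tnorm_sq[OF T] cls_adj cls_mult)
  show "Re (\<tau> (star C X \<otimes>\<^bsub>C\<^esub> X)) > 0"
  proof (rule ccontr)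
    assume "\<not> ?thesis"
    moreover have "Re (\<tau> (star C X \<otimes>\<^bsub>C\<^esub> X)) \<ge> 0"
      using tracial_statesD(3)[OF \<tau> a(1) a(1)] a by (simp add: cls_adj cls_mult complex_nonneg_iff)
    ultimately have "(\<lambda>n. (tnorm ?T (a n))\<^sup>2) \<longlonglongrightarrow> 0" using lim by simp
    from tendsto_real_sqrt[OF this] have a0: "(\<lambda>n. tnorm ?T (a n)) \<longlonglongrightarrow> 0"
      using a tnorm_nonneg[OF T] by simp
    \<comment> \<open>Right multiplication is bounded as well, because \<open>adj\<close> is
      isometric for the \<open>tnorm\<close> of a trace.\<close>
    have tn: "tnorm ?T (x * y) \<le> gnorm ?T (adj y) * tnorm ?T x" if "x \<in> B" "y \<in> B" for x y
      using tnorm_mult_le[OF T, of "adj y" "adj x"] that tnorm_adj[OF T, of "x * y"] tnorm_adj[OF T, of x]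
      by (simp add: adj_mult)
    have "(\<lambda>n. unorm (a n - 0)) \<longlonglongrightarrow> 0"
    proof (rule LIMSEQ_I)
      fix e :: real assume e: "e > 0"
      then obtain M where M: "\<forall>m\<ge>M. \<forall>n\<ge>M. unorm (a m - a n) < e/2"
        using csq_Cauchy[OF a(1), of "e/2"] by auto
      have "unorm (a n) \<le> e/2" if n: "n \<ge> M" for n
      proof -
        have "gnorm ?T (a n) \<le> e/2"
        proof (rule gnorm_least[OF T])
          fix b assume b: "b \<in> B"
          have *: "tnorm ?T (a n * b) \<le> e/2 * tnorm ?T b + gnorm ?T (adj b) * tnorm ?T (a m)" if m: "m \<ge> M" for m
          proof -
            have "a n * b = (a n - a m) * b + a m * b" by (simp add: algebra_simps)
            then have "tnorm ?T (a n * b) \<le> tnorm ?T ((a n - a m) * b) + tnorm ?T (a m * b)"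
              using tnorm_add[OF T, of "(a n - a m) * b" "a m * b"] a b by simp
            also have "tnorm ?T ((a n - a m) * b) \<le> gnorm ?T (a n - a m) * tnorm ?T b"
              using tnorm_mult_le[OF T] a b by simp
            also have "\<dots> \<le> e/2 * tnorm ?T b"
            proof (rule mult_right_mono[OF _ tnorm_nonneg[OF T b]])
              have "unorm (a n - a m) < e/2" using M n m by blast
              then show "gnorm ?T (a n - a m) \<le> e/2"
                using csn_le_unorm[OF csn_gnorm[OF T], of "a n - a m"] a by simp
            qed
            finally show ?thesis using tn[of "a m" b] a b by simp
          qed
          \<comment> \<open>Let \<open>m\<close> grow with \<open>n\<close> and \<open>b\<close>
            fixed; the second term of the bound disappears.\<close>
          show "tnorm ?T (a n * b) \<le> e/2 * tnorm ?T b"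
          proof (rule LIMSEQ_le_const)
            show "(\<lambda>m. e/2 * tnorm ?T b + gnorm ?T (adj b) * tnorm ?T (a m)) \<longlonglongrightarrow> e/2 * tnorm ?T b"
              using tendsto_add[OF tendsto_const tendsto_mult_left[OF a0]] by fastforce
          qed (use * in blast)
        qed (use a e in auto)
        then show ?thesis using le[of "a n"] a by simp
      qed
      then show "\<exists>N. \<forall>n\<ge>N. norm (unorm (a n - 0) - 0) < e"
        using e a by (intro exI[of _ M]) (auto intro: le_less_trans[of _ "e/2"])
    qed
    then have "cls a = cls (\<lambda>_. 0)" using a csq_const[of 0] by (intro cls_eqI) auto
    then show False using X a cls_zero by simp
  qed
qed

end

section \<open>Traces cut down by a central projection of the GNS space\<close>

context star_ring
begin

text \<open>\<open>P n\<close> plays the role of a sequence converging in the GNS space to a central projection \<open>P\<close>;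
  the conclusion produces the trace \<open>a \<mapsto> T (P a) / T P\<close>.\<close>

definition central_projection_seq :: "('r \<Rightarrow> complex) \<Rightarrow> (nat \<Rightarrow> 'r) \<Rightarrow> bool" where
  "central_projection_seq T P \<longleftrightarrow> (\<forall>n. P n \<in> B) \<and>
     (\<forall>e>0. \<exists>M. \<forall>m\<ge>M. \<forall>n\<ge>M. tnorm T (P m - P n) < e) \<and>
     (\<lambda>n. tnorm T (P n - adj (P n) * P n)) \<longlonglongrightarrow> 0 \<and>
     (\<forall>u\<in>unitaries. (\<lambda>n. tnorm T (u * P n - P n * u)) \<longlonglongrightarrow> 0)"

lemma tendsto_trace_mult_zero:
  assumes T: "trace_on T" and X: "\<And>n. X n \<in> B" and lim: "(\<lambda>n. tnorm T (X n)) \<longlonglongrightarrow> 0" and a: "a \<in> B"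
  shows "(\<lambda>n. T (X n * a)) \<longlonglongrightarrow> 0"
proof (rule tendsto_norm_zero_cancel, rule tendsto_sandwich[OF _ _ tendsto_const])
  show "(\<lambda>n. tnorm T (X n) * tnorm T a) \<longlonglongrightarrow> 0" using tendsto_mult_left_zero[OF lim] .
  show "\<forall>\<^sub>F n in sequentially. norm (T (X n * a)) \<le> tnorm T (X n) * tnorm T a"
    using X a trace_Cauchy_Schwarz'[OF T] by auto
qed auto

lemma central_projection_trace:
  assumes T: "trace_on T" and P: "central_projection_seq T P"
    and c: "(\<lambda>n. T (P n)) \<longlonglongrightarrow> of_real c" "c > 0"
  shows "\<exists>S. trace_on S \<and> (\<forall>a\<in>B. (\<lambda>n. T (P n * a)) \<longlonglongrightarrow> of_real c * S a)"
proof -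
  have PB: "P n \<in> B" for n using P by (simp add: central_projection_seq_def)
  have Cauchy: "\<exists>M. \<forall>m\<ge>M. \<forall>n\<ge>M. tnorm T (P m - P n) < e" if "e > 0" for e
    using P that unfolding central_projection_seq_def by blast
  have idem: "(\<lambda>n. tnorm T (P n - adj (P n) * P n)) \<longlonglongrightarrow> 0"
    using P by (simp add: central_projection_seq_def)
  have comm: "(\<lambda>n. tnorm T (u * P n - P n * u)) \<longlonglongrightarrow> 0" if "u \<in> unitaries" for u
    using P that by (simp add: central_projection_seq_def)
  \<comment> \<open>By Cauchy-Schwarz, the Cauchy property of \<open>P\<close> in
    \<open>tnorm\<close> passes to the numbers \<open>T (P n * a)\<close>.\<close>
  have conv: "convergent (\<lambda>n. T (P n * a))" if a: "a \<in> B" for a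
  proof (rule Cauchy_convergent, rule metric_CauchyI)
    fix e :: real assume e: "e > 0"
    define K where "K = tnorm T a + 1"
    have K: "K > 0" using tnorm_nonneg[OF T a] by (simp add: K_def)
    obtain M where M: "\<forall>m\<ge>M. \<forall>n\<ge>M. tnorm T (P m - P n) < e / K"
      using Cauchy[of "e / K"] e K by auto
    have "dist (T (P m * a)) (T (P n * a)) < e" if "m \<ge> M" "n \<ge> M" for m n
    proof -
      have "dist (T (P m * a)) (T (P n * a)) = cmod (T ((P m - P n) * a))"
        using a PB by (simp add: dist_norm left_diff_distrib trace_diff[OF T])
      also have "\<dots> \<le> tnorm T (P m - P n) * tnorm T a"
        using a PB trace_Cauchy_Schwarz'[OF T] by simp
      also have "\<dots> \<le> tnorm T (P m - P n) * K"
        using PB tnorm_nonneg[OF T] by (intro mult_left_mono) (auto simp: K_def)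
      also have "\<dots> < e / K * K" using M that K by (intro mult_strict_right_mono) auto
      finally show ?thesis using K by simp
    qed
    then show "\<exists>M. \<forall>m\<ge>M. \<forall>n\<ge>M. dist (T (P m * a)) (T (P n * a)) < e" by blast
  qed
  define S where "S a = lim (\<lambda>n. T (P n * a)) / of_real c" for a
  have lim: "(\<lambda>n. T (P n * a)) \<longlonglongrightarrow> of_real c * S a" if "a \<in> B" for a
    using conv[OF that] c by (simp add: S_def convergent_LIMSEQ_iff)
  have eq: "S a = l" if "a \<in> B" "(\<lambda>n. T (P n * a)) \<longlonglongrightarrow> of_real c * l" for a l
    using LIMSEQ_unique[OF lim[OF that(1)] that(2)] c by simp
  have add: "S (a + b) = S a + S b" if "a \<in> B" "b \<in> B" for a b
    using that PB tendsto_add[OF lim[of a] lim[of b]]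
    by (intro eq) (auto simp: distrib_left trace_add[OF T])
  have scl: "S (scalar d * a) = d * S a" if a: "a \<in> B" for a d
    using a PB tendsto_mult_left[OF lim[OF a], of d]
    by (intro eq) (auto simp: mult_scalar[of "P _" d a] trace_scale[OF T] mult.left_commute)
  have sum: "S (sum f F) = (\<Sum>i\<in>F. S (f i))" if "\<And>i. i \<in> F \<Longrightarrow> f i \<in> B" for f and F :: "'r set"
    using that
  proof (induction F rule: infinite_finite_induct)
    case (insert i F)
    then show ?case using add[of "f i" "sum f F"] by simp
  qed (use scl[of 0 0] in auto)
  have "trace_on S"
    unfolding trace_on_def
  proof (intro conjI ballI allI)
    show "S 1 = 1" using c by (intro eq) auto
    fix a assume a: "a \<in> B"
    show "S (scalar d * a) = d * S a" for d using scl a .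
    show "S (adj a * a) \<in> \<real>\<^sub>\<ge>\<^sub>0"
    proof -
      \<comment> \<open>In the limit \<open>P n\<close> may be replaced by
        \<open>adj (P n) * P n\<close>; cyclic rotation then turns the value into \<open>T\<close>
        of a positive element.\<close>
      have "(\<lambda>n. T ((P n - adj (P n) * P n) * (adj a * a))) \<longlonglongrightarrow> 0"
        using PB a idem by (intro tendsto_trace_mult_zero[OF T]) auto
      from tendsto_diff[OF lim[of "adj a * a"] this]
      have "(\<lambda>n. T (adj (P n) * P n * (adj a * a))) \<longlonglongrightarrow> of_real c * S (adj a * a)"
        using a PB by (simp add: left_diff_distrib trace_diff[OF T])
      moreover have "T (adj (P n) * P n * (adj a * a)) \<in> \<real>\<^sub>\<ge>\<^sub>0" for n
      proof -
        have "T (adj (P n) * (P n * (adj a * a))) = T (P n * (adj a * a) * adj (P n))"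
          using a PB by (intro trace_commute[OF T]) auto
        also have "\<dots> = T (adj (a * adj (P n)) * (a * adj (P n)))"
          by (simp add: adj_mult mult.assoc)
        finally show ?thesis
          using trace_pos[OF T, of "a * adj (P n)"] a PB by (simp add: mult.assoc)
      qed
      ultimately have "of_real c * S (adj a * a) \<in> \<real>\<^sub>\<ge>\<^sub>0"
        by (rule closed_sequentially[OF closed_nonneg_Reals_complex, rotated])
      then show ?thesis using c by (simp add: complex_nonneg_iff zero_le_mult_iff)
    qed
    fix b assume b: "b \<in> B"
    show "S (a + b) = S a + S b" using add a b .
    have u: "S (u * a) = S (a * u)" if "u \<in> unitaries" for u
    proof -
      have uB: "u \<in> B" using that by simp
      have "(\<lambda>n. T ((u * P n - P n * u) * a)) \<longlonglongrightarrow> 0"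
        using PB a that comm by (intro tendsto_trace_mult_zero[OF T]) auto
      moreover have "T ((u * P n - P n * u) * a) = T (P n * (a * u)) - T (P n * (u * a))" for n
        using trace_commute[OF T, of u "P n * a"] a PB uB
        by (simp add: left_diff_distrib trace_diff[OF T] mult.assoc)
      ultimately have "(\<lambda>n. T (P n * (a * u)) - T (P n * (u * a))) \<longlonglongrightarrow> 0" by simp
      from tendsto_diff[OF lim[of "a * u"] this] show ?thesis
        using a uB by (intro eq) auto
    qed
    \<comment> \<open>Asymptotic centrality is known for unitaries only; the general case follows by
      linear combination.\<close>
    obtain F k where F: "finite F" "F \<subseteq> unitaries" "b = (\<Sum>u\<in>F. scalar (k u) * u)"
      using unitary_span[OF b] by auto
    have "S (b * a) = (\<Sum>u\<in>F. k u * S (u * a))"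
      using a F scl by (simp add: sum_distrib_right mult.assoc subsetD sum)
    also have "\<dots> = (\<Sum>u\<in>F. k u * S (a * u))"
      using F u by (intro sum.cong) auto
    also have "\<dots> = S (a * b)"
      using a F scl by (simp add: sum_distrib_left mult_scalar subsetD sum)
    finally show "S (a * b) = S (b * a)" by simp
  qed
  then show ?thesis using lim by blast
qed

lemma central_projection_seq_complement:
  assumes T: "trace_on T" and P: "central_projection_seq T P"
  shows "central_projection_seq T (\<lambda>n. 1 - P n)"
proof -
  have PB: "P n \<in> B" for n using P by (simp add: central_projection_seq_def)
  have 1: "tnorm T (1 - P m - (1 - P n)) = tnorm T (P m - P n)" for m n
    using tnorm_minus[OF T, of "P m - P n"] PB by simp
  have 2: "tnorm T (1 - P n - adj (1 - P n) * (1 - P n)) = tnorm T (P n - adj (P n) * P n)" for n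
  proof -
    have "1 - P n - adj (1 - P n) * (1 - P n) = adj (P n - adj (P n) * P n)"
      by (simp add: adj_diff adj_mult algebra_simps)
    then show ?thesis using tnorm_adj[OF T, of "P n - adj (P n) * P n"] PB by simp
  qed
  have 3: "tnorm T (u * (1 - P n) - (1 - P n) * u) = tnorm T (u * P n - P n * u)"
    if "u \<in> unitaries" for u n
  proof -
    have "u * (1 - P n) - (1 - P n) * u = - (u * P n - P n * u)"
      by (simp add: algebra_simps)
    then show ?thesis using tnorm_minus[OF T, of "u * P n - P n * u"] PB that
      by (metis diff_closed mult_closed unitaryD(1))
  qed
  show ?thesis
    using P unfolding central_projection_seq_def
    by (simp only: 1 2 3 diff_closed one_closed simp_thms cong: ball_cong) blast
qed

text \<open>\<open>T\<close> is the combination, with weights \<open>c\<close> and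
  \<open>1 - c\<close>, of the traces cut down by the projection and by its complement. The
  hypothesis \<open>PP\<close> gives the first of them the value 1 at every \<open>P m\<close>. If
  it were equal to \<open>T\<close>, then \<open>T (P m) = 1\<close> for all \<open>m\<close> and so
  \<open>c = 1\<close>.\<close>

lemma not_extreme_trace_if_central_projection:
  assumes T: "trace_on T" and P: "central_projection_seq T P"
    and c: "(\<lambda>n. T (P n)) \<longlonglongrightarrow> of_real c" "0 < c" "c < 1"
    and PP: "\<And>m. (\<lambda>n. T (P n * P m)) \<longlonglongrightarrow> of_real c"
  shows "\<not> extreme_trace_on T"
proof
  assume ex: "extreme_trace_on T"
  have PB: "P n \<in> B" for n using P by (simp add: central_projection_seq_def)
  obtain S where S: "trace_on S" "\<forall>a\<in>B. (\<lambda>n. T (P n * a)) \<longlonglongrightarrow> of_real c * S a"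
    using central_projection_trace[OF T P c(1,2)] by blast
  have "(\<lambda>n. T (1 - P n)) \<longlonglongrightarrow> of_real (1 - c)"
    using tendsto_diff[OF tendsto_const[of 1] c(1)] PB
    by (simp add: trace_diff[OF T] trace_1[OF T])
  then obtain R where R: "trace_on R" "\<forall>a\<in>B. (\<lambda>n. T ((1 - P n) * a)) \<longlonglongrightarrow> of_real (1 - c) * R a"
    using central_projection_trace[OF T central_projection_seq_complement[OF T P], of "1 - c"] c by auto
  have "T a = of_real c * S a + of_real (1 - c) * R a" if a: "a \<in> B" for a
  proof -
    have "(\<lambda>n. T (P n * a) + T ((1 - P n) * a)) \<longlonglongrightarrow> of_real c * S a + of_real (1 - c) * R a"
      using S(2) R(2) a by (intro tendsto_add) auto
    moreover have "T (P n * a) + T ((1 - P n) * a) = T a" for n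
      using a PB by (simp add: left_diff_distrib trace_diff[OF T])
    ultimately show ?thesis by (simp add: LIMSEQ_const_iff)
  qed
  then have ST: "\<forall>a\<in>B. S a = T a"
    using ex S(1) R(1) c unfolding extreme_trace_on_def by blast
  have "T (P m) = 1" for m
  proof -
    have "of_real c * S (P m) = of_real c"
      using LIMSEQ_unique[OF PP[of m]] S(2) PB by metis
    then show ?thesis using ST PB c by simp
  qed
  then have "of_real c = (1::complex)" using c(1) by (simp add: LIMSEQ_const_iff)
  then show False using c by simp
qed

end

section \<open>Probability measures on the circle\<close>

definition circle_prob :: "complex measure \<Rightarrow> bool" where
  "circle_prob M \<longleftrightarrow> sets M = sets circle_borel \<and> prob_space M"

lemma circle_borel_set: "circle \<in> sets (borel :: complex measure)"
  by (intro borel_closed closed_sphere)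

lemma space_circle_borel [simp]: "space circle_borel = circle"
  by (simp add: circle_borel_def space_restrict_space)

lemma sets_circle_borel_iff: "A \<in> sets circle_borel \<longleftrightarrow> A \<in> sets borel \<and> A \<subseteq> circle"
  unfolding circle_borel_def by (subst sets_restrict_space_iff) (auto intro: circle_borel_set)

lemma circle_probD:
  assumes "circle_prob M"
  shows "sets M = sets circle_borel" "prob_space M" "space M = circle"
  using assms sets_eq_imp_space_eq[of M circle_borel] by (auto simp: circle_prob_def)

lemma circle_continuous_measurable:
  fixes f :: "complex \<Rightarrow> 'b::{second_countable_topology, t2_space}"
  assumes "sets M = sets circle_borel" "continuous_on circle f"
  shows "f \<in> borel_measurable M"
  using borel_measurable_continuous_on_restrict[OF assms(2)] assms(1)
  by (simp add: circle_borel_def cong: measurable_cong_sets)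

lemma circle_integrable:
  fixes f :: "complex \<Rightarrow> 'b::{banach, second_countable_topology}"
  assumes M: "circle_prob M" and f: "continuous_on circle f"
  shows "integrable M f"
proof -
  interpret prob_space M using M by (rule circle_probD)
  have "bounded (f ` circle)"
    using f by (intro compact_imp_bounded compact_continuous_image) auto
  then obtain B where "\<forall>x\<in>circle. norm (f x) \<le> B" by (auto simp: bounded_iff)
  then show ?thesis
    using circle_probD[OF M] f
    by (intro integrable_const_bound[of _ B]) (auto intro: circle_continuous_measurable)
qed

section \<open>Trigonometric polynomials and uniqueness of Fourier coefficients\<close>

lemma circle_powi_continuous: "continuous_on circle (\<lambda>z::complex. z powi n)"
  by (intro continuous_intros) auto

lemmas circle_powi_integrable = circle_integrable[OF _ circle_powi_continuous]

lemma cmod_powi_circle: "z \<in> circle \<Longrightarrow> cmod (z powi n) = 1"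
  by (simp add: norm_power_int)

lemma cnj_powi_circle: "z \<in> circle \<Longrightarrow> cnj (z powi n) = z powi (- n)"
proof -
  assume "z \<in> circle"
  then have "z powi n * cnj (z powi n) = 1" "z \<noteq> 0"
    using complex_norm_square[of "z powi n"] cmod_powi_circle[of z n] by auto
  then show ?thesis by (simp add: power_int_minus field_simps)
qed

text \<open>Trigonometric polynomials as functions. The rule \<open>cong\<close> forgets the values
  off the circle, where identities such as \<open>cnj z = inverse z\<close> fail.\<close>

inductive trig :: "(complex \<Rightarrow> complex) \<Rightarrow> bool" where
  monomial: "trig (\<lambda>z. c * z powi n)"
| add: "trig f \<Longrightarrow> trig g \<Longrightarrow> trig (\<lambda>z. f z + g z)"
| cong: "trig f \<Longrightarrow> (\<And>z. z \<in> circle \<Longrightarrow> f z = g z) \<Longrightarrow> trig g"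

lemma trig_continuous: "trig f \<Longrightarrow> continuous_on circle f"
proof (induction rule: trig.induct)
  case (monomial c n)
  show ?case by (intro continuous_intros) auto
next
  case (cong f g)
  then show ?case using continuous_on_cong[of circle circle f g] by simp
qed (intro continuous_intros)

lemma trig_mult_monomial: "trig f \<Longrightarrow> trig (\<lambda>z. c * z powi n * f z)"
proof (induction rule: trig.induct)
  case (monomial d m)
  have "trig (\<lambda>z. (c * d) * z powi (n + m))" by (rule trig.monomial)
  then show ?case by (rule trig.cong) (subst power_int_add, auto)
next
  case (add f g)
  from trig.add[OF add.IH] show ?case by (rule trig.cong) (simp add: distrib_left)
next
  case (cong f g)
  from cong.IH show ?case by (rule trig.cong) (simp add: cong)
qed

lemma trig_mult: "trig f \<Longrightarrow> trig g \<Longrightarrow> trig (\<lambda>z. f z * g z)"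
proof (induction rule: trig.induct)
  case (monomial c n)
  then show ?case by (rule trig_mult_monomial)
next
  case (add f h)
  from trig.add[OF add.IH(1)[OF add.prems] add.IH(2)[OF add.prems]] show ?case
    by (rule trig.cong) (simp add: distrib_right)
next
  case (cong f h)
  from cong.IH[OF cong.prems] show ?case by (rule trig.cong) (simp add: cong)
qed

text \<open>Stone-Weierstrass delivers real polynomials on the plane. On the circle the coordinates
  are \<open>(z + inverse z) / 2\<close> and \<open>(z - inverse z) / (2 * \<i>)\<close>, so such
  polynomials are trigonometric.\<close>

lemma trig_real_polynomial:
  assumes "real_polynomial_function g" shows "trig (\<lambda>z. of_real (g z))"
  using assms
proof (induction rule: real_polynomial_function.induct)
  case (linear f)
  have "trig (\<lambda>z. of_real (f 1) / 2 * z powi 1 + of_real (f 1) / 2 * z powi (- 1)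
     + (of_real (f \<i>) / (2 * \<i>) * z powi 1 + - of_real (f \<i>) / (2 * \<i>) * z powi (- 1)))"
    by (intro trig.add trig.monomial)
  then show ?case
  proof (rule trig.cong)
    fix z :: complex assume z: "z \<in> circle"
    have "f z = f (Re z *\<^sub>R 1 + Im z *\<^sub>R \<i>)"
      by (metis complex_eq mult.commute scaleR_conv_of_real mult.right_neutral)
    then have fz: "f z = Re z * f 1 + Im z * f \<i>"
      using linear by (simp add: bounded_linear.linear linear_add linear_scale)
    have inv: "inverse z = cnj z" using cnj_powi_circle[OF z, of 1] by (simp add: power_int_minus)
    have 1: "z + cnj z = 2 * of_real (Re z)" and 2: "z - cnj z = 2 * \<i> * of_real (Im z)"
      by (simp_all add: complex_eq_iff)
    have div: "d \<noteq> 0 \<Longrightarrow> a / d * (d * x) = a * x" for a d x :: complex by simp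
    have "of_real (f 1) / 2 * z + of_real (f 1) / 2 * cnj z
        + (of_real (f \<i>) / (2 * \<i>) * z + - of_real (f \<i>) / (2 * \<i>) * cnj z)
        = of_real (f 1) / 2 * (z + cnj z) + of_real (f \<i>) / (2 * \<i>) * (z - cnj z)"
      by (simp add: field_simps)
    also have "of_real (f \<i>) / (2 * \<i>) * (z - cnj z) = of_real (f \<i>) * of_real (Im z)"
      unfolding 2 by (rule div) simp
    also have "of_real (f 1) / 2 * (z + cnj z) + of_real (f \<i>) * of_real (Im z) = of_real (f z)"
      unfolding 1 fz by simp
    finally show "of_real (f 1) / 2 * z powi 1 + of_real (f 1) / 2 * z powi (- 1)
     + (of_real (f \<i>) / (2 * \<i>) * z powi 1 + - of_real (f \<i>) / (2 * \<i>) * z powi (- 1)) = of_real (f z)"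
      by (simp add: power_int_minus inv)
  qed
next
  case (const c)
  from trig.monomial[of "of_real c" 0] show ?case by simp
next
  case (add f g)
  from trig.add[OF add.IH] show ?case by simp
next
  case (mult f g)
  from trig_mult[OF mult.IH] show ?case by simp
qed

lemma fourier_coefficients_trig:
  assumes M: "circle_prob M" "circle_prob N"
    and eq: "\<And>n. (\<integral>z. z powi n \<partial>M) = (\<integral>z. z powi n \<partial>N)" and f: "trig f"
  shows "(\<integral>z. f z \<partial>M) = (\<integral>z. f z \<partial>N)"
  using f
proof (induction rule: trig.induct)
  case (monomial c n)
  then show ?case by (simp add: eq)
next
  case (add f g)
  then have "integrable L f \<and> integrable L g" if "circle_prob L" for L
    using that circle_integrable trig_continuous by blast
  then show ?case using M add.IH by simp
next
  case (cong f g)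
  have "(\<integral>z. g z \<partial>L) = (\<integral>z. f z \<partial>L)" if "circle_prob L" for L
    using cong(2) circle_probD(3)[OF that] by (intro Bochner_Integration.integral_cong) auto
  then show ?case using cong.IH M by simp
qed

lemma fourier_coefficients_continuous:
  assumes M: "circle_prob M" "circle_prob N"
    and eq: "\<And>n. (\<integral>z. z powi n \<partial>M) = (\<integral>z. z powi n \<partial>N)" and f: "continuous_on circle (f :: complex \<Rightarrow> real)"
  shows "(\<integral>z. f z \<partial>M) = (\<integral>z. f z \<partial>N)"
proof -
  have "\<bar>(\<integral>z. f z \<partial>M) - (\<integral>z. f z \<partial>N)\<bar> \<le> e" if e: "e > 0" for e
  proof -
    obtain g where g: "real_polynomial_function g" "\<And>z. z \<in> circle \<Longrightarrow> \<bar>f z - g z\<bar> < e / 2"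
      using Stone_Weierstrass_real_polynomial_function[of circle f "e / 2"] f e by auto
    have gc: "continuous_on circle g"
      using g(1) by (simp add: real_polynomial_function_eq continuous_on_polymonial_function)
    have near: "\<bar>(\<integral>z. f z \<partial>K) - (\<integral>z. g z \<partial>K)\<bar> \<le> e / 2" if K: "circle_prob K" for K
    proof -
      interpret prob_space K using K by (rule circle_probD)
      have int: "integrable K f" "integrable K g" using K f gc circle_integrable by blast+
      have "\<bar>(\<integral>z. f z \<partial>K) - (\<integral>z. g z \<partial>K)\<bar> = \<bar>\<integral>z. f z - g z \<partial>K\<bar>" using int by simp
      also have "\<dots> \<le> (\<integral>z. \<bar>f z - g z\<bar> \<partial>K)" by (rule integral_abs_bound)
      also have "\<dots> \<le> (\<integral>z. e / 2 \<partial>K)"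
        using int g(2) circle_probD(3)[OF K] by (intro integral_mono) (auto intro: less_imp_le)
      finally show ?thesis by (simp add: prob_space)
    qed
    have "complex_of_real (\<integral>z. g z \<partial>M) = complex_of_real (\<integral>z. g z \<partial>N)"
      using fourier_coefficients_trig[OF M eq trig_real_polynomial[OF g(1)]]
      by (simp only: integral_complex_of_real)
    then have "(\<integral>z. g z \<partial>M) = (\<integral>z. g z \<partial>N)" by (simp only: of_real_eq_iff)
    then show ?thesis using near[OF M(1)] near[OF M(2)] by linarith
  qed
  then have "\<bar>(\<integral>z. f z \<partial>M) - (\<integral>z. f z \<partial>N)\<bar> \<le> 0 + e" if "e > 0" for e
    using that by simp
  then have "\<bar>(\<integral>z. f z \<partial>M) - (\<integral>z. f z \<partial>N)\<bar> \<le> 0" by (rule field_le_epsilon)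
  then show ?thesis by simp
qed

lemma circle_distr_borel:
  assumes M: "circle_prob M"
  shows "(\<lambda>z. z) \<in> measurable M borel"
    and "A \<in> sets borel \<Longrightarrow> emeasure (distr M borel (\<lambda>z. z)) A = emeasure M (A \<inter> circle)"
proof -
  show *: "(\<lambda>z. z) \<in> measurable M borel"
    using circle_continuous_measurable[of M "\<lambda>z. z"] circle_probD[OF M] by auto
  assume "A \<in> sets borel"
  then show "emeasure (distr M borel (\<lambda>z. z)) A = emeasure M (A \<inter> circle)"
    using * circle_probD[OF M] by (simp add: emeasure_distr vimage_def Int_def)
qed

text \<open>These continuous functions decrease to the indicator of \<open>F\<close>, which puts
  closed sets within reach of Fourier coefficients. The empty set is excluded because
  \<open>infdist\<close> to it is 0 by convention.\<close>

lemma circle_closed_limit: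
  assumes M: "circle_prob M" and F: "closed F" "F \<noteq> {}"
  shows "(\<lambda>k. \<integral>z. max 0 (1 - real k * infdist z F) \<partial>M) \<longlonglongrightarrow> measure M (F \<inter> circle)"
proof -
  interpret prob_space M using M by (rule circle_probD)
  have FM: "F \<inter> circle \<in> sets M"
    using F circle_probD[OF M] by (auto simp: sets_circle_borel_iff circle_borel_set)
  have "(\<lambda>k. \<integral>z. max 0 (1 - real k * infdist z F) \<partial>M) \<longlonglongrightarrow> (\<integral>z. indicator (F \<inter> circle) z \<partial>M)"
  proof (rule integral_dominated_convergence[where w = "\<lambda>_. 1"])
    show "(\<lambda>z. max 0 (1 - real k * infdist z F)) \<in> borel_measurable M" for k
      using circle_probD[OF M] by (intro circle_continuous_measurable continuous_intros) auto
    show "AE z in M. norm (max 0 (1 - real k * infdist z F)) \<le> 1" for k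
      by (auto simp: infdist_nonneg)
    show "AE z in M. (\<lambda>k. max 0 (1 - real k * infdist z F)) \<longlonglongrightarrow> indicator (F \<inter> circle) z"
    proof (rule AE_I2)
      fix z assume "z \<in> space M"
      then have z: "z \<in> circle" using circle_probD[OF M] by simp
      show "(\<lambda>k. max 0 (1 - real k * infdist z F)) \<longlonglongrightarrow> indicator (F \<inter> circle) z"
      proof (cases "z \<in> F")
        case True
        then show ?thesis using z by simp
      next
        case False
        then have pos: "infdist z F > 0"
          using F in_closed_iff_infdist_zero[of F z] infdist_nonneg[of z F] by linarith
        obtain K where K: "real K * infdist z F > 1" using pos reals_Archimedean3 by blast
        have "max 0 (1 - real k * infdist z F) = 0" if "k \<ge> K" for k
        proof -
          have "real K * infdist z F \<le> real k * infdist z F" using that pos by simp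
          then show ?thesis using K by simp
        qed
        then have "(\<lambda>k. max 0 (1 - real k * infdist z F)) \<longlonglongrightarrow> 0"
          by (intro tendsto_eventually eventually_sequentiallyI[of K])
        then show ?thesis using False by simp
      qed
    qed
  qed (use FM in auto)
  then show ?thesis using FM by simp
qed

lemma circle_measure_eqI:
  assumes M: "circle_prob M" "circle_prob N"
    and eq: "\<And>n. (\<integral>z. z powi n \<partial>M) = (\<integral>z. z powi n \<partial>N)"
  shows "M = N"
proof (rule measure_eqI)
  show sets: "sets M = sets N" using M by (simp add: circle_prob_def)
  interpret PM: prob_space M using M(1) by (rule circle_probD)
  interpret PN: prob_space N using M(2) by (rule circle_probD)
  have closed: "emeasure M (F \<inter> circle) = emeasure N (F \<inter> circle)" if F: "closed F" for F
  proof (cases "F = {}")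
    case False
    have "(\<lambda>k. \<integral>z. max 0 (1 - real k * infdist z F) \<partial>M) = (\<lambda>k. \<integral>z. max 0 (1 - real k * infdist z F) \<partial>N)"
      by (intro ext fourier_coefficients_continuous[OF M eq] continuous_intros)
    then have "measure M (F \<inter> circle) = measure N (F \<inter> circle)"
      using circle_closed_limit[OF M(1) F False] circle_closed_limit[OF M(2) F False] LIMSEQ_unique by metis
    then show ?thesis by (simp add: PM.emeasure_eq_measure PN.emeasure_eq_measure)
  qed auto
  \<comment> \<open>The comparison is moved to the plane, where the closed sets are an
    intersection-stable generator of the Borel sets.\<close>
  have "distr M borel (\<lambda>z. z) = distr N borel (\<lambda>z. z)"
  proof (rule measure_eqI_generator_eq[where E = "Collect closed" and \<Omega> = UNIV and A = "\<lambda>_. UNIV"])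
    show "Int_stable (Collect closed :: complex set set)" by (auto simp: Int_stable_def)
    show "emeasure (distr M borel (\<lambda>z. z)) X = emeasure (distr N borel (\<lambda>z. z)) X"
      if "X \<in> Collect closed" for X
      using that circle_distr_borel[OF M(1)] circle_distr_borel[OF M(2)] closed by simp
    show "emeasure (distr M borel (\<lambda>z. z)) UNIV \<noteq> \<infinity>"
      using circle_distr_borel[OF M(1)] by simp
  qed (auto simp: borel_eq_closed sets_measure_of)
  moreover fix A assume "A \<in> sets M"
  then have "A \<in> sets borel" "A \<inter> circle = A"
    using circle_probD[OF M(1)] by (auto simp: sets_circle_borel_iff)
  ultimately show "emeasure M A = emeasure N A"
    using circle_distr_borel(2)[OF M(1), of A] circle_distr_borel(2)[OF M(2), of A] by simp
qed

text \<open>Pushed forward to the plane, the measure is a finite Borel measure on a Polish space,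
  hence regular. Relatively open subsets of the circle are the traces of open sets.\<close>

lemma circle_regular:
  assumes M: "circle_prob M" shows "regular_measure_on_circle M"
  unfolding regular_measure_on_circle_def
proof (intro ballI conjI)
  let ?M = "distr M borel (\<lambda>z. z)"
  interpret prob_space M using M by (rule circle_probD)
  fix A assume "A \<in> sets M"
  then have A: "A \<in> sets borel" "A \<subseteq> circle" "A \<inter> circle = A"
    using circle_probD[OF M] by (auto simp: sets_circle_borel_iff)
  have fin: "emeasure ?M (space ?M) \<noteq> \<infinity>" using circle_distr_borel(2)[OF M, of UNIV] by simp
  have MA: "emeasure M A = emeasure ?M A" using circle_distr_borel(2)[OF M A(1)] A by simp
  have "emeasure ?M A = (INF U\<in>{U. A \<subseteq> U \<and> open U}. emeasure ?M U)"
    using fin A by (intro outer_regular) auto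
  also have "\<dots> = (INF U\<in>{U. A \<subseteq> U \<and> open U}. emeasure M (U \<inter> circle))"
    using circle_distr_borel(2)[OF M] by (intro INF_cong) auto
  also have "\<dots> = (INF V\<in>(\<lambda>U. U \<inter> circle) ` {U. A \<subseteq> U \<and> open U}. emeasure M V)"
    by (simp add: image_image)
  also have "(\<lambda>U. U \<inter> circle) ` {U. A \<subseteq> U \<and> open U} = {U. openin (top_of_set circle) U \<and> A \<subseteq> U}"
    using A(2) by (auto simp: openin_open image_iff)
  finally show "emeasure M A = (INF U\<in>{U. openin (top_of_set circle) U \<and> A \<subseteq> U}. emeasure M U)"
    by (simp add: MA)
  have "emeasure ?M A = (SUP K\<in>{K. K \<subseteq> A \<and> compact K}. emeasure ?M K)"
    using fin A by (intro inner_regular) auto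
  also have "\<dots> = (SUP K\<in>{K. compact K \<and> K \<subseteq> A}. emeasure M K)"
  proof (intro SUP_cong)
    fix K assume "K \<in> {K. compact K \<and> K \<subseteq> A}"
    then have "K \<in> sets borel" "K \<inter> circle = K" using A(2) by (auto intro: borel_compact)
    then show "emeasure ?M K = emeasure M K" using circle_distr_borel(2)[OF M, of K] by simp
  qed auto
  finally show "emeasure M A = (SUP K\<in>{K. compact K \<and> K \<subseteq> A}. emeasure M K)" by (simp add: MA)
qed

lemma circle_power_measurable: "(\<lambda>z. z ^ k) \<in> measurable circle_borel circle_borel"
  unfolding circle_borel_def
  by (rule measurable_restrict_space2)
    (auto simp: space_restrict_space norm_power
      intro!: borel_measurable_continuous_on_restrict continuous_intros)

lemma circle_prob_distr:
  assumes "prob_space M" "f \<in> measurable M circle_borel" shows "circle_prob (distr M circle_borel f)"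
  using assms prob_space.prob_space_distr by (auto simp: circle_prob_def)

lemma circle_integral_distr:
  fixes g :: "complex \<Rightarrow> 'b::{banach, second_countable_topology}"
  assumes "f \<in> measurable M circle_borel" "continuous_on circle g"
  shows "(\<integral>z. g z \<partial>distr M circle_borel f) = (\<integral>x. g (f x) \<partial>M)"
  using assms circle_continuous_measurable[of circle_borel g] by (intro integral_distr) auto

lemma circle_power_measurable': "circle_prob M \<Longrightarrow> (\<lambda>z. z ^ k) \<in> measurable M circle_borel"
  using circle_power_measurable circle_probD(1)[of M] measurable_cong_sets[OF _ refl] by blast

lemma circle_integral_power:
  assumes M: "circle_prob M"
  shows "(\<integral>z. z powi n \<partial>distr M circle_borel (\<lambda>z. z ^ k)) = (\<integral>z. z powi (int k * n) \<partial>M)"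
  using circle_integral_distr[OF circle_power_measurable'[OF M] circle_powi_continuous[of n], of k]
  by (simp add: power_int_mult)

text \<open>Pushing forward by the \<open>k\<close>-th power multiplies frequencies by
  \<open>k\<close>, and a measure is determined by its Fourier coefficients.\<close>

lemma invariant_measures_iff:
  "M \<in> invariant_measures p q \<longleftrightarrow> circle_prob M \<and>
     (\<forall>n. (\<integral>z. z powi (int p * n) \<partial>M) = (\<integral>z. z powi n \<partial>M)) \<and>
     (\<forall>n. (\<integral>z. z powi (int q * n) \<partial>M) = (\<integral>z. z powi n \<partial>M))"
proof -
  have "distr M circle_borel (\<lambda>z. z ^ k) = M \<longleftrightarrow>
      (\<forall>n. (\<integral>z. z powi (int k * n) \<partial>M) = (\<integral>z. z powi n \<partial>M))" if M: "circle_prob M" for k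
  proof
    assume "distr M circle_borel (\<lambda>z. z ^ k) = M"
    then show "\<forall>n. (\<integral>z. z powi (int k * n) \<partial>M) = (\<integral>z. z powi n \<partial>M)"
      using circle_integral_power[OF M, where k = k] by metis
  next
    assume "\<forall>n. (\<integral>z. z powi (int k * n) \<partial>M) = (\<integral>z. z powi n \<partial>M)"
    then show "distr M circle_borel (\<lambda>z. z ^ k) = M"
      using circle_integral_power[OF M] M circle_power_measurable'[OF M] circle_probD[OF M]
      by (intro circle_measure_eqI circle_prob_distr) auto
  qed
  then show ?thesis
    using circle_regular by (auto simp: invariant_measures_def circle_prob_def)
qed

text \<open>The mixture is built as the law of a biased coin followed by sampling from
  \<open>M\<close> or \<open>N\<close>, so that \<open>\<bind>\<close> provides the measure and its
  nonnegative integrals.\<close>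

lemma circle_mixture:
  assumes M: "circle_prob M" "circle_prob N" and t: "0 \<le> t" "t \<le> 1"
  obtains K where "circle_prob K"
    "\<And>A. A \<in> sets circle_borel \<Longrightarrow> measure K A = t * measure M A + (1 - t) * measure N A"
    "\<And>n. (\<integral>z. z powi n \<partial>K) = of_real t * (\<integral>z. z powi n \<partial>M) + of_real (1 - t) * (\<integral>z. z powi n \<partial>N)"
proof -
  let ?f = "\<lambda>b::bool. if b then M else N"
  have MN: "M \<in> space (prob_algebra circle_borel)" "N \<in> space (prob_algebra circle_borel)"
    using M by (auto simp: space_prob_algebra circle_prob_def)
  then have f: "?f \<in> measurable (measure_pmf (bernoulli_pmf t)) (prob_algebra circle_borel)" by auto
  then have f': "?f \<in> measurable (measure_pmf (bernoulli_pmf t)) (subprob_algebra circle_borel)"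
    by (rule measurable_prob_algebraD)
  define K where "K = measure_pmf (bernoulli_pmf t) \<bind> ?f"
  interpret PM: prob_space M using M(1) by (rule circle_probD)
  interpret PN: prob_space N using M(2) by (rule circle_probD)
  have K: "circle_prob K"
    unfolding circle_prob_def K_def
    using f f' by (auto simp: measure_pmf.prob_space_axioms intro!: sets_bind[of _ _ circle_borel]
        prob_space_bind'[of _ "measure_pmf (bernoulli_pmf t)" _ circle_borel] simp: space_prob_algebra)
  interpret PK: prob_space K using K by (rule circle_probD)
  have 1: "measure K A = t * measure M A + (1 - t) * measure N A" if A: "A \<in> sets circle_borel" for A
  proof -
    have "emeasure K A = (\<integral>\<^sup>+b. emeasure (?f b) A \<partial>measure_pmf (bernoulli_pmf t))"
      unfolding K_def using f' A by (intro emeasure_bind) auto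
    also have "\<dots> = ennreal (t * measure M A + (1 - t) * measure N A)"
      using t by (simp add: PM.emeasure_eq_measure PN.emeasure_eq_measure ennreal_plus ennreal_mult'' mult.commute)
    finally have "ennreal (measure K A) = ennreal (t * measure M A + (1 - t) * measure N A)"
      by (simp only: PK.emeasure_eq_measure)
    then show ?thesis using t by (subst (asm) ennreal_inj) auto
  qed
  have real: "(\<integral>z. g z \<partial>K) = t * (\<integral>z. g z \<partial>M) + (1 - t) * (\<integral>z. g z \<partial>N)"
    if g: "continuous_on circle g" "\<And>z. z \<in> circle \<Longrightarrow> g z \<ge> 0" for g :: "complex \<Rightarrow> real"
  proof -
    have nn: "(\<integral>\<^sup>+z. g z \<partial>L) = ennreal (\<integral>z. g z \<partial>L)" "(\<integral>z. g z \<partial>L) \<ge> 0" if L: "circle_prob L" for L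
      using circle_integrable[OF L g(1)] g(2) circle_probD[OF L]
      by (auto intro!: nn_integral_eq_integral integral_nonneg_AE)
    have "(\<lambda>z. ennreal (g z)) \<in> borel_measurable circle_borel"
      using circle_continuous_measurable[of circle_borel g] g by auto
    then have "(\<integral>\<^sup>+z. g z \<partial>K) = (\<integral>\<^sup>+b. \<integral>\<^sup>+z. g z \<partial>?f b \<partial>measure_pmf (bernoulli_pmf t))"
      unfolding K_def using f' by (intro nn_integral_bind) auto
    also have "\<dots> = ennreal (t * (\<integral>z. g z \<partial>M) + (1 - t) * (\<integral>z. g z \<partial>N))"
      using t nn M by (simp add: ennreal_plus ennreal_mult'' mult.commute)
    finally have "ennreal (\<integral>z. g z \<partial>K) = ennreal (t * (\<integral>z. g z \<partial>M) + (1 - t) * (\<integral>z. g z \<partial>N))"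
      by (simp only: nn(1)[OF K])
    then show ?thesis using t nn(2) K M by (subst (asm) ennreal_inj) auto
  qed
  have 2: "(\<integral>z. z powi n \<partial>K) = of_real t * (\<integral>z. z powi n \<partial>M) + of_real (1 - t) * (\<integral>z. z powi n \<partial>N)" for n
  proof -
    have part: "(\<integral>z. h (z powi n) \<partial>K) = t * (\<integral>z. h (z powi n) \<partial>M) + (1 - t) * (\<integral>z. h (z powi n) \<partial>N)"
      if h: "bounded_linear h" "\<And>w. \<bar>h w\<bar> \<le> cmod w" for h :: "complex \<Rightarrow> real"
    proof -
      have c: "continuous_on circle (\<lambda>z. h (z powi n))"
        using circle_powi_continuous by (rule bounded_linear.continuous_on[OF h(1)])
      \<comment> \<open>Real and imaginary parts of a character are at least -1 on the circle;
        adding 1 makes the formula for nonnegative functions applicable.\<close>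
      have "0 \<le> h (z powi n) + 1" if "z \<in> circle" for z
        using h(2)[of "z powi n"] cmod_powi_circle[OF that, of n] by linarith
      then have "(\<integral>z. h (z powi n) + 1 \<partial>K) = t * (\<integral>z. h (z powi n) + 1 \<partial>M) + (1 - t) * (\<integral>z. h (z powi n) + 1 \<partial>N)"
        using c by (intro real continuous_intros)
      moreover have "(\<integral>z. h (z powi n) + 1 \<partial>L) = (\<integral>z. h (z powi n) \<partial>L) + 1" if L: "circle_prob L" for L
      proof -
        interpret prob_space L using L by (rule circle_probD)
        show ?thesis using circle_integrable[OF L c] by (simp add: prob_space)
      qed
      ultimately show ?thesis using K M by (simp add: algebra_simps)
    qed
    show ?thesis
      using part[of Re] part[of Im] abs_Re_le_cmod abs_Im_le_cmod circle_powi_integrable K M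
      by (simp add: complex_eq_iff bounded_linear_Re bounded_linear_Im)
  qed
  show thesis using that[OF K 1 2] .
qed

lemma circle_borel_cis: "(\<lambda>t. cis (2 * pi * t)) \<in> measurable borel circle_borel"
  unfolding circle_borel_def
  by (rule measurable_restrict_space2) (auto intro!: borel_measurable_continuous_onI continuous_intros)

lemma circle_prob_lebesgue: "circle_prob circle_lebesgue"
  unfolding circle_lebesgue_def
proof (rule circle_prob_distr)
  show "prob_space (restrict_space lborel {0..1::real})"
    by (rule prob_spaceI) (simp add: emeasure_restrict_space space_restrict_space)
  show "(\<lambda>t. cis (2 * pi * t)) \<in> measurable (restrict_space lborel {0..1}) circle_borel"
    using circle_borel_cis by (intro measurable_restrict_space1) (simp cong: measurable_cong_sets)
qed

lemma circle_lebesgue_integral: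
  fixes g :: "complex \<Rightarrow> 'b::{banach, second_countable_topology}"
  assumes "continuous_on circle g"
  shows "(\<integral>z. g z \<partial>circle_lebesgue) = (\<integral>t. indicator {0..1} t *\<^sub>R g (cis (2 * pi * t)) \<partial>lborel)"
proof -
  have "(\<lambda>t. cis (2 * pi * t)) \<in> measurable (restrict_space lborel {0..1}) circle_borel"
    using circle_borel_cis by (intro measurable_restrict_space1) (simp cong: measurable_cong_sets)
  then have "(\<integral>z. g z \<partial>circle_lebesgue) = (\<integral>t. g (cis (2 * pi * t)) \<partial>restrict_space lborel {0..1})"
    unfolding circle_lebesgue_def using assms by (rule circle_integral_distr)
  then show ?thesis by (simp add: integral_restrict_space)
qed

lemma cis_powi: "cis x powi n = cis (of_int n * x)"
  by (rule cis_power_int)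

lemma circle_lebesgue_fourier:
  "(\<integral>z. z powi n \<partial>circle_lebesgue) = (if n = 0 then 1 else 0)"
proof (cases "n = 0")
  case True
  interpret prob_space circle_lebesgue using circle_prob_lebesgue by (rule circle_probD)
  show ?thesis using True by (simp add: prob_space)
next
  case False
  define F where "F t = cis (of_int n * (2 * pi * t)) / (\<i> * of_real (of_int n * (2 * pi)))" for t
  have "(\<integral>t. indicator {0..1} t *\<^sub>R cis (of_int n * (2 * pi * t)) \<partial>lborel) = F 1 - F 0"
  proof (rule integral_FTC_atLeastAtMost)
    fix t :: real
    have "((\<lambda>t. cis (of_int n * (2 * pi * t))) has_vector_derivative
        (of_int n * (2 * pi)) *\<^sub>R (\<i> * cis (of_int n * (2 * pi * t)))) (at t within {0..1})"
      unfolding has_vector_derivative_def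
      by (rule has_derivative_eq_rhs[OF has_derivative_cis]) (auto intro!: derivative_eq_intros simp: mult_ac)
    from has_vector_derivative_divide[OF this, of "\<i> * of_real (of_int n * (2 * pi))"]
    show "(F has_vector_derivative cis (of_int n * (2 * pi * t))) (at t within {0..1})"
      using False unfolding F_def by (simp add: scaleR_conv_of_real field_simps)
  qed (auto intro!: continuous_intros)
  also have "\<dots> = 0" by (simp add: F_def cis_multiple_2pi mult.commute[of "of_int n"])
  finally show ?thesis
    using False circle_lebesgue_integral[OF circle_powi_continuous] by (simp add: cis_powi)
qed

text \<open>\<open>C N\<close> is the length of the \<open>n\<close>-th diagonal of an
  \<open>N\<close> by \<open>N\<close> matrix; divided by \<open>N\<close> it is the Fejer weight of
  frequency \<open>n\<close>.\<close>

lemma card_diagonal_bounds: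
  fixes n :: int
  defines "C \<equiv> \<lambda>N. card {j \<in> {..<N}. 0 \<le> int j + n \<and> int j + n < int N}"
  shows "C N \<le> N" and "real N - \<bar>real_of_int n\<bar> \<le> real (C N)"
proof -
  show "C N \<le> N" unfolding C_def using card_mono[of "{..<N}" "{j \<in> {..<N}. 0 \<le> int j + n \<and> int j + n < int N}"] by auto
  let ?D = "{j \<in> {..<N}. \<not> (0 \<le> int j + n \<and> int j + n < int N)}"
  have "card ?D \<le> nat \<bar>n\<bar>"
  proof (cases "n \<ge> 0")
    case True
    then have "?D \<subseteq> {N - nat n..<N}" by auto
    then have "card ?D \<le> card {N - nat n..<N}" by (intro card_mono) auto
    then show ?thesis using True by simp
  next
    case False
    then have "?D \<subseteq> {..<nat (- n)}" by auto
    then have "card ?D \<le> card {..<nat (- n)}" by (intro card_mono) auto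
    then show ?thesis using False by simp
  qed
  moreover have "N = C N + card ?D"
  proof -
    have "card ({j \<in> {..<N}. 0 \<le> int j + n \<and> int j + n < int N} \<union> ?D) = C N + card ?D"
      unfolding C_def by (rule card_Un_disjoint) auto
    moreover have "{j \<in> {..<N}. 0 \<le> int j + n \<and> int j + n < int N} \<union> ?D = {..<N}" by auto
    ultimately show ?thesis by (simp only: card_lessThan)
  qed
  ultimately show "real N - \<bar>real_of_int n\<bar> \<le> real (C N)" by linarith
qed

text \<open>The measures with Fejer-kernel densities are tight; a weak limit has the prescribed coefficients.\<close>

lemma Herglotz:
  fixes c :: "int \<Rightarrow> complex"
  assumes c0: "c 0 = 1"
    and pos: "\<And>z N. z \<in> circle \<Longrightarrow>
      (\<Sum>j<N. \<Sum>k<N. c (int k - int j) * z powi (int j - int k)) \<in> \<real>\<^sub>\<ge>\<^sub>0"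
  obtains M where "circle_prob M" "\<And>n. (\<integral>z. z powi n \<partial>M) = c n"
proof -
  \<comment> \<open>The Fejer mean of the formal Fourier series of \<open>c\<close>: up to the
    positive factor it is the Toeplitz form in \<open>pos\<close>, hence nonnegative on the
    circle.\<close>
  define S where "S m z = (\<Sum>j<Suc m. \<Sum>k<Suc m. c (int k - int j) * z powi (int j - int k)) / of_nat (Suc m)" for m z
  define f where "f m z = Re (S m z)" for m z
  have Sf: "S m z = of_real (f m z)" and f_nonneg: "0 \<le> f m z" if "z \<in> circle" for m z
    using pos[OF that, of "Suc m"] unfolding S_def f_def complex_nonneg_iff by (auto simp: complex_eq_iff)
  have Sc: "continuous_on circle (S m)" for m
    unfolding S_def by (intro continuous_intros) (auto simp del: of_nat_Suc)
  have fc: "continuous_on circle (f m)" for m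
    unfolding f_def by (intro continuous_intros Sc)
  define C where "C n N = card {j \<in> {..<N}. 0 \<le> int j + n \<and> int j + n < int N}" for n :: int and N :: nat
  have coeff: "(\<integral>z. f m z *\<^sub>R z powi n \<partial>circle_lebesgue) = of_real (real (C n (Suc m)) / real (Suc m)) * c n" for m n
  proof -
    have "(\<integral>z. f m z *\<^sub>R z powi n \<partial>circle_lebesgue) = (\<integral>z. (\<Sum>j<Suc m. \<Sum>k<Suc m.
        c (int k - int j) / of_nat (Suc m) * z powi (int j - int k + n)) \<partial>circle_lebesgue)"
    proof (rule Bochner_Integration.integral_cong[OF refl])
      fix z assume "z \<in> space circle_lebesgue"
      then have z: "z \<in> circle" using circle_probD(3)[OF circle_prob_lebesgue] by simp
      then have "z \<noteq> 0" by auto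
      then show "f m z *\<^sub>R z powi n = (\<Sum>j<Suc m. \<Sum>k<Suc m.
        c (int k - int j) / of_nat (Suc m) * z powi (int j - int k + n))"
        unfolding scaleR_conv_of_real Sf[OF z, symmetric] S_def
        by (simp only: sum_divide_distrib sum_distrib_right power_int_add simp_thms times_divide_eq_left mult.assoc)
    qed
    also have "\<dots> = (\<Sum>j<Suc m. \<Sum>k<Suc m.
        c (int k - int j) / of_nat (Suc m) * (if int j - int k + n = 0 then 1 else 0))"
    proof -
      have int: "integrable circle_lebesgue (\<lambda>z. a * z powi i)" for a i
        using circle_powi_integrable[OF circle_prob_lebesgue] by simp
      show ?thesis
        by (simp only: Bochner_Integration.integral_sum[OF Bochner_Integration.integrable_sum[OF int]]
            Bochner_Integration.integral_sum[OF int] integral_mult_right_zero circle_lebesgue_fourier)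
    qed
    also have "\<dots> = (\<Sum>j<Suc m. c n / of_nat (Suc m) * (if 0 \<le> int j + n \<and> int j + n < int (Suc m) then 1 else 0))"
    proof (rule sum.cong[OF refl])
      fix j
      have "(\<Sum>k<Suc m. c (int k - int j) / of_nat (Suc m) * (if int j - int k + n = 0 then 1 else 0))
          = (\<Sum>k<Suc m. if int k = int j + n then c n / of_nat (Suc m) else 0)"
      proof (rule sum.cong[OF refl])
        fix k
        have "int j - int k + n = 0 \<longleftrightarrow> int k = int j + n" by auto
        moreover have "int k = int j + n \<Longrightarrow> int k - int j = n" by simp
        ultimately show "c (int k - int j) / of_nat (Suc m) * (if int j - int k + n = 0 then 1 else 0)
          = (if int k = int j + n then c n / of_nat (Suc m) else 0)" by simp
      qed
      also have "\<dots> = (if 0 \<le> int j + n \<and> int j + n < int (Suc m) then c n / of_nat (Suc m) else 0)"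
      proof (cases "0 \<le> int j + n")
        case True
        then have "int k = int j + n \<longleftrightarrow> k = nat (int j + n)" for k by auto
        then show ?thesis using True by (simp only: sum.delta[OF finite_lessThan]) auto
      next
        case False
        then have "int k \<noteq> int j + n" for k by auto
        then show ?thesis using False by simp
      qed
      finally show "(\<Sum>k<Suc m. c (int k - int j) / of_nat (Suc m) * (if int j - int k + n = 0 then 1 else 0))
        = c n / of_nat (Suc m) * (if 0 \<le> int j + n \<and> int j + n < int (Suc m) then 1 else 0)" by simp
    qed
    also have "\<dots> = c n / of_nat (Suc m) * of_nat (C n (Suc m))"
      unfolding C_def sum_distrib_left[symmetric]
      by (subst sum.inter_filter[symmetric]) (simp_all del: sum.lessThan_Suc)
    finally show ?thesis by simp
  qed
  \<comment> \<open>The densities are moved to the real line through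
    \<open>t \<mapsto> cis (2 * pi * t)\<close>, because the selection theorem for tight sequences
    lives there.\<close>
  define g where "g m t = indicator {0..1} t * f m (cis (2 * pi * t))" for m t
  have g_nonneg: "0 \<le> g m t" for m t using f_nonneg by (simp add: g_def)
  have fcis: "continuous_on UNIV (\<lambda>t. f m (cis (2 * pi * t)))" for m
    by (rule continuous_on_compose2[OF fc]) (auto intro!: continuous_intros)
  then have [measurable]: "(\<lambda>t. f m (cis (2 * pi * t))) \<in> borel_measurable borel" for m
    by (intro borel_measurable_continuous_onI)
  have g_meas [measurable]: "g m \<in> borel_measurable borel" for m
    unfolding g_def by measurable
  have g_int: "(\<integral>t. g m t *\<^sub>R cis (2 * pi * t) powi n \<partial>lborel) = of_real (real (C n (Suc m)) / real (Suc m)) * c n" for m n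
  proof -
    have "continuous_on circle (\<lambda>z. f m z *\<^sub>R z powi n)"
      by (intro continuous_intros fc) auto
    from circle_lebesgue_integral[OF this] show ?thesis
      by (simp add: coeff g_def)
  qed
  have g_total: "(\<integral>t. g m t \<partial>lborel) = 1" for m
  proof -
    have "{j \<in> {..<Suc m}. 0 \<le> int j + 0 \<and> int j + 0 < int (Suc m)} = {..<Suc m}" by auto
    then have "C 0 (Suc m) = Suc m" unfolding C_def by (simp only: card_lessThan)
    then have "complex_of_real (\<integral>t. g m t \<partial>lborel) = 1"
      using g_int[of m 0] c0 by (simp add: scaleR_conv_of_real)
    then show ?thesis by simp
  qed
  \<comment> \<open>A non-integrable function has integral 0 by convention, which the value 1
    excludes.\<close>
  have g_integrable: "integrable lborel (g m)" for m
    using g_total[of m] not_integrable_integral_eq[of lborel "g m"] by fastforce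
  have g_nn: "(\<integral>\<^sup>+t. g m t \<partial>lborel) = 1" for m
    using nn_integral_eq_integral[OF g_integrable[of m]] g_nonneg g_total[of m] by simp
  define \<mu> where "\<mu> m = density lborel (\<lambda>t. ennreal (g m t))" for m
  have \<mu>_sets [simp]: "sets (\<mu> m) = sets borel" for m by (simp add: \<mu>_def)
  have prob: "prob_space (\<mu> m)" for m
    by (rule prob_spaceI) (simp add: \<mu>_def emeasure_density g_nn)
  then have rd: "real_distribution (\<mu> m)" for m
    by (intro real_distribution.intro real_distribution_axioms.intro) auto
  \<comment> \<open>Tightness asks for left-open intervals; the left end -1 lets the interval
    contain all of \<open>{0..1}\<close>.\<close>
  have mass: "measure (\<mu> m) {- 1<..1} = 1" for m
  proof -
    have "emeasure (\<mu> m) {- 1<..1} = (\<integral>\<^sup>+t. ennreal (g m t) * indicator {- 1<..1} t \<partial>lborel)"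
      by (simp add: \<mu>_def emeasure_density)
    also have "\<dots> = (\<integral>\<^sup>+t. g m t \<partial>lborel)"
      by (intro nn_integral_cong) (auto simp: g_def indicator_def)
    finally show ?thesis by (simp add: g_nn measure_def)
  qed
  have "tight \<mu>"
    unfolding tight_def
  proof (intro conjI allI impI rd)
    fix \<epsilon> :: real assume "\<epsilon> > 0"
    then have "(- 1 :: real) < 1 \<and> (\<forall>m. 1 - \<epsilon> < measure (\<mu> m) {- 1<..1})" using mass by simp
    then show "\<exists>a b. a < b \<and> (\<forall>m. 1 - \<epsilon> < measure (\<mu> m) {a<..b})" by blast
  qed
  from tight_imp_convergent_subsubsequence[OF this strict_mono_id]
  obtain r R where r: "strict_mono r" and R: "real_distribution R" "weak_conv_m (\<mu> \<circ> id \<circ> r) R"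
    by blast
  interpret R: real_distribution R by (rule R(1))
  have cis_meas: "(\<lambda>t. cis (2 * pi * t)) \<in> measurable R circle_borel"
    using circle_borel_cis by (simp cong: measurable_cong_sets)
  define M where "M = distr R circle_borel (\<lambda>t. cis (2 * pi * t))"
  have M: "circle_prob M"
    unfolding M_def using R.prob_space_axioms cis_meas by (rule circle_prob_distr)
  have "(\<integral>z. z powi n \<partial>M) = c n" for n
  proof -
    let ?h = "\<lambda>t. cis (2 * pi * t) powi n"
    have hc: "continuous_on UNIV ?h" by (intro continuous_intros) auto
    have "(\<lambda>i. integral\<^sup>L ((\<mu> \<circ> id \<circ> r) i) ?h) \<longlonglongrightarrow> integral\<^sup>L R ?h"
    proof (rule weak_conv_imp_integral_bdd_continuous_conv[where B = 1])
      show "real_distribution ((\<mu> \<circ> id \<circ> r) i)" for i using rd by simp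
      show "isCont ?h x" for x using hc by (simp add: continuous_on_eq_continuous_at)
      show "norm (?h x) \<le> 1" for x by (simp add: norm_power_int)
    qed (use R in \<open>auto simp: o_def\<close>)
    moreover have "integral\<^sup>L (\<mu> m) ?h = of_real (real (C n (Suc m)) / real (Suc m)) * c n" for m
    proof -
      have "?h \<in> borel_measurable lborel" using hc by (simp add: borel_measurable_continuous_onI)
      then show ?thesis unfolding \<mu>_def using g_nonneg g_int
        by (subst integral_density) auto
    qed
    ultimately have lim1: "(\<lambda>i. of_real (real (C n (Suc (r i))) / real (Suc (r i))) * c n) \<longlonglongrightarrow> integral\<^sup>L R ?h"
      by simp
    have "(\<lambda>m. real (C n (Suc m)) / real (Suc m)) \<longlonglongrightarrow> 1"
    proof (rule tendsto_sandwich)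
      show "\<forall>\<^sub>F m in sequentially. 1 - \<bar>real_of_int n\<bar> / real (Suc m) \<le> real (C n (Suc m)) / real (Suc m)"
      proof (intro always_eventually allI)
        fix m
        have "1 - \<bar>real_of_int n\<bar> / real (Suc m) = (real (Suc m) - \<bar>real_of_int n\<bar>) / real (Suc m)"
          by (simp add: diff_divide_distrib)
        also have "\<dots> \<le> real (C n (Suc m)) / real (Suc m)"
          unfolding C_def using card_diagonal_bounds(2)[of "Suc m" n] by (intro divide_right_mono) auto
        finally show "1 - \<bar>real_of_int n\<bar> / real (Suc m) \<le> real (C n (Suc m)) / real (Suc m)" .
      qed
      show "\<forall>\<^sub>F m in sequentially. real (C n (Suc m)) / real (Suc m) \<le> 1"
        unfolding C_def using card_diagonal_bounds(1)[of "Suc _" n]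
        by (intro always_eventually allI) (simp add: field_simps del: of_nat_Suc)
      show "(\<lambda>m. 1 - \<bar>real_of_int n\<bar> / real (Suc m)) \<longlonglongrightarrow> 1"
        using tendsto_diff[OF tendsto_const LIMSEQ_Suc[OF lim_const_over_n[of "\<bar>real_of_int n\<bar>"]], of 1]
        by simp
    qed auto
    from LIMSEQ_subseq_LIMSEQ[OF this r]
    have "(\<lambda>i. complex_of_real (real (C n (Suc (r i))) / real (Suc (r i))) * c n) \<longlonglongrightarrow> of_real 1 * c n"
      by (intro tendsto_mult tendsto_of_real tendsto_const) (simp add: o_def)
    then have "integral\<^sup>L R ?h = c n" using lim1 LIMSEQ_unique by fastforce
    then show ?thesis
      unfolding M_def using circle_integral_distr[OF cis_meas circle_powi_continuous] by simp
  qed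
  then show thesis using that M by blast
qed

section \<open>Means of powers, roots of unity and conditioning on invariant sets\<close>

definition mean_power :: "nat \<Rightarrow> complex \<Rightarrow> complex" where
  "mean_power n w = (\<Sum>i<n. w ^ i) / of_nat n"

lemma mean_power_le: assumes "w \<in> circle" shows "cmod (mean_power n w) \<le> 1"
proof -
  have "cmod (\<Sum>i<n. w ^ i) \<le> (\<Sum>i<n. 1)"
    using assms by (intro sum_norm_le) (simp add: norm_power)
  then show ?thesis by (cases "n = 0") (auto simp: mean_power_def norm_divide divide_le_eq)
qed

lemma mean_power_tendsto:
  assumes "w \<in> circle" shows "(\<lambda>n. mean_power n w) \<longlonglongrightarrow> of_bool (w = 1)"
proof (cases "w = 1")
  case True
  have "\<forall>\<^sub>F n in sequentially. mean_power n w = 1"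
    using eventually_gt_at_top[of 0] by eventually_elim (simp add: True mean_power_def)
  then show ?thesis using True by (simp add: tendsto_eventually)
next
  case False
  have "(\<lambda>n. mean_power n w) \<longlonglongrightarrow> 0"
  proof (rule tendsto_norm_zero_cancel, rule tendsto_sandwich[OF _ _ tendsto_const])
    show "(\<lambda>n. (2 / cmod (w - 1)) / real n) \<longlonglongrightarrow> 0" by (rule lim_const_over_n)
    show "\<forall>\<^sub>F n in sequentially. norm (mean_power n w) \<le> (2 / cmod (w - 1)) / real n"
    proof (intro always_eventually allI)
      fix n
      have "cmod (w ^ n - 1) \<le> 2"
        using norm_triangle_ineq4[of "w ^ n" 1] assms by (simp add: norm_power)
      then have "cmod (\<Sum>i<n. w ^ i) \<le> 2 / cmod (w - 1)"
        using False by (simp add: geometric_sum norm_divide divide_right_mono)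
      then show "norm (mean_power n w) \<le> (2 / cmod (w - 1)) / real n"
        unfolding mean_power_def norm_divide norm_of_nat by (rule divide_right_mono) simp
    qed
  qed auto
  then show ?thesis using False by simp
qed

lemma circle_distr_invariant:
  "M \<in> invariant_measures p q \<Longrightarrow> distr M circle_borel (\<lambda>z. z ^ p) = M \<and> distr M circle_borel (\<lambda>z. z ^ q) = M"
  by (simp add: invariant_measures_def)

lemma invariant_circle_prob: "M \<in> invariant_measures p q \<Longrightarrow> circle_prob M"
  by (simp add: invariant_measures_iff)

lemma circle_emeasure_preimage:
  assumes M: "circle_prob M" "distr M circle_borel (\<lambda>z. z ^ k) = M" and A: "A \<in> sets circle_borel"
  shows "emeasure M {z \<in> circle. z ^ k \<in> A} = emeasure M A"
proof -
  have "emeasure (distr M circle_borel (\<lambda>z. z ^ k)) A = emeasure M ((\<lambda>z. z ^ k) -` A \<inter> space M)"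
    using circle_power_measurable'[OF M(1)] A by (rule emeasure_distr)
  moreover have "(\<lambda>z. z ^ k) -` A \<inter> space M = {z \<in> circle. z ^ k \<in> A}"
    using circle_probD[OF M(1)] by auto
  ultimately show ?thesis using M(2) by simp
qed

lemma circle_closed_in_sets: "closed F \<Longrightarrow> {z \<in> circle. z \<in> F} \<in> sets circle_borel"
  using circle_borel_set by (auto simp: sets_circle_borel_iff Collect_conj_eq)

definition root_set :: "nat \<Rightarrow> complex set" where
  "root_set d = {z \<in> circle. z ^ d = 1}"

lemma finite_root_set: "d > 0 \<Longrightarrow> finite (root_set d)"
  using finite_roots_unity[of d] by (auto simp: root_set_def intro: finite_subset)

lemma root_set_sets: "root_set d \<in> sets circle_borel"
proof -
  have "closed {z :: complex. z ^ d = 1}" by (intro closed_Collect_eq continuous_intros)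
  from circle_closed_in_sets[OF this] show ?thesis by (simp add: root_set_def)
qed

lemma root_set_mono: "d dvd e \<Longrightarrow> root_set d \<subseteq> root_set e"
  by (auto simp: root_set_def power_mult elim!: dvdE)

lemma root_set_preimage: "{z \<in> circle. z ^ k \<in> root_set d} = root_set (k * d)"
  by (auto simp: root_set_def power_mult norm_power)

lemma measure_root_set_mult:
  assumes M: "circle_prob M" "distr M circle_borel (\<lambda>z. z ^ k) = M"
  shows "measure M (root_set (k * d)) = measure M (root_set d)"
  using circle_emeasure_preimage[OF M root_set_sets[of d], unfolded root_set_preimage]
  by (simp add: measure_def)

lemma measure_root_set_mult_power:
  assumes M: "circle_prob M" "distr M circle_borel (\<lambda>z. z ^ k) = M"
  shows "measure M (root_set (k ^ i * d)) = measure M (root_set d)"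
  using measure_root_set_mult[OF M] by (induction i) (simp_all add: mult.assoc)

text \<open>The preimage of \<open>root_set d\<close> is the larger set
  \<open>root_set (k * d)\<close>, which has the same measure by invariance; the two differ by a
  null set.\<close>

lemma AE_root_set_invariant:
  assumes M: "circle_prob M" "distr M circle_borel (\<lambda>z. z ^ k) = M"
  shows "AE z in M. z ^ k \<in> root_set d \<longleftrightarrow> z \<in> root_set d"
proof -
  interpret prob_space M using M(1) by (rule circle_probD)
  have sets: "root_set e \<in> sets M" for e using root_set_sets circle_probD[OF M(1)] by simp
  have sub: "root_set d \<subseteq> root_set (k * d)" by (rule root_set_mono) simp
  have "measure M (root_set (k * d) - root_set d) = 0"
    using finite_measure_Diff[OF sets sets sub] measure_root_set_mult[OF M] by simp
  then have "AE z in M. z \<notin> root_set (k * d) - root_set d"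
    using sets by (intro AE_not_in) (auto simp: null_sets_def emeasure_eq_measure)
  moreover have "AE z in M. z \<in> circle" using circle_probD(3)[OF M(1)] by (intro AE_I2) simp
  ultimately show ?thesis
  proof eventually_elim
    case (elim z)
    then show ?case using root_set_preimage[of k d] sub by auto
  qed
qed

lemma uniform_measure_circle_prob:
  assumes M: "circle_prob M" and G: "G \<in> sets circle_borel" "measure M G > 0"
  shows "circle_prob (uniform_measure M G)"
proof -
  interpret prob_space M using M by (rule circle_probD)
  have "emeasure M G \<noteq> 0" using G by (simp add: emeasure_eq_measure)
  then show ?thesis
    using circle_probD(1)[OF M] emeasure_finite
    by (auto simp: circle_prob_def intro!: prob_space_uniform_measure)
qed

text \<open>Up to a null set, the preimage of \<open>G \<inter> A\<close> is \<open>G\<close>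
  intersected with the preimage of \<open>A\<close>; that is all conditioning on \<open>G\<close>
  sees.\<close>

lemma uniform_measure_invariant:
  assumes M: "circle_prob M" "distr M circle_borel (\<lambda>z. z ^ k) = M"
    and G: "G \<in> sets circle_borel" "AE z in M. z ^ k \<in> G \<longleftrightarrow> z \<in> G"
  shows "distr (uniform_measure M G) circle_borel (\<lambda>z. z ^ k) = uniform_measure M G"
proof (rule measure_eqI)
  have sM: "sets M = sets circle_borel" using circle_probD(1)[OF M(1)] .
  then show "sets (distr (uniform_measure M G) circle_borel (\<lambda>z. z ^ k)) = sets (uniform_measure M G)" by simp
  fix A assume "A \<in> sets (distr (uniform_measure M G) circle_borel (\<lambda>z. z ^ k))"
  then have A: "A \<in> sets circle_borel" by simp
  have meas: "(\<lambda>z. z ^ k) \<in> measurable M circle_borel" using circle_power_measurable'[OF M(1)] .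
  have GM: "G \<in> sets M" and AM: "A \<in> sets M" unfolding sM by (rule G(1), rule A)
  have meas': "(\<lambda>z. z ^ k) \<in> measurable (uniform_measure M G) circle_borel"
    using meas by (simp only: measurable_cong_sets[OF sets_uniform_measure[of M G] refl])
  have vim: "(\<lambda>z. z ^ k) -` X \<inter> space M = {z \<in> circle. z ^ k \<in> X}" for X
    unfolding circle_probD(3)[OF M(1)] by auto
  have pre: "{z \<in> circle. z ^ k \<in> X} \<in> sets M" if "X \<in> sets circle_borel" for X
    using measurable_sets[OF meas that] unfolding vim .
  have "emeasure (distr (uniform_measure M G) circle_borel (\<lambda>z. z ^ k)) A
      = emeasure (uniform_measure M G) {z \<in> circle. z ^ k \<in> A}"
    using emeasure_distr[OF meas' A] by (simp only: space_uniform_measure vim)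
  also have "\<dots> = emeasure M (G \<inter> {z \<in> circle. z ^ k \<in> A}) / emeasure M G"
    by (rule emeasure_uniform_measure[OF GM pre[OF A]])
  also have "emeasure M (G \<inter> {z \<in> circle. z ^ k \<in> A}) = emeasure M {z \<in> circle. z ^ k \<in> G \<inter> A}"
  proof (rule emeasure_eq_AE)
    have "AE z in M. z \<in> circle" using circle_probD(3)[OF M(1)] by (intro AE_I2) simp
    with G(2) show "AE z in M. z \<in> G \<inter> {z \<in> circle. z ^ k \<in> A} \<longleftrightarrow> z \<in> {z \<in> circle. z ^ k \<in> G \<inter> A}"
      by eventually_elim auto
    show "G \<inter> {z \<in> circle. z ^ k \<in> A} \<in> sets M" by (rule sets.Int[OF GM pre[OF A]])
    show "{z \<in> circle. z ^ k \<in> G \<inter> A} \<in> sets M" by (rule pre[OF sets.Int[OF G(1) A]])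
  qed
  also have "\<dots> = emeasure M (G \<inter> A)"
    by (rule circle_emeasure_preimage[OF M sets.Int[OF G(1) A]])
  also have "\<dots> / emeasure M G = emeasure (uniform_measure M G) A"
    by (rule emeasure_uniform_measure[OF GM AM, symmetric])
  finally show "emeasure (distr (uniform_measure M G) circle_borel (\<lambda>z. z ^ k)) A = emeasure (uniform_measure M G) A" .
qed

lemma invariant_measuresI:
  assumes "circle_prob M" "distr M circle_borel (\<lambda>z. z ^ p) = M" "distr M circle_borel (\<lambda>z. z ^ q) = M"
  shows "M \<in> invariant_measures p q"
  using assms circle_regular by (auto simp: invariant_measures_def circle_prob_def)

text \<open>Otherwise \<open>M\<close> would be a proper convex combination of its conditionings on
  \<open>G\<close> and on the complement of \<open>G\<close>, both invariant, against
  extremality.\<close>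

lemma ergodic_measure_zero_one:
  assumes erg: "ergodic_measure p q M" and G: "G \<in> sets circle_borel"
    and inv: "AE z in M. z ^ p \<in> G \<longleftrightarrow> z \<in> G" "AE z in M. z ^ q \<in> G \<longleftrightarrow> z \<in> G"
  shows "measure M G = 0 \<or> measure M G = 1"
proof (rule ccontr)
  assume neq: "\<not> (measure M G = 0 \<or> measure M G = 1)"
  have Minv: "M \<in> invariant_measures p q" using erg by (simp add: ergodic_measure_def)
  note M = invariant_circle_prob[OF Minv]
  note d = circle_distr_invariant[OF Minv]
  interpret prob_space M using M by (rule circle_probD)
  have t: "0 < measure M G" "measure M G < 1"
    using neq prob_le_1[of G] measure_nonneg[of M G] by linarith+
  let ?H = "circle - G"
  have GM: "G \<in> sets M" using G circle_probD(1)[OF M] by simp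
  have H: "?H \<in> sets circle_borel" using G sets.compl_sets[of G circle_borel] by simp
  have mH: "measure M ?H = 1 - measure M G"
    using prob_compl[OF GM] circle_probD(3)[OF M] by simp
  have inM: "AE z in M. z \<in> circle" using circle_probD(3)[OF M] by (intro AE_I2) simp
  have invH: "AE z in M. z ^ k \<in> ?H \<longleftrightarrow> z \<in> ?H" if "AE z in M. z ^ k \<in> G \<longleftrightarrow> z \<in> G" for k
    using that inM by eventually_elim (auto simp: norm_power)
  have 1: "uniform_measure M G \<in> invariant_measures p q"
    using M d G t inv by (intro invariant_measuresI uniform_measure_circle_prob uniform_measure_invariant) auto
  have 2: "uniform_measure M ?H \<in> invariant_measures p q"
    using M d H t mH inv invH by (intro invariant_measuresI uniform_measure_circle_prob uniform_measure_invariant) auto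
  have "measure M A = measure M G * measure (uniform_measure M G) A
      + (1 - measure M G) * measure (uniform_measure M ?H) A" if A: "A \<in> sets circle_borel" for A
  proof -
    have AM: "A \<in> sets M" and HM: "?H \<in> sets M" using A H circle_probD(1)[OF M] by auto
    have e: "emeasure M G \<noteq> 0" "emeasure M ?H \<noteq> 0" using t mH by (auto simp: emeasure_eq_measure)
    have "A = (G \<inter> A) \<union> (?H \<inter> A)" using A by (auto simp: sets_circle_borel_iff)
    then have "measure M A = measure M (G \<inter> A) + measure M (?H \<inter> A)"
      using GM AM HM by (subst finite_measure_Union[symmetric]) auto
    moreover have "measure (uniform_measure M G) A = measure M (G \<inter> A) / measure M G"
      using e AM by (intro measure_uniform_measure) (auto simp: emeasure_eq_measure)
    moreover have "measure (uniform_measure M ?H) A = measure M (?H \<inter> A) / measure M ?H"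
      using e AM by (intro measure_uniform_measure) (auto simp: emeasure_eq_measure)
    ultimately show ?thesis using t mH by simp
  qed
  then have "uniform_measure M G = M"
    using erg 1 2 t unfolding ergodic_measure_def by blast
  moreover have "measure (uniform_measure M G) G = measure M (G \<inter> G) / measure M G"
    using t GM by (intro measure_uniform_measure) (auto simp: emeasure_eq_measure)
  ultimately show False using t by simp
qed

section \<open>Supports of invariant measures\<close>

lemma circle_openin_sets: "openin (top_of_set circle) U \<Longrightarrow> U \<in> sets circle_borel"
  using circle_borel_set by (auto simp: openin_open sets_circle_borel_iff)

lemma circle_support_subset: "circle_support M \<subseteq> circle"
  by (auto simp: circle_support_def)

lemma circle_support_complement:
  "circle - circle_support M = \<Union>{U. openin (top_of_set circle) U \<and> measure M U = 0}"
proof -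
  have "U \<subseteq> circle" if "openin (top_of_set circle) U" for U :: "complex set"
    using openin_imp_subset that by blast
  then show ?thesis
    unfolding circle_support_def using measure_nonneg[of M] by (auto simp: order_less_le)
qed

lemma closed_circle_support: "closed (circle_support M)"
proof -
  have "openin (top_of_set circle) (circle - circle_support M)"
    unfolding circle_support_complement by auto
  then have "closedin (top_of_set circle) (circle_support M)"
    using circle_support_subset by (simp add: closedin_def)
  then show ?thesis using closedin_closed_trans closed_sphere by blast
qed

lemma circle_support_sets: "circle_support M \<in> sets circle_borel"
proof -
  have "{z \<in> circle. z \<in> circle_support M} = circle_support M"
    using circle_support_subset[of M] by auto
  then show ?thesis using circle_closed_in_sets[OF closed_circle_support, of M] by (simp only:)
qed

text \<open>The complement is a union of relatively open null sets, and by the Lindelof property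
  countably many of them suffice.\<close>

lemma measure_circle_support: assumes M: "circle_prob M" shows "measure M (circle_support M) = 1"
proof -
  interpret prob_space M using M by (rule circle_probD)
  let ?F = "{U. openin (top_of_set circle) U \<and> measure M U = 0}"
  obtain F' where F': "F' \<subseteq> ?F" "countable F'" "\<Union>F' = \<Union>?F"
    using Lindelof_openin[of ?F circle] by blast
  have "(\<Union>U\<in>F'. U) \<in> null_sets M"
    using F' circle_openin_sets circle_probD(1)[OF M]
    by (intro null_sets_UN') (auto simp: null_sets_def emeasure_eq_measure)
  then have "circle - circle_support M \<in> null_sets M"
    using F' by (simp add: circle_support_complement)
  then have "measure M (space M - circle_support M) = 0"
    using circle_probD(3)[OF M] by (auto simp: null_sets_def measure_def)
  then show ?thesis
    using prob_compl[of "circle_support M"] circle_support_sets circle_probD(1)[OF M] by simp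
qed

lemma circle_support_power:
  assumes M: "circle_prob M" "distr M circle_borel (\<lambda>z. z ^ k) = M" and z: "z \<in> circle_support M"
  shows "z ^ k \<in> circle_support M"
  unfolding circle_support_def
proof (intro CollectI conjI allI impI)
  have zc: "z \<in> circle" using z circle_support_subset by blast
  then show "z ^ k \<in> circle" by (simp add: norm_power)
  fix U assume U: "openin (top_of_set circle) U \<and> z ^ k \<in> U"
  have "openin (top_of_set circle) (circle \<inter> (\<lambda>z. z ^ k) -` U)"
    using U by (intro continuous_openin_preimage[where T = circle] continuous_intros) (auto simp: norm_power)
  moreover have "circle \<inter> (\<lambda>z. z ^ k) -` U = {z \<in> circle. z ^ k \<in> U}" by auto
  ultimately have "measure M {z \<in> circle. z ^ k \<in> U} > 0"
    using z U zc by (simp add: circle_support_def)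
  then show "measure M U > 0"
    using circle_emeasure_preimage[OF M circle_openin_sets, of U] U by (simp add: measure_def)
qed

text \<open>The support is mapped into itself by the power map. If it were finite, each of its
  points would have a repeating orbit, hence be a root of unity and a null atom, although the whole
  support has mass 1.\<close>

lemma infinite_circle_support:
  assumes M: "circle_prob M" "distr M circle_borel (\<lambda>z. z ^ k) = M" and k: "k \<ge> 2"
    and null: "\<And>d. d > 0 \<Longrightarrow> measure M (root_set d) = 0"
  shows "infinite (circle_support M)"
proof
  assume fin: "finite (circle_support M)"
  interpret prob_space M using M by (intro circle_probD)
  have sM: "sets M = sets circle_borel" using circle_probD(1)[OF M(1)] .
  have sing: "{z} \<in> sets M" if "z \<in> circle" for z
    using that sM by (auto simp: sets_circle_borel_iff)
  have "measure M {z} = 0" if z: "z \<in> circle_support M" for z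
  proof -
    have zi: "z ^ (k ^ i) \<in> circle_support M" for i
    proof (induction i)
      case (Suc i)
      then show ?case using circle_support_power[OF M Suc] by (simp flip: power_mult add: mult.commute)
    qed (use z in simp)
    have "finite (range (\<lambda>i. z ^ (k ^ i)))"
      by (rule finite_subset[OF _ fin]) (use zi in blast)
    then have "\<not> inj (\<lambda>i. z ^ (k ^ i))"
      using range_inj_infinite by blast
    then obtain a b where "z ^ (k ^ a) = z ^ (k ^ b)" "a \<noteq> b" unfolding inj_def by blast
    then obtain i j where ij: "z ^ (k ^ i) = z ^ (k ^ j)" "i < j"
      using that[of a b] that[of b a] by (cases "a < b") simp_all
    have lt: "k ^ i < k ^ j" using ij k by (intro power_strict_increasing) auto
    have zc: "z \<in> circle" using z circle_support_subset by blast
    then have "z \<noteq> 0" by auto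
    have "z ^ (k ^ j) = z ^ (k ^ i) * z ^ (k ^ j - k ^ i)"
      using lt by (simp flip: power_add)
    then have "z ^ (k ^ j - k ^ i) = 1" using ij \<open>z \<noteq> 0\<close> by simp
    then have "{z} \<subseteq> root_set (k ^ j - k ^ i)" using zc by (simp add: root_set_def)
    moreover have "root_set (k ^ j - k ^ i) \<in> sets M" using root_set_sets sM by simp
    ultimately have "measure M {z} \<le> measure M (root_set (k ^ j - k ^ i))"
      by (intro finite_measure_mono) auto
    then show ?thesis using null[of "k ^ j - k ^ i"] lt measure_nonneg[of M "{z}"] by simp
  qed
  moreover have "measure M (circle_support M) = (\<Sum>z\<in>circle_support M. measure M {z})"
    using fin sing circle_support_subset by (intro finite_measure_eq_sum_singleton) blast+
  ultimately show False using measure_circle_support[OF M(1)] by simp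
qed

text \<open>By the zero-one law positive mass would be full mass, which confines the support to a
  finite set.\<close>

lemma ergodic_root_set_null:
  assumes erg: "ergodic_measure p q M" and inf: "infinite (circle_support M)" and d: "d > 0"
  shows "measure M (root_set d) = 0"
proof (rule ccontr)
  assume neq: "measure M (root_set d) \<noteq> 0"
  have Minv: "M \<in> invariant_measures p q" using erg by (simp add: ergodic_measure_def)
  note M = invariant_circle_prob[OF Minv]
  interpret prob_space M using M by (rule circle_probD)
  note i = circle_distr_invariant[OF Minv]
  have "measure M (root_set d) = 1"
    using ergodic_measure_zero_one[OF erg root_set_sets] AE_root_set_invariant M i neq by blast
  have "circle_support M \<subseteq> root_set d"
  proof
    fix z assume z: "z \<in> circle_support M"
    then have zc: "z \<in> circle" using circle_support_subset by blast
    show "z \<in> root_set d"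
    proof (rule ccontr)
      assume "z \<notin> root_set d"
      then have "openin (top_of_set circle) (circle - root_set d) \<and> z \<in> circle - root_set d"
        using zc finite_imp_closed[OF finite_root_set[OF d]] by (auto simp: openin_open Diff_eq)
      then have "measure M (circle - root_set d) > 0" using z unfolding circle_support_def by blast
      moreover have "measure M (circle - root_set d) = 0"
        using prob_compl[of "root_set d"] root_set_sets circle_probD[OF M] \<open>measure M (root_set d) = 1\<close>
        by simp
      ultimately show False by simp
    qed
  qed
  then show False using inf finite_root_set[OF d] finite_subset by blast
qed

lemma circle_dominated_convergence:
  fixes G :: "nat \<Rightarrow> complex \<Rightarrow> 'b::{banach, second_countable_topology}"
  assumes M: "circle_prob M" and G: "\<And>n. continuous_on circle (G n)"
    and bound: "\<And>n z. z \<in> circle \<Longrightarrow> norm (G n z) \<le> K"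
    and L: "L \<in> borel_measurable M" and lim: "AE z in M. (\<lambda>n. G n z) \<longlonglongrightarrow> L z"
  shows "(\<lambda>n. \<integral>z. G n z \<partial>M) \<longlonglongrightarrow> (\<integral>z. L z \<partial>M)"
proof -
  interpret prob_space M using M by (rule circle_probD)
  show ?thesis
    using circle_continuous_measurable[OF circle_probD(1)[OF M] G] L lim bound circle_probD(3)[OF M]
    by (intro integral_dominated_convergence[where w = "\<lambda>_. K"]) auto
qed

lemma mean_power_root_set:
  assumes "z \<in> circle" shows "(\<lambda>n. mean_power n (z ^ d)) \<longlonglongrightarrow> indicator (root_set d) z"
  using mean_power_tendsto[of "z ^ d"] assms
  by (auto simp: root_set_def indicator_def norm_power of_bool_def)

section \<open>Furstenberg's theorem on closed invariant sets\<close>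

lemma small_log_combination:
  fixes \<alpha> \<beta> :: real
  assumes "\<alpha> > 0" "\<beta> > 0" "\<alpha> / \<beta> \<notin> \<rat>" "\<delta> > 0"
  obtains a b :: nat where "a > 0" "b > 0" "0 < a * \<alpha> - b * \<beta>" "a * \<alpha> - b * \<beta> < \<delta>"
proof -
  \<comment> \<open>Kronecker approximation with target and tolerance both \<open>\<eta>\<close>
    gives a value strictly between 0 and \<open>2 * \<eta>\<close>. After multiplication by
    \<open>\<beta>\<close> it is below \<open>\<delta>\<close> and below \<open>\<alpha>\<close>;
    the latter forces \<open>h > 0\<close>.\<close>
  define \<eta> where "\<eta> = min \<delta> \<alpha> / (2 * \<beta>)"
  have \<eta>: "\<eta> > 0" using assms by (simp add: \<eta>_def)
  obtain h k :: int where k: "k > 0" "\<bar>of_int k * (\<alpha> / \<beta>) - of_int h - \<eta>\<bar> < \<eta>"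
    using sequence_of_fractional_parts_is_dense[OF assms(3) \<eta>, of \<eta>] by metis
  have bounds: "0 < x \<and> x < 2 * \<eta>" if "\<bar>x - \<eta>\<bar> < \<eta>" for x using that by linarith
  have "0 < of_int k * (\<alpha> / \<beta>) - of_int h" "of_int k * (\<alpha> / \<beta>) - of_int h < 2 * \<eta>"
    using bounds[OF k(2)] by (simp_all only:)
  then have "0 < (of_int k * (\<alpha> / \<beta>) - of_int h) * \<beta>" "(of_int k * (\<alpha> / \<beta>) - of_int h) * \<beta> < 2 * \<eta> * \<beta>"
    using assms by simp_all
  moreover have "(of_int k * (\<alpha> / \<beta>) - of_int h) * \<beta> = of_int k * \<alpha> - of_int h * \<beta>"
    using assms by (simp add: left_diff_distrib)
  moreover have "2 * \<eta> * \<beta> = min \<delta> \<alpha>" using assms by (simp add: \<eta>_def)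
  ultimately have d: "0 < of_int k * \<alpha> - of_int h * \<beta>" "of_int k * \<alpha> - of_int h * \<beta> < \<delta>"
      "of_int k * \<alpha> - of_int h * \<beta> < \<alpha>" by auto
  have "\<alpha> \<le> of_int k * \<alpha>" using k(1) assms(1) by simp
  then have "0 < of_int h * \<beta>" using d(3) by linarith
  then have "h > 0" using assms(2) by (simp add: zero_less_mult_iff)
  then show thesis using that[of "nat k" "nat h"] d k(1) by simp
qed

lemma multiplicatively_independent_log_irrational:
  assumes "p \<ge> 2" "q \<ge> 2" "multiplicatively_independent p q"
  shows "ln (real p) / ln (real q) \<notin> \<rat>"
proof
  assume "ln (real p) / ln (real q) \<in> \<rat>"
  then obtain m n where mn: "n \<noteq> 0" "\<bar>ln (real p) / ln (real q)\<bar> = real m / real n"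
    using Rats_abs_nat_div_natE by metis
  have pos: "ln (real p) > 0" "ln (real q) > 0" using assms by simp_all
  then have "real n * ln (real p) = real m * ln (real q)" using mn by (simp add: field_simps)
  then have "ln (real (p ^ n)) = ln (real (q ^ m))" using assms by (simp add: ln_realpow)
  then have "real (p ^ n) = real (q ^ m)" using assms by (subst (asm) ln_inj_iff) auto
  then have eq: "p ^ n = q ^ m" by (simp only: of_nat_eq_iff)
  have "m > 0"
  proof (rule ccontr)
    assume "\<not> m > 0"
    then have "p ^ n = 1" using eq by simp
    then show False using assms mn by simp
  qed
  then show False using assms(3) eq mn unfolding multiplicatively_independent_def by blast
qed

lemma multiplicatively_independent_sym:
  "multiplicatively_independent p q \<Longrightarrow> multiplicatively_independent q p"
  unfolding multiplicatively_independent_def by metis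

lemma multiplicatively_independent_power:
  assumes "multiplicatively_independent p q" "u > 0"
  shows "multiplicatively_independent (p ^ u) (q ^ u)"
  using assms unfolding multiplicatively_independent_def
  by (metis nat_0_less_mult_iff power_mult)

text \<open>Two ratios, \<open>p ^ a / q ^ b\<close> and \<open>q ^ d / p ^ c\<close>, lie between 1
  and \<open>1 + \<epsilon>\<close>. A large element of the semigroup contains \<open>q ^ b\<close>
  or \<open>p ^ c\<close>, so multiplying by one of the ratios stays in the semigroup and exceeds
  the element only slightly.\<close>

lemma semigroup_next:
  fixes p q :: nat and \<epsilon> :: real
  assumes p: "p \<ge> 2" and q: "q \<ge> 2" and ind: "multiplicatively_independent p q" and \<epsilon>: "\<epsilon> > 0"
  obtains K where "K > 0"
    "\<And>y. y \<ge> K \<Longrightarrow> \<exists>n m. y \<le> real (p ^ n * q ^ m) \<and> real (p ^ n * q ^ m) \<le> (1 + \<epsilon>) * y"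
proof -
  have pos: "ln (real p) > 0" "ln (real q) > 0" "ln (1 + \<epsilon>) > 0" using p q \<epsilon> by simp_all
  obtain a b :: nat where ab: "0 < a * ln p - b * ln q" "a * ln p - b * ln q < ln (1 + \<epsilon>)"
    using small_log_combination[OF pos(1,2) multiplicatively_independent_log_irrational[OF p q ind] pos(3)]
    by blast
  obtain d c :: nat where dc: "0 < d * ln q - c * ln p" "d * ln q - c * ln p < ln (1 + \<epsilon>)"
    using small_log_combination[OF pos(2,1) multiplicatively_independent_log_irrational[OF q p
        multiplicatively_independent_sym[OF ind]] pos(3)]
    by blast
  have step: "real (x ^ i * z ^ (n - j)) > real (x ^ 0 * z ^ n) \<and> real (x ^ i * z ^ (n - j)) < (1 + \<epsilon>) * real (z ^ n)"
    if x: "x \<ge> 2" "z \<ge> 2" and l: "0 < i * ln x - j * ln z" "i * ln x - j * ln z < ln (1 + \<epsilon>)" and "n \<ge> j"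
    for x z i j n :: nat
  proof -
    have "ln (real (x ^ i * z ^ (n - j))) = ln (real (z ^ n)) + (i * ln x - j * ln z)"
      using x \<open>n \<ge> j\<close> by (simp add: ln_mult ln_realpow of_nat_diff left_diff_distrib)
    then have "ln (real (z ^ n)) < ln (real (x ^ i * z ^ (n - j)))"
      "ln (real (x ^ i * z ^ (n - j))) < ln (1 + \<epsilon>) + ln (real (z ^ n))" using l by linarith+
    moreover have "ln (1 + \<epsilon>) + ln (real (z ^ n)) = ln ((1 + \<epsilon>) * real (z ^ n))"
      using x \<epsilon> by (subst ln_mult) auto
    ultimately show ?thesis using x \<epsilon> by (simp add: ln_less_cancel_iff)
  qed
  \<comment> \<open>The largest element below \<open>y\<close> is more than \<open>y / p\<close>;
    for \<open>y \<ge> K\<close> it therefore exceeds \<open>p ^ c * q ^ b\<close>, and one of its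
    exponents is large enough.\<close>
  define K where "K = real (p * (p ^ c * q ^ b))"
  have "K > 0" using p q by (simp add: K_def)
  moreover have "\<exists>n m. y \<le> real (p ^ n * q ^ m) \<and> real (p ^ n * q ^ m) \<le> (1 + \<epsilon>) * y" if y: "y \<ge> K" for y
  proof -
    let ?S = "{s. real s \<le> y \<and> (\<exists>n m. s = p ^ n * q ^ m)}"
    have fin: "finite ?S"
      by (rule finite_subset[of _ "{..nat \<lfloor>y\<rfloor>}"]) (use le_nat_floor in blast)+
    have "0 < p * (p ^ c * q ^ b)" using p q by simp
    then have "1 \<le> K" unfolding K_def by linarith
    then have "real (p ^ 0 * q ^ 0) \<le> y" using y by simp
    then have "p ^ 0 * q ^ 0 \<in> ?S" by blast
    then have "?S \<noteq> {}" by blast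
    with fin have "Max ?S \<in> ?S" by (rule Max_in)
    then have "real (Max ?S) \<le> y \<and> (\<exists>n m. Max ?S = p ^ n * q ^ m)" by (rule CollectD)
    then obtain n m where nm: "Max ?S = p ^ n * q ^ m" "real (p ^ n * q ^ m) \<le> y" by metis
    have greater: "y < real (p ^ n' * q ^ m')" if "p ^ n' * q ^ m' > p ^ n * q ^ m" for n' m'
    proof (rule ccontr)
      assume "\<not> ?thesis"
      then have "p ^ n' * q ^ m' \<in> ?S" unfolding not_less by blast
      with fin have "p ^ n' * q ^ m' \<le> Max ?S" by (rule Max_ge)
      then show False using that nm by simp
    qed
    have "y < real (p ^ Suc n * q ^ m)" using p q by (intro greater) simp
    then have "K < real (p * (p ^ n * q ^ m))" using y by (simp add: mult.assoc)
    then have "p ^ c * q ^ b < p ^ n * q ^ m" unfolding K_def using p by (simp only: of_nat_less_iff) simp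
    then have "\<not> (n \<le> c \<and> m \<le> b)"
      using p q mult_le_mono[OF power_increasing[of n c p] power_increasing[of m b q]]
      by (auto simp: not_less[symmetric])
    then consider "m \<ge> b" | "n \<ge> c" by linarith
    then obtain n' m' where "real (p ^ n' * q ^ m') > real (p ^ n * q ^ m)"
        "real (p ^ n' * q ^ m') \<le> (1 + \<epsilon>) * real (p ^ n * q ^ m)"
    proof cases
      case 1
      from step[OF p q ab 1]
      have *: "real (q ^ m) < real (p ^ a * q ^ (m - b))" "real (p ^ a * q ^ (m - b)) \<le> (1 + \<epsilon>) * real (q ^ m)"
        by simp_all
      have "real (p ^ n) * real (q ^ m) < real (p ^ n) * real (p ^ a * q ^ (m - b))"
        "real (p ^ n) * real (p ^ a * q ^ (m - b)) \<le> real (p ^ n) * ((1 + \<epsilon>) * real (q ^ m))"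
        using * p by (intro mult_strict_left_mono mult_left_mono; simp)+
      then show ?thesis using that[of "n + a" "m - b"] by (simp add: power_add mult_ac)
    next
      case 2
      from step[OF q p dc 2]
      have *: "real (p ^ n) < real (q ^ d * p ^ (n - c))" "real (q ^ d * p ^ (n - c)) \<le> (1 + \<epsilon>) * real (p ^ n)"
        by simp_all
      have "real (q ^ m) * real (p ^ n) < real (q ^ m) * real (q ^ d * p ^ (n - c))"
        "real (q ^ m) * real (q ^ d * p ^ (n - c)) \<le> real (q ^ m) * ((1 + \<epsilon>) * real (p ^ n))"
        using * q by (intro mult_strict_left_mono mult_left_mono; simp)+
      then show ?thesis using that[of "n - c" "m + d"] by (simp add: power_add mult_ac)
    qed
    moreover have "(1 + \<epsilon>) * real (p ^ n * q ^ m) \<le> (1 + \<epsilon>) * y"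
      using nm \<epsilon> by (intro mult_left_mono) auto
    ultimately have "real (p ^ n' * q ^ m') \<le> (1 + \<epsilon>) * y" "y < real (p ^ n' * q ^ m')"
      using greater[of n' m'] by (linarith, simp only: of_nat_less_iff)
    then show ?thesis using less_imp_le by blast
  qed
  ultimately show thesis using that by blast
qed

lemma norm_cis_diff_le: "cmod (cis a - cis b) \<le> \<bar>a - b\<bar>"
proof -
  have "cis a - cis b = cis b * (exp (\<i> * of_real (a - b)) - 1)"
    by (simp add: cis_conv_exp right_diff_distrib flip: exp_add)
  then have "cmod (cis a - cis b) = 2 * \<bar>sin ((a - b) / 2)\<bar>"
    by (simp only: norm_mult norm_cis dist_exp_i_1)
  then show ?thesis using abs_sin_x_le_abs_x[of "(a - b) / 2"] by simp
qed

definition power_invariant :: "nat \<Rightarrow> complex set \<Rightarrow> bool" where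
  "power_invariant k X \<longleftrightarrow> (\<forall>z\<in>X. z ^ k \<in> X)"

lemma power_invariant_power: "power_invariant k X \<Longrightarrow> power_invariant (k ^ u) X"
proof (induction u)
  case (Suc u)
  then show ?case by (auto simp: power_invariant_def power_mult)
qed (simp add: power_invariant_def)

lemma power_invariant_mult: "power_invariant k X \<Longrightarrow> power_invariant l X \<Longrightarrow> power_invariant (k * l) X"
  by (auto simp: power_invariant_def power_mult)

lemma circle_eq_cis: assumes "z \<in> circle" shows "z = cis (Arg z)"
proof -
  have "z \<noteq> 0" "sgn z = z" using assms by (auto simp: sgn_div_norm)
  then show ?thesis using cis_Arg[of z] by simp
qed

text \<open>Near \<open>1\<close> the semigroup acts on angles by multiplication, and consecutive elements of the
  semigroup have ratio tending to \<open>1\<close>.\<close>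

lemma invariant_accumulating_at_one:
  assumes p: "p \<ge> 2" "q \<ge> 2" "multiplicatively_independent p q"
    and X: "closed X" "X \<subseteq> circle" "power_invariant p X" "power_invariant q X" and lim: "1 islimpt X"
  shows "X = circle"
proof (rule antisym[OF X(2)], rule subsetI)
  fix w :: complex assume w: "w \<in> circle"
  have "w \<in> closure X"
    unfolding closure_approachable
  proof (intro allI impI)
    fix e :: real assume e: "e > 0"
    \<comment> \<open>The final error is at most \<open>\<epsilon> * \<bar>\<theta>\<bar>\<close>
      with \<open>\<bar>\<theta>\<bar> \<le> 4 * pi\<close>, that is, \<open>e / 2\<close>.\<close>
    define \<epsilon> where "\<epsilon> = e / (8 * pi)"
    have \<epsilon>: "\<epsilon> > 0" using e by (simp add: \<epsilon>_def)
    obtain K where K: "K > 0" "\<And>y. y \<ge> K \<Longrightarrow> \<exists>n m. y \<le> real (p ^ n * q ^ m) \<and> real (p ^ n * q ^ m) \<le> (1 + \<epsilon>) * y"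
      using semigroup_next[OF p \<epsilon>] by blast
    have "isCont Arg 1" by (rule continuous_at_Arg) auto
    then have "\<exists>d>0. \<forall>x. dist x 1 < d \<longrightarrow> dist (Arg x) (Arg 1) < pi / K"
      unfolding continuous_at_eps_delta using K(1) by simp
    then obtain d where d: "d > 0" "\<And>x. dist x 1 < d \<Longrightarrow> \<bar>Arg x\<bar> < pi / K" by (auto simp: dist_real_def)
    obtain x where x: "x \<in> X" "x \<noteq> 1" "dist x 1 < d" using lim d(1) unfolding islimpt_approachable by blast
    define t where "t = Arg x"
    have xt: "x = cis t" using x X(2) circle_eq_cis by (auto simp: t_def)
    have t0: "t \<noteq> 0" using xt x(2) by auto
    have tK: "\<bar>t\<bar> < pi / K" using d(2)[OF x(3)] by (simp add: t_def)
    \<comment> \<open>An argument of \<open>w\<close> with the sign of \<open>t\<close> and of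
      modulus at least \<open>pi\<close>, so that \<open>\<theta> / t\<close> is positive and, as
      \<open>\<bar>t\<bar> < pi / K\<close>, at least \<open>K\<close>.\<close>
    define \<theta> where "\<theta> = (if t > 0 then Arg w + 2 * pi else Arg w - 2 * pi)"
    have w\<theta>: "w = cis \<theta>"
      using circle_eq_cis[OF w] by (auto simp: \<theta>_def simp flip: cis_mult cis_divide)
    have A: "- pi < Arg w" "Arg w \<le> pi" using Arg_bounded by auto
    have \<theta>: "\<theta> / t > 0" "pi \<le> \<bar>\<theta>\<bar>" "\<bar>\<theta>\<bar> \<le> 4 * pi"
      using A t0 pi_gt_zero by (auto simp: \<theta>_def zero_less_divide_iff)
    have "K \<le> \<bar>\<theta>\<bar> / \<bar>t\<bar>"
    proof -
      have "K * \<bar>t\<bar> \<le> pi" using tK K(1) by (simp add: field_simps)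
      then show ?thesis using \<theta>(2) t0 by (simp add: field_simps)
    qed
    then have "K \<le> \<theta> / t" using \<theta>(1) by (simp flip: abs_divide)
    then obtain n m where nm: "\<theta> / t \<le> real (p ^ n * q ^ m)" "real (p ^ n * q ^ m) \<le> (1 + \<epsilon>) * (\<theta> / t)"
      using K(2) by blast
    let ?s = "p ^ n * q ^ m"
    have "(1 + \<epsilon>) * (\<theta> / t) = \<theta> / t + \<epsilon> * (\<theta> / t)" by (simp only: distrib_right mult_1)
    then have "\<bar>real ?s - \<theta> / t\<bar> \<le> \<epsilon> * (\<theta> / t)" using nm by (simp only: abs_of_nonneg diff_ge_0_iff_ge)
    then have "\<bar>real ?s - \<theta> / t\<bar> * \<bar>t\<bar> \<le> \<epsilon> * (\<theta> / t) * \<bar>t\<bar>" by (rule mult_right_mono) simp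
    also have "\<epsilon> * (\<theta> / t) * \<bar>t\<bar> = \<epsilon> * \<bar>\<theta>\<bar>"
      using \<theta>(1) t0 by (simp add: zero_less_divide_iff) (auto simp: abs_if)
    also have "\<bar>real ?s - \<theta> / t\<bar> * \<bar>t\<bar> = \<bar>real ?s * t - \<theta>\<bar>"
      using t0 by (simp add: left_diff_distrib flip: abs_mult)
    also have "\<epsilon> * \<bar>\<theta>\<bar> \<le> \<epsilon> * (4 * pi)" using \<theta>(3) \<epsilon> by simp
    finally have "\<bar>real ?s * t - \<theta>\<bar> \<le> e / 2" by (simp add: \<epsilon>_def)
    then have "dist (x ^ ?s) w < e"
      using norm_cis_diff_le[of "real ?s * t" \<theta>] e unfolding w\<theta> xt Complex.DeMoivre dist_norm by linarith
    moreover have "x ^ ?s \<in> X"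
      using power_invariant_mult[OF power_invariant_power[OF X(3)] power_invariant_power[OF X(4)]] x(1)
      unfolding power_invariant_def by blast
    ultimately show "\<exists>y\<in>X. dist y w < e" by blast
  qed
  then show "w \<in> X" using X(1) by simp
qed

text \<open>Only finitely many points have the same \<open>k\<close>-th power as \<open>z\<close>,
  while infinitely many points of \<open>X\<close> lie near \<open>z\<close>; some nearby point
  therefore has a different power.\<close>

lemma islimpt_power:
  fixes z :: complex
  assumes z: "z islimpt X" and k: "k > 0" and inv: "power_invariant k X"
  shows "z ^ k islimpt X"
  unfolding islimpt_approachable
proof (intro allI impI)
  fix e :: real assume "e > 0"
  have "isCont (\<lambda>x. x ^ k) z" by (intro continuous_intros)
  then obtain d where d: "d > 0" "\<And>x. dist x z < d \<Longrightarrow> dist (x ^ k) (z ^ k) < e"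
    using \<open>e > 0\<close> unfolding continuous_at_eps_delta by blast
  have fin: "finite {x. x ^ k = z ^ k}" using k by (rule finite_nth_roots)
  have "infinite (ball z d \<inter> X)" using z d(1) unfolding islimpt_eq_acc_point by simp
  then have "\<not> ball z d \<inter> X \<subseteq> {x. x ^ k = z ^ k}" using fin finite_subset by blast
  then obtain x where x: "x \<in> ball z d" "x \<in> X" "x ^ k \<noteq> z ^ k" by blast
  then have "dist x z < d" by (simp add: dist_commute)
  with x show "\<exists>x'\<in>X. x' \<noteq> z ^ k \<and> dist x' (z ^ k) < e"
    using d(2)[of x] inv unfolding power_invariant_def by blast
qed

lemma cong_one_power_root_of_unity:
  fixes z :: complex
  assumes "z ^ e = 1" "[k = 1] (mod e)" shows "z ^ k = z"
proof (cases "e = 0")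
  case True
  then show ?thesis using assms by (simp add: cong_def)
next
  case False
  have "z ^ k = z ^ (k mod e)"
  proof -
    have "z ^ k = z ^ (e * (k div e) + k mod e)" by simp
    also have "\<dots> = z ^ (k mod e)" by (simp only: power_add power_mult assms power_one mult_1)
    finally show ?thesis .
  qed
  also have "k mod e = 1 mod e" using assms(2) by (simp add: cong_def)
  also have "z ^ (1 mod e) = z" using assms(1) False by (cases "e = 1") auto
  finally show ?thesis .
qed

text \<open>For such \<open>u\<close> the powers with exponents \<open>p ^ u\<close> and
  \<open>q ^ u\<close> fix every \<open>e\<close>-th root of unity, so rotations by such roots
  commute with these maps.\<close>

lemma exponent_one_mod:
  fixes p q e :: nat
  assumes "coprime p e" "coprime q e" "e > 0"
  obtains u where "u > 0" "[p ^ u = 1] (mod e)" "[q ^ u = 1] (mod e)"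
  using that[of "totient e"] euler_theorem assms by simp

lemma closed_translate:
  fixes X :: "complex set" and w :: complex
  assumes "closed X" "w \<noteq> 0" shows "closed ((\<lambda>x. x * w) ` X)"
proof -
  have "(\<lambda>x. x * w) ` X = (\<lambda>x. x / w) -` X" using assms by (auto simp: image_iff intro!: bexI[of _ "_ / w"])
  moreover have "closed ((\<lambda>x. x / w) -` X)"
    using assms by (intro closed_vimage continuous_intros) auto
  ultimately show ?thesis by simp
qed

text \<open>The orbit of \<open>z\<close> under the power \<open>p * q\<close> is eventually
  periodic, so some image \<open>y\<close> has order prime to \<open>p * q\<close> and is fixed by
  the powers \<open>p ^ u\<close> and \<open>q ^ u\<close>. Rotating \<open>y\<close> to 1 reduces
  the claim to accumulation at 1, for the independent pair \<open>p ^ u\<close>,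
  \<open>q ^ u\<close>.\<close>

lemma invariant_accumulating_at_root_of_unity:
  assumes p: "p \<ge> 2" "q \<ge> 2" "multiplicatively_independent p q"
    and X: "closed X" "X \<subseteq> circle" "power_invariant p X" "power_invariant q X"
    and z: "z islimpt X" "z ^ d = 1" "d > 0"
  shows "X = circle"
proof -
  let ?k = "p * q"
  have k2: "?k \<ge> 2" using p mult_le_mono[of 2 p 1 q] by simp
  have kinv: "power_invariant ?k X" using X power_invariant_mult by blast
  have "range (\<lambda>i. z ^ (?k ^ i)) \<subseteq> {w. w ^ d = 1}"
  proof (rule image_subsetI, rule CollectI)
    fix i
    have "(z ^ (?k ^ i)) ^ d = (z ^ d) ^ (?k ^ i)" by (simp only: power_mult[symmetric] mult.commute)
    then show "(z ^ (?k ^ i)) ^ d = 1" using z(2) by simp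
  qed
  then have "finite (range (\<lambda>i. z ^ (?k ^ i)))"
    using finite_nth_roots[OF z(3)] by (rule finite_subset)
  then have "\<not> inj (\<lambda>i. z ^ (?k ^ i))" using range_inj_infinite by blast
  then obtain a b where "z ^ (?k ^ a) = z ^ (?k ^ b)" "a \<noteq> b" unfolding inj_def by blast
  then obtain i j where ij: "z ^ (?k ^ i) = z ^ (?k ^ j)" "i < j"
    using that[of a b] that[of b a] by (cases "a < b") simp_all
  define y where "y = z ^ (?k ^ i)"
  \<comment> \<open>One less than a positive power of \<open>p * q\<close> is prime to
    \<open>p * q\<close>, and periodicity of \<open>y\<close> says \<open>y ^ e = 1\<close>.\<close>
  define e where "e = ?k ^ (j - i) - 1"
  have "?k ^ 1 \<le> ?k ^ (j - i)" using ij k2 by (intro power_increasing) linarith+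
  then have "2 \<le> ?k ^ (j - i)" using k2 by (simp only: power_one_right)
  then have e: "e > 0" "?k ^ (j - i) = Suc e" unfolding e_def by linarith+
  have ylim: "y islimpt X"
    unfolding y_def using z(1) power_invariant_power[OF kinv] k2 p by (intro islimpt_power) auto
  have yX: "y \<in> X" using ylim X(1) by (simp add: closed_limpt)
  then have yc: "cmod y = 1" "y \<noteq> 0" using X(2) by auto
  have "y ^ (?k ^ (j - i)) = z ^ (?k ^ (i + (j - i)))" unfolding y_def by (simp only: power_add power_mult)
  then have "y ^ Suc e = y" using ij e by (simp add: y_def)
  then have ye: "y ^ e = 1" using yc by simp
  have cop: "coprime ?k e"
  proof (rule coprimeI)
    fix c assume c: "c dvd ?k" "c dvd e"
    then have "c dvd Suc e" using e(2) ij by (metis dvd_power_same dvd_trans dvd_power zero_less_diff)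
    then show "is_unit c" using c(2) by (metis dvd_diff_nat Suc_eq_plus1 diff_add_inverse)
  qed
  then obtain u where u: "u > 0" "[p ^ u = 1] (mod e)" "[q ^ u = 1] (mod e)"
    using exponent_one_mod[of p e q] e(1) by auto
  let ?Y = "(\<lambda>x. x * cnj y) ` X"
  have ycnj: "y * cnj y = 1" using yc complex_norm_square[of y] by simp
  have pinv: "power_invariant (r ^ u) ?Y" if "[r ^ u = 1] (mod e)" "power_invariant r X" for r
  proof -
    have "cnj y ^ (r ^ u) = cnj y"
      using cong_one_power_root_of_unity[OF ye that(1)] by (simp flip: complex_cnj_power)
    then show ?thesis
      using power_invariant_power[OF that(2), of u] unfolding power_invariant_def
      by (auto simp: power_mult_distrib)
  qed
  have "?Y = circle"
  proof (rule invariant_accumulating_at_one[OF _ _ multiplicatively_independent_power[OF p(3) u(1)]])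
    show "p ^ u \<ge> 2" "q ^ u \<ge> 2"
      using p u(1) power_increasing[of 1 u p] power_increasing[of 1 u q] by auto
    show "closed ?Y" using X(1) yc by (intro closed_translate) auto
    show "?Y \<subseteq> circle" using X(2) yc by (auto simp: norm_mult)
    show "power_invariant (p ^ u) ?Y" "power_invariant (q ^ u) ?Y" using pinv u X by auto
    show "1 islimpt ?Y"
      unfolding islimpt_approachable
    proof (intro allI impI)
      fix r :: real assume "r > 0"
      then obtain x where x: "x \<in> X" "x \<noteq> y" "dist x y < r"
        using ylim unfolding islimpt_approachable by blast
      have "dist (x * cnj y) (y * cnj y) = dist x y"
        using yc by (simp add: dist_norm norm_mult flip: left_diff_distrib)
      moreover have "x * cnj y \<noteq> y * cnj y" using x yc by simp
      ultimately show "\<exists>x'\<in>?Y. x' \<noteq> 1 \<and> dist x' 1 < r" using x ycnj by auto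
    qed
  qed
  show "X = circle"
  proof (rule antisym[OF X(2)], rule subsetI)
    fix w :: complex assume "w \<in> circle"
    then have "w * cnj y \<in> ?Y" using \<open>?Y = circle\<close> yc by (simp add: norm_mult)
    then show "w \<in> X" using yc by auto
  qed
qed

lemma infinite_power_orbit:
  fixes z :: complex
  assumes k: "k \<ge> 2" and z: "z \<noteq> 0" "\<And>d. d > 0 \<Longrightarrow> z ^ d \<noteq> 1" and X: "z \<in> X" "power_invariant k X"
  shows "infinite X"
proof -
  have "inj (\<lambda>i. z ^ (k ^ i))"
  proof (rule injI, rule ccontr)
    fix a b assume "z ^ (k ^ a) = z ^ (k ^ b)" "a \<noteq> b"
    then obtain i j where ij: "z ^ (k ^ i) = z ^ (k ^ j)" "i < j"
      using that[of a b] that[of b a] by (cases "a < b") simp_all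
    have lt: "k ^ i < k ^ j" using ij k by (intro power_strict_increasing) auto
    then have "z ^ (k ^ j) = z ^ (k ^ i) * z ^ (k ^ j - k ^ i)" by (simp flip: power_add)
    then have "z ^ (k ^ j - k ^ i) = 1" using ij z(1) by simp
    then show False using z(2)[of "k ^ j - k ^ i"] lt by simp
  qed
  then have "infinite (range (\<lambda>i. z ^ (k ^ i)))" by (rule range_inj_infinite)
  moreover have "range (\<lambda>i. z ^ (k ^ i)) \<subseteq> X"
    using power_invariant_power[OF X(2)] X(1) by (auto simp: power_invariant_def)
  ultimately show ?thesis using finite_subset by blast
qed

text \<open>A nonempty invariant set without roots of unity contains an infinite orbit, so its set
  of quotients accumulates at 1. The quotients form a closed invariant set, hence fill the
  circle.\<close>

lemma difference_set_contains:
  assumes p: "p \<ge> 2" "q \<ge> 2" "multiplicatively_independent p q"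
    and X: "closed X" "X \<subseteq> circle" "power_invariant p X" "power_invariant q X" "X \<noteq> {}"
    and nr: "\<And>z d. z \<in> X \<Longrightarrow> d > 0 \<Longrightarrow> z ^ d \<noteq> 1" and w: "w \<in> circle"
  shows "\<exists>x\<in>X. x * w \<in> X"
proof -
  let ?D = "(\<lambda>(x, y). x * cnj y) ` (X \<times> X)"
  have cX: "compact X" using X(1,2) closed_Int_compact[of X circle] by (simp add: Int_absorb2)
  have "compact ?D"
    using cX by (intro compact_continuous_image compact_Times) (auto simp: case_prod_unfold intro!: continuous_intros)
  moreover have "?D \<subseteq> circle"
  proof -
    have "cmod x = 1" if "x \<in> X" for x using X(2) that by auto
    then show ?thesis by (auto simp: norm_mult)
  qed
  moreover have "power_invariant r ?D" if "power_invariant r X" for r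
    unfolding power_invariant_def
  proof
    fix z assume "z \<in> ?D"
    then obtain x y where "x \<in> X" "y \<in> X" "z = x * cnj y" by auto
    then have "x ^ r \<in> X" "y ^ r \<in> X" "z ^ r = x ^ r * cnj (y ^ r)"
      using that by (auto simp: power_invariant_def power_mult_distrib)
    then show "z ^ r \<in> ?D" by (intro image_eqI[of _ _ "(x ^ r, y ^ r)"]) simp_all
  qed
  moreover have "1 islimpt ?D"
  proof -
    obtain z where z: "z \<in> X" using X by blast
    then have "z \<noteq> 0" using X(2) by auto
    then have "infinite X" using infinite_power_orbit[OF p(1) _ nr[OF z] z X(3)] by blast
    then obtain y where y: "y \<in> X" "y islimpt X"
      using cX unfolding compact_eq_Bolzano_Weierstrass by blast
    then have yc: "cmod y = 1" "y \<noteq> 0" using X(2) by auto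
    have ycnj: "y * cnj y = 1" using yc complex_norm_square[of y] by simp
    show ?thesis
      unfolding islimpt_approachable
    proof (intro allI impI)
      fix r :: real assume "r > 0"
      then obtain x where x: "x \<in> X" "x \<noteq> y" "dist x y < r"
        using y(2) unfolding islimpt_approachable by blast
      have "dist (x * cnj y) (y * cnj y) = dist x y"
        using yc by (simp add: dist_norm norm_mult flip: left_diff_distrib)
      moreover have "x * cnj y \<noteq> y * cnj y" using x yc by simp
      ultimately show "\<exists>x'\<in>?D. x' \<noteq> 1 \<and> dist x' 1 < r"
        using x y ycnj by (intro bexI[of _ "x * cnj y"]) auto
    qed
  qed
  ultimately have "?D = circle"
    using X by (intro invariant_accumulating_at_one[OF p] compact_imp_closed)
  then have "w \<in> ?D" using w by (simp only:)
  then obtain x y where xy: "x \<in> X" "y \<in> X" "w = x * cnj y" by auto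
  then have "y * cnj y = 1" using X(2) complex_norm_square[of y] by auto
  then have "y * w = x" using xy by (simp add: mult.left_commute)
  then show ?thesis using xy by blast
qed

text \<open>If \<open>X\<close> is not the circle, its derived set \<open>L\<close> contains no root
  of unity. Yet for large \<open>t\<close> prime to \<open>p * q\<close> a whole progression
  \<open>x, x \<zeta>, ..., x \<zeta> ^ t\<close> with \<open>\<zeta>\<close> of order
  \<open>t\<close> lies in \<open>L\<close>. Such progressions come close to 1, which is then in
  \<open>L\<close>, a contradiction.\<close>

theorem Furstenberg_closed_invariant:
  assumes p: "p \<ge> 2" "q \<ge> 2" "multiplicatively_independent p q"
    and X: "closed X" "X \<subseteq> circle" "power_invariant p X" "power_invariant q X" "infinite X"
  shows "X = circle"
proof (rule ccontr)
  assume neq: "X \<noteq> circle"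
  define L where "L = {z. z islimpt X}"
  have LX: "L \<subseteq> X" using X(1) by (auto simp: L_def closed_limpt)
  have nr: "z ^ d \<noteq> 1" if "z \<in> L" "d > 0" for z d
    using invariant_accumulating_at_root_of_unity[OF p X(1-4)] neq that by (auto simp: L_def)
  have Lc: "closed L" unfolding L_def by (rule closed_limpts)
  have Linv: "power_invariant p L" "power_invariant q L"
    using islimpt_power X p unfolding power_invariant_def L_def by auto
  have "compact X" using X(1,2) closed_Int_compact[of X circle] by (simp add: Int_absorb2)
  then have Lne: "L \<noteq> {}"
    using X(5) unfolding compact_eq_Bolzano_Weierstrass L_def by blast
  have "1 \<in> closure L"
    unfolding closure_approachable
  proof (intro allI impI)
    fix \<epsilon> :: real assume \<epsilon>: "\<epsilon> > 0"
    let ?k = "p * q"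
    have k2: "?k \<ge> 2" using p mult_le_mono[of 2 p 1 q] by simp
    obtain N :: nat where N: "real N > 2 * pi / \<epsilon>" using reals_Archimedean2 by blast
    \<comment> \<open>Being 1 modulo \<open>p * q\<close>, \<open>t\<close> is prime to it;
      \<open>N\<close> makes \<open>2 * pi / t\<close> less than \<open>\<epsilon>\<close>.\<close>
    define t where "t = ?k * Suc N + 1"
    have t: "t > 0" "real t > 2 * pi / \<epsilon>"
    proof -
      have "1 * N \<le> ?k * Suc N" using k2 by (intro mult_le_mono) linarith+
      then have "N \<le> t" by (simp add: t_def)
      then show "real t > 2 * pi / \<epsilon>" using N by linarith
    qed (simp add: t_def)
    have "coprime ?k t"
    proof (rule coprimeI)
      fix c assume "c dvd ?k" "c dvd t"
      then show "is_unit c" unfolding t_def by (metis dvd_add_right_iff dvd_mult2)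
    qed
    then obtain u where u: "u > 0" "[p ^ u = 1] (mod t)" "[q ^ u = 1] (mod t)"
      using exponent_one_mod[of p t q] t(1) by auto
    have pu: "p ^ u \<ge> 2" "q ^ u \<ge> 2"
      using p u(1) power_increasing[of 1 u p] power_increasing[of 1 u q] by auto
    define \<zeta> where "\<zeta> = cis (2 * pi / t)"
    have \<zeta>t: "\<zeta> ^ t = 1" using t by (simp add: \<zeta>_def Complex.DeMoivre)
    have \<zeta>u: "\<zeta> ^ (p ^ u) = \<zeta>" "\<zeta> ^ (q ^ u) = \<zeta>"
      using cong_one_power_root_of_unity[OF \<zeta>t] u by auto
    have \<zeta>c: "\<zeta> \<in> circle" "\<zeta> \<noteq> 0" by (auto simp: \<zeta>_def)
    \<comment> \<open>Passing from \<open>Y\<close> to the \<open>x\<close> in \<open>Y\<close> with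
      \<open>x * \<zeta>\<close> in \<open>Y\<close> prolongs the progression by one. The smaller
      set stays invariant under the powers \<open>p ^ u\<close> and \<open>q ^ u\<close> because
      they fix \<open>\<zeta>\<close>, and it is nonempty by
      \<open>difference_set_contains\<close>.\<close>
    have "\<exists>Y. Y \<noteq> {} \<and> closed Y \<and> Y \<subseteq> L \<and> power_invariant (p ^ u) Y \<and> power_invariant (q ^ u) Y \<and>
        (\<forall>x\<in>Y. \<forall>j\<le>i. x * \<zeta> ^ j \<in> L)" for i
    proof (induction i)
      case 0
      then show ?case
        using Lne Lc power_invariant_power[OF Linv(1)] power_invariant_power[OF Linv(2)]
        by (intro exI[of _ L]) auto
    next
      case (Suc i)
      then obtain Y where Y: "Y \<noteq> {}" "closed Y" "Y \<subseteq> L" "power_invariant (p ^ u) Y" "power_invariant (q ^ u) Y"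
          and Yj: "\<And>x j. x \<in> Y \<Longrightarrow> j \<le> i \<Longrightarrow> x * \<zeta> ^ j \<in> L" by blast
      have "\<exists>x\<in>Y. x * \<zeta> \<in> Y"
        using Y LX X(2) nr \<zeta>c pu
        by (intro difference_set_contains[OF pu multiplicatively_independent_power[OF p(3) u(1)]]) auto
      then have "{x \<in> Y. x * \<zeta> \<in> Y} \<noteq> {}" by blast
      moreover have "closed {x \<in> Y. x * \<zeta> \<in> Y}"
      proof -
        have "closed ((\<lambda>x. x * \<zeta>) -` Y)" using Y(2) by (intro closed_vimage continuous_intros)
        moreover have "{x \<in> Y. x * \<zeta> \<in> Y} = Y \<inter> (\<lambda>x. x * \<zeta>) -` Y" by auto
        ultimately show ?thesis using Y(2) by (simp add: closed_Int)
      qed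
      moreover have "power_invariant (p ^ u) {x \<in> Y. x * \<zeta> \<in> Y}" "power_invariant (q ^ u) {x \<in> Y. x * \<zeta> \<in> Y}"
        using Y(4,5) \<zeta>u unfolding power_invariant_def by (force simp: power_mult_distrib)+
      moreover have "x * \<zeta> ^ j \<in> L" if "x \<in> Y" "x * \<zeta> \<in> Y" "j \<le> Suc i" for x j
      proof (cases j)
        case 0
        then show ?thesis using that Y(3) by auto
      next
        case (Suc j')
        then show ?thesis using Yj[OF that(2), of j'] that(3) by (simp add: mult.assoc)
      qed
      ultimately show ?case using Y(3) by (intro exI[of _ "{x \<in> Y. x * \<zeta> \<in> Y}"]) auto
    qed
    from this[of t] obtain x where x: "x \<in> L" "\<And>j. j \<le> t \<Longrightarrow> x * \<zeta> ^ j \<in> L"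
      by (metis equals0I subsetD)
    have xc: "x \<in> circle" using x LX X(2) by auto
    define \<theta> where "\<theta> = (if Arg x \<le> 0 then - Arg x else 2 * pi - Arg x)"
    have \<theta>: "0 \<le> \<theta>" "\<theta> \<le> 2 * pi" using Arg_bounded[of x] by (auto simp: \<theta>_def)
    have "Arg x + \<theta> = 0 \<or> Arg x + \<theta> = 2 * pi" by (simp add: \<theta>_def)
    then have "cis (Arg x + \<theta>) = 1" by auto
    then have x\<theta>: "x * cis \<theta> = 1"
      by (subst circle_eq_cis[OF xc]) (simp only: cis_mult)
    \<comment> \<open>The multiple of \<open>2 * pi / t\<close> just below \<open>\<theta>\<close>,
      the angle that rotates \<open>x\<close> to 1.\<close>
    define j where "j = nat \<lfloor>\<theta> * t / (2 * pi)\<rfloor>"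
    have j0: "0 \<le> \<theta> * t / (2 * pi)" using \<theta> by simp
    then have j: "real j \<le> \<theta> * t / (2 * pi)" "\<theta> * t / (2 * pi) < real j + 1"
      unfolding j_def by linarith+
    have "\<theta> * t / (2 * pi) \<le> real t" using \<theta> mult_right_mono[of \<theta> "2 * pi" "real t"] by (simp add: field_simps)
    then have "j \<le> t" using j(1) by linarith
    have "\<bar>real j * (2 * pi / t) - \<theta>\<bar> \<le> 2 * pi / t"
    proof -
      have "real j * (2 * pi / t) \<le> \<theta>" using j(1) t by (simp add: field_simps)
      moreover have "\<theta> \<le> (real j + 1) * (2 * pi / t)" using j(2) t by (simp add: field_simps)
      moreover have "(real j + 1) * (2 * pi / t) = real j * (2 * pi / t) + 2 * pi / t"
        by (simp only: distrib_right mult_1)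
      ultimately show ?thesis by linarith
    qed
    moreover have "2 * pi / t < \<epsilon>" using t \<epsilon> by (simp add: field_simps)
    ultimately have "cmod (\<zeta> ^ j - cis \<theta>) < \<epsilon>"
      using norm_cis_diff_le[of "real j * (2 * pi / t)" \<theta>] unfolding \<zeta>_def Complex.DeMoivre by linarith
    moreover have "dist (x * \<zeta> ^ j) 1 = cmod (\<zeta> ^ j - cis \<theta>)"
      using xc by (simp add: dist_norm norm_mult flip: x\<theta> right_diff_distrib)
    ultimately show "\<exists>y\<in>L. dist y 1 < \<epsilon>"
      using x(2)[OF \<open>j \<le> t\<close>] by (intro bexI[of _ "x * \<zeta> ^ j"]) simp_all
  qed
  then have "1 \<in> L" using Lc by simp
  then show False using nr[of 1 1] by simp
qed

section \<open>Group algebras\<close>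

abbreviation (input) lookup where "lookup \<equiv> Poly_Mapping.lookup"
abbreviation (input) keys where "keys \<equiv> Poly_Mapping.keys"
abbreviation (input) single where "single \<equiv> Poly_Mapping.single"

lemma poly_mapping_sum_single: "f = (\<Sum>g\<in>keys f. single g (lookup f g))"
proof (rule poly_mapping_eqI)
  fix k
  have "lookup (\<Sum>g\<in>keys f. single g (lookup f g)) k = (\<Sum>g\<in>keys f. if g = k then lookup f g else 0)"
    by (simp add: lookup_sum lookup_single when_def)
  then show "lookup f k = lookup (\<Sum>g\<in>keys f. single g (lookup f g)) k"
    by (simp add: in_keys_iff)
qed

lemma poly_mapping_single_induct [case_names zero single add]:
  fixes f :: "'g \<Rightarrow>\<^sub>0 'c::comm_monoid_add"
  assumes "P 0" "\<And>g c. g \<in> keys f \<Longrightarrow> P (single g c)" "\<And>a b. P a \<Longrightarrow> P b \<Longrightarrow> P (a + b)"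
  shows "P f"
proof -
  have "P (\<Sum>g\<in>A. single g (lookup f g))" if "finite A" "A \<subseteq> keys f" for A
    using that by (induction A rule: finite_induct) (auto intro: assms)
  from this[OF finite_keys subset_refl] show ?thesis by (simp only: poly_mapping_sum_single[symmetric])
qed

text \<open>Groups are written additively, as the convolution product of \<open>Poly_Mapping\<close>
  requires; \<open>group_add\<close> does not imply commutativity.\<close>

lemma lookup_mult_group:
  fixes f h :: "'g::group_add \<Rightarrow>\<^sub>0 'c::semiring_0"
  shows "lookup (f * h) k = (\<Sum>l\<in>keys f. lookup f l * lookup h (- l + k))"
proof -
  have "(\<Sum>q. lookup h q when k = l + q) = lookup h (- l + k)" for l
  proof -
    have "k = l + q \<longleftrightarrow> q = - l + k" for q
      by (metis add_minus_cancel minus_add_cancel)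
    then have "(\<Sum>q. lookup h q when k = l + q) = (\<Sum>q. lookup h q when q = - l + k)"
      by (simp only:)
    also have "\<dots> = lookup h (- l + k)" by (rule Sum_any_when_equal)
    finally show ?thesis .
  qed
  then have "lookup (f * h) k = (\<Sum>l. lookup f l * lookup h (- l + k))" by (simp add: lookup_mult)
  also have "\<dots> = (\<Sum>l\<in>keys f. lookup f l * lookup h (- l + k))"
    by (rule Sum_any.expand_superset) (auto simp: in_keys_iff)
  finally show ?thesis .
qed

lift_definition galg_adj :: "('g::group_add \<Rightarrow>\<^sub>0 complex) \<Rightarrow> 'g \<Rightarrow>\<^sub>0 complex" is "\<lambda>f g. cnj (f (- g))"
proof -
  fix f :: "'g \<Rightarrow> complex" assume "finite {x. f x \<noteq> 0}"
  then have "finite (uminus ` {x. f x \<noteq> 0})" by simp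
  moreover have "{x. cnj (f (- x)) \<noteq> 0} \<subseteq> uminus ` {x. f x \<noteq> 0}"
    by (auto simp: image_iff intro!: exI[of _ "- _"])
  ultimately show "finite {x. cnj (f (- x)) \<noteq> 0}" by (rule finite_subset[rotated])
qed

lemma galg_adj_add: "galg_adj (a + b) = galg_adj a + galg_adj b"
  by transfer simp

lemma galg_adj_zero [simp]: "galg_adj 0 = 0"
  by transfer simp

lemma galg_adj_adj [simp]: "galg_adj (galg_adj a) = a"
  by transfer simp

lemma galg_adj_single [simp]: "galg_adj (single g c) = single (- g) (cnj c)"
  by transfer (auto simp: when_def fun_eq_iff)

lemma keys_galg_adj: "keys (galg_adj a) = uminus ` keys a"
  by transfer (auto simp: image_iff intro!: exI[of _ "- _"])

lemma galg_adj_mult: "galg_adj (a * b) = galg_adj b * galg_adj a"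
proof (induction a rule: poly_mapping_single_induct)
  case (single g c)
  show ?case
  proof (induction b rule: poly_mapping_single_induct)
    case (single h d)
    then show ?case by (simp add: mult_single minus_add mult.commute)
  qed (simp_all add: distrib_left distrib_right galg_adj_add)
qed (simp_all add: distrib_left distrib_right galg_adj_add)

lemma single_zero_central: "a * single 0 c = single 0 c * (a :: 'g::group_add \<Rightarrow>\<^sub>0 complex)"
proof (induction a rule: poly_mapping_single_induct)
  case (single g d)
  then show ?case by (simp add: mult_single mult.commute)
qed (simp_all add: distrib_left distrib_right)

lemma keys_sum_single: "keys (\<Sum>i\<in>I. single (f i) (c i)) \<subseteq> f ` I"
  using keys_sum[of "\<lambda>i. single (f i) (c i)" I] by (fastforce split: if_splits)

text \<open>Subgroups of one ambient type, so that the algebra of the whole group and those of its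
  translations and integer translations lie in a single ring.\<close>

locale subgroup_algebra =
  fixes H :: "'g::group_add set"
  assumes H_zero [simp, intro]: "0 \<in> H"
    and H_add [simp, intro]: "g \<in> H \<Longrightarrow> h \<in> H \<Longrightarrow> g + h \<in> H"
    and H_uminus [simp, intro]: "g \<in> H \<Longrightarrow> - g \<in> H"
begin

definition "HA = {f :: 'g \<Rightarrow>\<^sub>0 complex. keys f \<subseteq> H}"

definition "HU = {single g (1::complex) | g. g \<in> H}"

lemma HA_single [simp, intro]: "g \<in> H \<Longrightarrow> single g c \<in> HA"
  by (simp add: HA_def)

lemma HA_add: "a \<in> HA \<Longrightarrow> b \<in> HA \<Longrightarrow> a + b \<in> HA"
  using keys_add[of a b] unfolding HA_def by blast

lemma HA_mult: "a \<in> HA \<Longrightarrow> b \<in> HA \<Longrightarrow> a * b \<in> HA"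
  using keys_mult[of a b] unfolding HA_def by blast

lemma HA_adj: "a \<in> HA \<Longrightarrow> galg_adj a \<in> HA"
proof -
  assume "a \<in> HA"
  then show ?thesis by (auto simp: HA_def keys_galg_adj)
qed

sublocale star_ring HA "single 0" galg_adj HU
proof
  show "single 0 (c + d) = single 0 c + (single 0 d :: 'g \<Rightarrow>\<^sub>0 complex)" for c d by (rule single_add)
  show "single 0 (c * d) = single 0 c * (single 0 d :: 'g \<Rightarrow>\<^sub>0 complex)" for c d by (simp add: mult_single)
  show "u \<in> HA \<and> galg_adj u * u = 1 \<and> u * galg_adj u = 1" if "u \<in> HU" for u
    using that by (auto simp: HU_def mult_single)
  fix a :: "'g \<Rightarrow>\<^sub>0 complex" assume a: "a \<in> HA"
  let ?u = "\<lambda>g :: 'g. single g (1::complex)"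
  have inj: "inj ?u"
  proof (rule injI)
    fix g h :: 'g assume "?u g = ?u h"
    then have "keys (?u g) = keys (?u h)" by simp
    then show "g = h" by simp
  qed
  have "a = (\<Sum>g\<in>keys a. single 0 (lookup a g) * ?u g)"
    by (simp add: mult_single flip: poly_mapping_sum_single)
  \<comment> \<open>\<open>unitary_span\<close> indexes coefficients by unitaries, so the sum is
    reindexed along the injection \<open>g \<mapsto> single g 1\<close>.\<close>
  also have "\<dots> = (\<Sum>u\<in>?u ` keys a. single 0 (lookup a (the_inv ?u u)) * u)"
    by (subst sum.reindex[OF inj_on_subset[OF inj subset_UNIV]]) (simp only: o_def the_inv_f_f[OF inj])
  finally show "\<exists>F c. finite F \<and> F \<subseteq> HU \<and> a = (\<Sum>u\<in>F. single 0 (c u) * u)"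
    using a by (intro exI[of _ "?u ` keys a"] exI[of _ "\<lambda>u. lookup a (the_inv ?u u)"]) (auto simp: HU_def HA_def)
qed (auto intro: HA_add HA_mult HA_adj simp: galg_adj_add galg_adj_mult single_zero_central)

end

definition lin :: "('g \<Rightarrow> complex) \<Rightarrow> ('g \<Rightarrow>\<^sub>0 complex) \<Rightarrow> complex" where
  "lin \<phi> f = (\<Sum>g\<in>keys f. lookup f g * \<phi> g)"

lemma lin_zero [simp]: "lin \<phi> 0 = 0"
  by (simp add: lin_def)

lemma lin_single [simp]: "lin \<phi> (single g c) = c * \<phi> g"
  by (simp add: lin_def)

lemma lin_add: "lin \<phi> (a + b) = lin \<phi> a + lin \<phi> b"
  unfolding lin_def by (rule setsum_keys_plus_distrib) (simp_all add: distrib_right)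

lemma lin_sum: "lin \<phi> (sum f F) = (\<Sum>i\<in>F. lin \<phi> (f i))"
  by (induction F rule: infinite_finite_induct) (simp_all add: lin_add)

lemma lin_scale: "lin \<phi> (single 0 c * a) = c * lin \<phi> (a :: 'g::group_add \<Rightarrow>\<^sub>0 complex)"
  by (induction a rule: poly_mapping_single_induct) (simp_all add: mult_single distrib_left lin_add)

lemma lin_cong: "(\<And>g. g \<in> keys a \<Longrightarrow> \<phi> g = \<psi> g) \<Longrightarrow> lin \<phi> a = lin \<psi> a"
  unfolding lin_def by (intro sum.cong) auto

context subgroup_algebra
begin

lemma HA_induct [consumes 1, case_names zero single add]:
  assumes "f \<in> HA" "P 0" "\<And>g c. g \<in> H \<Longrightarrow> P (single g c)"
    "\<And>a b. a \<in> HA \<Longrightarrow> b \<in> HA \<Longrightarrow> P a \<Longrightarrow> P b \<Longrightarrow> P (a + b)"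
  shows "P f"
proof -
  have "(\<Sum>g\<in>A. single g (lookup f g)) \<in> HA \<and> P (\<Sum>g\<in>A. single g (lookup f g))"
    if "finite A" "A \<subseteq> keys f" for A
    using that
  proof (induction A rule: finite_induct)
    case (insert g A)
    then have "g \<in> H" using assms(1) by (auto simp: HA_def)
    then show ?case using insert assms(3,4) by simp
  qed (use assms(2) in simp)
  from this[OF finite_keys subset_refl] show ?thesis by (simp only: poly_mapping_sum_single[symmetric])
qed

lemma trace_eq_lin:
  assumes T: "trace_on T" and a: "a \<in> HA" shows "T a = lin (\<lambda>g. T (single g 1)) a"
  using a
proof (induction rule: HA_induct)
  case (single g c)
  then show ?case using trace_scale[OF T, of "single g 1" c] by (simp add: mult_single)
next
  case (add a b)
  then show ?case by (simp add: trace_add[OF T] lin_add)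
qed (simp add: trace_zero[OF T])

lemma lin_commute:
  assumes \<phi>: "\<And>g h. g \<in> H \<Longrightarrow> h \<in> H \<Longrightarrow> \<phi> (g + h) = \<phi> (h + g)" and a: "a \<in> HA" and b: "b \<in> HA"
  shows "lin \<phi> (a * b) = lin \<phi> (b * a)"
  using a
proof (induction rule: HA_induct)
  case (single g c)
  show ?case using b
  proof (induction rule: HA_induct)
    case (single h d)
    then show ?case using \<phi> \<open>g \<in> H\<close> by (simp add: mult_single)
  qed (simp_all add: distrib_left distrib_right lin_add)
qed (simp_all add: distrib_left distrib_right lin_add)

lemma trace_onI:
  assumes "\<phi> 0 = 1" "\<And>g h. g \<in> H \<Longrightarrow> h \<in> H \<Longrightarrow> \<phi> (g + h) = \<phi> (h + g)"
    "\<And>f. f \<in> HA \<Longrightarrow> lin \<phi> (galg_adj f * f) \<in> \<real>\<^sub>\<ge>\<^sub>0"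
  shows "trace_on (lin \<phi>)"
  unfolding trace_on_def
proof (intro conjI ballI allI)
  show "lin \<phi> 1 = 1" using assms(1) lin_single[of \<phi> 0 1] by simp
qed (use assms lin_commute in \<open>auto simp: lin_add lin_scale\<close>)

definition delta_trace :: "('g \<Rightarrow>\<^sub>0 complex) \<Rightarrow> complex" where
  "delta_trace = lin (\<lambda>g. of_bool (g = 0))"

lemma delta_trace_lookup: "delta_trace a = lookup a 0"
proof -
  have "delta_trace a = (\<Sum>g\<in>keys a. if g = 0 then lookup a g else 0)"
    unfolding delta_trace_def lin_def by (intro sum.cong) auto
  then show ?thesis by (simp add: in_keys_iff)
qed

lemma delta_trace_adj_mult: "delta_trace (galg_adj a * a) = (\<Sum>g\<in>keys a. of_real ((cmod (lookup a g))\<^sup>2))"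
proof -
  have "lookup (galg_adj a) (- g) = cnj (lookup a g)" for g by transfer simp
  then show ?thesis
    by (simp add: keys_galg_adj delta_trace_lookup lookup_mult_group sum.reindex complex_norm_square mult.commute
        flip: of_real_power)
qed

lemma trace_on_delta: "trace_on delta_trace"
  unfolding delta_trace_def
proof (rule trace_onI)
  fix g h :: 'g
  have "g + h = 0 \<longleftrightarrow> h + g = 0" by (metis add.inverse_inverse add_eq_0_iff)
  then show "of_bool (g + h = 0) = (of_bool (h + g = 0) :: complex)" by simp
next
  fix f :: "'g \<Rightarrow>\<^sub>0 complex"
  have "delta_trace (galg_adj f * f) \<in> \<real>\<^sub>\<ge>\<^sub>0"
    unfolding delta_trace_adj_mult of_real_sum[symmetric] by (auto simp: complex_nonneg_iff intro!: sum_nonneg)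
  then show "lin (\<lambda>g. of_bool (g = 0)) (galg_adj f * f) \<in> \<real>\<^sub>\<ge>\<^sub>0" by (simp only: delta_trace_def)
qed simp

text \<open>For the canonical trace the square of \<open>tnorm\<close> is the sum of the squared
  absolute coefficients, and every \<open>tnorm\<close> is below \<open>unorm\<close>. Hence the
  group algebra embeds in its completion.\<close>

lemma unorm_pos: assumes "a \<in> HA" "a \<noteq> 0" shows "unorm a > 0"
proof -
  obtain g where g: "g \<in> keys a" using assms by (metis keys_eq_empty equals0I)
  have "(tnorm delta_trace a)\<^sup>2 = (\<Sum>g\<in>keys a. (cmod (lookup a g))\<^sup>2)"
    using assms by (simp add: tnorm_sq[OF trace_on_delta] delta_trace_adj_mult flip: of_real_power)
  also have "\<dots> > 0" using g by (intro sum_pos2[of _ g]) (auto simp: in_keys_iff)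
  finally have "tnorm delta_trace a \<noteq> 0" by auto
  then show ?thesis
    using tnorm_le_unorm[OF trace_on_delta assms(1)] tnorm_nonneg[OF trace_on_delta assms(1)] by linarith
qed

end

locale group_model = subgroup_algebra H + G: group G
  for H :: "'g::group_add set" and G :: "('a, 'm) monoid_scheme" (structure) +
  fixes e :: "'a \<Rightarrow> 'g"
  assumes e_bij: "bij_betw e (carrier G) H"
    and e_mult: "x \<in> carrier G \<Longrightarrow> y \<in> carrier G \<Longrightarrow> e (x \<otimes> y) = e x + e y"
begin

definition gemb :: "('g \<Rightarrow>\<^sub>0 complex) \<Rightarrow> 'a \<Rightarrow> complex" where
  "gemb f x = (if x \<in> carrier G then lookup f (e x) else 0)"

lemma e_H [simp]: "x \<in> carrier G \<Longrightarrow> e x \<in> H"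
  using e_bij by (auto simp: bij_betw_def)

lemma e_inj: "x \<in> carrier G \<Longrightarrow> y \<in> carrier G \<Longrightarrow> e x = e y \<longleftrightarrow> x = y"
  using e_bij by (auto simp: bij_betw_def inj_on_def)

lemma e_one: "e \<one> = 0"
proof -
  have "e \<one> + 0 = e \<one> + e \<one>" using e_mult[of \<one> \<one>] by simp
  then show ?thesis by (metis add_left_imp_eq)
qed

lemma e_inv: assumes "x \<in> carrier G" shows "e (inv x) = - e x"
proof -
  have "e (inv x) + e x = 0" using e_mult[of "inv x" x] assms e_one by simp
  then show ?thesis by (simp add: eq_neg_iff_add_eq_0)
qed

lemma group_algebra_simps:
  "carrier (group_algebra G) = {f. finite {g. f g \<noteq> 0} \<and> {g. f g \<noteq> 0} \<subseteq> carrier G}"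
  "mult (group_algebra G) f h = (\<lambda>g. if g \<in> carrier G
      then \<Sum>x | f x \<noteq> 0. f x * h (inv x \<otimes> g) else 0)"
  "one (group_algebra G) = (\<lambda>g. if g = \<one> then 1 else 0)"
  "zero (group_algebra G) = (\<lambda>g. 0)"
  "add (group_algebra G) f h = (\<lambda>g. f g + h g)"
  "smult (group_algebra G) c f = (\<lambda>g. c * f g)"
  "star (group_algebra G) f = (\<lambda>g. if g \<in> carrier G then cnj (f (inv g)) else 0)"
  by (simp_all add: group_algebra_def)

lemma gemb_support: "{x. gemb f x \<noteq> 0} = {x \<in> carrier G. e x \<in> keys f}"
  by (auto simp: gemb_def in_keys_iff)

lemma finite_gemb_support: "finite {x. gemb f x \<noteq> 0}"
proof -
  have "inj_on e {x. gemb f x \<noteq> 0}"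
    using e_bij unfolding gemb_support bij_betw_def by (auto intro: inj_on_subset)
  moreover have "e ` {x. gemb f x \<noteq> 0} \<subseteq> keys f" by (auto simp: gemb_support)
  ultimately show ?thesis using finite_imageD finite_subset finite_keys by metis
qed

lemma gemb_bij: "bij_betw gemb HA (carrier (group_algebra G))"
proof (rule bij_betwI')
  fix a b assume "a \<in> HA" "b \<in> HA"
  then have ab: "lookup a k = 0 \<and> lookup b k = 0" if "k \<notin> H" for k
    using that by (auto simp: HA_def in_keys_iff)
  show "gemb a = gemb b \<longleftrightarrow> a = b"
  proof
    assume eq: "gemb a = gemb b"
    show "a = b"
    proof (rule poly_mapping_eqI)
      fix k
      show "lookup a k = lookup b k"
      proof (cases "k \<in> H")
        case True
        then obtain x where "x \<in> carrier G" "k = e x" using e_bij by (auto simp: bij_betw_def)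
        then show ?thesis using fun_cong[OF eq, of x] by (simp add: gemb_def)
      qed (use ab in simp)
    qed
  qed simp
next
  fix a assume "a \<in> HA"
  then show "gemb a \<in> carrier (group_algebra G)"
    using finite_gemb_support[of a] by (auto simp: group_algebra_simps gemb_support)
next
  fix F assume "F \<in> carrier (group_algebra G)"
  then have F: "finite {g. F g \<noteq> 0}" "{g. F g \<noteq> 0} \<subseteq> carrier G" by (auto simp: group_algebra_simps)
  define a where "a = (\<Sum>x\<in>{g. F g \<noteq> 0}. single (e x) (F x))"
  have "keys a \<subseteq> e ` {g. F g \<noteq> 0}" unfolding a_def by (rule keys_sum_single)
  then have "a \<in> HA" using F(2) unfolding HA_def by fastforce
  moreover have "F = gemb a"
  proof
    fix x
    show "F x = gemb a x"
    proof (cases "x \<in> carrier G")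
      case True
      have "lookup a (e x) = (\<Sum>y\<in>{g. F g \<noteq> 0}. if y = x then F y else 0)"
        unfolding a_def lookup_sum using True F(2) e_inj
        by (intro sum.cong) (auto simp: lookup_single when_def)
      then show ?thesis using True F(1) by (simp add: gemb_def)
    qed (use F(2) in \<open>auto simp: gemb_def\<close>)
  qed
  ultimately show "\<exists>a\<in>HA. F = gemb a" by blast
qed

lemma gemb_mult:
  assumes "f \<in> HA" "h \<in> HA"
  shows "gemb (f * h) = gemb f \<otimes>\<^bsub>group_algebra G\<^esub> gemb h"
proof
  fix g
  show "gemb (f * h) g = (gemb f \<otimes>\<^bsub>group_algebra G\<^esub> gemb h) g"
  proof (cases "g \<in> carrier G")
    case True
    have img: "e ` {x. gemb f x \<noteq> 0} = keys f"
      using assms(1) e_bij unfolding gemb_support HA_def bij_betw_def by auto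
    have inj: "inj_on e {x. gemb f x \<noteq> 0}"
      using e_bij unfolding gemb_support bij_betw_def by (auto intro: inj_on_subset)
    have "(\<Sum>x | gemb f x \<noteq> 0. gemb f x * gemb h (inv x \<otimes> g))
        = (\<Sum>x | gemb f x \<noteq> 0. lookup f (e x) * lookup h (- e x + e g))"
      using True by (intro sum.cong) (auto simp: gemb_support gemb_def e_mult e_inv)
    also have "\<dots> = (\<Sum>l\<in>keys f. lookup f l * lookup h (- l + e g))"
      unfolding img[symmetric] using inj by (subst sum.reindex) auto
    finally show ?thesis using True by (simp add: group_algebra_simps gemb_def[of "f * h"] lookup_mult_group)
  qed (simp add: group_algebra_simps gemb_def)
qed

sublocale star_ring_model HA "single 0" galg_adj HU "group_algebra G" gemb
proof
  show "bij_betw gemb HA (carrier (group_algebra G))" by (rule gemb_bij)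
  show "gemb (a + b) = gemb a \<oplus>\<^bsub>group_algebra G\<^esub> gemb b" for a b
    by (auto simp: group_algebra_simps gemb_def lookup_add)
  show "gemb (a * b) = gemb a \<otimes>\<^bsub>group_algebra G\<^esub> gemb b" if "a \<in> HA" "b \<in> HA" for a b
    using that by (rule gemb_mult)
  show "gemb (single 0 c * a) = c \<odot>\<^bsub>group_algebra G\<^esub> gemb a" for c a
    by (cases "c = 0") (auto simp: group_algebra_simps gemb_def lookup_mult_group fun_eq_iff)
  show "gemb (galg_adj a) = star (group_algebra G) (gemb a)" for a
  proof -
    have "lookup (galg_adj a) k = cnj (lookup a (- k))" for k by transfer simp
    then show ?thesis by (auto simp: group_algebra_simps gemb_def e_inv)
  qed
  have "e x = 0 \<longleftrightarrow> x = \<one>" if "x \<in> carrier G" for x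
    using that e_inj[of x \<one>] e_one by simp
  then show "gemb 1 = \<one>\<^bsub>group_algebra G\<^esub>"
    by (auto simp: group_algebra_simps gemb_def lookup_one when_def)
  show "gemb 0 = \<zero>\<^bsub>group_algebra G\<^esub>"
    by (auto simp: group_algebra_simps gemb_def)
qed

lemma group_cstar_eq: "group_cstar G = C"
  by (simp add: group_cstar_def)

lemma canonical_unitary_cls: assumes "x \<in> carrier G" shows "canonical_unitary G x = cls (\<lambda>_. single (e x) 1)"
proof -
  have "gemb (single (e x) 1) = (\<lambda>y. if y = x then 1 else 0)"
    using assms e_inj by (auto simp: gemb_def lookup_single when_def)
  then show ?thesis unfolding canonical_unitary_def completion_embed_emb[symmetric] by simp
qed

text \<open>The definite description is justified because a tracial state is determined by its
  values on the canonical unitaries, by linearity and continuity.\<close>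

lemma canonical_trace_eq: "canonical_trace G = extension delta_trace"
  unfolding canonical_trace_def group_cstar_eq
proof (rule the_equality)
  have "extension delta_trace (canonical_unitary G x) = 0" if "x \<in> carrier G - {\<one>}" for x
  proof -
    have "e x \<noteq> 0" using that e_inj[of x \<one>] e_one by auto
    then show ?thesis
      using that restr_extension[OF trace_on_delta, of "single (e x) 1"]
      by (simp add: canonical_unitary_cls restr_def delta_trace_def)
  qed
  then show "extension delta_trace \<in> tracial_states C \<and> (\<forall>x\<in>carrier G - {\<one>}. extension delta_trace (canonical_unitary G x) = 0)"
    using extension_tracial_state[OF trace_on_delta] by blast
next
  fix \<tau> assume \<tau>: "\<tau> \<in> tracial_states C \<and> (\<forall>x\<in>carrier G - {\<one>}. \<tau> (canonical_unitary G x) = 0)"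
  note T = trace_on_restr[of \<tau>]
  have g: "restr \<tau> (single g 1) = of_bool (g = 0)" if gH: "g \<in> H" for g
  proof (cases "g = 0")
    case True
    then show ?thesis using trace_1[OF T] \<tau> by simp
  next
    case False
    obtain x where x: "x \<in> carrier G" "g = e x" using gH e_bij by (auto simp: bij_betw_def)
    then have "x \<noteq> \<one>" using False e_one by auto
    then have "\<tau> (canonical_unitary G x) = 0" using \<tau> x by blast
    then show ?thesis using x False canonical_unitary_cls[of x] by (simp add: restr_def)
  qed
  show "\<tau> = extension delta_trace"
  proof (rule tracial_state_eqI)
    fix a assume a: "a \<in> HA"
    have "restr \<tau> a = delta_trace a"
      unfolding trace_eq_lin[OF T[OF conjunct1[OF \<tau>]] a] delta_trace_def
      by (intro lin_cong g) (use a in \<open>auto simp: HA_def\<close>)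
    then show "restr \<tau> a = restr (extension delta_trace) a"
      using restr_extension[OF trace_on_delta a] by simp
  qed (use \<tau> extension_tracial_state[OF trace_on_delta] in auto)
qed

end

section \<open>The group as a group of affine maps of the rational line\<close>

text \<open>\<open>\<int>[1/pq] \<rtimes> \<int>\<^sup>2\<close> embeds into the orientation-preserving affine group of \<open>\<rat>\<close>, a type that does not
  depend on \<open>p\<close> and \<open>q\<close>.\<close>

typedef affine_map = "{g :: rat \<times> rat. snd g > 0}"
  by (rule exI[of _ "(0, 1)"]) simp

setup_lifting type_definition_affine_map

lift_definition trl :: "affine_map \<Rightarrow> rat" is fst .

lift_definition dil :: "affine_map \<Rightarrow> rat" is snd .

text \<open>The value 1 for \<open>s \<le> 0\<close> makes the function total.\<close>

lift_definition affmap :: "rat \<Rightarrow> rat \<Rightarrow> affine_map" is "\<lambda>x s. (x, if s > 0 then s else 1)"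
  by simp

instantiation affine_map :: group_add
begin

lift_definition zero_affine_map :: affine_map is "(0, 1)" by simp

text \<open>Composition of the maps \<open>y \<mapsto> x + s * y\<close>.\<close>

lift_definition plus_affine_map :: "affine_map \<Rightarrow> affine_map \<Rightarrow> affine_map" is
  "\<lambda>g h. (fst g + snd g * fst h, snd g * snd h)" by simp

lift_definition uminus_affine_map :: "affine_map \<Rightarrow> affine_map" is
  "\<lambda>g. (- fst g / snd g, 1 / snd g)" by simp

definition minus_affine_map :: "affine_map \<Rightarrow> affine_map \<Rightarrow> affine_map" where
  "minus_affine_map g h = g + (- h)"

instance
proof
  fix a b c :: affine_map
  show "a + b + c = a + (b + c)" by transfer (simp add: algebra_simps)
  show "0 + a = a" by transfer simp
  show "a + 0 = a" by transfer simp
  show "- a + a = 0" by transfer (simp add: field_simps)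
  show "a + - b = a - b" by (simp add: minus_affine_map_def)
qed

end

lemma trl_zero [simp]: "trl 0 = 0" and dil_zero [simp]: "dil 0 = 1"
  by (transfer; simp)+

lemma trl_add [simp]: "trl (g + h) = trl g + dil g * trl h" and dil_add [simp]: "dil (g + h) = dil g * dil h"
  by (transfer; simp)+

lemma trl_uminus [simp]: "trl (- g) = - trl g / dil g" and dil_uminus [simp]: "dil (- g) = 1 / dil g"
  by (transfer; simp)+

lemma dil_pos [simp]: "dil g > 0"
  by transfer simp

lemma dil_nonzero [simp]: "dil g \<noteq> 0"
  using dil_pos[of g] by linarith

lemma trl_affine [simp]: "trl (affmap x s) = x" and dil_affine [simp]: "s > 0 \<Longrightarrow> dil (affmap x s) = s"
  by (transfer; simp)+

lemma affine_map_eqI: "trl g = trl h \<Longrightarrow> dil g = dil h \<Longrightarrow> g = h"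
  by transfer (auto simp: prod_eq_iff)

lemma affmap_eta [simp]: "affmap (trl g) (dil g) = g"
  by (rule affine_map_eqI) simp_all

lemma affmap_add: "s > 0 \<Longrightarrow> t > 0 \<Longrightarrow> affmap x s + affmap y t = affmap (x + s * y) (s * t)"
  by (rule affine_map_eqI) simp_all

lemma affmap_uminus: "s > 0 \<Longrightarrow> - affmap x s = affmap (- x / s) (1 / s)"
  by (rule affine_map_eqI) simp_all

lemma affmap_zero: "affmap 0 1 = 0"
  by (rule affine_map_eqI) simp_all

locale independent_pair =
  fixes p q :: nat
  assumes p2: "p \<ge> 2" and q2: "q \<ge> 2" and independent: "multiplicatively_independent p q"
begin

definition pqs :: "int \<Rightarrow> int \<Rightarrow> rat" where
  "pqs n m = of_nat p powi n * of_nat q powi m"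

definition Ss :: "rat set" where
  "Ss = {pqs n m | n m. True}"

definition Ns :: "rat set" where
  "Ns = carrier (Z_inverse (p * q))"

definition H :: "affine_map set" where
  "H = {g. trl g \<in> Ns \<and> dil g \<in> Ss}"

definition PQ :: rat where
  "PQ = of_nat (p * q)"

lemma pq_nonzero [simp]: "p \<noteq> 0" "q \<noteq> 0" "of_nat p \<noteq> (0 :: rat)" "of_nat q \<noteq> (0 :: rat)"
  using p2 q2 by auto

lemma PQ_pos [simp]: "PQ > 0" "PQ \<noteq> 0"
  using p2 q2 by (auto simp: PQ_def)

lemma pqs_pos [simp]: "pqs n m > 0"
  using p2 q2 by (simp add: pqs_def)

lemma pqs_nonzero [simp]: "pqs n m \<noteq> 0"
  using pqs_pos[of n m] by linarith

lemma pqs_mult: "pqs n m * pqs i j = pqs (n + i) (m + j)"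
  by (simp add: pqs_def power_int_add)

lemma pqs_inverse: "1 / pqs n m = pqs (- n) (- m)"
  by (simp add: pqs_def power_int_minus field_simps)

lemma pqs_zero [simp]: "pqs 0 0 = 1"
  by (simp add: pqs_def)

lemma pqs_nat: "pqs (int i) (int j) = of_nat (p ^ i * q ^ j)"
  by (simp add: pqs_def)

text \<open>Multiplicative independence in integer exponents. It makes the pair of exponents
  recoverable from the dilation, without which the affine maps would only form a quotient of the
  semidirect product.\<close>

lemma pqs_eq_one_iff: "pqs n m = 1 \<longleftrightarrow> n = 0 \<and> m = 0"
proof
  assume 1: "pqs n m = 1"
  \<comment> \<open>A positive \<open>n\<close> makes the power of \<open>p\<close> exceed 1, which
    forces \<open>- m > 0\<close>; the equation then has natural exponents and contradicts
    independence.\<close>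
  have pos: False if "pqs n m = 1" "n > 0" for n m
  proof -
    have eq: "of_nat p powi n = (of_nat q powi (- m) :: rat)"
      using that by (simp add: pqs_def power_int_minus field_simps)
    have "(of_nat p :: rat) powi n > 1" using p2 that by (simp add: power_int_def one_less_power)
    have "- m > 0"
    proof (rule ccontr)
      assume "\<not> - m > 0"
      then have "(1 :: rat) \<le> of_nat q powi m" using q2 by (simp add: power_int_def one_le_power)
      then have "(of_nat q :: rat) powi (- m) \<le> 1" by (simp add: power_int_minus field_simps)
      then show False using eq \<open>(of_nat p :: rat) powi n > 1\<close> by simp
    qed
    have "of_nat (p ^ nat n) = (of_nat (q ^ nat (- m)) :: rat)"
      using eq that \<open>- m > 0\<close> by (simp add: power_int_def)
    then have "p ^ nat n = q ^ nat (- m)" by (simp only: of_nat_eq_iff)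
    then show False
      using independent \<open>- m > 0\<close> that unfolding multiplicatively_independent_def
      by (metis zero_less_nat_eq)
  qed
  have "n = 0"
  proof (rule ccontr)
    assume "n \<noteq> 0"
    then consider "n > 0" | "- n > 0" by linarith
    then show False
    proof cases
      case 2
      have "pqs (- n) (- m) = 1" using pqs_inverse[of n m] 1 by simp
      then show False using pos 2 by blast
    qed (use pos 1 in blast)
  qed
  moreover have "m = 0"
  proof (rule ccontr)
    assume "m \<noteq> 0"
    have "(of_nat q :: rat) powi m = 1" using 1 \<open>n = 0\<close> by (simp add: pqs_def)
    then have "(of_nat q :: rat) powi \<bar>m\<bar> = 1" by (auto simp: abs_if power_int_minus)
    moreover have "(of_nat q :: rat) powi \<bar>m\<bar> > 1"
      using q2 \<open>m \<noteq> 0\<close> by (simp add: power_int_def one_less_power)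
    ultimately show False by simp
  qed
  ultimately show "n = 0 \<and> m = 0" by simp
qed simp

lemma pqs_inj: "pqs n m = pqs i j \<longleftrightarrow> n = i \<and> m = j"
proof
  assume "pqs n m = pqs i j"
  then have "pqs n m * pqs (- i) (- j) = 1"
    unfolding pqs_inverse[symmetric] by simp
  then show "n = i \<and> m = j" unfolding pqs_mult pqs_eq_one_iff by simp
qed simp

lemma pqs_Ss [simp, intro]: "pqs n m \<in> Ss"
  unfolding Ss_def by blast

lemma Ss_mult: "s \<in> Ss \<Longrightarrow> t \<in> Ss \<Longrightarrow> s * t \<in> Ss"
  unfolding Ss_def using pqs_mult by blast

lemma Ss_inverse: "s \<in> Ss \<Longrightarrow> 1 / s \<in> Ss"
  unfolding Ss_def using pqs_inverse by blast

lemma Ss_one [simp]: "1 \<in> Ss"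
  unfolding Ss_def using pqs_zero by (metis (mono_tags, lifting) mem_Collect_eq)

lemma Ss_pos [simp]: "s \<in> Ss \<Longrightarrow> s > 0"
  by (auto simp: Ss_def)

lemma Ss_nat: "of_nat (p ^ i * q ^ j) \<in> Ss"
  unfolding pqs_nat[symmetric] Ss_def by blast

lemma PQ_power_Ss: "PQ ^ k \<in> Ss"
  using Ss_nat[of k k] by (simp add: PQ_def power_mult_distrib)

lemma Ss_quotient:
  assumes "s \<in> Ss"
  obtains i j k l where "s * of_nat (p ^ k * q ^ l) = of_nat (p ^ i * q ^ j)"
proof -
  obtain n m where "s = pqs n m" using assms by (auto simp: Ss_def)
  then have "s * of_nat (p ^ nat (- n) * q ^ nat (- m)) = of_nat (p ^ nat n * q ^ nat m)"
    unfolding pqs_nat[symmetric] by (simp only: pqs_mult) (simp add: pqs_inj)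
  then show thesis using that by blast
qed

lemma Ns_iff: "x \<in> Ns \<longleftrightarrow> (\<exists>k. x * PQ ^ k \<in> \<int>)"
proof
  assume "x \<in> Ns"
  then obtain a :: int and k where "x = of_int a / PQ ^ k" by (auto simp: Ns_def Z_inverse_def PQ_def)
  then have "x * PQ ^ k = of_int a" by simp
  then show "\<exists>k. x * PQ ^ k \<in> \<int>" by (metis Ints_of_int)
next
  assume "\<exists>k. x * PQ ^ k \<in> \<int>"
  then obtain k a where "x * PQ ^ k = of_int a" by (auto elim: Ints_cases)
  then have "x = of_int a / of_nat (p * q) ^ k" by (simp add: field_simps PQ_def)
  then show "x \<in> Ns" by (auto simp: Ns_def Z_inverse_def)
qed

lemma PQ_power_int: "PQ ^ k \<in> \<int>"
  by (simp add: PQ_def)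

lemma Ns_scale_up: "x * PQ ^ k \<in> \<int> \<Longrightarrow> k \<le> l \<Longrightarrow> x * PQ ^ l \<in> \<int>"
proof -
  assume "x * PQ ^ k \<in> \<int>" "k \<le> l"
  moreover have "(x * PQ ^ k) * PQ ^ (l - k) = x * PQ ^ l"
    using \<open>k \<le> l\<close> by (simp only: mult.assoc power_add[symmetric]) simp
  ultimately show ?thesis using Ints_mult[OF _ PQ_power_int, of "x * PQ ^ k" "l - k"] by (simp only:)
qed

lemma Ns_add: assumes "x \<in> Ns" "y \<in> Ns" shows "x + y \<in> Ns"
proof -
  obtain k l where "x * PQ ^ k \<in> \<int>" "y * PQ ^ l \<in> \<int>" using assms by (auto simp: Ns_iff)
  then have "x * PQ ^ (max k l) \<in> \<int>" "y * PQ ^ (max k l) \<in> \<int>" using Ns_scale_up by auto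
  then have "(x + y) * PQ ^ (max k l) \<in> \<int>" by (simp add: distrib_right)
  then show ?thesis by (auto simp: Ns_iff)
qed

lemma Ns_uminus: "x \<in> Ns \<Longrightarrow> - x \<in> Ns"
  by (auto simp: Ns_iff)

lemma Ns_of_int [simp]: "of_int n \<in> Ns"
  by (auto simp: Ns_iff intro!: exI[of _ 0])

lemma Ns_of_nat [simp]: "of_nat n \<in> Ns"
  using Ns_of_int[of "int n"] by simp

lemma Ns_zero [simp]: "0 \<in> Ns"
  using Ns_of_int[of 0] by simp

lemma Ns_scale: assumes "s \<in> Ss" "x \<in> Ns" shows "s * x \<in> Ns"
proof -
  obtain i j k l where s: "s * of_nat (p ^ k * q ^ l) = of_nat (p ^ i * q ^ j)"
    using Ss_quotient[OF assms(1)] .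
  obtain r where r: "x * PQ ^ r \<in> \<int>" using assms by (auto simp: Ns_iff)
  have "PQ ^ (k + l) = of_nat (p ^ k * q ^ l) * of_nat (p ^ l * q ^ k)"
    by (simp add: PQ_def power_add power_mult_distrib mult_ac)
  then have "s * x * PQ ^ (k + l + r) = of_nat (p ^ i * q ^ j) * of_nat (p ^ l * q ^ k) * (x * PQ ^ r)"
    unfolding power_add[of PQ "k + l" r] s[symmetric] by (simp add: mult_ac)
  also have "\<dots> \<in> \<int>" by (intro Ints_mult[OF _ r] Ints_mult Ints_of_nat)
  finally show ?thesis by (auto simp: Ns_iff)
qed

text \<open>Integer translations are the characters of the circle; other translations are brought
  into this subgroup by conjugation with a dilation.\<close>

definition Zs :: "affine_map set" where
  "Zs = {g. trl g \<in> \<int> \<and> dil g = 1}"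

definition Ts :: "affine_map set" where
  "Ts = {g. trl g \<in> Ns \<and> dil g = 1}"

sublocale Z: subgroup_algebra Zs
  by standard (auto simp: Zs_def)

sublocale Tr: subgroup_algebra Ts
  by standard (auto simp: Ts_def Ns_add Ns_uminus)

definition coord :: "rat \<times> int \<times> int \<Rightarrow> affine_map" where
  "coord = (\<lambda>(x, n, m). affmap x (pqs n m))"

abbreviation "G \<equiv> pq_group p q"

lemma pq_group_carrier: "carrier G = Ns \<times> UNIV"
  by (auto simp: pq_group_def semidirect_product_def Ns_def DirProd_def)

lemma pq_group_mult: "(x, n, m) \<otimes>\<^bsub>G\<^esub> (y, i, j) = (x + pqs n m * y, n + i, m + j)"
  by (simp add: pq_group_def semidirect_product_def DirProd_def Z_inverse_def pq_action_def pqs_def)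

lemma pq_group_one: "\<one>\<^bsub>G\<^esub> = (0, 0, 0)"
  by (simp add: pq_group_def semidirect_product_def DirProd_def Z_inverse_def)

lemma coord_mult: "coord (a \<otimes>\<^bsub>G\<^esub> b) = coord a + coord b"
  by (cases a, cases b) (simp add: coord_def pq_group_mult affmap_add pqs_mult)

lemma coord_inj: "coord a = coord b \<longleftrightarrow> a = b"
proof
  assume eq: "coord a = coord b"
  obtain x n m y i j where ab: "a = (x, n, m)" "b = (y, i, j)" by (metis prod_cases3)
  have "trl (coord a) = trl (coord b)" "dil (coord a) = dil (coord b)" using eq by simp_all
  then show "a = b" unfolding ab by (simp add: coord_def pqs_inj)
qed simp

lemma coord_image: "coord ` carrier G = H"
proof (intro equalityI subsetI)
  fix g assume "g \<in> coord ` carrier G"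
  then show "g \<in> H" by (auto simp: pq_group_carrier coord_def H_def)
next
  fix g assume "g \<in> H"
  then obtain n m where "trl g \<in> Ns" "dil g = pqs n m" by (auto simp: H_def Ss_def)
  then have "(trl g, n, m) \<in> carrier G" "g = coord (trl g, n, m)"
    by (auto simp: pq_group_carrier coord_def) (metis affmap_eta)
  then show "g \<in> coord ` carrier G" by blast
qed

lemma pq_group_closed: "a \<in> carrier G \<Longrightarrow> b \<in> carrier G \<Longrightarrow> a \<otimes>\<^bsub>G\<^esub> b \<in> carrier G"
proof -
  assume ab: "a \<in> carrier G" "b \<in> carrier G"
  obtain x n m y i j where "a = (x, n, m)" "b = (y, i, j)" by (metis prod_cases3)
  then show ?thesis using ab by (simp add: pq_group_mult pq_group_carrier Ns_add Ns_scale)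
qed

lemma H_subgroup: "0 \<in> H" "g \<in> H \<Longrightarrow> h \<in> H \<Longrightarrow> g + h \<in> H" "g \<in> H \<Longrightarrow> - g \<in> H"
proof -
  show "0 \<in> H" by (simp add: H_def)
  show "g + h \<in> H" if "g \<in> H" "h \<in> H" using that by (simp add: H_def Ns_add Ns_scale Ss_mult)
  show "- g \<in> H" if "g \<in> H"
    using that Ns_scale[of "1 / dil g" "- trl g"] by (simp add: H_def Ss_inverse Ns_uminus)
qed

text \<open>The group laws are pulled back along the injection \<open>coord\<close> into the affine
  group.\<close>

lemma group_pq_group: "group G"
proof (rule groupI)
  show "\<one>\<^bsub>G\<^esub> \<in> carrier G" by (simp add: pq_group_one pq_group_carrier)
  fix a assume a: "a \<in> carrier G"
  have one: "coord \<one>\<^bsub>G\<^esub> = 0" by (simp add: pq_group_one coord_def affmap_zero)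
  show "\<one>\<^bsub>G\<^esub> \<otimes>\<^bsub>G\<^esub> a = a" using coord_mult[of "\<one>\<^bsub>G\<^esub>" a] one coord_inj by simp
  have "- coord a \<in> H" using a coord_image H_subgroup(3) by blast
  then obtain b where "b \<in> carrier G" "coord b = - coord a" using coord_image by (metis imageE)
  then show "\<exists>b\<in>carrier G. b \<otimes>\<^bsub>G\<^esub> a = \<one>\<^bsub>G\<^esub>"
    using coord_mult[of b a] one coord_inj by (metis ab_left_minus left_minus)
  fix b c assume bc: "b \<in> carrier G" "c \<in> carrier G"
  show "a \<otimes>\<^bsub>G\<^esub> b \<in> carrier G" using a bc pq_group_closed by blast
  have "coord (a \<otimes>\<^bsub>G\<^esub> b \<otimes>\<^bsub>G\<^esub> c) = coord (a \<otimes>\<^bsub>G\<^esub> (b \<otimes>\<^bsub>G\<^esub> c))"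
    by (simp add: coord_mult add.assoc)
  then show "a \<otimes>\<^bsub>G\<^esub> b \<otimes>\<^bsub>G\<^esub> c = a \<otimes>\<^bsub>G\<^esub> (b \<otimes>\<^bsub>G\<^esub> c)" using coord_inj by blast
qed

sublocale group_model H G coord
proof (intro group_model.intro group_model_axioms.intro subgroup_algebra.intro group_pq_group)
  show "bij_betw coord (carrier G) H"
    using coord_image coord_inj by (auto simp: bij_betw_def inj_on_def)
qed (use H_subgroup coord_mult in auto)

end

section \<open>Traces and invariant measures\<close>

text \<open>The Fourier transform at \<open>z\<close>: a star homomorphism on the algebra of integer
  translations, where the floor is exact and merely converts the rational \<open>trl g\<close> into
  an exponent.\<close>

definition evc :: "complex \<Rightarrow> (affine_map \<Rightarrow>\<^sub>0 complex) \<Rightarrow> complex" where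
  "evc z = lin (\<lambda>g. z powi \<lfloor>trl g\<rfloor>)"

lemma evc_continuous: "continuous_on circle (\<lambda>z. evc z f)"
  unfolding evc_def lin_def by (intro continuous_intros) auto

lemma evc_single [simp]: "evc z (single g c) = c * z powi \<lfloor>trl g\<rfloor>"
  by (simp add: evc_def)

lemma evc_zero [simp]: "evc z 0 = 0"
  by (simp add: evc_def)

lemma evc_one [simp]: "evc z 1 = 1"
  using evc_single[of z 0 1] by simp

lemma evc_add: "evc z (a + b) = evc z a + evc z b"
  by (simp add: evc_def lin_add)

lemma evc_sum: "evc z (sum f F) = (\<Sum>i\<in>F. evc z (f i))"
  by (simp add: evc_def lin_sum)

context independent_pair
begin

lemma Zs_H: "g \<in> Zs \<Longrightarrow> g \<in> H"
  by (auto simp: Zs_def H_def elim!: Ints_cases)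

lemma Ts_H: "g \<in> Ts \<Longrightarrow> g \<in> H"
  by (auto simp: Ts_def H_def)

lemma ZHA_HA: "a \<in> Z.HA \<Longrightarrow> a \<in> HA" and THA_HA: "a \<in> Tr.HA \<Longrightarrow> a \<in> HA"
    and ZHA_THA: "a \<in> Z.HA \<Longrightarrow> a \<in> Tr.HA"
  unfolding Z.HA_def HA_def Tr.HA_def using Zs_H Ts_H
  by (auto simp: Zs_def Ts_def elim!: Ints_cases)

lemma evc_uminus: "a \<in> Z.HA \<Longrightarrow> evc z (- a) = - evc z a"
  using evc_add[of z a "- a"] by (simp add: eq_neg_iff_add_eq_0 add.commute)

lemma evc_diff: "a \<in> Z.HA \<Longrightarrow> b \<in> Z.HA \<Longrightarrow> evc z (a - b) = evc z a - evc z b"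
  using evc_add[of z a "- b"] evc_uminus[of b z] by simp

lemma evc_mult:
  assumes z: "z \<in> circle" and "a \<in> Z.HA" "b \<in> Z.HA" shows "evc z (a * b) = evc z a * evc z b"
  using assms(2)
proof (induction rule: Z.HA_induct)
  case (single g c)
  show ?case using assms(3)
  proof (induction rule: Z.HA_induct)
    case (single h d)
    have "z \<noteq> 0" using z by auto
    then show ?case using single \<open>g \<in> Zs\<close>
      by (auto simp: mult_single Zs_def power_int_add elim!: Ints_cases)
  qed (simp_all add: distrib_left evc_add)
qed (simp_all add: distrib_right evc_add)

lemma evc_adj: assumes z: "z \<in> circle" and "a \<in> Z.HA" shows "evc z (galg_adj a) = cnj (evc z a)"
  using assms(2)
proof (induction rule: Z.HA_induct)
  case (single g c)
  then show ?case using cnj_powi_circle[OF z] by (auto simp: Zs_def elim!: Ints_cases)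
qed (simp_all add: galg_adj_add evc_add)

lemma evc_power: "z \<in> circle \<Longrightarrow> a \<in> Z.HA \<Longrightarrow> evc z (a ^ n) = evc z a ^ n"
  by (induction n) (simp_all add: evc_mult)

lemma evc_adj_mult: "z \<in> circle \<Longrightarrow> a \<in> Z.HA \<Longrightarrow> evc z (galg_adj a * a) = of_real ((cmod (evc z a))\<^sup>2)"
  by (simp add: evc_mult evc_adj complex_norm_square mult.commute del: of_real_power)

definition tr :: "rat \<Rightarrow> affine_map \<Rightarrow>\<^sub>0 complex" where
  "tr x = single (affmap x 1) 1"

definition dl :: "rat \<Rightarrow> affine_map \<Rightarrow>\<^sub>0 complex" where
  "dl s = single (affmap 0 s) 1"

definition represents :: "((affine_map \<Rightarrow>\<^sub>0 complex) \<Rightarrow> complex) \<Rightarrow> complex measure \<Rightarrow> bool" where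
  "represents T M \<longleftrightarrow> trace_on T \<and> M \<in> invariant_measures p q \<and> (\<forall>n. (\<integral>z. z powi n \<partial>M) = T (tr (of_int n)))"

lemma affmap_H [simp, intro]: "x \<in> Ns \<Longrightarrow> s \<in> Ss \<Longrightarrow> affmap x s \<in> H"
  by (simp add: H_def)

lemma HU_I [intro]: "x \<in> Ns \<Longrightarrow> s \<in> Ss \<Longrightarrow> single (affmap x s) 1 \<in> HU"
  unfolding HU_def by blast

lemma HU_cases:
  assumes "u \<in> HU" obtains x s where "x \<in> Ns" "s \<in> Ss" "u = single (affmap x s) 1"
proof -
  obtain g where g: "g \<in> H" "u = single g 1" using assms unfolding HU_def by blast
  then have "u = single (affmap (trl g) (dil g)) 1" by simp
  then show thesis using that g(1) unfolding H_def by blast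
qed

lemma Ss_nonzero [simp]: "s \<in> Ss \<Longrightarrow> s \<noteq> 0"
  using Ss_pos[of s] by linarith

lemma dl_HU [simp, intro]: "s \<in> Ss \<Longrightarrow> dl s \<in> HU"
  by (auto simp: dl_def)

lemma tr_HU [simp, intro]: "x \<in> Ns \<Longrightarrow> tr x \<in> HU"
  by (auto simp: tr_def)

lemma dl_adj: "s \<in> Ss \<Longrightarrow> galg_adj (dl s) = dl (1 / s)"
  by (simp add: dl_def affmap_uminus)

lemma dl_conj_single: "s \<in> Ss \<Longrightarrow> dl s * single (affmap x t) c * galg_adj (dl s) = single (affmap (s * x) t) c" if "t > 0" for s
  using that by (simp add: dl_def mult_single affmap_uminus affmap_add)

lemma trace_conj: "trace_on T \<Longrightarrow> u \<in> HU \<Longrightarrow> a \<in> HA \<Longrightarrow> T (u * a * galg_adj u) = T a"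
proof -
  assume T: "trace_on T" and u: "u \<in> HU" and a: "a \<in> HA"
  have "T (u * a * galg_adj u) = T (galg_adj u * (u * a))"
    using T u a by (intro trace_commute) auto
  also have "galg_adj u * (u * a) = a" using u by (simp flip: mult.assoc)
  finally show ?thesis .
qed

lemma trace_tr_scale:
  assumes T: "trace_on T" and "s \<in> Ss" "x \<in> Ns" shows "T (tr (s * x)) = T (tr x)"
  using trace_conj[OF T dl_HU[OF assms(2)], of "tr x"] dl_conj_single[of 1 s x 1] assms
  by (simp add: tr_def)

text \<open>Conjugation by the dilations \<open>p\<close> and \<open>q\<close> yields invariance of
  the measure, and positivity of \<open>T\<close> yields the Toeplitz condition of
  \<open>Herglotz\<close>.\<close>

lemma trace_represented:
  assumes T: "trace_on T" shows "\<exists>M. represents T M"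
proof -
  have "T (tr (of_int 0)) = 1" using trace_1[OF T] by (simp add: tr_def affmap_zero)
  moreover have "(\<Sum>j<N. \<Sum>k<N. T (tr (of_int (int k - int j))) * z powi (int j - int k)) \<in> \<real>\<^sub>\<ge>\<^sub>0"
    if z: "z \<in> circle" for z N
  proof -
    \<comment> \<open>Weighting the translation by \<open>k\<close> with
      \<open>z powi (- int k)\<close> makes \<open>T (galg_adj f * f)\<close> the required Toeplitz
      sum.\<close>
    define f where "f = (\<Sum>k<N. single (affmap (of_nat k) 1) (z powi (- int k)))"
    have mem: "single (affmap (of_nat k) 1) c \<in> HA" for k c by (intro HA_single affmap_H) simp_all
    have fH: "f \<in> HA" unfolding f_def using mem by (intro sum_closed)
    have "galg_adj f * f = (\<Sum>j<N. \<Sum>k<N. single 0 (z powi (int j - int k)) * tr (of_int (int k - int j)))"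
    proof -
      have "z \<noteq> 0" using z by auto
      have "cnj z powi n = z powi (- n)" for n using cnj_powi_circle[OF z, of n] by simp
      then have "cnj z powi - int j * z powi - int k = z powi (int j - int k)" for j k
        using \<open>z \<noteq> 0\<close> power_int_add[of z "int j" "- int k"] by simp
      then show ?thesis
        unfolding f_def adj_sum sum_product
        by (intro sum.cong refl) (simp add: mult_single affmap_uminus affmap_add tr_def)
    qed
    then have "T (galg_adj f * f) = (\<Sum>j<N. \<Sum>k<N. z powi (int j - int k) * T (tr (of_int (int k - int j))))"
    proof -
      have tH: "tr (of_int n) \<in> HA" for n using tr_HU by (intro unitaryD(1)) simp
      have "T (\<Sum>j<N. \<Sum>k<N. single 0 (z powi (int j - int k)) * tr (of_int (int k - int j)))
          = (\<Sum>j<N. T (\<Sum>k<N. single 0 (z powi (int j - int k)) * tr (of_int (int k - int j))))"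
        by (intro trace_sum[OF T] sum_closed mult_closed scalar_closed tH)
      also have "\<dots> = (\<Sum>j<N. \<Sum>k<N. T (single 0 (z powi (int j - int k)) * tr (of_int (int k - int j))))"
        by (intro sum.cong refl trace_sum[OF T] mult_closed scalar_closed tH)
      finally show ?thesis by (simp only: \<open>galg_adj f * f = _\<close> trace_scale[OF T tH])
    qed
    then show ?thesis using trace_pos[OF T fH] by (simp add: mult.commute)
  qed
  ultimately obtain M where M: "circle_prob M" "\<And>n. (\<integral>z. z powi n \<partial>M) = T (tr (of_int n))"
    using Herglotz[of "\<lambda>n. T (tr (of_int n))"] by blast
  have "of_nat p \<in> Ss" "of_nat q \<in> Ss" using Ss_nat[of 1 0] Ss_nat[of 0 1] by auto
  then have "M \<in> invariant_measures p q"
    unfolding invariant_measures_iff using M trace_tr_scale[OF T, of _ "of_int _"] by simp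
  then show ?thesis using M T unfolding represents_def by blast
qed

lemma representsD:
  assumes "represents T M"
  shows "trace_on T" "circle_prob M" "M \<in> invariant_measures p q"
    "distr M circle_borel (\<lambda>z. z ^ p) = M" "distr M circle_borel (\<lambda>z. z ^ q) = M"
    "(\<integral>z. z powi n \<partial>M) = T (tr (of_int n))"
  using assms invariant_circle_prob circle_distr_invariant by (auto simp: represents_def)

lemma trace_eq_integral:
  assumes R: "represents T M" and a: "a \<in> Z.HA"
  shows "T a = (\<integral>z. evc z a \<partial>M)"
  using a
proof (induction rule: Z.HA_induct)
  case zero
  then show ?case using trace_zero[OF representsD(1)[OF R]] by simp
next
  case (single g c)
  then obtain n where g: "g = affmap (of_int n) 1"
    by (auto simp: Zs_def elim!: Ints_cases) (metis affmap_eta)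
  have "single g c = single 0 c * tr (of_int n)" by (simp add: g tr_def mult_single)
  then have "T (single g c) = c * T (tr (of_int n))"
    using trace_scale[OF representsD(1)[OF R]] by simp
  then show ?case using g representsD(6)[OF R, of n] by simp
next
  case (add a b)
  then show ?case
    using trace_add[OF representsD(1)[OF R]] ZHA_HA
      circle_integrable[OF representsD(2)[OF R] evc_continuous]
    by (simp add: evc_add)
qed

text \<open>The closure of the integer translations in the GNS space is thus the space of
  square-integrable functions for \<open>M\<close>, and limits can be computed pointwise.\<close>

lemma tnorm_eq_integral:
  assumes R: "represents T M" and a: "a \<in> Z.HA"
  shows "(tnorm T a)\<^sup>2 = (\<integral>z. (cmod (evc z a))\<^sup>2 \<partial>M)"
proof -
  have "T (galg_adj a * a) = (\<integral>z. evc z (galg_adj a * a) \<partial>M)"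
    using R a by (intro trace_eq_integral) auto
  also have "\<dots> = (\<integral>z. of_real ((cmod (evc z a))\<^sup>2) \<partial>M)"
    using a circle_probD(3)[OF representsD(2)[OF R]] by (intro Bochner_Integration.integral_cong evc_adj_mult) auto
  finally have "T (galg_adj a * a) = of_real (\<integral>z. (cmod (evc z a))\<^sup>2 \<partial>M)"
    by (simp only: integral_complex_of_real)
  then show ?thesis using tnorm_sq[OF representsD(1)[OF R] ZHA_HA[OF a]] by simp
qed

section \<open>Averages of translations and the projections they converge to\<close>

definition avg :: "nat \<Rightarrow> nat \<Rightarrow> affine_map \<Rightarrow>\<^sub>0 complex" where
  "avg d n = (\<Sum>i<n. single (affmap (of_nat (d * i)) 1) (1 / of_nat n))"

lemma avg_ZHA [simp, intro]: "avg d n \<in> Z.HA"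
  unfolding avg_def by (intro Z.sum_closed Z.HA_single) (simp add: Zs_def)

lemma avg_HA [simp, intro]: "avg d n \<in> HA"
  by (rule ZHA_HA) simp

lemma evc_avg: "evc z (avg d n) = mean_power n (z ^ d)"
  unfolding avg_def evc_sum mean_power_def sum_divide_distrib
  by (intro sum.cong) (simp_all add: power_int_mult flip: power_mult of_nat_mult)

lemma tnorm_tendsto_zero:
  assumes R: "represents T M" and a: "\<And>n. a n \<in> Z.HA"
    and bound: "\<And>n z. z \<in> circle \<Longrightarrow> cmod (evc z (a n)) \<le> K"
    and lim: "AE z in M. (\<lambda>n. evc z (a n)) \<longlonglongrightarrow> 0"
  shows "(\<lambda>n. tnorm T (a n)) \<longlonglongrightarrow> 0"
proof -
  have "(\<lambda>n. \<integral>z. (cmod (evc z (a n)))\<^sup>2 \<partial>M) \<longlonglongrightarrow> (\<integral>z. 0 \<partial>M)"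
  proof (rule circle_dominated_convergence[OF representsD(2)[OF R], where K = "K\<^sup>2"])
    show "continuous_on circle (\<lambda>z. (cmod (evc z (a n)))\<^sup>2)" for n by (intro continuous_intros evc_continuous)
    show "norm ((cmod (evc z (a n)))\<^sup>2) \<le> K\<^sup>2" if "z \<in> circle" for n z
      using power_mono[OF bound[OF that, of n] norm_ge_zero, of 2] by simp
    show "AE z in M. (\<lambda>n. (cmod (evc z (a n)))\<^sup>2) \<longlonglongrightarrow> 0"
      using lim
    proof eventually_elim
      case (elim z)
      from tendsto_power[OF tendsto_norm[OF elim], of 2] show ?case by simp
    qed
  qed simp
  then have "(\<lambda>n. (tnorm T (a n))\<^sup>2) \<longlonglongrightarrow> 0" using tnorm_eq_integral[OF R a] by simp
  from tendsto_real_sqrt[OF this] show ?thesis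
    using tnorm_nonneg[OF representsD(1)[OF R] ZHA_HA[OF a]] by simp
qed

lemma AE_circle: "circle_prob M \<Longrightarrow> AE z in M. z \<in> circle"
  using circle_probD(3)[of M] by (intro AE_I2) simp

lemma measure_root_set_scale:
  assumes R: "represents T M"
  shows "measure M (root_set (p ^ i * q ^ j * d)) = measure M (root_set d)"
  using measure_root_set_mult_power[OF representsD(2,4)[OF R]] measure_root_set_mult_power[OF representsD(2,5)[OF R]]
  by (simp add: mult.assoc)

text \<open>Averaging over conjugates by translations \<open>b i\<close>, with \<open>(1 - s) b\<close> a nonzero integer.\<close>

lemma trace_vanishes_off_translations:
  assumes R: "represents T M" and null: "\<And>d. d > 0 \<Longrightarrow> measure M (root_set d) = 0"
    and x: "x \<in> Ns" and s: "s \<in> Ss" "s \<noteq> 1"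
  shows "T (single (affmap x s) 1) = 0"
proof -
  note T = representsD(1)[OF R]
  obtain i j k l where sq: "s * of_nat (p ^ k * q ^ l) = of_nat (p ^ i * q ^ j)"
    using Ss_quotient[OF s(1)] .
  \<comment> \<open>The denominator of \<open>s\<close>: multiplied by \<open>1 - s\<close> it
    becomes an integer, nonzero since \<open>s \<noteq> 1\<close>. Its sign is adjusted below to
    obtain \<open>d > 0\<close>.\<close>
  define b0 :: int where "b0 = int (p ^ k * q ^ l)"
  have "(1 - s) * of_int b0 = of_int (b0 - int (p ^ i * q ^ j))"
    using sq by (simp add: b0_def left_diff_distrib)
  moreover have "(1 - s) * of_int b0 \<noteq> 0" using s by (simp add: b0_def)
  ultimately obtain b d where d: "d > 0" "(1 - s) * of_int b = of_nat d"
  proof (cases "b0 - int (p ^ i * q ^ j) > 0")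
    case True
    then show ?thesis using that[of "nat (b0 - int (p ^ i * q ^ j))" b0] \<open>(1 - s) * of_int b0 = _\<close> by simp
  next
    case False
    then have "b0 - int (p ^ i * q ^ j) < 0" using \<open>(1 - s) * of_int b0 = _\<close> \<open>(1 - s) * of_int b0 \<noteq> 0\<close>
      by (metis linorder_neqE_linordered_idom of_int_0)
    then show ?thesis using that[of "nat (- (b0 - int (p ^ i * q ^ j)))" "- b0"] \<open>(1 - s) * of_int b0 = _\<close>
      by simp
  qed
  let ?u = "single (affmap x s) 1 :: affine_map \<Rightarrow>\<^sub>0 complex"
  have u: "?u \<in> HU" using x s by blast
  \<comment> \<open>Conjugating \<open>?u\<close> by the translation \<open>b * i\<close> adds
    \<open>d * i\<close> to its translation part, so each summand of the average contributes the
    same value of the trace.\<close>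
  have eq: "T (avg d n * ?u) = T ?u" if n: "n > 0" for n
  proof -
    have "T (single (affmap (of_nat (d * i)) 1) (1 / of_nat n) * ?u) = T ?u / of_nat n" for i
    proof -
      let ?y = "of_int b * of_nat i :: rat"
      have y: "?y \<in> Ns" using Ns_of_int[of "b * int i"] by simp
      have yeq: "?y + x - s * ?y = of_nat (d * i) + x"
      proof -
        have "?y + x - s * ?y = (1 - s) * of_int b * of_nat i + x" by (simp add: algebra_simps)
        then show ?thesis by (simp add: d(2))
      qed
      have "tr ?y * ?u * galg_adj (tr ?y) = single (affmap (?y + x - s * ?y) s) 1"
        using s by (simp add: tr_def mult_single affmap_uminus affmap_add)
      then have "tr ?y * ?u * galg_adj (tr ?y) = single (affmap (of_nat (d * i) + x) s) 1"
        unfolding yeq .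
      then have "T (single (affmap (of_nat (d * i) + x) s) 1) = T ?u"
        using trace_conj[OF T tr_HU[OF y], of ?u] u by simp
      moreover have "single (affmap (of_nat (d * i)) 1) (1 / of_nat n) * ?u
          = single 0 (1 / of_nat n) * single (affmap (of_nat (d * i) + x) s) 1"
        using s by (simp add: mult_single affmap_add)
      moreover have "single (affmap (of_nat (d * i) + x) s) 1 \<in> HA"
        using x s by (intro HA_single affmap_H Ns_add Ns_of_nat)
      ultimately show ?thesis using trace_scale[OF T] by simp
    qed
    moreover have "single (affmap (of_nat (d * i)) 1) (1 / of_nat n) * ?u \<in> HA" for i
      using x s by (intro mult_closed HA_single affmap_H Ns_of_nat Ss_one)
    ultimately have "T (avg d n * ?u) = (\<Sum>i<n. T ?u / of_nat n)"
      unfolding avg_def sum_distrib_right by (simp add: trace_sum[OF T])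
    then show ?thesis using n by simp
  qed
  have "(\<lambda>n. tnorm T (avg d n)) \<longlonglongrightarrow> 0"
  proof (rule tnorm_tendsto_zero[OF R, where K = 1])
    show "cmod (evc z (avg d n)) \<le> 1" if "z \<in> circle" for n z
      unfolding evc_avg using that by (intro mean_power_le) (simp add: norm_power)
    interpret prob_space M using representsD(2)[OF R] by (rule circle_probD)
    have "root_set d \<in> null_sets M"
      using null[OF d(1)] root_set_sets circle_probD(1)[OF representsD(2)[OF R]]
      by (simp add: null_sets_def emeasure_eq_measure)
    from AE_not_in[OF this] AE_circle[OF representsD(2)[OF R]]
    show "AE z in M. (\<lambda>n. evc z (avg d n)) \<longlonglongrightarrow> 0"
    proof eventually_elim
      case (elim z)
      then show ?case using mean_power_root_set[of z d] by (simp add: evc_avg)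
    qed
  qed simp
  moreover have "\<forall>\<^sub>F n in sequentially. cmod (T ?u) \<le> tnorm T (avg d n)"
    using eventually_gt_at_top[of 0]
  proof eventually_elim
    case (elim n)
    have "cmod (T (avg d n * ?u)) \<le> tnorm T (avg d n * ?u)"
      using u by (intro trace_le_tnorm[OF T]) auto
    then show ?case using eq[OF elim] tnorm_mult_unitary[OF T u] by simp
  qed
  ultimately have "cmod (T ?u) \<le> 0"
    by (intro tendsto_lowerbound) auto
  then show ?thesis by simp
qed

end

context independent_pair
begin

lemma HU_adj [simp, intro]: "u \<in> HU \<Longrightarrow> galg_adj u \<in> HU"
  unfolding HU_def using H_uminus by fastforce

lemma tnorm_conj: "trace_on T \<Longrightarrow> u \<in> HU \<Longrightarrow> a \<in> HA \<Longrightarrow> tnorm T (u * a * galg_adj u) = tnorm T a"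
  by (simp add: tnorm_mult_unitary tnorm_unitary_mult)

lemma conj_avg: 
  assumes "of_nat b \<in> Ss" shows "dl (of_nat b) * avg d n * galg_adj (dl (of_nat b)) = avg (b * d) n"
proof -
  have "of_nat b * of_nat (d * i) = (of_nat (b * d * i) :: rat)" for i by simp
  then show ?thesis
    unfolding avg_def sum_distrib_left sum_distrib_right
    by (intro sum.cong refl) (simp only: dl_conj_single[OF zero_less_one assms])
qed

text \<open>Conjugation by \<open>u\<close> replaces multiples of \<open>d\<close> by multiples of
  \<open>s * d\<close>; a further conjugation by the denominator of \<open>s\<close> makes them
  integral. Both conjugations are isometric for \<open>tnorm\<close>.\<close>

lemma tnorm_commutator_avg:
  assumes T: "trace_on T" and u: "u \<in> HU"
  obtains i j k l where "\<And>d n. tnorm T (u * avg d n - avg d n * u)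
    = tnorm T (avg (p ^ i * q ^ j * d) n - avg (p ^ k * q ^ l * d) n)"
proof -
  obtain x s where xs: "x \<in> Ns" "s \<in> Ss" "u = single (affmap x s) 1" using HU_cases[OF u] .
  obtain i j k l where sq: "s * of_nat (p ^ k * q ^ l) = of_nat (p ^ i * q ^ j)"
    using Ss_quotient[OF xs(2)] .
  let ?b = "p ^ k * q ^ l" and ?a = "p ^ i * q ^ j"
  let ?w = "dl (of_nat ?b)"
  have w: "?w \<in> HU" using Ss_nat by (rule dl_HU)
  have "tnorm T (u * avg d n - avg d n * u) = tnorm T (avg (?a * d) n - avg (?b * d) n)" for d n
  proof -
    have uinv: "galg_adj u * u = 1" using u by simp
    have "u * avg d n - avg d n * u = (u * avg d n * galg_adj u - avg d n) * u"
      unfolding left_diff_distrib mult.assoc uinv by simp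
    then have "tnorm T (u * avg d n - avg d n * u) = tnorm T (u * avg d n * galg_adj u - avg d n)"
      using u by (simp add: tnorm_mult_unitary[OF T])
    also have "\<dots> = tnorm T (?w * (u * avg d n * galg_adj u - avg d n) * galg_adj ?w)"
      using u by (intro tnorm_conj[OF T w, symmetric]) auto
    also have "?w * (u * avg d n * galg_adj u - avg d n) * galg_adj ?w
        = ?w * (u * avg d n * galg_adj u) * galg_adj ?w - ?w * avg d n * galg_adj ?w"
      by (simp only: left_diff_distrib right_diff_distrib)
    also have "?w * avg d n * galg_adj ?w = avg (?b * d) n" using Ss_nat by (rule conj_avg)
    also have "?w * (u * avg d n * galg_adj u) * galg_adj ?w = avg (?a * d) n"
    proof -
      have "u * single (affmap y 1) c * galg_adj u = single (affmap (s * y) 1) c" for y c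
        using xs by (simp add: mult_single affmap_uminus affmap_add)
      then have "u * avg d n * galg_adj u = (\<Sum>r<n. single (affmap (s * of_nat (d * r)) 1) (1 / of_nat n))"
        unfolding avg_def sum_distrib_left sum_distrib_right by simp
      moreover have "?w * single (affmap (s * of_nat (d * r)) 1) c * galg_adj ?w
          = single (affmap (of_nat (?a * d * r)) 1) c" for r c
      proof -
        have "of_nat ?b * (s * of_nat (d * r)) = (s * of_nat ?b) * of_nat (d * r)" by (simp add: mult_ac)
        also have "\<dots> = of_nat (?a * d * r)" unfolding sq by (simp add: mult_ac)
        finally have "of_nat ?b * (s * of_nat (d * r)) = of_nat (?a * d * r)" .
        then show ?thesis by (simp only: dl_conj_single[OF zero_less_one Ss_nat])
      qed
      ultimately show ?thesis
        unfolding avg_def by (simp only: sum_distrib_left sum_distrib_right)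
    qed
    finally show ?thesis .
  qed
  then show thesis using that by blast
qed

lemma cmod_evc_avg: "z \<in> circle \<Longrightarrow> cmod (evc z (avg d n)) \<le> 1"
  unfolding evc_avg by (intro mean_power_le) (simp add: norm_power)

lemma evc_avg_tendsto: "z \<in> circle \<Longrightarrow> (\<lambda>n. evc z (avg d n)) \<longlonglongrightarrow> indicator (root_set d) z"
  unfolding evc_avg by (rule mean_power_root_set)

text \<open>Arguing by contradiction replaces the two free indices by sequences \<open>f N\<close>
  and \<open>g N\<close>, to which dominated convergence applies.\<close>

lemma avg_Cauchy:
  assumes R: "represents T M" and e: "e > 0"
  shows "\<exists>N. \<forall>m\<ge>N. \<forall>n\<ge>N. tnorm T (avg d m - avg d n) < e"
proof (rule ccontr)
  assume "\<not> ?thesis"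
  then have "\<forall>N. \<exists>m n. m \<ge> N \<and> n \<ge> N \<and> \<not> tnorm T (avg d m - avg d n) < e" by blast
  then obtain f g where fg: "\<And>N. f N \<ge> N" "\<And>N. g N \<ge> N" "\<And>N. \<not> tnorm T (avg d (f N) - avg d (g N)) < e"
    by metis
  have "filterlim h at_top sequentially" if "\<And>N. h N \<ge> N" for h :: "nat \<Rightarrow> nat"
    by (rule filterlim_at_top_mono[OF filterlim_ident]) (simp add: that always_eventually)
  then have top: "filterlim f at_top sequentially" "filterlim g at_top sequentially"
    using fg by blast+
  have "(\<lambda>N. tnorm T (avg d (f N) - avg d (g N))) \<longlonglongrightarrow> 0"
  proof (rule tnorm_tendsto_zero[OF R, where K = 2])
    show "cmod (evc z (avg d (f n) - avg d (g n))) \<le> 2" if "z \<in> circle" for n z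
      using norm_triangle_ineq4[of "evc z (avg d (f n))" "evc z (avg d (g n))"]
        cmod_evc_avg[OF that, of d "f n"] cmod_evc_avg[OF that, of d "g n"] by (simp add: evc_diff)
    from AE_circle[OF representsD(2)[OF R]]
    show "AE z in M. (\<lambda>n. evc z (avg d (f n) - avg d (g n))) \<longlonglongrightarrow> 0"
    proof eventually_elim
      case (elim z)
      from tendsto_diff[OF filterlim_compose[OF evc_avg_tendsto[OF elim, of d] top(1)]
          filterlim_compose[OF evc_avg_tendsto[OF elim, of d] top(2)]]
      show ?case by (simp add: evc_diff)
    qed
  qed (intro Z.diff_closed avg_ZHA)
  then have "\<forall>\<^sub>F N in sequentially. tnorm T (avg d (f N) - avg d (g N)) < e" using e by (rule order_tendstoD)
  then show False using fg(3) by (auto simp: eventually_sequentially)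
qed

text \<open>The index \<open>Suc n\<close> avoids the empty average \<open>avg d 0\<close>, which is
  zero and so does not take the value 1 on \<open>root_set d\<close>.\<close>

lemma avg_central_projection:
  assumes R: "represents T M"
  shows "central_projection_seq T (\<lambda>n. avg d (Suc n))"
  unfolding central_projection_seq_def
proof (intro conjI allI impI ballI)
  note T = representsD(1)[OF R]
  note MC = AE_circle[OF representsD(2)[OF R]]
  show "avg d (Suc n) \<in> HA" for n by simp
  show "\<exists>N. \<forall>m\<ge>N. \<forall>n\<ge>N. tnorm T (avg d (Suc m) - avg d (Suc n)) < e" if "e > 0" for e
    using avg_Cauchy[OF R that] le_Suc_eq by (metis le_SucI)
  have "(\<lambda>n. tnorm T (avg d n - galg_adj (avg d n) * avg d n)) \<longlonglongrightarrow> 0"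
  proof (rule tnorm_tendsto_zero[OF R, where K = 2])
    show "cmod (evc z (avg d n - galg_adj (avg d n) * avg d n)) \<le> 2" if "z \<in> circle" for n z
    proof -
      have "cmod (evc z (galg_adj (avg d n) * avg d n)) \<le> 1"
        unfolding evc_adj_mult[OF that avg_ZHA] norm_of_real
        using power_le_one[OF norm_ge_zero cmod_evc_avg[OF that, of d n], of 2] by simp
      then show ?thesis
        using norm_triangle_ineq4[of "evc z (avg d n)" "evc z (galg_adj (avg d n) * avg d n)"]
          cmod_evc_avg[OF that, of d n] by (simp add: evc_diff)
    qed
    from MC show "AE z in M. (\<lambda>n. evc z (avg d n - galg_adj (avg d n) * avg d n)) \<longlonglongrightarrow> 0"
    proof eventually_elim
      case (elim z)
      note l = evc_avg_tendsto[OF elim, of d]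
      have "(\<lambda>n. evc z (avg d n) - of_real ((cmod (evc z (avg d n)))\<^sup>2)) \<longlonglongrightarrow>
          indicator (root_set d) z - of_real ((cmod (indicator (root_set d) z))\<^sup>2)"
        by (intro tendsto_diff l tendsto_of_real tendsto_power tendsto_norm)
      moreover have "indicator (root_set d) z - complex_of_real ((cmod (indicator (root_set d) z))\<^sup>2) = 0"
        by (simp add: indicator_def)
      ultimately show ?case
        by (simp only: evc_diff[OF avg_ZHA Z.mult_closed[OF Z.adj_closed[OF avg_ZHA] avg_ZHA]]
            evc_adj_mult[OF elim avg_ZHA])
    qed
  qed (intro Z.diff_closed Z.mult_closed Z.adj_closed avg_ZHA)
  from LIMSEQ_Suc[OF this]
  show "(\<lambda>n. tnorm T (avg d (Suc n) - galg_adj (avg d (Suc n)) * avg d (Suc n))) \<longlonglongrightarrow> 0" .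
  fix u assume "u \<in> HU"
  then obtain i j k l where comm: "\<And>d n. tnorm T (u * avg d n - avg d n * u)
    = tnorm T (avg (p ^ i * q ^ j * d) n - avg (p ^ k * q ^ l * d) n)"
    using tnorm_commutator_avg[OF T] by blast
  let ?a = "p ^ i * q ^ j * d" and ?b = "p ^ k * q ^ l * d"
  \<comment> \<open>Both averages in the commutator formula have, almost everywhere, the limit
    belonging to \<open>root_set d\<close>.\<close>
  have root: "AE z in M. z \<in> root_set (p ^ i * q ^ j * d) \<longleftrightarrow> z \<in> root_set d" for i j
  proof -
    interpret prob_space M using representsD(2)[OF R] by (rule circle_probD)
    have sets: "root_set c \<in> sets M" for c using root_set_sets circle_probD[OF representsD(2)[OF R]] by simp
    have sub: "root_set d \<subseteq> root_set (p ^ i * q ^ j * d)" by (rule root_set_mono) simp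
    have "measure M (root_set (p ^ i * q ^ j * d) - root_set d) = 0"
      using finite_measure_Diff[OF sets sets sub] measure_root_set_scale[OF R] by simp
    then have "AE z in M. z \<notin> root_set (p ^ i * q ^ j * d) - root_set d"
      using sets by (intro AE_not_in) (auto simp: null_sets_def emeasure_eq_measure)
    then show ?thesis by eventually_elim (use sub in auto)
  qed
  have "(\<lambda>n. tnorm T (avg ?a n - avg ?b n)) \<longlonglongrightarrow> 0"
  proof (rule tnorm_tendsto_zero[OF R, where K = 2])
    show "cmod (evc z (avg ?a n - avg ?b n)) \<le> 2" if "z \<in> circle" for n z
      using norm_triangle_ineq4[of "evc z (avg ?a n)" "evc z (avg ?b n)"]
        cmod_evc_avg[OF that, of ?a n] cmod_evc_avg[OF that, of ?b n] by (simp add: evc_diff)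
    from MC root[of i j] root[of k l]
    show "AE z in M. (\<lambda>n. evc z (avg ?a n - avg ?b n)) \<longlonglongrightarrow> 0"
    proof eventually_elim
      case (elim z)
      have "indicator (root_set ?a) z = (indicator (root_set ?b) z :: complex)"
        using elim(2,3) by (simp add: indicator_def)
      then show ?case
        using tendsto_diff[OF evc_avg_tendsto[OF elim(1), of ?a] evc_avg_tendsto[OF elim(1), of ?b]]
        by (simp add: evc_diff)
    qed
  qed (intro Z.diff_closed avg_ZHA)
  from LIMSEQ_Suc[OF this]
  show "(\<lambda>n. tnorm T (u * avg d (Suc n) - avg d (Suc n) * u)) \<longlonglongrightarrow> 0" by (simp only: comm)
qed

lemma integral_indicator_root_set:
  assumes M: "circle_prob M"
  shows "(\<integral>z. indicator (root_set d) z \<partial>M) = complex_of_real (measure M (root_set d))"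
proof -
  interpret prob_space M using M by (rule circle_probD)
  have "root_set d \<in> sets M" using root_set_sets circle_probD(1)[OF M] by simp
  then have "(\<integral>z. indicator (root_set d) z \<partial>M) = measure M (root_set d)" by simp
  moreover have "(\<integral>z. complex_of_real (indicator (root_set d) z) \<partial>M) = of_real (\<integral>z. indicator (root_set d) z \<partial>M)"
    by (rule integral_complex_of_real)
  moreover have "(\<lambda>z. complex_of_real (indicator (root_set d) z)) = indicator (root_set d)"
    by (auto simp: indicator_def)
  ultimately show ?thesis by simp
qed

lemma trace_avg_tendsto:
  assumes R: "represents T M" and a: "a \<in> Z.HA" and a1: "\<And>z. z \<in> root_set d \<Longrightarrow> evc z a = 1"
  shows "(\<lambda>n. T (avg d n * a)) \<longlonglongrightarrow> of_real (measure M (root_set d))"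
proof -
  note M = representsD(2)[OF R]
  have "bounded ((\<lambda>z. evc z a) ` circle)"
    by (intro compact_imp_bounded compact_continuous_image evc_continuous compact_sphere)
  then obtain K where "\<forall>w\<in>(\<lambda>z. evc z a) ` circle. cmod w \<le> K" unfolding bounded_iff by blast
  then have K: "cmod (evc z a) \<le> K" if "z \<in> circle" for z using that by blast
  have "(\<lambda>n. \<integral>z. evc z (avg d n * a) \<partial>M) \<longlonglongrightarrow> (\<integral>z. indicator (root_set d) z \<partial>M)"
  proof (rule circle_dominated_convergence[OF M evc_continuous, where K = K])
    show "norm (evc z (avg d n * a)) \<le> K" if "z \<in> circle" for n z
      unfolding evc_mult[OF that avg_ZHA a] norm_mult
      using mult_mono[OF cmod_evc_avg[OF that, of d n] K[OF that]] by simp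
    show "indicator (root_set d) \<in> borel_measurable M"
      using root_set_sets circle_probD(1)[OF M] by (intro borel_measurable_indicator) simp
    from AE_circle[OF M] show "AE z in M. (\<lambda>n. evc z (avg d n * a)) \<longlonglongrightarrow> indicator (root_set d) z"
    proof eventually_elim
      case (elim z)
      have "indicator (root_set d) z * evc z a = indicator (root_set d) z"
        using a1 by (simp add: indicator_def)
      then show ?case
        using tendsto_mult[OF evc_avg_tendsto[OF elim, of d] tendsto_const, of "evc z a"]
        by (simp only: evc_mult[OF elim avg_ZHA a])
    qed
  qed
  then show ?thesis
    using trace_eq_integral[OF R Z.mult_closed[OF avg_ZHA a]] integral_indicator_root_set[OF M] by simp
qed

lemma evc_avg_root_set: "z \<in> root_set d \<Longrightarrow> n > 0 \<Longrightarrow> evc z (avg d n) = 1"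
  by (simp add: evc_avg mean_power_def root_set_def)

lemma extreme_faithful_root_set_null:
  assumes ex: "extreme_trace_on T" and R: "represents T M"
    and faithful: "\<And>x. x \<in> HA \<Longrightarrow> T (galg_adj x * x) = 0 \<Longrightarrow> unorm x = 0" and d: "d > 0"
  shows "measure M (root_set d) = 0"
proof (rule ccontr)
  note T = representsD(1)[OF R]
  note M = representsD(2)[OF R]
  interpret prob_space M using M by (rule circle_probD)
  assume "measure M (root_set d) \<noteq> 0"
  then have pos: "0 < measure M (root_set d)" using measure_nonneg[of M "root_set d"] by linarith
  have one: "(\<lambda>n. T (avg d n)) \<longlonglongrightarrow> of_real (measure M (root_set d))"
    using trace_avg_tendsto[OF R Z.one_closed] by simp
  have "\<not> measure M (root_set d) < 1"
  proof
    assume lt: "measure M (root_set d) < 1"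
    have "(\<lambda>n. T (avg d (Suc n) * avg d (Suc m))) \<longlonglongrightarrow> of_real (measure M (root_set d))" for m
      using LIMSEQ_Suc[OF trace_avg_tendsto[OF R avg_ZHA evc_avg_root_set]] by blast
    from not_extreme_trace_if_central_projection[OF T avg_central_projection[OF R] LIMSEQ_Suc[OF one] pos lt this]
    show False using ex by blast
  qed
  then have full: "measure M (root_set d) = 1" using prob_le_1[of "root_set d"] by linarith
  \<comment> \<open>As a function this is \<open>z ^ d - 1\<close>, which vanishes on
    \<open>root_set d\<close> and so is null for \<open>T\<close>, while it is a nonzero element of
    the group algebra.\<close>
  let ?x = "tr (of_nat d) - 1"
  have xZ: "?x \<in> Z.HA" unfolding tr_def by (intro Z.diff_closed Z.one_closed Z.HA_single) (simp add: Zs_def)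
  have "AE z in M. z \<in> root_set d"
    using full root_set_sets circle_probD(1)[OF M] by (intro prob_eq_1[THEN iffD1]) auto
  then have "AE z in M. (cmod (evc z ?x))\<^sup>2 = 0"
  proof eventually_elim
    case (elim z)
    have "tr (of_nat d) \<in> Z.HA" unfolding tr_def by (intro Z.HA_single) (simp add: Zs_def)
    then show ?case using elim by (simp add: evc_diff root_set_def tr_def)
  qed
  then have "(\<integral>z. (cmod (evc z ?x))\<^sup>2 \<partial>M) = (\<integral>z. 0 \<partial>M)"
    using circle_continuous_measurable[OF circle_probD(1)[OF M]] evc_continuous
    by (intro integral_cong_AE) (auto intro!: circle_continuous_measurable[OF circle_probD(1)[OF M]] continuous_intros evc_continuous)
  then have "(tnorm T ?x)\<^sup>2 = 0" using tnorm_eq_integral[OF R xZ] by simp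
  then have "T (galg_adj ?x * ?x) = 0" using trace_adj_mult[OF T ZHA_HA[OF xZ]] by simp
  then have "unorm ?x = 0" using faithful ZHA_HA[OF xZ] by blast
  moreover have "?x \<noteq> 0"
  proof
    assume "?x = 0"
    then have "lookup ?x 0 = 0" by simp
    moreover have "affmap (of_nat d) 1 \<noteq> 0" using d by (metis trl_affine trl_zero of_nat_eq_0_iff less_irrefl)
    ultimately show False by (simp add: tr_def lookup_minus lookup_single when_def lookup_one)
  qed
  ultimately show False using unorm_pos[OF ZHA_HA[OF xZ]] by simp
qed

end

section \<open>The grading by dilations and the trace of an invariant measure\<close>

lemma lin_vanish: "(\<And>g. g \<in> keys a \<Longrightarrow> \<phi> g = 0) \<Longrightarrow> lin \<phi> a = 0"
  by (simp add: lin_def)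

text \<open>The component of degree \<open>s\<close> in the grading of the group algebra by the
  quotient group of dilations.\<close>

definition dil_part :: "rat \<Rightarrow> (affine_map \<Rightarrow>\<^sub>0 complex) \<Rightarrow> (affine_map \<Rightarrow>\<^sub>0 complex)" where
  "dil_part s f = (\<Sum>g\<in>{g \<in> keys f. dil g = s}. single g (lookup f g))"

lemma keys_dil_part: "keys (dil_part s f) \<subseteq> {g \<in> keys f. dil g = s}"
  unfolding dil_part_def using keys_sum_single[of "\<lambda>g. g" "lookup f" "{g \<in> keys f. dil g = s}"] by simp

lemma sum_dil_part: "(\<Sum>s\<in>dil ` keys f. dil_part s f) = f"
proof -
  have "(\<Sum>s\<in>dil ` keys f. dil_part s f) = (\<Sum>g\<in>keys f. single g (lookup f g))"
    unfolding dil_part_def by (rule sum.image_gen[symmetric]) simp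
  then show ?thesis by (simp only: poly_mapping_sum_single[symmetric])
qed

context independent_pair
begin

text \<open>Elements of \<open>galg_adj (X s) * X t\<close> have dilation \<open>t / s\<close>, so
  different degrees are orthogonal for a functional that vanishes off the translations.\<close>

lemma lin_orthogonal:
  assumes \<phi>: "\<And>g. dil g \<noteq> 1 \<Longrightarrow> \<phi> g = 0" and A: "finite A"
    and X: "\<And>s g. s \<in> A \<Longrightarrow> g \<in> keys (X s) \<Longrightarrow> dil g = s"
  shows "lin \<phi> (galg_adj (sum X A) * sum X A) = (\<Sum>s\<in>A. lin \<phi> (galg_adj (X s) * X s))"
proof -
  have off: "lin \<phi> (galg_adj (X s) * X t) = 0" if "s \<in> A" "t \<in> A" "s \<noteq> t" for s t
  proof (rule lin_vanish)
    fix g assume "g \<in> keys (galg_adj (X s) * X t)"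
    then obtain h k where "h \<in> keys (X s)" "k \<in> keys (X t)" "g = - h + k"
      using keys_mult[of "galg_adj (X s)" "X t"] by (auto simp: keys_galg_adj)
    then have "dil h = s" "dil k = t" "dil g = 1 / dil h * dil k" using X that by auto
    moreover from this have "s \<noteq> 0" using dil_nonzero[of h] by simp
    ultimately have "dil g = 1 / s * t" "s \<noteq> 0" by simp_all
    then show "\<phi> g = 0" using \<open>s \<noteq> t\<close> by (intro \<phi>) (auto simp: field_simps)
  qed
  have "lin \<phi> (galg_adj (sum X A) * sum X A) = (\<Sum>s\<in>A. \<Sum>t\<in>A. lin \<phi> (galg_adj (X s) * X t))"
    by (simp only: adj_sum sum_product lin_sum)
  also have "\<dots> = (\<Sum>s\<in>A. \<Sum>t\<in>A. if t = s then lin \<phi> (galg_adj (X s) * X t) else 0)"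
    using off by (intro sum.cong refl) auto
  finally show ?thesis using A by simp
qed

lemma HA_keysD: "a \<in> HA \<Longrightarrow> g \<in> keys a \<Longrightarrow> trl g \<in> Ns \<and> dil g \<in> Ss"
  unfolding HA_def by (auto simp: H_def)

lemma dil_part_HA: "f \<in> HA \<Longrightarrow> dil_part s f \<in> HA"
  using keys_dil_part[of s f] by (auto simp: HA_def)

lemma dil_part_translation:
  assumes f: "f \<in> HA" and s: "s \<in> Ss"
  shows "dil_part s f * dl (1 / s) \<in> Tr.HA" and "dil_part s f = dil_part s f * dl (1 / s) * dl s"
proof -
  show "dil_part s f * dl (1 / s) \<in> Tr.HA"
    unfolding Tr.HA_def
  proof (intro CollectI subsetI)
    fix g assume "g \<in> keys (dil_part s f * dl (1 / s))"
    then obtain h where "h \<in> keys f" "dil h = s" "g = h + affmap 0 (1 / s)"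
      using keys_mult[of "dil_part s f" "dl (1 / s)"] keys_dil_part[of s f] by (auto simp: dl_def)
    then show "g \<in> Ts" using f s unfolding HA_def by (auto simp: Ts_def H_def)
  qed
  have "dl (1 / s) * dl s = 1" using s by (simp add: dl_def mult_single affmap_add affmap_zero)
  then show "dil_part s f = dil_part s f * dl (1 / s) * dl s" by (simp add: mult.assoc)
qed

lemma conj_integral:
  assumes "c \<in> Tr.HA"
  shows "\<exists>k. dl (PQ ^ k) * c * galg_adj (dl (PQ ^ k)) \<in> Z.HA"
proof -
  \<comment> \<open>The claim is made for all large exponents, so that two summands have a common
    one.\<close>
  have "\<exists>k. \<forall>l\<ge>k. dl (PQ ^ l) * c * galg_adj (dl (PQ ^ l)) \<in> Z.HA"
    using assms
  proof (induction rule: Tr.HA_induct)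
    case (single g c)
    then obtain k where k: "trl g * PQ ^ k \<in> \<int>" and g: "g = affmap (trl g) 1"
      using affmap_eta[of g] by (auto simp: Ts_def Ns_iff)
    have "dl (PQ ^ l) * single g c * galg_adj (dl (PQ ^ l)) \<in> Z.HA" if "l \<ge> k" for l
    proof -
      have "dl (PQ ^ l) * single g c * galg_adj (dl (PQ ^ l)) = single (affmap (PQ ^ l * trl g) 1) c"
        by (subst g) (rule dl_conj_single[OF zero_less_one PQ_power_Ss])
      moreover have "affmap (PQ ^ l * trl g) 1 \<in> Zs"
        using Ns_scale_up[OF k that] by (simp add: Zs_def mult.commute)
      ultimately show ?thesis by simp
    qed
    then show ?case by blast
  next
    case (add a b)
    then obtain k l where "\<forall>r\<ge>k. dl (PQ ^ r) * a * galg_adj (dl (PQ ^ r)) \<in> Z.HA"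
      "\<forall>r\<ge>l. dl (PQ ^ r) * b * galg_adj (dl (PQ ^ r)) \<in> Z.HA" by blast
    then have "\<forall>r\<ge>max k l. dl (PQ ^ r) * (a + b) * galg_adj (dl (PQ ^ r)) \<in> Z.HA"
      by (simp add: distrib_left distrib_right)
    then show ?case by blast
  qed simp
  then show ?thesis by blast
qed

text \<open>The Fourier coefficients of the extension of \<open>M\<close> to the solenoid dual to
  Z[1/pq]. Invariance makes the value independent of the power of \<open>PQ\<close> that clears the
  denominator; \<open>LEAST\<close> fixes one.\<close>

definition fcoef :: "complex measure \<Rightarrow> rat \<Rightarrow> complex" where
  "fcoef M x = (\<integral>z. z powi \<lfloor>x * PQ ^ (LEAST k. x * PQ ^ k \<in> \<int>)\<rfloor> \<partial>M)"

lemma integral_powi_scale: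
  assumes M: "M \<in> invariant_measures p q"
  shows "(\<integral>z. z powi (int (p ^ i * q ^ j) * n) \<partial>M) = (\<integral>z. z powi n \<partial>M)"
proof -
  have "(\<integral>z. z powi (int (p ^ i) * n) \<partial>M) = (\<integral>z. z powi n \<partial>M)" for n i
  proof (induction i)
    case (Suc i)
    have "(\<integral>z. z powi (int p * (int (p ^ i) * n)) \<partial>M) = (\<integral>z. z powi (int (p ^ i) * n) \<partial>M)"
      using M unfolding invariant_measures_iff by blast
    then show ?case using Suc by (simp add: mult.assoc)
  qed simp
  moreover have "(\<integral>z. z powi (int (q ^ j) * n) \<partial>M) = (\<integral>z. z powi n \<partial>M)" for n
  proof (induction j)
    case (Suc j)
    have "(\<integral>z. z powi (int q * (int (q ^ j) * n)) \<partial>M) = (\<integral>z. z powi (int (q ^ j) * n) \<partial>M)"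
      using M unfolding invariant_measures_iff by blast
    then show ?case using Suc by (simp add: mult.assoc)
  qed simp
  ultimately show ?thesis by (metis mult.assoc of_nat_mult)
qed

text \<open>An exponent that clears the denominator exceeds the least one by some
  \<open>k - l\<close>, and the surplus factor \<open>(p * q) ^ (k - l)\<close> in the frequency is
  absorbed by invariance.\<close>

lemma fcoef_eq:
  assumes M: "M \<in> invariant_measures p q" and x: "x * PQ ^ k = of_int n"
  shows "fcoef M x = (\<integral>z. z powi n \<partial>M)"
proof -
  define l where "l = (LEAST k. x * PQ ^ k \<in> \<int>)"
  have "x * PQ ^ k \<in> \<int>" using x by simp
  then have l: "x * PQ ^ l \<in> \<int>" "l \<le> k"
    unfolding l_def by (rule LeastI, rule Least_le)
  then obtain m where m: "x * PQ ^ l = of_int m" by (auto elim: Ints_cases)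
  have "x * PQ ^ k = x * PQ ^ l * PQ ^ (k - l)" using l(2) by (simp add: mult.assoc flip: power_add)
  also have "\<dots> = of_int (int (p ^ (k - l) * q ^ (k - l)) * m)"
    unfolding m by (simp add: PQ_def power_mult_distrib mult_ac)
  finally have "n = int (p ^ (k - l) * q ^ (k - l)) * m" unfolding x by (simp only: of_int_eq_iff)
  then show ?thesis
    using integral_powi_scale[OF M] by (simp only: fcoef_def l_def[symmetric] m floor_of_int)
qed

lemma fcoef_of_int: "M \<in> invariant_measures p q \<Longrightarrow> fcoef M (of_int n) = (\<integral>z. z powi n \<partial>M)"
  by (rule fcoef_eq[where k = 0]) simp_all

lemma fcoef_scale:
  assumes M: "M \<in> invariant_measures p q" and s: "s \<in> Ss" and x: "x \<in> Ns"
  shows "fcoef M (s * x) = fcoef M x"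
proof -
  have nat: "fcoef M (of_nat (p ^ i * q ^ j) * y) = fcoef M y" if "y \<in> Ns" for i j y
  proof -
    obtain k n where n: "y * PQ ^ k = of_int n" using \<open>y \<in> Ns\<close> by (auto simp: Ns_iff elim: Ints_cases)
    have "of_nat (p ^ i * q ^ j) * y * PQ ^ k = of_nat (p ^ i * q ^ j) * (y * PQ ^ k)" by (rule mult.assoc)
    also have "\<dots> = of_int (int (p ^ i * q ^ j) * n)" unfolding n by simp
    finally show ?thesis using fcoef_eq[OF M] n integral_powi_scale[OF M] by metis
  qed
  obtain i j k l where sq: "s * of_nat (p ^ k * q ^ l) = of_nat (p ^ i * q ^ j)" using Ss_quotient[OF s] .
  have "fcoef M (s * x) = fcoef M (of_nat (p ^ k * q ^ l) * (s * x))"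
    using nat Ns_scale[OF s x] by simp
  also have "of_nat (p ^ k * q ^ l) * (s * x) = s * of_nat (p ^ k * q ^ l) * x" by (simp add: mult_ac)
  also have "fcoef M \<dots> = fcoef M x" unfolding sq using nat x by simp
  finally show ?thesis .
qed

definition mtrace_coef :: "complex measure \<Rightarrow> affine_map \<Rightarrow> complex" where
  "mtrace_coef M g = (if dil g = 1 then fcoef M (trl g) else 0)"

text \<open>The trace that vanishes off the translation subgroup and restricts to \<open>M\<close> there.\<close>

definition mtrace :: "complex measure \<Rightarrow> (affine_map \<Rightarrow>\<^sub>0 complex) \<Rightarrow> complex" where
  "mtrace M = lin (mtrace_coef M)"

text \<open>\<open>g + h\<close> is the conjugate of \<open>h + g\<close> by \<open>g\<close>; when
  the dilations cancel, this multiplies the translation by \<open>dil g\<close>, which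
  \<open>fcoef\<close> does not notice.\<close>

lemma mtrace_coef_commute:
  assumes M: "M \<in> invariant_measures p q" and "g \<in> H" "h \<in> H"
  shows "mtrace_coef M (g + h) = mtrace_coef M (h + g)"
proof (cases "dil g * dil h = 1")
  case True
  have "dil g * (trl h + dil h * trl g) = dil g * trl h + dil g * dil h * trl g" by (simp add: algebra_simps)
  then have "trl (g + h) = dil g * trl (h + g)" using True by simp
  moreover have "trl (h + g) \<in> Ns" "dil g \<in> Ss" using assms H_add by (auto simp: H_def Ns_add Ns_scale)
  ultimately show ?thesis
    using True fcoef_scale[OF M] by (simp add: mtrace_coef_def mult.commute del: trl_add)
qed (simp add: mtrace_coef_def mult.commute)

lemma mtrace_integral:
  assumes M: "M \<in> invariant_measures p q" and a: "a \<in> Z.HA"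
  shows "mtrace M a = (\<integral>z. evc z a \<partial>M)"
  using a
proof (induction rule: Z.HA_induct)
  case (single g c)
  then obtain n where "trl g = of_int n" "dil g = 1" by (auto simp: Zs_def elim!: Ints_cases)
  then show ?case using fcoef_of_int[OF M] by (simp add: mtrace_def mtrace_coef_def)
next
  case (add a b)
  then show ?case
    using circle_integrable[OF invariant_circle_prob[OF M] evc_continuous]
    by (simp add: mtrace_def lin_add evc_add)
qed (simp add: mtrace_def)

lemma mtrace_conj:
  assumes M: "M \<in> invariant_measures p q" and u: "u \<in> HU" and a: "a \<in> HA"
  shows "mtrace M (galg_adj u * a * u) = mtrace M a"
proof -
  have "mtrace M (galg_adj u * a * u) = mtrace M (u * (galg_adj u * a))"
    unfolding mtrace_def using M u a by (intro lin_commute mtrace_coef_commute) auto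
  also have "u * (galg_adj u * a) = a" using u by (simp flip: mult.assoc)
  finally show ?thesis .
qed

text \<open>Conjugating by a power of \<open>PQ\<close> makes all translations integral, where the
  value is the integral of a squared modulus.\<close>

lemma mtrace_pos_translation:
  assumes M: "M \<in> invariant_measures p q" and c: "c \<in> Tr.HA"
  shows "mtrace M (galg_adj c * c) \<in> \<real>\<^sub>\<ge>\<^sub>0"
proof -
  obtain k where k: "dl (PQ ^ k) * c * galg_adj (dl (PQ ^ k)) \<in> Z.HA" using conj_integral[OF c] by blast
  define w where "w = dl (PQ ^ k)"
  have w: "w \<in> HU" unfolding w_def using PQ_power_Ss by (rule dl_HU)
  have cH: "c \<in> HA" using c by (rule THA_HA)
  let ?b = "w * c * galg_adj w"
  have "galg_adj w * w = 1" using w by simp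
  then have "galg_adj ?b * ?b = w * (galg_adj c * c) * galg_adj w"
    by (simp add: galg_adj_mult mult.assoc) (simp flip: mult.assoc[of "galg_adj w" w])
  then have "mtrace M (galg_adj ?b * ?b) = mtrace M (galg_adj c * c)"
    using mtrace_conj[OF M HU_adj[OF w], of "galg_adj c * c"] cH by simp
  moreover have "mtrace M (galg_adj ?b * ?b) = (\<integral>z. of_real ((cmod (evc z ?b))\<^sup>2) \<partial>M)"
  proof -
    have b: "?b \<in> Z.HA" using k by (simp add: w_def)
    then have "mtrace M (galg_adj ?b * ?b) = (\<integral>z. evc z (galg_adj ?b * ?b) \<partial>M)"
      using M by (intro mtrace_integral) auto
    also have "\<dots> = (\<integral>z. of_real ((cmod (evc z ?b))\<^sup>2) \<partial>M)"
      using b circle_probD(3)[OF invariant_circle_prob[OF M]]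
      by (intro Bochner_Integration.integral_cong evc_adj_mult) auto
    finally show ?thesis .
  qed
  ultimately have "mtrace M (galg_adj c * c) = of_real (\<integral>z. (cmod (evc z ?b))\<^sup>2 \<partial>M)"
    by (simp only: integral_complex_of_real)
  then show ?thesis by (simp add: complex_nonneg_iff integral_nonneg_AE)
qed

text \<open>Positivity splits along the grading: a component has the form \<open>c * dl s\<close>
  with \<open>c\<close> supported on translations, and its contribution is the one of
  \<open>c\<close>.\<close>

lemma trace_on_mtrace: assumes M: "M \<in> invariant_measures p q" shows "trace_on (mtrace M)"
  unfolding mtrace_def
proof (rule trace_onI)
  interpret prob_space M using invariant_circle_prob[OF M] by (rule circle_probD)
  show "mtrace_coef M 0 = 1" using fcoef_of_int[OF M, of 0] prob_space by (simp add: mtrace_coef_def)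
  show "mtrace_coef M (g + h) = mtrace_coef M (h + g)" if "g \<in> H" "h \<in> H" for g h
    using mtrace_coef_commute[OF M that] .
  fix f assume f: "f \<in> HA"
  have "lin (mtrace_coef M) (galg_adj f * f)
      = (\<Sum>s\<in>dil ` keys f. lin (mtrace_coef M) (galg_adj (dil_part s f) * dil_part s f))"
  proof -
    have "lin (mtrace_coef M) (galg_adj (\<Sum>s\<in>dil ` keys f. dil_part s f) * (\<Sum>s\<in>dil ` keys f. dil_part s f))
      = (\<Sum>s\<in>dil ` keys f. lin (mtrace_coef M) (galg_adj (dil_part s f) * dil_part s f))"
      by (rule lin_orthogonal) (use keys_dil_part in \<open>auto simp: mtrace_coef_def\<close>)
    then show ?thesis by (simp only: sum_dil_part)
  qed
  also have "\<dots> \<in> \<real>\<^sub>\<ge>\<^sub>0"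
  proof -
    have "lin (mtrace_coef M) (galg_adj (dil_part s f) * dil_part s f) \<in> \<real>\<^sub>\<ge>\<^sub>0" if "s \<in> dil ` keys f" for s
    proof -
      have s: "s \<in> Ss" using that HA_keysD[OF f] by auto
      define c where "c = dil_part s f * dl (1 / s)"
      have c: "c \<in> Tr.HA" unfolding c_def using f s by (rule dil_part_translation)
      have "dil_part s f = c * dl s" unfolding c_def using f s by (rule dil_part_translation)
      then have "galg_adj (dil_part s f) * dil_part s f = galg_adj (dl s) * (galg_adj c * c) * dl s"
        by (simp add: galg_adj_mult mult.assoc)
      then have "mtrace M (galg_adj (dil_part s f) * dil_part s f) = mtrace M (galg_adj c * c)"
        using mtrace_conj[OF M dl_HU[OF s], of "galg_adj c * c"] THA_HA[OF c] by simp
      then show ?thesis using mtrace_pos_translation[OF M c] by (simp only: mtrace_def)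
    qed
    then show ?thesis by (auto simp: complex_nonneg_iff intro!: sum_nonneg)
  qed
  finally show "lin (mtrace_coef M) (galg_adj f * f) \<in> \<real>\<^sub>\<ge>\<^sub>0" .
qed

lemma represents_mtrace: assumes M: "M \<in> invariant_measures p q" shows "represents (mtrace M) M"
  using trace_on_mtrace[OF M] M fcoef_of_int[OF M]
  by (simp add: represents_def mtrace_def tr_def mtrace_coef_def)

lemma trace_eq_mtrace:
  assumes R: "represents T M" and null: "\<And>d. d > 0 \<Longrightarrow> measure M (root_set d) = 0" and a: "a \<in> HA"
  shows "T a = mtrace M a"
proof -
  note T = representsD(1)[OF R] and M = representsD(3)[OF R]
  have "T (single g 1) = mtrace_coef M g" if "g \<in> keys a" for g
  proof -
    have g: "trl g \<in> Ns" "dil g \<in> Ss" using HA_keysD[OF a that] by auto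
    show ?thesis
    proof (cases "dil g = 1")
      case False
      then show ?thesis
        using trace_vanishes_off_translations[OF R null g] by (simp add: mtrace_coef_def)
    next
      case True
      obtain k n where n: "trl g * PQ ^ k = of_int n" using g by (auto simp: Ns_iff elim: Ints_cases)
      have "single g 1 = tr (trl g)" using affmap_eta[of g] True by (simp add: tr_def)
      then have "T (single g 1) = T (tr (PQ ^ k * trl g))" using trace_tr_scale[OF T PQ_power_Ss g(1)] by simp
      also have "\<dots> = (\<integral>z. z powi n \<partial>M)" using n representsD(6)[OF R] by (simp add: mult.commute)
      also have "\<dots> = mtrace_coef M g" using fcoef_eq[OF M n] True by (simp add: mtrace_coef_def)
      finally show ?thesis .
    qed
  qed
  then show ?thesis unfolding trace_eq_lin[OF T a] mtrace_def by (intro lin_cong)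
qed

end

section \<open>Amenability: the enveloping norm is attained in GNS representations\<close>

text \<open>A polynomial factor disappears under roots. The exponents are powers of two because
  repeated use of the C-star identity gives \<open>N (h ^ (2 ^ j)) = N h ^ (2 ^ j)\<close> for
  self-adjoint \<open>h\<close>. The squared linear factor fits the growth of pairs of
  integers.\<close>

lemma le_of_powers_le:
  fixes x y A :: real
  assumes "0 \<le> x" "0 \<le> y" and A: "0 \<le> A" and le: "\<And>j. x ^ (2 ^ j) \<le> (A * 2 ^ j + 1)\<^sup>2 * y ^ (2 ^ j)"
  shows "x \<le> y"
proof (rule ccontr)
  assume "\<not> x \<le> y"
  have "y \<noteq> 0"
  proof
    assume "y = 0"
    then show False using le[of 0] assms(1) \<open>\<not> x \<le> y\<close> by simp
  qed
  then have y: "y > 0" using assms(2) by simp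
  \<comment> \<open>Taking the square root of the ratio matches the square on the linear factor,
    leaving a linear function over an exponential.\<close>
  define r where "r = sqrt (x / y)"
  have r: "r > 1" "r\<^sup>2 = x / y" using \<open>\<not> x \<le> y\<close> y assms(1) by (simp_all add: r_def)
  have ge: "1 \<le> (A * 2 ^ j + 1) / r ^ (2 ^ j)" for j :: nat
  proof -
    have "(r ^ (2 ^ j))\<^sup>2 = x ^ (2 ^ j) / y ^ (2 ^ j)"
      by (metis power_commutes power_mult r(2) power_divide mult.commute)
    also have "\<dots> \<le> (A * 2 ^ j + 1)\<^sup>2" using le[of j] y by (simp add: divide_le_eq)
    finally have "r ^ (2 ^ j) \<le> A * 2 ^ j + 1" by (rule power2_le_imp_le) (use A in simp)
    moreover have "0 < r ^ (2 ^ j)" using r(1) by simp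
    ultimately show ?thesis by (simp only: le_divide_eq_1_pos)
  qed
  have "(\<lambda>n. A * (real n / r ^ n) + 1 / r ^ n) \<longlonglongrightarrow> A * 0 + 0"
    using lim_n_over_pown[of r] LIMSEQ_inverse_realpow_zero[OF r(1)] r
    by (intro tendsto_add tendsto_mult tendsto_const) (auto simp: divide_inverse)
  then have "(\<lambda>n. (A * real n + 1) / r ^ n) \<longlonglongrightarrow> 0" by (simp add: add_divide_distrib)
  moreover have "strict_mono (\<lambda>j. 2 ^ j :: nat)" by (auto intro: strict_monoI power_strict_increasing)
  ultimately have "((\<lambda>n. (A * real n + 1) / r ^ n) \<circ> (\<lambda>j. 2 ^ j)) \<longlonglongrightarrow> 0" by (rule LIMSEQ_subseq_LIMSEQ)
  then have "(\<lambda>j. (A * 2 ^ j + 1) / r ^ (2 ^ j)) \<longlonglongrightarrow> 0" by (simp add: o_def)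
  then have "(1 :: real) \<le> 0" by (rule LIMSEQ_le_const) (use ge in blast)
  then show False by simp
qed

lemma (in star_ring) csn_power_of_two:
  assumes N: "cstar_seminorm_on N" and h: "h \<in> B" "adj h = h"
  shows "N (h ^ (2 ^ j)) = N h ^ (2 ^ j)"
proof (induction j)
  case (Suc j)
  have adj_pow: "adj (h ^ n) = h ^ n" for n by (induction n) (simp_all add: adj_mult h power_commutes)
  have "h ^ (2 ^ Suc j) = adj (h ^ (2 ^ j)) * h ^ (2 ^ j)" by (simp add: adj_pow mult_2 power_add)
  then have "N (h ^ (2 ^ Suc j)) = (N (h ^ (2 ^ j)))\<^sup>2" using csn_cstar[OF N, of "h ^ (2 ^ j)"] h by simp
  then show ?case using Suc by (simp add: mult_2 power2_eq_square power_add)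
qed simp

lemma (in star_ring) csn_power_le:
  assumes N: "cstar_seminorm_on N" and h: "h \<in> B" and n: "n > 0"
  shows "N (h ^ n) \<le> N h ^ n"
  using n
proof (induction n rule: nat_induct_non_zero)
  case (Suc n)
  have "N (h * h ^ n) \<le> N h * N (h ^ n)" using csn_mult[OF N] h by simp
  also have "\<dots> \<le> N h * N h ^ n" using Suc csn_nonneg[OF N h] by (intro mult_left_mono)
  finally show ?case by simp
qed simp

context independent_pair
begin

lemma csn_single_le: "cstar_seminorm_on N \<Longrightarrow> g \<in> H \<Longrightarrow> N (single g c) \<le> cmod c"
proof -
  assume N: "cstar_seminorm_on N" and g: "g \<in> H"
  have u: "single g (1::complex) \<in> HU" using g unfolding HU_def by blast
  have "single g c = single 0 c * single g 1" by (simp add: mult_single)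
  then have "N (single g c) = cmod c * N (single g 1)" using csn_scale[OF N unitaryD(1)[OF u]] by simp
  also have "\<dots> \<le> cmod c * 1" using csn_unitary_le[OF N u] by (intro mult_left_mono) auto
  finally show ?thesis by simp
qed

lemma csn_le_coefficients:
  assumes N: "cstar_seminorm_on N" and a: "a \<in> HA"
  shows "N a \<le> (\<Sum>g\<in>keys a. cmod (lookup a g))"
proof -
  have g: "g \<in> H" if "g \<in> keys a" for g using that a by (auto simp: HA_def)
  have "N (\<Sum>g\<in>keys a. single g (lookup a g)) \<le> (\<Sum>g\<in>keys a. N (single g (lookup a g)))"
    using g by (intro csn_sum[OF N]) auto
  also have "\<dots> \<le> (\<Sum>g\<in>keys a. cmod (lookup a g))"
    using g csn_single_le[OF N] by (intro sum_mono) auto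
  finally show ?thesis by (simp only: poly_mapping_sum_single[symmetric])
qed

lemma coefficient_integral:
  assumes "f \<in> Z.HA"
  shows "lookup f (affmap (of_int i) 1) = (\<integral>z. evc z f * z powi (- i) \<partial>circle_lebesgue)"
  using assms
proof (induction rule: Z.HA_induct)
  case (single g c)
  then obtain n where n: "trl g = of_int n" "dil g = 1" by (auto simp: Zs_def elim!: Ints_cases)
  have "g = affmap (of_int i) 1 \<longleftrightarrow> n = i"
    using n affmap_eta[of g] by (metis of_int_eq_iff trl_affine)
  then have "lookup (single g c) (affmap (of_int i) 1) = c * (if n - i = 0 then 1 else 0)"
    by (simp add: lookup_single when_def)
  also have "\<dots> = (\<integral>z. c * z powi (n - i) \<partial>circle_lebesgue)"
    by (simp only: integral_mult_right_zero circle_lebesgue_fourier)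
  also have "\<dots> = (\<integral>z. evc z (single g c) * z powi (- i) \<partial>circle_lebesgue)"
  proof (rule Bochner_Integration.integral_cong[OF refl])
    fix z assume "z \<in> space circle_lebesgue"
    then have "z \<noteq> 0" using circle_probD(3)[OF circle_prob_lebesgue] by auto
    then show "c * z powi (n - i) = evc z (single g c) * z powi (- i)"
      using power_int_add[of z n "- i"] by (simp add: n)
  qed
  finally show ?case .
next
  case (add a b)
  have "integrable circle_lebesgue (\<lambda>z. evc z f * z powi (- i))" for f
    by (intro circle_integrable[OF circle_prob_lebesgue] continuous_intros evc_continuous) auto
  then show ?case using add by (simp add: lookup_add evc_add distrib_right)
qed simp

lemma coefficient_le:
  assumes f: "f \<in> Z.HA" and K: "\<And>z. z \<in> circle \<Longrightarrow> cmod (evc z f) \<le> K" and g: "g \<in> Zs"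
  shows "cmod (lookup f g) \<le> K"
proof -
  interpret prob_space circle_lebesgue using circle_prob_lebesgue by (rule circle_probD)
  obtain i where "g = affmap (of_int i) 1"
    using g affmap_eta[of g] by (auto simp: Zs_def elim!: Ints_cases)
  then have "cmod (lookup f g) = cmod (\<integral>z. evc z f * z powi (- i) \<partial>circle_lebesgue)"
    using coefficient_integral[OF f] by simp
  also have "\<dots> \<le> (\<integral>z. cmod (evc z f * z powi (- i)) \<partial>circle_lebesgue)" by (rule integral_norm_bound)
  also have "\<dots> \<le> (\<integral>z. K \<partial>circle_lebesgue)"
  proof (rule integral_mono)
    show "integrable circle_lebesgue (\<lambda>z. cmod (evc z f * z powi (- i)))"
      by (intro circle_integrable[OF circle_prob_lebesgue] continuous_intros evc_continuous) auto
    fix z assume "z \<in> space circle_lebesgue"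
    then have z: "z \<in> circle" using circle_probD(3)[OF circle_prob_lebesgue] by simp
    show "cmod (evc z f * z powi (- i)) \<le> K"
      using K[OF z] cmod_powi_circle[OF z, of "- i"] by (simp only: norm_mult mult_1_right)
  qed simp
  finally show ?thesis by (simp add: prob_space)
qed

lemma keys_power_Zs:
  assumes h: "\<And>g. g \<in> keys h \<Longrightarrow> \<exists>i. g = affmap (of_int i) 1 \<and> \<bar>i\<bar> \<le> int D"
  shows "g \<in> keys (h ^ n) \<Longrightarrow> \<exists>i. g = affmap (of_int i) 1 \<and> \<bar>i\<bar> \<le> int (n * D)"
proof (induction n arbitrary: g)
  case 0
  then show ?case by (auto simp: affmap_zero intro!: exI[of _ 0])
next
  case (Suc n)
  then obtain k l where kl: "k \<in> keys h" "l \<in> keys (h ^ n)" "g = k + l"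
    using keys_mult[of h "h ^ n"] by auto
  obtain i where i: "k = affmap (of_int i) 1" "\<bar>i\<bar> \<le> int D" using h[OF kl(1)] by blast
  obtain j where j: "l = affmap (of_int j) 1" "\<bar>j\<bar> \<le> int (n * D)" using Suc.IH[OF kl(2)] by blast
  have "g = affmap (of_int (i + j)) 1" using i j kl by (simp add: affmap_add)
  moreover have "\<bar>i + j\<bar> \<le> int (Suc n * D)" using i j by simp
  ultimately show ?case by blast
qed

text \<open>Since \<open>\<int>\<close> has polynomial growth, powers of a self-adjoint element detect the supremum norm.\<close>

lemma csn_le_sup:
  assumes N: "cstar_seminorm_on N" and c: "c \<in> Z.HA" and K0: "0 \<le> K"
    and K: "\<And>z. z \<in> circle \<Longrightarrow> cmod (evc z c) \<le> K"
  shows "N c \<le> K"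
proof -
  define h where "h = galg_adj c * c"
  have hZ: "h \<in> Z.HA" unfolding h_def using c by auto
  have hH: "h ^ n \<in> HA" for n using hZ by (intro ZHA_HA) auto
  have h_adj: "galg_adj h = h" by (simp add: h_def galg_adj_mult)
  have hK: "cmod (evc z (h ^ n)) \<le> (K\<^sup>2) ^ n" if "z \<in> circle" for z n
  proof -
    have "cmod (evc z h) = (cmod (evc z c))\<^sup>2" unfolding h_def evc_adj_mult[OF that c] norm_of_real by simp
    also have "\<dots> \<le> K\<^sup>2" using K[OF that] by (intro power_mono) auto
    finally show ?thesis unfolding evc_power[OF that hZ] norm_power by (intro power_mono) auto
  qed
  have "\<exists>D. \<forall>g\<in>keys h. \<exists>i. g = affmap (of_int i) 1 \<and> \<bar>i\<bar> \<le> int D"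
  proof -
    have "\<exists>i. g = affmap (of_int i) 1" if "g \<in> keys h" for g
    proof -
      have "g \<in> Zs" using that hZ by (auto simp: Z.HA_def)
      then show ?thesis using affmap_eta[of g] by (auto simp: Zs_def elim!: Ints_cases)
    qed
    then obtain i where i: "\<And>g. g \<in> keys h \<Longrightarrow> g = affmap (of_int (i g)) 1" by metis
    have "\<bar>i g\<bar> \<le> int (\<Sum>g\<in>keys h. nat \<bar>i g\<bar>)" if "g \<in> keys h" for g
    proof -
      have "\<bar>i g\<bar> = int (nat \<bar>i g\<bar>)" by simp
      also have "\<dots> \<le> int (\<Sum>g\<in>keys h. nat \<bar>i g\<bar>)"
        unfolding of_nat_le_iff using that by (intro member_le_sum) auto
      finally show ?thesis .
    qed
    then show ?thesis using i by blast
  qed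
  then obtain D where D: "\<And>g. g \<in> keys h \<Longrightarrow> \<exists>i. g = affmap (of_int i) 1 \<and> \<bar>i\<bar> \<le> int D" by blast
  have main: "N h ^ (2 ^ j) \<le> (2 * real D * 2 ^ j + 1)\<^sup>2 * (K\<^sup>2) ^ (2 ^ j)" for j
  proof -
    let ?n = "2 ^ j :: nat"
    have "keys (h ^ ?n) \<subseteq> (\<lambda>i. affmap (of_int i) 1) ` {- int (?n * D)..int (?n * D)}"
      using keys_power_Zs[OF D] by (fastforce simp: abs_le_iff)
    then have "card (keys (h ^ ?n)) \<le> card ((\<lambda>i. affmap (of_int i) 1) ` {- int (?n * D)..int (?n * D)})"
      by (intro card_mono) auto
    also have "\<dots> \<le> card {- int (?n * D)..int (?n * D)}" by (rule card_image_le) simp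
    also have "card {- int m..int m} = 2 * m + 1" for m by simp
    also have "2 * (?n * D) + 1 = 2 * D * ?n + 1" by simp
    finally have "card (keys (h ^ ?n)) \<le> 2 * D * ?n + 1" .
    then have "real (card (keys (h ^ ?n))) \<le> real (2 * D * ?n + 1)" by (simp only: of_nat_le_iff)
    then have card: "real (card (keys (h ^ ?n))) \<le> 2 * real D * 2 ^ j + 1" by simp
    have "N h ^ ?n = N (h ^ ?n)" using csn_power_of_two[OF N _ h_adj] hH[of 1] by simp
    also have "\<dots> \<le> (\<Sum>g\<in>keys (h ^ ?n). cmod (lookup (h ^ ?n) g))" using csn_le_coefficients[OF N hH] .
    also have "\<dots> \<le> (\<Sum>g\<in>keys (h ^ ?n). (K\<^sup>2) ^ ?n)"
    proof (rule sum_mono)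
      fix g assume "g \<in> keys (h ^ ?n)"
      then have "g \<in> Zs" using Z.power_closed[OF hZ, of ?n] by (auto simp: Z.HA_def)
      then show "cmod (lookup (h ^ ?n) g) \<le> (K\<^sup>2) ^ ?n"
        using coefficient_le[OF Z.power_closed[OF hZ] hK] by blast
    qed
    also have "\<dots> = real (card (keys (h ^ ?n))) * (K\<^sup>2) ^ ?n" by simp
    also have "\<dots> \<le> (2 * real D * 2 ^ j + 1) * (K\<^sup>2) ^ ?n" using card by (intro mult_right_mono) auto
    \<comment> \<open>The growth of the integers is only linear; squaring the factor, which is at
      least 1, gives the shape of \<open>le_of_powers_le\<close>.\<close>
    also have "\<dots> \<le> (2 * real D * 2 ^ j + 1)\<^sup>2 * (K\<^sup>2) ^ ?n"
      by (intro mult_right_mono self_le_power) auto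
    finally show ?thesis .
  qed
  have "N h \<le> K\<^sup>2"
    by (rule le_of_powers_le[where A = "2 * real D", OF _ _ _ main])
      (use csn_nonneg[OF N hH[of 1]] in simp_all)
  then have "(N c)\<^sup>2 \<le> K\<^sup>2" using csn_cstar[OF N ZHA_HA[OF c]] by (simp add: h_def)
  then show ?thesis using K0 by (rule power2_le_imp_le)
qed

text \<open>If \<open>evc z c\<close> were larger than \<open>r > K\<close> in modulus, it would be
  so on an open set, which has positive mass by full support. There \<open>c ^ n\<close> grows at
  least like \<open>r ^ n\<close>, while the hypothesis, started at 1, bounds its
  \<open>tnorm\<close> by \<open>K ^ n\<close>. The powers of \<open>c\<close> act as test functions
  inside \<open>Z.HA\<close>.\<close>

lemma sup_le_of_multiplier_bound:
  assumes R: "represents T M" and full: "circle_support M = circle" and c: "c \<in> Z.HA" and K: "0 \<le> K"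
    and le: "\<And>k. k \<in> Z.HA \<Longrightarrow> tnorm T (c * k) \<le> K * tnorm T k" and z: "z \<in> circle"
  shows "cmod (evc z c) \<le> K"
proof (rule ccontr)
  note T = representsD(1)[OF R] and M = representsD(2)[OF R]
  interpret prob_space M using M by (rule circle_probD)
  assume "\<not> ?thesis"
  then obtain r where r: "K < r" "r < cmod (evc z c)" using dense[of K "cmod (evc z c)"] by auto
  define U where "U = {w \<in> circle. r < cmod (evc w c)}"
  have cont: "continuous_on circle (\<lambda>w. cmod (evc w c))" by (intro continuous_intros evc_continuous)
  have "openin (top_of_set circle) (circle \<inter> (\<lambda>w. cmod (evc w c)) -` {r<..})"
    using cont by (rule continuous_openin_preimage_gen) simp
  moreover have "circle \<inter> (\<lambda>w. cmod (evc w c)) -` {r<..} = U" by (auto simp: U_def)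
  ultimately have open_U: "openin (top_of_set circle) U" by simp
  moreover have "z \<in> circle_support M" "z \<in> U" using full z r by (auto simp: U_def)
  ultimately have mU: "measure M U > 0" unfolding circle_support_def by blast
  have US: "U \<in> sets M" using circle_openin_sets[OF open_U] circle_probD(1)[OF M] by simp
  have pow: "tnorm T (c ^ n) \<le> K ^ n" for n
  proof (induction n)
    case 0
    then show ?case by (simp add: tnorm_one[OF T])
  next
    case (Suc n)
    have "tnorm T (c * c ^ n) \<le> K * tnorm T (c ^ n)" using c by (intro le) auto
    also have "\<dots> \<le> K * K ^ n" using Suc K by (intro mult_left_mono)
    finally show ?case by simp
  qed
  have "measure M U \<le> ((K / r)\<^sup>2) ^ n" for n
  proof -
    have int: "integrable M (\<lambda>w. (cmod (evc w (c ^ n)))\<^sup>2)"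
      by (intro circle_integrable[OF M] continuous_intros evc_continuous)
    have "(r ^ n)\<^sup>2 * measure M U = (\<integral>w. (r ^ n)\<^sup>2 * indicator U w \<partial>M)" using US by simp
    also have "\<dots> \<le> (\<integral>w. (cmod (evc w (c ^ n)))\<^sup>2 \<partial>M)"
    proof (rule integral_mono[OF _ int])
      show "integrable M (\<lambda>w. (r ^ n)\<^sup>2 * indicator U w)"
        by (intro integrable_mult_right integrable_real_indicator US) (simp add: emeasure_eq_measure)
      fix w assume "w \<in> space M"
      then have w: "w \<in> circle" using circle_probD(3)[OF M] by simp
      show "(r ^ n)\<^sup>2 * indicator U w \<le> (cmod (evc w (c ^ n)))\<^sup>2"
      proof (cases "w \<in> U")
        case True
        then have "r ^ n \<le> cmod (evc w c) ^ n" using r K by (intro power_mono) (auto simp: U_def)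
        then have "(r ^ n)\<^sup>2 \<le> (cmod (evc w c) ^ n)\<^sup>2" by (rule power_mono) (use r K in simp)
        then show ?thesis using True by (simp add: evc_power[OF w c] norm_power)
      qed simp
    qed
    also have "\<dots> = (tnorm T (c ^ n))\<^sup>2" using tnorm_eq_integral[OF R Z.power_closed[OF c]] by simp
    also have "\<dots> \<le> (K ^ n)\<^sup>2"
      using pow tnorm_nonneg[OF T ZHA_HA[OF Z.power_closed[OF c]]] by (intro power_mono)
    finally have "measure M U \<le> (K ^ n)\<^sup>2 / (r ^ n)\<^sup>2" using r K by (simp add: field_simps)
    then show ?thesis by (simp add: power_divide flip: power_mult) (simp add: mult.commute)
  qed
  moreover have "(\<lambda>n. ((K / r)\<^sup>2) ^ n) \<longlonglongrightarrow> 0"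
    using r K by (intro LIMSEQ_realpow_zero) (auto simp: power_divide power_strict_mono abs_square_less_1)
  ultimately have "measure M U \<le> 0" by (intro LIMSEQ_le_const) auto
  then show False using mU by simp
qed

lemma Tr_conj: assumes u: "u \<in> HU" and k: "k \<in> Tr.HA" shows "u * k * galg_adj u \<in> Tr.HA"
proof -
  obtain x s where xs: "x \<in> Ns" "s \<in> Ss" "u = single (affmap x s) 1" using HU_cases[OF u] .
  show ?thesis
    using k
  proof (induction rule: Tr.HA_induct)
    case (single g c)
    then have g: "g = affmap (trl g) 1" "trl g \<in> Ns" using affmap_eta[of g] by (auto simp: Ts_def)
    have "u * single (affmap (trl g) 1) c * galg_adj u = single (affmap (s * trl g) 1) c"
      using xs by (simp add: mult_single affmap_uminus affmap_add)
    moreover have "affmap (s * trl g) 1 \<in> Ts" using xs g(2) by (simp add: Ts_def Ns_scale)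
    ultimately show ?case using g(1) by (metis Tr.HA_single)
  qed (simp_all add: distrib_left distrib_right)
qed

text \<open>The components of \<open>F * k'\<close> are mutually orthogonal, so a single one is no
  longer than the whole. Replacing \<open>k\<close> by its conjugate \<open>k'\<close> moves it past
  the dilation that was split off.\<close>

lemma tnorm_part_le:
  assumes R: "M \<in> invariant_measures p q" and F: "F \<in> HA" and s: "s \<in> dil ` keys F" and k: "k \<in> Tr.HA"
  shows "tnorm (mtrace M) (dil_part s F * dl (1 / s) * k) \<le> gnorm (mtrace M) F * tnorm (mtrace M) k"
proof -
  let ?T = "mtrace M"
  note T = trace_on_mtrace[OF R]
  have sS: "s \<in> Ss" using s HA_keysD[OF F] by auto
  define v where "v = dl s"
  have v: "v \<in> HU" unfolding v_def using sS by (rule dl_HU)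
  define k' where "k' = galg_adj v * k * v"
  have k'T: "k' \<in> Tr.HA" unfolding k'_def using Tr_conj[OF HU_adj[OF v] k] by simp
  note kH = THA_HA[OF k] and k'H = THA_HA[OF k'T]
  have "dil_part s F * dl (1 / s) * k * v = dil_part s F * k'"
    using dl_adj[OF sS] by (simp add: k'_def v_def mult.assoc)
  moreover have pH: "dil_part t F \<in> HA" for t using dil_part_HA[OF F] .
  moreover have "dil_part s F * dl (1 / s) * k \<in> HA"
    by (rule mult_closed[OF mult_closed[OF pH unitaryD(1)[OF dl_HU[OF Ss_inverse[OF sS]]]] kH])
  ultimately have 1: "tnorm ?T (dil_part s F * dl (1 / s) * k) = tnorm ?T (dil_part s F * k')"
    using tnorm_mult_unitary[OF T v] by metis
  have "?T (galg_adj (\<Sum>t\<in>dil ` keys F. dil_part t F * k') * (\<Sum>t\<in>dil ` keys F. dil_part t F * k'))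
      = (\<Sum>t\<in>dil ` keys F. ?T (galg_adj (dil_part t F * k') * (dil_part t F * k')))"
    unfolding mtrace_def
  proof (rule lin_orthogonal)
    show "dil g = t" if "g \<in> keys (dil_part t F * k')" for t g
    proof -
      obtain a b where "a \<in> keys (dil_part t F)" "b \<in> keys k'" "g = a + b"
        using keys_mult[of "dil_part t F" k'] \<open>g \<in> _\<close> by blast
      moreover have "b \<in> Ts" using calculation(2) k'T by (auto simp: Tr.HA_def)
      ultimately show ?thesis using keys_dil_part[of t F] by (auto simp: Ts_def)
    qed
  qed (auto simp: mtrace_coef_def)
  moreover have "(\<Sum>t\<in>dil ` keys F. dil_part t F * k') = F * k'"
    by (simp only: sum_distrib_right[symmetric] sum_dil_part)
  ultimately have eq: "(tnorm ?T (F * k'))\<^sup>2 = (\<Sum>t\<in>dil ` keys F. (tnorm ?T (dil_part t F * k'))\<^sup>2)"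
    using F k'H pH by (simp add: tnorm_sq[OF T])
  have "(tnorm ?T (dil_part s F * k'))\<^sup>2 \<le> (tnorm ?T (F * k'))\<^sup>2"
    unfolding eq by (rule member_le_sum[OF s]) auto
  then have "tnorm ?T (dil_part s F * k') \<le> tnorm ?T (F * k')"
    by (rule power2_le_imp_le) (rule tnorm_nonneg[OF T mult_closed[OF F k'H]])
  also have "\<dots> \<le> gnorm ?T F * tnorm ?T k'" using F k'H by (rule tnorm_mult_le[OF T])
  also have "tnorm ?T k' = tnorm ?T k"
    using tnorm_conj[OF T HU_adj[OF v] kH] by (simp add: k'_def)
  finally show ?thesis by (simp only: 1)
qed

text \<open>Splitting off \<open>dl s\<close> and conjugating by a power of \<open>PQ\<close> puts
  the component into the algebra of integer translations. There \<open>N\<close> is at most the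
  supremum norm, and by full support that norm is at most any multiplier bound, in particular the
  one from \<open>tnorm_part_le\<close>.\<close>

lemma csn_part_le:
  assumes N: "cstar_seminorm_on N" and M: "M \<in> invariant_measures p q" and full: "circle_support M = circle"
    and F: "F \<in> HA" and s: "s \<in> dil ` keys F"
  shows "N (dil_part s F) \<le> gnorm (mtrace M) F"
proof -
  let ?T = "mtrace M"
  note T = trace_on_mtrace[OF M] and R = represents_mtrace[OF M]
  have sS: "s \<in> Ss" using s HA_keysD[OF F] by auto
  define c where "c = dil_part s F * dl (1 / s)"
  have cT: "c \<in> Tr.HA" unfolding c_def using F sS by (rule dil_part_translation)
  note cH = THA_HA[OF cT]
  obtain j where j: "dl (PQ ^ j) * c * galg_adj (dl (PQ ^ j)) \<in> Z.HA" using conj_integral[OF cT] by blast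
  define w where "w = dl (PQ ^ j)"
  have w: "w \<in> HU" unfolding w_def using PQ_power_Ss by (rule dl_HU)
  have bZ: "w * c * galg_adj w \<in> Z.HA" using j by (simp only: w_def)
  have "N (dil_part s F) = N (c * dl s)" using dil_part_translation(2)[OF F sS] by (simp only: c_def)
  also have "\<dots> \<le> N c * N (dl s)" using cH dl_HU[OF sS] by (intro csn_mult[OF N]) auto
  also have "\<dots> \<le> N c * 1"
    using csn_unitary_le[OF N dl_HU[OF sS]] csn_nonneg[OF N cH] by (rule mult_left_mono)
  also have "N c * 1 = N (w * c * galg_adj w)" using csn_conj_unitary[OF N w cH] by simp
  also have "\<dots> \<le> gnorm ?T F"
  proof (rule csn_le_sup[OF N bZ gnorm_nonneg[OF T F]])
    fix z assume z: "z \<in> circle"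
    show "cmod (evc z (w * c * galg_adj w)) \<le> gnorm ?T F"
    proof (rule sup_le_of_multiplier_bound[OF R full bZ gnorm_nonneg[OF T F] _ z])
      fix k assume k: "k \<in> Z.HA"
      define k' where "k' = galg_adj w * k * w"
      have k'T: "k' \<in> Tr.HA" unfolding k'_def using Tr_conj[OF HU_adj[OF w] ZHA_THA[OF k]] by simp
      have "w * c * galg_adj w * k = w * (c * k') * galg_adj w"
      proof -
        have "w * (c * k') * galg_adj w = w * c * galg_adj w * k * (w * galg_adj w)"
          by (simp only: k'_def mult.assoc)
        then show ?thesis using w by simp
      qed
      then have "tnorm ?T (w * c * galg_adj w * k) = tnorm ?T (c * k')"
        using tnorm_conj[OF T w, of "c * k'"] cH THA_HA[OF k'T] by simp
      also have "\<dots> \<le> gnorm ?T F * tnorm ?T k'"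
        unfolding c_def by (rule tnorm_part_le[OF M F s k'T])
      also have "tnorm ?T k' = tnorm ?T k"
        using tnorm_conj[OF T HU_adj[OF w] ZHA_HA[OF k]] by (simp add: k'_def)
      finally show "tnorm ?T (w * c * galg_adj w * k) \<le> gnorm ?T F * tnorm ?T k" .
    qed
  qed
  finally show ?thesis .
qed

section \<open>Polynomial growth of the group of dilations\<close>

definition SR :: "nat \<Rightarrow> rat set" where
  "SR R = {pqs n m | n m. n \<in> {- int R..int R} \<and> m \<in> {- int R..int R}}"

lemma SR_I: "n \<in> {- int R..int R} \<Longrightarrow> m \<in> {- int R..int R} \<Longrightarrow> pqs n m \<in> SR R"
  unfolding SR_def by blast

lemma SR_E:
  assumes "s \<in> SR R"
  obtains n m where "s = pqs n m" "n \<in> {- int R..int R}" "m \<in> {- int R..int R}"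
  using assms unfolding SR_def by blast

lemma SR_mono: assumes "R \<le> R'" shows "SR R \<subseteq> SR R'"
proof
  fix s assume "s \<in> SR R"
  then obtain n m where "s = pqs n m" "n \<in> {- int R..int R}" "m \<in> {- int R..int R}" by (rule SR_E)
  then show "s \<in> SR R'" using assms SR_I[of n R' m] by simp
qed

lemma SR_subset: "SR R \<subseteq> (\<lambda>x. pqs (fst x) (snd x)) ` ({- int R..int R} \<times> {- int R..int R})"
proof
  fix s assume "s \<in> SR R"
  then obtain n m where "s = pqs n m" "n \<in> {- int R..int R}" "m \<in> {- int R..int R}" by (rule SR_E)
  then show "s \<in> (\<lambda>x. pqs (fst x) (snd x)) ` ({- int R..int R} \<times> {- int R..int R})"
    by (intro image_eqI[of _ _ "(n, m)"]) simp_all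
qed

lemma finite_SR: "finite (SR R)"
  by (rule finite_subset[OF SR_subset]) simp

lemma card_SR: "card (SR R) \<le> (2 * R + 1)\<^sup>2"
proof -
  have "card (SR R) \<le> card ((\<lambda>x. pqs (fst x) (snd x)) ` ({- int R..int R} \<times> {- int R..int R}))"
    by (intro card_mono SR_subset) simp
  also have "\<dots> \<le> card ({- int R..int R} \<times> {- int R..int R})" by (rule card_image_le) simp
  also have "\<dots> = (2 * R + 1) * (2 * R + 1)"
  proof -
    have "card {- int R..int R} = 2 * R + 1" by simp
    then show ?thesis by (simp only: card_cartesian_product)
  qed
  finally show ?thesis by (simp only: power2_eq_square)
qed

lemma SR_add: assumes "s \<in> SR R" "t \<in> SR R'" shows "s * t \<in> SR (R + R')"
proof -
  obtain n m where nm: "s = pqs n m" "n \<in> {- int R..int R}" "m \<in> {- int R..int R}"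
    using assms(1) by (rule SR_E)
  obtain i j where ij: "t = pqs i j" "i \<in> {- int R'..int R'}" "j \<in> {- int R'..int R'}"
    using assms(2) by (rule SR_E)
  have "pqs (n + i) (m + j) \<in> SR (R + R')" using nm ij by (intro SR_I) simp_all
  then show ?thesis unfolding nm(1) ij(1) pqs_mult .
qed

lemma finite_dilations_bounded: assumes "f \<in> HA" shows "\<exists>R. dil ` keys f \<subseteq> SR R"
proof -
  have "\<exists>R. S \<subseteq> SR R" if "finite S" "S \<subseteq> Ss" for S
    using that
  proof (induction S rule: finite_induct)
    case (insert s S)
    then obtain R where R: "S \<subseteq> SR R" by auto
    have "s \<in> Ss" using insert.prems by simp
    then obtain n m where s: "s = pqs n m" unfolding Ss_def by blast
    let ?R = "R + nat \<bar>n\<bar> + nat \<bar>m\<bar>"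
    have "s \<in> SR ?R" unfolding s by (rule SR_I) auto
    moreover have "S \<subseteq> SR ?R" using R SR_mono[of R ?R] by auto
    ultimately have "insert s S \<subseteq> SR ?R" by simp
    then show ?case by blast
  qed simp
  moreover have "dil ` keys f \<subseteq> Ss" using HA_keysD[OF assms] by auto
  ultimately show ?thesis by simp
qed

lemma dilations_power: assumes "dil ` keys f \<subseteq> SR R" shows "dil ` keys (f ^ n) \<subseteq> SR (n * R)"
proof (induction n)
  case 0
  have "pqs 0 0 \<in> SR 0" by (rule SR_I) simp_all
  then show ?case by simp
next
  case (Suc n)
  show ?case
  proof (rule image_subsetI)
    fix g assume "g \<in> keys (f ^ Suc n)"
    then have "g \<in> keys (f * f ^ n)" by simp
    then obtain a b where "a \<in> keys f" "b \<in> keys (f ^ n)" "g = a + b"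
      using keys_mult[of f "f ^ n"] by blast
    moreover from this have "dil a \<in> SR R" "dil b \<in> SR (n * R)" using assms Suc by blast+
    ultimately show "dil g \<in> SR (Suc n * R)" using SR_add[of "dil a" R "dil b" "n * R"] by simp
  qed
qed

text \<open>The analogous growth argument for the quotient \<open>\<int>\<^sup>2\<close>.\<close>

theorem unorm_le_gnorm_mtrace:
  assumes M: "M \<in> invariant_measures p q" and full: "circle_support M = circle" and f: "f \<in> HA"
  shows "unorm f \<le> gnorm (mtrace M) f"
proof (rule unorm_least[OF f])
  fix N assume N: "cstar_seminorm_on N"
  let ?T = "mtrace M"
  note T = trace_on_mtrace[OF M]
  define h where "h = galg_adj f * f"
  have h: "h \<in> HA" unfolding h_def using f by auto
  have h_adj: "galg_adj h = h" by (simp add: h_def galg_adj_mult)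
  obtain R where R: "dil ` keys h \<subseteq> SR R" using finite_dilations_bounded[OF h] by blast
  have main: "N h ^ (2 ^ j) \<le> (2 * real R * 2 ^ j + 1)\<^sup>2 * gnorm ?T h ^ (2 ^ j)" for j
  proof -
    let ?n = "2 ^ j :: nat"
    have hn: "h ^ ?n \<in> HA" using h by simp
    have "card (dil ` keys (h ^ ?n)) \<le> card (SR (?n * R))"
      using dilations_power[OF R] by (intro card_mono finite_SR)
    also have "\<dots> \<le> (2 * (?n * R) + 1)\<^sup>2" by (rule card_SR)
    finally have "real (card (dil ` keys (h ^ ?n))) \<le> real ((2 * (?n * R) + 1)\<^sup>2)" by (simp only: of_nat_le_iff)
    then have card: "real (card (dil ` keys (h ^ ?n))) \<le> (2 * real R * 2 ^ j + 1)\<^sup>2" by (simp add: ac_simps)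
    have "N h ^ ?n = N (h ^ ?n)" using csn_power_of_two[OF N h h_adj] by simp
    also have "\<dots> = N (\<Sum>s\<in>dil ` keys (h ^ ?n). dil_part s (h ^ ?n))" by (simp only: sum_dil_part)
    also have "\<dots> \<le> (\<Sum>s\<in>dil ` keys (h ^ ?n). N (dil_part s (h ^ ?n)))"
      using dil_part_HA[OF hn] by (intro csn_sum[OF N])
    also have "\<dots> \<le> (\<Sum>s\<in>dil ` keys (h ^ ?n). gnorm ?T (h ^ ?n))"
      by (intro sum_mono csn_part_le[OF N M full hn])
    also have "\<dots> = real (card (dil ` keys (h ^ ?n))) * gnorm ?T (h ^ ?n)" by simp
    \<comment> \<open>The number of degrees in a power of \<open>h\<close> is quadratic in the
      exponent, and \<open>gnorm\<close> is submultiplicative.\<close>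
    also have "\<dots> \<le> (2 * real R * 2 ^ j + 1)\<^sup>2 * gnorm ?T h ^ ?n"
      using card csn_power_le[OF csn_gnorm[OF T] h, of ?n] gnorm_nonneg[OF T hn] by (intro mult_mono) auto
    finally show ?thesis .
  qed
  have "N h \<le> gnorm ?T h"
    by (rule le_of_powers_le[where A = "2 * real R", OF _ _ _ main])
      (use csn_nonneg[OF N h] gnorm_nonneg[OF T h] in simp_all)
  then have "(N f)\<^sup>2 \<le> (gnorm ?T f)\<^sup>2"
    using csn_cstar[OF N f] csn_cstar[OF csn_gnorm[OF T] f] by (simp add: h_def)
  then show "N f \<le> gnorm ?T f" using gnorm_nonneg[OF T f] by (rule power2_le_imp_le)
qed

end

section \<open>The correspondence\<close>

context star_ring
begin

lemma trace_on_cong: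
  assumes T: "trace_on T" and eq: "\<And>a. a \<in> B \<Longrightarrow> S a = T a"
  shows "trace_on S"
proof -
  have "trace_on S \<longleftrightarrow> trace_on T" unfolding trace_on_def by (simp add: eq cong: ball_cong)
  then show ?thesis using T by blast
qed

lemma extreme_trace_on_cong:
  assumes ex: "extreme_trace_on T" and eq: "\<And>a. a \<in> B \<Longrightarrow> S a = T a"
  shows "extreme_trace_on S"
proof -
  have "trace_on S" using ex trace_on_cong[OF _ eq] by (simp add: extreme_trace_on_def)
  moreover have "\<forall>a\<in>B. U a = S a \<and> V a = S a"
    if "trace_on U" "trace_on V" "0 < t \<and> t < 1" "\<forall>a\<in>B. S a = of_real t * U a + of_real (1 - t) * V a"
    for U V and t :: real
  proof -
    have "\<forall>a\<in>B. T a = of_real t * U a + of_real (1 - t) * V a" using that(4) eq by metis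
    then have "\<forall>a\<in>B. U a = T a \<and> V a = T a" using ex that(1-3) unfolding extreme_trace_on_def by blast
    then show ?thesis using eq by metis
  qed
  ultimately show ?thesis unfolding extreme_trace_on_def by blast
qed

lemma gnorm_cong:
  assumes eq: "\<And>a. a \<in> B \<Longrightarrow> S a = T a" and a: "a \<in> B" shows "gnorm S a = gnorm T a"
proof -
  have t: "tnorm S b = tnorm T b" if "b \<in> B" for b using that eq by (simp add: tnorm_def)
  have "{b \<in> B. tnorm S b \<le> 1} = {b \<in> B. tnorm T b \<le> 1}" using t by auto
  then show ?thesis unfolding gnorm_def using t a by (intro SUP_cong) auto
qed

end

text \<open>Both sides say that \<open>M\<close> is the mixture of \<open>M1\<close> and
  \<open>M2\<close>. The left one occurs in ergodicity, the right one is what a decomposition of a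
  trace provides.\<close>

lemma circle_mixture_integral:
  assumes M: "circle_prob M" "circle_prob M1" "circle_prob M2" and t: "0 < t" "t < 1"
  shows "(\<forall>A\<in>sets circle_borel. measure M A = t * measure M1 A + (1 - t) * measure M2 A) \<longleftrightarrow>
    (\<forall>n. (\<integral>z. z powi n \<partial>M) = of_real t * (\<integral>z. z powi n \<partial>M1) + of_real (1 - t) * (\<integral>z. z powi n \<partial>M2))"
proof -
  obtain K where K: "circle_prob K"
    "\<And>A. A \<in> sets circle_borel \<Longrightarrow> measure K A = t * measure M1 A + (1 - t) * measure M2 A"
    "\<And>n. (\<integral>z. z powi n \<partial>K) = of_real t * (\<integral>z. z powi n \<partial>M1) + of_real (1 - t) * (\<integral>z. z powi n \<partial>M2)"
    using circle_mixture[OF M(2,3), of t] t by auto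
  interpret PM: prob_space M using M(1) by (rule circle_probD)
  interpret PK: prob_space K using K(1) by (rule circle_probD)
  show ?thesis
  proof
    assume eq: "\<forall>A\<in>sets circle_borel. measure M A = t * measure M1 A + (1 - t) * measure M2 A"
    have "M = K"
    proof (rule measure_eqI)
      show "sets M = sets K" using M(1) K(1) by (simp add: circle_prob_def)
      fix A assume "A \<in> sets M"
      then have "A \<in> sets circle_borel" using circle_probD(1)[OF M(1)] by simp
      then have "measure M A = measure K A" using eq K(2) by simp
      then show "emeasure M A = emeasure K A" by (simp only: PM.emeasure_eq_measure PK.emeasure_eq_measure)
    qed
    then show "\<forall>n. (\<integral>z. z powi n \<partial>M) = of_real t * (\<integral>z. z powi n \<partial>M1) + of_real (1 - t) * (\<integral>z. z powi n \<partial>M2)"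
      using K(3) by simp
  next
    assume "\<forall>n. (\<integral>z. z powi n \<partial>M) = of_real t * (\<integral>z. z powi n \<partial>M1) + of_real (1 - t) * (\<integral>z. z powi n \<partial>M2)"
    then have "M = K" using circle_measure_eqI[OF M(1) K(1)] K(3) by simp
    then show "\<forall>A\<in>sets circle_borel. measure M A = t * measure M1 A + (1 - t) * measure M2 A"
      using K(2) by simp
  qed
qed

context independent_pair
begin

lemma fcoef_mixture:
  assumes M: "M \<in> invariant_measures p q" "M1 \<in> invariant_measures p q" "M2 \<in> invariant_measures p q"
    and eq: "\<And>n. (\<integral>z. z powi n \<partial>M) = s * (\<integral>z. z powi n \<partial>M1) + t * (\<integral>z. z powi n \<partial>M2)"
    and a: "a \<in> HA"
  shows "mtrace M a = s * mtrace M1 a + t * mtrace M2 a"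
proof -
  have "fcoef M x = s * fcoef M1 x + t * fcoef M2 x" if x: "x \<in> Ns" for x
  proof -
    obtain k n where n: "x * PQ ^ k = of_int n" using x by (auto simp: Ns_iff elim: Ints_cases)
    show ?thesis using fcoef_eq[OF _ n] M eq by simp
  qed
  then have coef: "mtrace_coef M g = s * mtrace_coef M1 g + t * mtrace_coef M2 g" if "g \<in> keys a" for g
    using HA_keysD[OF a that] by (simp add: mtrace_coef_def)
  have "mtrace M a = (\<Sum>g\<in>keys a. lookup a g * (s * mtrace_coef M1 g + t * mtrace_coef M2 g))"
    unfolding mtrace_def lin_def using coef by (intro sum.cong) auto
  then show ?thesis
    by (simp add: mtrace_def lin_def distrib_left sum.distrib sum_distrib_left mult.left_commute)
qed

lemma mtrace_tr: "M \<in> invariant_measures p q \<Longrightarrow> mtrace M (tr (of_int n)) = (\<integral>z. z powi n \<partial>M)"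
  using representsD(6)[OF represents_mtrace] by simp

lemma tr_HA: "tr (of_int n) \<in> HA"
  using tr_HU[OF Ns_of_int] by simp

lemma mtrace_inj:
  assumes "M1 \<in> invariant_measures p q" "M2 \<in> invariant_measures p q"
    and "\<And>a. a \<in> HA \<Longrightarrow> mtrace M1 a = mtrace M2 a"
  shows "M1 = M2"
proof (rule circle_measure_eqI[OF invariant_circle_prob[OF assms(1)] invariant_circle_prob[OF assms(2)]])
  show "(\<integral>z. z powi n \<partial>M1) = (\<integral>z. z powi n \<partial>M2)" for n
    using assms(3)[OF tr_HA] mtrace_tr[OF assms(1)] mtrace_tr[OF assms(2)] by simp
qed

lemma ergodic_of_extreme:
  assumes M: "M \<in> invariant_measures p q" and ex: "extreme_trace_on (mtrace M)"
  shows "ergodic_measure p q M"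
  unfolding ergodic_measure_def
proof (intro conjI ballI allI impI M)
  fix M1 M2 and t :: real
  assume i: "M1 \<in> invariant_measures p q" "M2 \<in> invariant_measures p q" and t: "0 < t \<and> t < 1"
    and eq: "\<forall>A\<in>sets circle_borel. measure M A = t * measure M1 A + (1 - t) * measure M2 A"
  have "(\<integral>z. z powi n \<partial>M) = of_real t * (\<integral>z. z powi n \<partial>M1) + of_real (1 - t) * (\<integral>z. z powi n \<partial>M2)" for n
    using eq circle_mixture_integral[of M M1 M2 t] invariant_circle_prob M i t by blast
  then have "\<forall>a\<in>HA. mtrace M a = of_real t * mtrace M1 a + of_real (1 - t) * mtrace M2 a"
    using fcoef_mixture[OF M i] by blast
  then have "\<forall>a\<in>HA. mtrace M1 a = mtrace M a \<and> mtrace M2 a = mtrace M a"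
    using ex trace_on_mtrace[OF i(1)] trace_on_mtrace[OF i(2)] t unfolding extreme_trace_on_def by blast
  then show "M1 = M" "M2 = M" using mtrace_inj M i by blast+
qed

text \<open>A decomposition of the trace induces one of \<open>M\<close>, so both parts are
  represented by \<open>M\<close> itself; as \<open>M\<close> has no mass at roots of unity, it
  determines them.\<close>

lemma extreme_of_ergodic:
  assumes erg: "ergodic_measure p q M" and inf: "infinite (circle_support M)"
  shows "extreme_trace_on (mtrace M)"
proof -
  have M: "M \<in> invariant_measures p q" using erg by (simp add: ergodic_measure_def)
  note null = ergodic_root_set_null[OF erg inf]
  show ?thesis
    unfolding extreme_trace_on_def
  proof (intro conjI allI impI trace_on_mtrace[OF M])
    fix S R and t :: real
    assume S: "trace_on S" and R: "trace_on R" and t: "0 < t \<and> t < 1"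
      and eq: "\<forall>a\<in>HA. mtrace M a = of_real t * S a + of_real (1 - t) * R a"
    obtain M1 where M1: "represents S M1" using trace_represented[OF S] by blast
    obtain M2 where M2: "represents R M2" using trace_represented[OF R] by blast
    note i = representsD(3)[OF M1] representsD(3)[OF M2]
    have "(\<integral>z. z powi n \<partial>M) = of_real t * (\<integral>z. z powi n \<partial>M1) + of_real (1 - t) * (\<integral>z. z powi n \<partial>M2)" for n
      using eq tr_HA mtrace_tr[OF M] representsD(6)[OF M1] representsD(6)[OF M2] by simp
    then have "\<forall>A\<in>sets circle_borel. measure M A = t * measure M1 A + (1 - t) * measure M2 A"
      using circle_mixture_integral[of M M1 M2 t] invariant_circle_prob M i t by blast
    then have "M1 = M" "M2 = M" using erg i t unfolding ergodic_measure_def by blast+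
    then show "\<forall>a\<in>HA. S a = mtrace M a \<and> R a = mtrace M a"
      using trace_eq_mtrace[of S M] trace_eq_mtrace[of R M] M1 M2 null by blast
  qed
qed

lemma full_support:
  assumes M: "M \<in> invariant_measures p q" and inf: "infinite (circle_support M)"
  shows "circle_support M = circle"
proof (rule Furstenberg_closed_invariant[OF p2 q2 independent closed_circle_support circle_support_subset _ _ inf])
  note d = circle_distr_invariant[OF M]
  show "power_invariant p (circle_support M)" "power_invariant q (circle_support M)"
    unfolding power_invariant_def using circle_support_power[OF invariant_circle_prob[OF M]] d by blast+
qed

lemma restr_mtrace: "M \<in> invariant_measures p q \<Longrightarrow> a \<in> HA \<Longrightarrow> restr (extension (mtrace M)) a = mtrace M a"
  by (intro restr_extension trace_on_mtrace)

lemma faithful_extension_mtrace: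
  assumes M: "M \<in> invariant_measures p q" and inf: "infinite (circle_support M)"
  shows "faithful_trace C (extension (mtrace M))"
proof (rule faithful_traceI[OF extension_tracial_state[OF trace_on_mtrace[OF M]]])
  fix a assume a: "a \<in> HA"
  have "gnorm (restr (extension (mtrace M))) a = gnorm (mtrace M) a"
    using restr_mtrace[OF M] a by (rule gnorm_cong)
  then show "unorm a \<le> gnorm (restr (extension (mtrace M))) a"
    using unorm_le_gnorm_mtrace[OF M full_support[OF M inf] a] by simp
qed

lemma lebesgue_invariant: "circle_lebesgue \<in> invariant_measures p q"
  unfolding invariant_measures_iff using circle_prob_lebesgue by (simp add: circle_lebesgue_fourier)

lemma mtrace_lebesgue: assumes a: "a \<in> HA" shows "mtrace circle_lebesgue a = delta_trace a"
  unfolding mtrace_def delta_trace_def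
proof (rule lin_cong)
  fix g assume g: "g \<in> keys a"
  obtain k n where n: "trl g * PQ ^ k = of_int n" using HA_keysD[OF a g] by (auto simp: Ns_iff elim: Ints_cases)
  have "n = 0 \<longleftrightarrow> trl g = 0" using n by (metis PQ_pos(2) mult_eq_0_iff of_int_eq_0_iff power_not_zero)
  moreover have "g = 0 \<longleftrightarrow> trl g = 0 \<and> dil g = 1" by (metis affine_map_eqI dil_zero trl_zero)
  ultimately show "mtrace_coef circle_lebesgue g = of_bool (g = 0)"
    using fcoef_eq[OF lebesgue_invariant n] by (simp add: mtrace_coef_def circle_lebesgue_fourier)
qed

lemma canonical_trace_lebesgue: "canonical_trace G = extension (mtrace circle_lebesgue)"
  unfolding canonical_trace_eq
  by (rule tracial_state_eqI)
    (simp_all add: extension_tracial_state trace_on_delta trace_on_mtrace lebesgue_invariant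
      restr_extension mtrace_lebesgue)

lemma extreme_faithful_mtrace:
  assumes "ergodic_measure p q M" "infinite (circle_support M)"
  shows "extreme_tracial_state C (extension (mtrace M)) \<and> faithful_trace C (extension (mtrace M))"
proof -
  have M: "M \<in> invariant_measures p q" using assms by (simp add: ergodic_measure_def)
  have "extreme_trace_on (restr (extension (mtrace M)))"
    using extreme_of_ergodic[OF assms] restr_mtrace[OF M] by (rule extreme_trace_on_cong)
  then show ?thesis
    using extreme_tracial_state_iff extension_tracial_state[OF trace_on_mtrace[OF M]]
      faithful_extension_mtrace[OF M assms(2)] by blast
qed

text \<open>Extremality and faithfulness together exclude mass at roots of unity; from then on the
  measure determines the trace and has infinite support.\<close>

lemma extreme_faithful_obtain:
  assumes ex: "extreme_tracial_state C \<tau>" and faithful: "faithful_trace C \<tau>"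
  obtains M where "ergodic_measure p q M" "infinite (circle_support M)" "\<tau> = extension (mtrace M)"
proof -
  have \<tau>: "\<tau> \<in> tracial_states C" and ex': "extreme_trace_on (restr \<tau>)"
    using ex extreme_tracial_state_iff by blast+
  obtain M where R: "represents (restr \<tau>) M" using trace_represented[OF trace_on_restr[OF \<tau>]] by blast
  note M = representsD(3)[OF R]
  have null: "measure M (root_set d) = 0" if "d > 0" for d
    using extreme_faithful_root_set_null[OF ex' R faithful_trace_unorm_zero[OF faithful] that] by blast
  have eq: "restr \<tau> a = mtrace M a" if "a \<in> HA" for a using trace_eq_mtrace[OF R null that] .
  have "ergodic_measure p q M"
    using ergodic_of_extreme[OF M] extreme_trace_on_cong[OF ex'] eq by simp
  moreover have "infinite (circle_support M)"
    using infinite_circle_support[OF representsD(2,4)[OF R] p2 null] .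
  moreover have "\<tau> = extension (mtrace M)"
    using \<tau> eq restr_mtrace[OF M] extension_tracial_state[OF trace_on_mtrace[OF M]]
    by (intro tracial_state_eqI) auto
  ultimately show thesis using that by blast
qed

lemma extension_mtrace_inj:
  assumes M: "M1 \<in> invariant_measures p q" "M2 \<in> invariant_measures p q"
    and eq: "extension (mtrace M1) = extension (mtrace M2)"
  shows "M1 = M2"
proof (rule mtrace_inj[OF M])
  fix a assume "a \<in> HA"
  then show "mtrace M1 a = mtrace M2 a" using restr_mtrace M eq by metis
qed

lemma extreme_faithful_traces:
  "{\<tau>. extreme_tracial_state C \<tau> \<and> faithful_trace C \<tau>}
    = (\<lambda>M. extension (mtrace M)) ` {M. ergodic_measure p q M \<and> infinite (circle_support M)}"
  using extreme_faithful_obtain extreme_faithful_mtrace by blast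

end

theorem corollary3p7:
  fixes p q :: nat
  assumes "p \<ge> 2" and "q \<ge> 2" and "multiplicatively_independent p q"
  shows "{\<tau>. extreme_tracial_state (group_cstar (pq_group p q)) \<tau> \<and>
              faithful_trace (group_cstar (pq_group p q)) \<tau>} = {canonical_trace (pq_group p q)}
         \<longleftrightarrow> furstenberg_conjecture p q"
proof -
  interpret independent_pair p q using assms by unfold_locales
  let ?E = "{M. ergodic_measure p q M \<and> infinite (circle_support M)}"
  let ?F = "\<lambda>M. extension (mtrace M)"
  have E: "?E \<subseteq> invariant_measures p q" by (auto simp: ergodic_measure_def)
  \<comment> \<open>Since \<open>?F\<close> is injective on invariant measures, equality of the
    image with a singleton can be pulled back.\<close>
  have "?F ` ?E = {?F circle_lebesgue} \<longleftrightarrow> ?E = {circle_lebesgue}"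
  proof
    assume eq: "?F ` ?E = {?F circle_lebesgue}"
    have "M = circle_lebesgue" if "M \<in> ?E" for M
      using that eq E extension_mtrace_inj[OF _ lebesgue_invariant] by blast
    moreover have "?E \<noteq> {}" using eq by blast
    ultimately show "?E = {circle_lebesgue}" by blast
  qed simp
  then show ?thesis
    unfolding group_cstar_eq extreme_faithful_traces canonical_trace_lebesgue furstenberg_conjecture_def .
qed

end
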